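(* Let $m\in\mathbb{Z}_{\ge0}$ and let $p>1+(m+3)/n$. Let $u_0\in L^1_{m+1}(\mathbb{R}^n)\cap L^\infty(\mathbb{R}^n)$ and let $u\in X$ be a global solution to (P) satisfying $$\sup_{q\in[1,+\infty]}\ \sup_{t>0}\ t^{\frac n2\left(1-\frac1q\right)}\|u(t)\|_q<+\infty .$$ Then, with the profiles $\mathcal{A}_k(t)$ defined in the context, $$\lim_{t\to+\infty}t^{\frac n2\left(1-\frac1q\right)+\frac m2+\frac12}\|u(t)-\mathcal{A}_m(t)\|_q=\|\mathcal{A}_{m+1}(1)-\mathcal{A}_m(1)\|_q$$ holds for any $q\in[1,+\infty]$. In particular, the following assertions are equivalent: (i) $\mathcal{A}_{m+1}(1)-\mathcal{A}_m(1)\not\equiv0$. (ii) There exists $\alpha\in\mathbb{Z}_{\ge0}^n$ with $|\alpha|=m+1$ such that $$\mathcal{M}_\alpha(u_0)+\sum_{\substack{\beta+2\gamma=\alpha\\|\gamma|\le(m+1)/2}}\frac{(-\nu)^{|\gamma|}}{\gamma!}\mathcal{M}_\beta(\psi_{|\gamma|})\ne0.$$ (iii) For any $q\in[1,+\infty]$ and $\varepsilon\in(0,1)$, there exists $t_0>0$ such that $$0<t^{-\frac12}(1-\varepsilon)\|\mathcal{A}_{m+1}(1)-\mathcal{A}_m(1)\|_q\le t^{\frac n2\left(1-\frac1q\right)+\frac m2}\|u(t)-\mathcal{A}_m(t)\|_q\le t^{-\frac12}(1+\varepsilon)\|\mathcal{A}_{m+1}(1)-\mathcal{A}_m(1)\|_q$$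 holds for all $t>t_0$.
   Context: Let $n\in\mathbb{Z}_{>0}$, $\nu\in\mathbb{C}$ with $\operatorname{Re}\nu>0$, and $p\in(1,+\infty)$. Let $f:\mathbb{C}\to\mathbb{C}$ satisfy $f(0)=0$ and, for some $K>0$, $|f(\xi)-f(\eta)|\le K(|\xi|^{p-1}+|\eta|^{p-1})|\xi-\eta|$ for all $\xi,\eta\in\mathbb{C}$. (P) denotes the Cauchy problem $\partial_t u-\nu\Delta u=f(u)$ in $(0,+\infty)\times\mathbb{R}^n$, $u(0)=u_0$ in $\mathbb{R}^n$, for a complex-valued unknown $u$. $L^q(\mathbb{R}^n)$, $q\in[1,+\infty]$, is the complex-valued Lebesgue space with norm $\|\cdot\|_q$. Greek indices $\alpha,\beta,\gamma$ range over $\mathbb{Z}_{\ge0}^n$; $|\alpha|=\sum_j\alpha_j$, $\alpha!=\prod_j\alpha_j!$, $x^\alpha=\prod_jx_j^{\alpha_j}$, and $\alpha\le\beta$ means $\alpha_j\le\beta_j$ for all $j$. For $k\in\mathbb{Z}_{>0}$, $L^1_k(\mathbb{R}^n)$ is the set of $\varphi\in L^1(\mathbb{R}^n)$ with $x^\alpha\varphi\in L^1(\mathbb{R}^n)$ for all $|\alpha|\le k$. $G_{t\nu}(x)=(4\pi t\nu)^{-n/2}\exp\left(-\frac{|x|^2}{4t\nu}\right)$ (principal branch of the power), $G_\nu$ is the case $t=1$, and $e^{t\nu\Delta}\varphi=G_{t\nu}*\varphi$ for $t>0$, $e^{0\nu\Delta}\varphi=\varphi$. $X=(C\cap L^\infty)([0,+\infty);L^1(\mathbb{R}^n))\cap(C\cap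 L^\infty)((0,+\infty);L^\infty(\mathbb{R}^n))$. For $u_0\in L^1(\mathbb{R}^n)\cap L^\infty(\mathbb{R}^n)$, a function $u\in X$ is a global (mild) solution to (P) if $u(t)=e^{t\nu\Delta}u_0+\int_0^t e^{(t-s)\nu\Delta}f(u(s))\,ds$ holds in $L^1(\mathbb{R}^n)\cap L^\infty(\mathbb{R}^n)$ for all $t>0$. Asymptotic profiles: for $k\in\{m,m+1\}$, $$\mathcal{A}_k(t):=\Lambda_{0,k}(t;u_0)+\sum_{|\gamma|\le k/2}\frac{(-\nu)^{|\gamma|}}{\gamma!}\Lambda_{2\gamma,\,k-2|\gamma|}(t;\psi_{|\gamma|}),\qquad \psi_j:=\int_0^{+\infty}s^jf(u(s))\,ds,$$ $$\Lambda_{\alpha,N}(t;\varphi):=(-2)^{-|\alpha|}t^{-\frac{|\alpha|}2}\sum_{j=0}^N2^{-j}t^{-\frac j2}\sum_{|\beta|=j}\mathcal{M}_\beta(\varphi)\,\delta_t(\boldsymbol{h}_{\nu,\alpha+\beta}G_\nu),$$ $$\mathcal{M}_\beta(\varphi):=\frac1{\beta!}\int_{\mathbb{R}^n}y^\beta\varphi(y)\,dy,\qquad \boldsymbol{h}_{\nu,\alpha}(x):=\sum_{2\beta\le\alpha}\frac{(-1)^{|\beta|}\alpha!}{\beta!(\alpha-2\beta)!}\nu^{-|\alpha-\beta|}x^{\alpha-2\beta},\qquad(\delta_t\varphi)(x)=t^{-\frac n2}\varphi(t^{-\frac12}x).$$ *)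

theory Defs
  imports "HOL-Analysis.Analysis" "HOL-Probability.Essential_Supremum"
begin

section \<open>Multi-indices\<close>

definition mdeg :: "('n::finite \<Rightarrow> nat) \<Rightarrow> nat"
  where "mdeg \<alpha> = (\<Sum>i\<in>UNIV. \<alpha> i)"

definition mfact :: "('n::finite \<Rightarrow> nat) \<Rightarrow> nat"
  where "mfact \<alpha> = (\<Prod>i\<in>UNIV. fact (\<alpha> i))"

definition mpow :: "real ^ 'n \<Rightarrow> ('n::finite \<Rightarrow> nat) \<Rightarrow> real"
  where "mpow x \<alpha> = (\<Prod>i\<in>UNIV. (x $ i) ^ \<alpha> i)"

section \<open>Lebesgue spaces\<close>

text \<open>Elements of $L^q$ are represented by Lebesgue measurable functions; the norm is extended
  real valued and vanishes on functions that are zero almost everywhere. Since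
  \<open>1 / \<infinity> = 0\<close> in \<^typ>\<open>ennreal\<close>, the function \<open>recip\<close> follows the convention $1/\infty = 0$.\<close>

definition recip :: "ennreal \<Rightarrow> real"
  where "recip q = enn2real (1 / q)"

definition lq_norm :: "ennreal \<Rightarrow> (real ^ 'n::finite \<Rightarrow> complex) \<Rightarrow> ennreal" where
  "lq_norm q \<phi> =
    (if q = \<infinity> then esssup lebesgue (\<lambda>x. ennreal (norm (\<phi> x)))
     else let I = (\<integral>\<^sup>+ x. ennreal (norm (\<phi> x) powr enn2real q) \<partial>lebesgue)
          in if I = \<infinity> then \<infinity> else ennreal (enn2real I powr recip q))"

definition Lq :: "ennreal \<Rightarrow> (real ^ 'n::finite \<Rightarrow> complex) set" where
  "Lq q = {\<phi>. \<phi> \<in> borel_measurable lebesgue \<and> lq_norm q \<phi> < \<infinity>}"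

text \<open>The weighted space $L^1_k$.\<close>

definition L1_weighted :: "nat \<Rightarrow> (real ^ 'n::finite \<Rightarrow> complex) set" where
  "L1_weighted k =
    {\<phi> \<in> Lq 1. \<forall>\<alpha>. mdeg \<alpha> \<le> k \<longrightarrow> (\<lambda>x. complex_of_real (mpow x \<alpha>) * \<phi> x) \<in> Lq 1}"

section \<open>Bochner integrals with values in a space of functions\<close>

text \<open>\<open>has_bochner_integral_in E N M F I\<close> says that \<open>F\<close> is Bochner integrable over \<open>M\<close> as a map
  into the space \<open>E\<close> with (extended) seminorm \<open>N\<close>, with integral \<open>I\<close>. The library's
  \<^const>\<open>has_bochner_integral\<close> needs a separable normed type as codomain, hence applies neither to
  $L^\infty$ nor to representatives of classes. As there, the integral is the limit of the integrals
  of approximating simple functions. The integral of a simple function with values in a space of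
  functions is taken pointwise, which agrees with the finite sum defining it. The integral is
  determined only up to functions of seminorm zero.\<close>

definition has_bochner_integral_in ::
  "('a \<Rightarrow> complex) set \<Rightarrow> (('a \<Rightarrow> complex) \<Rightarrow> ennreal) \<Rightarrow> real measure
    \<Rightarrow> (real \<Rightarrow> 'a \<Rightarrow> complex) \<Rightarrow> ('a \<Rightarrow> complex) \<Rightarrow> bool" where
  "has_bochner_integral_in E N M F I \<longleftrightarrow>
    I \<in> E \<and> (AE s in M. F s \<in> E) \<and>
    (\<exists>S :: nat \<Rightarrow> real \<Rightarrow> 'a \<Rightarrow> complex.
      (\<forall>k. simple_function M (S k) \<and> (\<forall>s\<in>space M. S k s \<in> E) \<and>
           emeasure M {s \<in> space M. S k s \<noteq> (\<lambda>x. 0)} < \<infinity>) \<and>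
      (AE s in M. (\<lambda>k. N (\<lambda>x. F s x - S k s x)) \<longlonglongrightarrow> 0) \<and>
      (\<lambda>k. \<integral>\<^sup>+ s. N (\<lambda>x. F s x - S k s x) \<partial>M) \<longlonglongrightarrow> 0 \<and>
      (\<lambda>k. N (\<lambda>x. Bochner_Integration.simple_bochner_integral M (\<lambda>s. S k s x) - I x)) \<longlonglongrightarrow> 0)"

section \<open>The complex heat semigroup and mild solutions\<close>

text \<open>On \<^typ>\<open>complex\<close>, \<open>powr\<close> is the principal branch.\<close>

definition gauss :: "complex \<Rightarrow> real ^ 'n::finite \<Rightarrow> complex" where
  "gauss z x = (4 * complex_of_real pi * z) powr (- (of_nat CARD('n) / 2))
               * exp (- (complex_of_real ((norm x)\<^sup>2) / (4 * z)))"

definition heat :: "complex \<Rightarrow> real \<Rightarrow> (real ^ 'n::finite \<Rightarrow> complex) \<Rightarrow> real ^ 'n \<Rightarrow> complex" where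
  "heat \<nu> t \<phi> =
    (if t = 0 then \<phi>
     else (\<lambda>x. \<integral>y. gauss (complex_of_real t * \<nu>) (x - y) * \<phi> y \<partial>lebesgue))"

definition solution_space :: "(real \<Rightarrow> real ^ 'n::finite \<Rightarrow> complex) set" where
  "solution_space =
    {u. (\<forall>t\<ge>0. u t \<in> Lq 1) \<and>
        (\<forall>t\<ge>0. ((\<lambda>s. lq_norm 1 (\<lambda>x. u s x - u t x)) \<longlongrightarrow> 0) (at t within {0..})) \<and>
        (SUP t\<in>{0..}. lq_norm 1 (u t)) < \<infinity> \<and>
        (\<forall>t>0. u t \<in> Lq \<infinity>) \<and>
        (\<forall>t>0. ((\<lambda>s. lq_norm \<infinity> (\<lambda>x. u s x - u t x)) \<longlongrightarrow> 0) (at t within {0<..})) \<and>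
        (SUP t\<in>{0<..}. lq_norm \<infinity> (u t)) < \<infinity>}"

definition global_mild_solution ::
  "complex \<Rightarrow> (complex \<Rightarrow> complex) \<Rightarrow> (real ^ 'n::finite \<Rightarrow> complex)
    \<Rightarrow> (real \<Rightarrow> real ^ 'n \<Rightarrow> complex) \<Rightarrow> bool" where
  "global_mild_solution \<nu> f u0 u \<longleftrightarrow>
    u0 \<in> Lq 1 \<inter> Lq \<infinity> \<and> u \<in> solution_space \<and>
    (\<forall>t>0. \<exists>I.
      has_bochner_integral_in (Lq 1 \<inter> Lq \<infinity>) (\<lambda>\<phi>. lq_norm 1 \<phi> + lq_norm \<infinity> \<phi>)
        (lebesgue_on {0..t}) (\<lambda>s. heat \<nu> (t - s) (\<lambda>x. f (u s x))) I \<and>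
      (AE x in lebesgue. u t x = heat \<nu> t u0 x + I x))"

section \<open>Asymptotic profiles\<close>

definition moment :: "('n::finite \<Rightarrow> nat) \<Rightarrow> (real ^ 'n \<Rightarrow> complex) \<Rightarrow> complex" where
  "moment \<beta> \<phi> =
    1 / of_nat (mfact \<beta>) * (\<integral>y. complex_of_real (mpow y \<beta>) * \<phi> y \<partial>lebesgue)"

definition hpoly :: "complex \<Rightarrow> ('n::finite \<Rightarrow> nat) \<Rightarrow> real ^ 'n \<Rightarrow> complex" where
  "hpoly \<nu> \<alpha> x =
    (\<Sum>\<beta> \<in> {\<beta>. \<forall>i. 2 * \<beta> i \<le> \<alpha> i}.
       (- 1) ^ mdeg \<beta> * of_nat (mfact \<alpha>)
         / (of_nat (mfact \<beta>) * of_nat (mfact (\<lambda>i. \<alpha> i - 2 * \<beta> i)))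
       * \<nu> powi (- int (mdeg (\<lambda>i. \<alpha> i - \<beta> i)))
       * complex_of_real (mpow x (\<lambda>i. \<alpha> i - 2 * \<beta> i)))"

definition dilate :: "real \<Rightarrow> (real ^ 'n::finite \<Rightarrow> complex) \<Rightarrow> real ^ 'n \<Rightarrow> complex" where
  "dilate t \<phi> x = complex_of_real (t powr (- (real CARD('n) / 2))) * \<phi> (t powr (- (1 / 2)) *\<^sub>R x)"

definition Lam ::
  "complex \<Rightarrow> ('n::finite \<Rightarrow> nat) \<Rightarrow> nat \<Rightarrow> real \<Rightarrow> (real ^ 'n \<Rightarrow> complex) \<Rightarrow> real ^ 'n \<Rightarrow> complex"
  where
  "Lam \<nu> \<alpha> N t \<phi> x =
    (- 2) powi (- int (mdeg \<alpha>)) * complex_of_real (t powr (- (real (mdeg \<alpha>) / 2)))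
    * (\<Sum>j = 0..N.
         2 powi (- int j) * complex_of_real (t powr (- (real j / 2)))
         * (\<Sum>\<beta> \<in> {\<beta>. mdeg \<beta> = j}.
              moment \<beta> \<phi> * dilate t (\<lambda>y. hpoly \<nu> (\<lambda>i. \<alpha> i + \<beta> i) y * gauss \<nu> y) x))"

text \<open>A representative of the Bochner integral $\int_0^\infty s^j f(u(s))\,ds$ in $L^1$. The integral
  must not be taken pointwise in \<open>x\<close>, because the representatives \<open>u s\<close> can be changed on a null set
  for each \<open>s\<close>.\<close>

definition psi ::
  "(complex \<Rightarrow> complex) \<Rightarrow> (real \<Rightarrow> real ^ 'n::finite \<Rightarrow> complex) \<Rightarrow> nat \<Rightarrow> real ^ 'n \<Rightarrow> complex"
  where
  "psi f u j =
    (SOME g. has_bochner_integral_in (Lq 1) (lq_norm 1) (lebesgue_on {0..})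
               (\<lambda>s x. complex_of_real (s ^ j) * f (u s x)) g)"

text \<open>The profile $\mathcal{A}_k(t)$ belonging to the initial datum \<open>u0\<close> and the solution \<open>u\<close>.
  The subtraction in \<open>k - 2 * mdeg \<gamma>\<close> does not truncate on the range of summation.\<close>

definition profile ::
  "complex \<Rightarrow> (complex \<Rightarrow> complex) \<Rightarrow> (real ^ 'n::finite \<Rightarrow> complex)
    \<Rightarrow> (real \<Rightarrow> real ^ 'n \<Rightarrow> complex) \<Rightarrow> nat \<Rightarrow> real \<Rightarrow> real ^ 'n \<Rightarrow> complex" where
  "profile \<nu> f u0 u k t x =
    Lam \<nu> (\<lambda>i. 0) k t u0 x
    + (\<Sum>\<gamma> \<in> {\<gamma>. real (mdeg \<gamma>) \<le> real k / 2}.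
         (- \<nu>) ^ mdeg \<gamma> / of_nat (mfact \<gamma>)
         * Lam \<nu> (\<lambda>i. 2 * \<gamma> i) (k - 2 * mdeg \<gamma>) t (psi f u (mdeg \<gamma>)) x)"

end

theory Submission
  imports Defs "HOL-Probability.Distributions"
begin

text \<open>In Duhamel's formula, expand the kernel $G_{(t-s)\nu}(x-y)$ in a Taylor polynomial in \<open>(s, y)\<close> of
  parabolic order \<open>m + 1\<close>, where \<open>s\<close> counts twice. Integrated against the initial datum and against the
  source $f(u(s))$, this polynomial gives exactly the profile of order \<open>m + 1\<close>, because
  $\partial_t = \nu\Delta$ turns time derivatives into space derivatives of even order. The source decays like
  $(1+s)^{-n(p-1)/2}$ with $n(p-1)/2 > (m+1)/2 + 1$, and a Gronwall argument shows that moments of order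
  \<open>m + 1\<close> of \<open>u s\<close> grow at most like $s^{(m+1)/2}$. So the source has all the moments needed, and dominated
  convergence makes the remainder $o(t^{-(m+1)/2})$ in $L^1$ and $o(t^{-(m+1)/2-n/2})$ in $L^\infty$, hence in
  every $L^q$ by interpolation. The difference of the profiles of order \<open>m + 1\<close> and \<open>m\<close> is homogeneous under
  parabolic scaling, which yields the limit, and it vanishes only if all its coefficients do, because
  products of Hermite polynomials are linearly independent.\<close>

section \<open>Hermite polynomials with complex parameter\<close>

text \<open>Three obstacles shape the proof. (1) The Duhamel term is a Bochner integral of classes
  and \<open>psi\<close> is a Hilbert choice, so neither can be evaluated at a point directly. Both
  are identified almost everywhere with ordinary integrals of one jointly Borel measurable source
  \<open>g\<close>; after that the estimates live on \<open>lborel\<close>, where Fubini is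
  available. (2) Only moments of order m + 1 are at hand, which would give merely O(t^(-(m+1)/2))
  for the remainder after order m + 1. The Taylor error is therefore kept in the form \<rho>^(m+1)
  min 1 \<rho>: the power is integrable against the source, and the factor min 1 \<rho> tends to 0
  pointwise, which turns O into o. (3) For s between t/2 and t the kernel is close to its
  singularity. There the decay of the source alone is used, and the time interval of length t/2
  costs one power of t. This loss and the weight s^((m+1)/2) in the moments lead to the same
  threshold n(p-1)/2 > (m+1)/2 + 1, that is p > 1 + (m+3)/n.\<close>

definition herm :: "complex \<Rightarrow> nat \<Rightarrow> real \<Rightarrow> complex" where
  "herm \<nu> N x = (\<Sum>l\<in>{l. 2 * l \<le> N}. (- 1) ^ l * of_nat (fact N) / (of_nat (fact l) * of_nat (fact (N - 2 * l)))
     * \<nu> powi (- int (N - l)) * complex_of_real (x ^ (N - 2 * l)))"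

lemma powi_minus_nat: "z powi (- int n) = inverse z ^ n" for z :: complex
  by (simp add: power_int_minus power_inverse)

text \<open>The constraint 2 \<beta> \<le> \<alpha> acts on each coordinate separately, so the
  multi-index sum is an expanded product. The factor \<open>herm \<nu> N x\<close> is \<nu>^(-N/2)
  H_N(x / (2 sqrt \<nu>)) with H_N the physicists' Hermite polynomial.\<close>

lemma hpoly_eq_prod_herm: "hpoly \<nu> \<alpha> x = (\<Prod>i\<in>UNIV. herm \<nu> (\<alpha> i) (x $ i))"
proof -
  have "(\<Prod>i\<in>UNIV. herm \<nu> (\<alpha> i) (x $ i)) =
     (\<Sum>\<beta>\<in>PiE UNIV (\<lambda>i. {l. 2 * l \<le> \<alpha> i}). \<Prod>i\<in>UNIV. (- 1) ^ \<beta> i * of_nat (fact (\<alpha> i)) / (of_nat (fact (\<beta> i)) * of_nat (fact (\<alpha> i - 2 * \<beta> i)))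
     * \<nu> powi (- int (\<alpha> i - \<beta> i)) * complex_of_real ((x $ i) ^ (\<alpha> i - 2 * \<beta> i)))"
    unfolding herm_def
  proof (rule prod_sum_PiE)
    show "finite {l. 2 * l \<le> \<alpha> i}" for i
      by (rule finite_subset[of _ "{..\<alpha> i}"]) auto
  qed simp
  also have "PiE UNIV (\<lambda>i. {l. 2 * l \<le> \<alpha> i}) = {\<beta>. \<forall>i. 2 * \<beta> i \<le> \<alpha> i}"
    by (auto simp: PiE_def)
  also have "(\<Sum>\<beta>\<in>{\<beta>. \<forall>i. 2 * \<beta> i \<le> \<alpha> i}. \<Prod>i\<in>UNIV. (- 1) ^ \<beta> i * of_nat (fact (\<alpha> i)) / (of_nat (fact (\<beta> i)) * of_nat (fact (\<alpha> i - 2 * \<beta> i)))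
     * \<nu> powi (- int (\<alpha> i - \<beta> i)) * complex_of_real ((x $ i) ^ (\<alpha> i - 2 * \<beta> i))) = hpoly \<nu> \<alpha> x"
    unfolding hpoly_def powi_minus_nat mdeg_def mfact_def mpow_def
    by (simp add: prod.distrib prod_dividef power_sum)
  finally show ?thesis by simp
qed

lemma herm_0: "herm \<nu> 0 x = 1"
  by (simp add: herm_def)

lemma herm_1: "herm \<nu> (Suc 0) x = of_real x / \<nu>"
proof -
  have "{l. 2 * l \<le> Suc 0} = {0}" by auto
  then show ?thesis by (simp add: herm_def power_int_minus field_simps)
qed

text \<open>The closed form with the range of summation extended to a range independent of the parity
  of \<open>N\<close>; the extra terms are switched off.\<close>

definition hcoeff :: "complex \<Rightarrow> nat \<Rightarrow> nat \<Rightarrow> complex" where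
  "hcoeff \<nu> N l = (if 2 * l \<le> N then (- 1) ^ l * fact N / (fact l * fact (N - 2 * l))
     * inverse \<nu> ^ (N - l) else 0)"

lemma herm_eq_sum_hcoeff:
  assumes "N \<le> M"
  shows "herm \<nu> N x = (\<Sum>l\<le>M. hcoeff \<nu> N l * of_real x ^ (N - 2 * l))"
proof -
  have "herm \<nu> N x = (\<Sum>l\<in>{l. 2 * l \<le> N}. hcoeff \<nu> N l * of_real x ^ (N - 2 * l))"
    unfolding herm_def hcoeff_def powi_minus_nat
    by (intro sum.cong) auto
  also have "\<dots> = (\<Sum>l\<le>M. hcoeff \<nu> N l * of_real x ^ (N - 2 * l))"
    using assms by (intro sum.mono_neutral_left) (auto simp: hcoeff_def)
  finally show ?thesis .
qed

text \<open>The Hermite recurrence read off coefficient by coefficient. The cases separate the range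
  where all three terms vanish, the boundary where only the term with N + 1 vanishes, and the range
  where none does.\<close>

lemma hcoeff_rec:
  assumes "\<nu> \<noteq> 0"
  shows "hcoeff \<nu> (Suc (Suc N)) (Suc l) = inverse \<nu> * hcoeff \<nu> (Suc N) (Suc l)
    - 2 * of_nat (Suc N) * inverse \<nu> * hcoeff \<nu> N l"
proof -
  consider "N < 2 * l" | "N = 2 * l" | k where "N = 2 * l + Suc k"
    by (metis add_Suc_right less_natE linorder_neqE_nat)
  then show ?thesis
  proof cases
    case 1
    then show ?thesis by (simp add: hcoeff_def)
  next
    case 2
    have e: "Suc (Suc N) - Suc l = Suc l" "Suc (Suc N) - 2 * Suc l = 0" "2 * Suc l \<le> Suc (Suc N)" 
      "\<not> 2 * Suc l \<le> Suc N" "2 * l \<le> N" "N - 2 * l = 0" "N - l = l"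
      using 2 by auto
    have f: "fact (Suc (Suc N)) = 2 * (of_nat l + 1) * of_nat (Suc N) * (fact N :: complex)"
       "fact (Suc l) = (of_nat l + 1) * (fact l :: complex)" using 2 by (simp_all add: algebra_simps)
    have nz: "of_nat l + 1 \<noteq> (0::complex)"
      by (metis of_nat_Suc of_nat_neq_0 add.commute)
    show ?thesis using nz assms by (simp only: hcoeff_def e if_True if_False f) (simp add: divide_simps, simp add: algebra_simps)
  next
    case 3
    have e: "Suc (Suc N) - Suc l = Suc (Suc (l + k))" "Suc (Suc N) - 2 * Suc l = Suc k" "2 * Suc l \<le> Suc (Suc N)" 
      "2 * Suc l \<le> Suc N" "Suc N - 2 * Suc l = k" "Suc N - Suc l = Suc (l + k)" "2 * l \<le> N" "N - 2 * l = Suc k" "N - l = Suc (l + k)"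
      using 3 by auto
    define v A B K L F fk fl where "v = inverse \<nu>" "A = (of_nat (Suc (Suc N))::complex)" "B = (of_nat (Suc N)::complex)"
      "K = (of_nat (Suc k)::complex)" "L = (of_nat (Suc l)::complex)"
      "F = (fact N::complex)" "fk = (fact k :: complex)" "fl = (fact l::complex)"
    note defs = v_A_B_K_L_F_fk_fl_def
    have f: "fact (Suc (Suc N)) = A * (B * F)" "fact (Suc N) = B * F" "fact (Suc k) = K * fk" "fact (Suc l) = L * fl"
      by (simp_all only: fact_Suc of_nat_mult defs)
    have nz: "K \<noteq> 0" "L \<noteq> 0" "fk \<noteq> 0" "fl \<noteq> 0"
      unfolding defs of_nat_eq_0_iff by simp_all
    \<comment> \<open>With N = 2l + k + 1 this reads N + 2 = 2(l + 1) + (k + 1); once the common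
      factorials are cancelled it is the whole content of the recurrence.\<close>
    have A: "A = 2 * L + K" using 3 by (simp add: defs)
    have "(- 1) * (A * (B * F)) / ((L * fl) * (K * fk)) * (v * v) = 
       v * (- 1 * (B * F) / ((L * fl) * fk) * v) - 2 * B * v * (F / (fl * (K * fk)) * v)"
      unfolding A using nz by (simp add: divide_simps) (simp add: algebra_simps)
    from arg_cong[OF this, where f="\<lambda>z. (-1)^l * v^(l+k) * z"]
    have eq: "(- 1) ^ l * v ^ (l + k) * ((- 1) * (A * (B * F)) / ((L * fl) * (K * fk)) * (v * v)) =
      (- 1) ^ l * v ^ (l + k) * (v * (- 1 * (B * F) / ((L * fl) * fk) * v) - 2 * B * v * (F / (fl * (K * fk)) * v))" .
    have h1: "hcoeff \<nu> (Suc (Suc N)) (Suc l) = (- 1) ^ l * v ^ (l + k) * ((- 1) * (A * (B * F)) / ((L * fl) * (K * fk)) * (v * v))"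
      by (simp only: hcoeff_def e if_True f defs(1)[symmetric]) (simp add: mult_ac)
    have h2: "hcoeff \<nu> (Suc N) (Suc l) = (- 1) ^ l * v ^ (l + k) * (- 1 * (B * F) / ((L * fl) * fk) * v)"
      by (simp only: hcoeff_def e if_True f defs(1,7)[symmetric]) (simp add: mult_ac)
    have h3: "hcoeff \<nu> N l = (- 1) ^ l * v ^ (l + k) * (F / (fl * (K * fk)) * v)"
      by (simp only: hcoeff_def e if_True f defs(1,6,8)[symmetric]) (simp add: mult_ac)
    show ?thesis
      unfolding h1 h2 h3 eq defs(1)[symmetric] defs(3)[symmetric] by (simp add: mult_ac right_diff_distrib)
  qed
qed

lemma hcoeff_0: "hcoeff \<nu> N 0 = inverse \<nu> ^ N"
  by (simp add: hcoeff_def)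

lemma herm_rec:
  assumes "\<nu> \<noteq> 0"
  shows "herm \<nu> (Suc (Suc N)) x = of_real x / \<nu> * herm \<nu> (Suc N) x - 2 * of_nat (Suc N) / \<nu> * herm \<nu> N x"
proof -
  let ?x = "complex_of_real x"
  \<comment> \<open>Past the end of the polynomial the coefficient is 0, so the truncated exponent
    does no harm.\<close>
  have p: "hcoeff \<nu> (Suc N) l * ?x ^ (Suc (Suc N) - 2 * l) = hcoeff \<nu> (Suc N) l * (?x * ?x ^ (Suc N - 2 * l))" for l
    by (cases "2 * l \<le> Suc N") (auto simp: hcoeff_def Suc_diff_le)
  have "herm \<nu> (Suc (Suc N)) x = hcoeff \<nu> (Suc (Suc N)) 0 * ?x ^ (Suc (Suc N)) +
     (\<Sum>l\<le>Suc N. hcoeff \<nu> (Suc (Suc N)) (Suc l) * ?x ^ (Suc (Suc N) - 2 * Suc l))"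
    by (simp only: herm_eq_sum_hcoeff[OF order_refl] sum.atMost_Suc_shift) simp
  also have "(\<Sum>l\<le>Suc N. hcoeff \<nu> (Suc (Suc N)) (Suc l) * ?x ^ (Suc (Suc N) - 2 * Suc l)) =
    inverse \<nu> * (\<Sum>l\<le>Suc N. hcoeff \<nu> (Suc N) (Suc l) * ?x ^ (Suc (Suc N) - 2 * Suc l))
    - 2 * of_nat (Suc N) * inverse \<nu> * (\<Sum>l\<le>Suc N. hcoeff \<nu> N l * ?x ^ (N - 2 * l))"
    unfolding hcoeff_rec[OF assms] by (simp only: sum_distrib_left sum_subtractf[symmetric]) (rule sum.cong, auto simp: algebra_simps)
  also have "(\<Sum>l\<le>Suc N. hcoeff \<nu> N l * ?x ^ (N - 2 * l)) = herm \<nu> N x"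
    by (rule herm_eq_sum_hcoeff[symmetric]) simp
  also have "hcoeff \<nu> (Suc (Suc N)) 0 * ?x ^ (Suc (Suc N)) + (inverse \<nu> * (\<Sum>l\<le>Suc N. hcoeff \<nu> (Suc N) (Suc l) * ?x ^ (Suc (Suc N) - 2 * Suc l)) - 2 * of_nat (Suc N) * inverse \<nu> * herm \<nu> N x)
    = inverse \<nu> * ?x * (\<Sum>l\<le>Suc (Suc N). hcoeff \<nu> (Suc N) l * ?x ^ (Suc N - 2 * l)) - 2 * of_nat (Suc N) * inverse \<nu> * herm \<nu> N x"
    unfolding p sum.atMost_Suc_shift[of _ "Suc N"] by (simp add: hcoeff_0 sum_distrib_left algebra_simps)
  also have "(\<Sum>l\<le>Suc (Suc N). hcoeff \<nu> (Suc N) l * ?x ^ (Suc N - 2 * l)) = herm \<nu> (Suc N) x"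
    by (rule herm_eq_sum_hcoeff[symmetric]) simp
  finally show ?thesis by (simp add: divide_inverse algebra_simps)
qed

text \<open>Appell property of the Hermite polynomials, by induction along the three-term
  recurrence. At N = 0 the truncated index N - 1 is multiplied by 0.\<close>

lemma has_vector_derivative_herm:
  assumes "\<nu> \<noteq> 0"
  shows "(herm \<nu> N has_vector_derivative of_nat N / \<nu> * herm \<nu> (N - 1) x) (at x within S)"
proof (induction N rule: induct_nat_012)
  case 0
  have "herm \<nu> 0 = (\<lambda>_. 1)" by (auto simp: herm_0)
  then show ?case by simp
next
  case 1
  have "herm \<nu> (Suc 0) = (\<lambda>x. of_real x / \<nu>)" by (auto simp: herm_1)
  then show ?case by (auto simp: herm_0 intro!: derivative_eq_intros)
next
  case (ge2 N)
  have *: "herm \<nu> (Suc (Suc N)) = (\<lambda>x. of_real x / \<nu> * herm \<nu> (Suc N) x - 2 * of_nat (Suc N) / \<nu> * herm \<nu> N x)"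
    using herm_rec[OF assms] by auto
  \<comment> \<open>This is the recurrence one index lower, times (N + 1)/\<nu>. The derivative of
    the factor x/\<nu> then supplies one further copy, which turns N + 1 into N + 2.\<close>
  have r: "of_real x / \<nu> * (of_nat (Suc N) / \<nu> * herm \<nu> N x) - 2 * of_nat (Suc N) / \<nu> * (of_nat N / \<nu> * herm \<nu> (N - 1) x) =
     of_nat (Suc N) / \<nu> * herm \<nu> (Suc N) x"
  proof (cases N)
    case 0 then show ?thesis by (simp add: herm_0 herm_1)
  next
    case (Suc M)
    show ?thesis unfolding Suc herm_rec[OF assms, of M] by (simp add: divide_inverse algebra_simps)
  qed
  have "((\<lambda>x. of_real x / \<nu> * herm \<nu> (Suc N) x - 2 * of_nat (Suc N) / \<nu> * herm \<nu> N x) has_vector_derivative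
     ((of_real x / \<nu> * (of_nat (Suc N) / \<nu> * herm \<nu> N x) + 1 / \<nu> * herm \<nu> (Suc N) x) - 2 * of_nat (Suc N) / \<nu> * (of_nat N / \<nu> * herm \<nu> (N - 1) x))) (at x within S)"
    by (rule derivative_eq_intros ge2 refl | simp)+
  also have "((of_real x / \<nu> * (of_nat (Suc N) / \<nu> * herm \<nu> N x) + 1 / \<nu> * herm \<nu> (Suc N) x) - 2 * of_nat (Suc N) / \<nu> * (of_nat N / \<nu> * herm \<nu> (N - 1) x))
    = of_nat (Suc (Suc N)) / \<nu> * herm \<nu> (Suc N) x"
    using r by (simp add: algebra_simps add_divide_distrib)
  finally show ?case by (simp only: * diff_Suc_1)
qed

text \<open>The N-th iterate of -d/dx applied to exp(-x^2/(4 \<nu>)); division by 2^N removes all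
  constants from the derivative rule.\<close>

definition herm_gauss :: "complex \<Rightarrow> nat \<Rightarrow> real \<Rightarrow> complex" where
  "herm_gauss \<nu> N x = herm \<nu> N x / 2 ^ N * exp (- (of_real (x\<^sup>2) / (4 * \<nu>)))"

lemma herm_gauss_rec:
  assumes "\<nu> \<noteq> 0"
  shows "herm_gauss \<nu> (Suc (Suc N)) x = of_real x / (2 * \<nu>) * herm_gauss \<nu> (Suc N) x - of_nat (Suc N) / (2 * \<nu>) * herm_gauss \<nu> N x"
  unfolding herm_gauss_def herm_rec[OF assms] using assms by (simp add: divide_simps) (simp add: algebra_simps)

lemma herm_Suc:
  assumes "\<nu> \<noteq> 0"
  shows "herm \<nu> (Suc N) x = of_real x / \<nu> * herm \<nu> N x - 2 * (of_nat N / \<nu> * herm \<nu> (N - 1) x)"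
  by (cases N) (simp_all add: herm_0 herm_1 herm_rec[OF assms])

lemma has_vector_derivative_exp_quadratic:
  "((\<lambda>x. exp (- (complex_of_real (x\<^sup>2) / (4 * \<nu>)))) has_vector_derivative
     - (of_real x / (2 * \<nu>)) * exp (- (of_real (x\<^sup>2) / (4 * \<nu>)))) (at x within S)"
proof -
  have "((\<lambda>z. exp (- (z\<^sup>2 / (4 * \<nu>)))) has_field_derivative - (z / (2 * \<nu>)) * exp (- (z\<^sup>2 / (4 * \<nu>)))) (at z within UNIV)" for z
    by (cases "\<nu> = 0") (auto intro!: derivative_eq_intros simp: field_simps)
  from has_vector_derivative_real_field[OF this, of _ S] show ?thesis by simp
qed

lemma has_vector_derivative_herm_gauss:
  assumes "\<nu> \<noteq> 0"
  shows "(herm_gauss \<nu> N has_vector_derivative - herm_gauss \<nu> (Suc N) x) (at x within S)"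
proof -
  let ?e = "\<lambda>x. exp (- (complex_of_real (x\<^sup>2) / (4 * \<nu>)))"
  have "((\<lambda>x. herm \<nu> N x / 2 ^ N * ?e x) has_vector_derivative
    herm \<nu> N x / 2 ^ N * (- (of_real x / (2 * \<nu>)) * ?e x) + (of_nat N / \<nu> * herm \<nu> (N - 1) x) / 2 ^ N * ?e x) (at x within S)"
    by (intro has_vector_derivative_mult has_vector_derivative_divide has_vector_derivative_herm[OF assms] has_vector_derivative_exp_quadratic)
  also have "herm \<nu> N x / 2 ^ N * (- (of_real x / (2 * \<nu>)) * ?e x) + (of_nat N / \<nu> * herm \<nu> (N - 1) x) / 2 ^ N * ?e x
     = - herm_gauss \<nu> (Suc N) x"
    unfolding herm_gauss_def herm_Suc[OF assms] using assms by (simp add: divide_simps) (simp add: algebra_simps)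
  finally show ?thesis by (simp add: herm_gauss_def[abs_def])
qed

text \<open>One-dimensional factor of $(-\partial)^N$ of the heat kernel at time \<open>t\<close>, without the constant.\<close>

definition herm_kernel :: "complex \<Rightarrow> nat \<Rightarrow> real \<Rightarrow> real \<Rightarrow> complex" where
  "herm_kernel \<nu> N t x = of_real (t powr (- (real (Suc N) / 2))) * herm_gauss \<nu> N (t powr (- (1 / 2)) * x)"

lemma has_vector_derivative_herm_kernel_space:
  assumes "\<nu> \<noteq> 0" "t > 0"
  shows "(herm_kernel \<nu> N t has_vector_derivative - herm_kernel \<nu> (Suc N) t x) (at x within S)"
proof -
  let ?r = "t powr (- (1 / 2))"
  have "((\<lambda>x. herm_gauss \<nu> N (?r * x)) has_vector_derivative ?r *\<^sub>R (- herm_gauss \<nu> (Suc N) (?r * x))) (at x within S)"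
  proof -
    have "((\<lambda>x. ?r * x) has_vector_derivative ?r) (at x within S)" by (auto intro!: derivative_eq_intros)
    from vector_diff_chain_within[OF this has_vector_derivative_herm_gauss[OF assms(1)]] show ?thesis by (simp add: o_def)
  qed
  then have "(herm_kernel \<nu> N t has_vector_derivative of_real (t powr (- (real (Suc N) / 2))) * (?r *\<^sub>R (- herm_gauss \<nu> (Suc N) (?r * x)))) (at x within S)"
    unfolding herm_kernel_def[abs_def] by (rule has_vector_derivative_mult_right)
  moreover have "t powr (- (real (Suc N) / 2)) * ?r = t powr (- (real (Suc (Suc N)) / 2))"
    by (simp add: powr_add[symmetric] add_divide_distrib)
  ultimately show ?thesis unfolding herm_kernel_def scaleR_conv_of_real
    by (metis (no_types, lifting) mult.assoc mult_minus_right of_real_mult)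
qed

text \<open>One-dimensional heat equation for all derivatives of the kernel. Differentiating the
  power of t and the rescaled argument produces the two terms of \<open>herm_gauss_rec\<close>,
  which combine into the function of index N + 2.\<close>

lemma has_vector_derivative_herm_kernel_time:
  assumes "\<nu> \<noteq> 0" "t > 0"
  shows "((\<lambda>t. herm_kernel \<nu> N t x) has_vector_derivative \<nu> * herm_kernel \<nu> (Suc (Suc N)) t x) (at t within S)"
proof -
  let ?q = "- (real (Suc N) / 2)" and ?r = "t powr (- (1 / 2))"
  have 1: "((\<lambda>t. complex_of_real (t powr ?q)) has_vector_derivative of_real (?q * t powr (?q - 1))) (at t within S)"
    using assms(2) by (auto intro!: derivative_eq_intros)
  have 2: "((\<lambda>t. t powr (- (1 / 2)) * x) has_vector_derivative (- (1 / 2)) * t powr (- (1/2) - 1) * x) (at t within S)"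
    using assms(2) unfolding has_real_derivative_iff_has_vector_derivative[symmetric] by (auto intro!: derivative_eq_intros)
  have 3: "((\<lambda>t. herm_gauss \<nu> N (t powr (- (1 / 2)) * x)) has_vector_derivative
      (- (1 / 2) * t powr (- (1/2) - 1) * x) *\<^sub>R (- herm_gauss \<nu> (Suc N) (?r * x))) (at t within S)"
    using vector_diff_chain_within[OF 2 has_vector_derivative_herm_gauss[OF assms(1)]] by (simp add: o_def)
  have 4: "((\<lambda>t. herm_kernel \<nu> N t x) has_vector_derivative
     of_real (t powr ?q) * ((- (1 / 2) * t powr (- (1/2) - 1) * x) *\<^sub>R (- herm_gauss \<nu> (Suc N) (?r * x)))
     + of_real (?q * t powr (?q - 1)) * herm_gauss \<nu> N (?r * x)) (at t within S)"
    unfolding herm_kernel_def by (rule has_vector_derivative_mult[OF 1 3])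
  have e: "t powr ?q * t powr (- (1/2) - 1) = t powr (?q - 1) * ?r" "t powr (- (real (Suc (Suc (Suc N))) / 2)) = t powr (?q - 1)"
    by (simp_all add: powr_add[symmetric] add_divide_distrib algebra_simps)
  have "of_real (t powr ?q) * ((- (1 / 2) * t powr (- (1/2) - 1) * x) *\<^sub>R (- herm_gauss \<nu> (Suc N) (?r * x)))
    = of_real (t powr ?q * t powr (- (1/2) - 1)) * (of_real x / 2) * herm_gauss \<nu> (Suc N) (?r * x)"
    by (simp add: scaleR_conv_of_real algebra_simps)
  also have "\<dots> + of_real (?q * t powr (?q - 1)) * herm_gauss \<nu> N (?r * x) = \<nu> * herm_kernel \<nu> (Suc (Suc N)) t x"
    unfolding herm_kernel_def e herm_gauss_rec[OF assms(1)] using assms(1) by (simp add: field_simps)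
  finally show ?thesis using 4 by simp
qed

text \<open>A single term of the exponential series bounds r^(2j) exp(-c r^2) by j!/c^j. For r > 1
  the power r^j lies below r^(2j), and for r \<le> 1 both factors are at most 1.\<close>

lemma power_times_exp_bound:
  assumes "c > (0::real)"
  shows "\<exists>C>0. \<forall>r\<ge>0. r ^ j * exp (- c * r\<^sup>2) \<le> C"
proof -
  have b: "(r\<^sup>2) ^ j * exp (- c * r\<^sup>2) \<le> fact j / c ^ j" for r
  proof -
    have "(c * r\<^sup>2) ^ j / fact j \<le> exp (c * r\<^sup>2)"
    proof -
      have "(\<Sum>n\<in>{j}. inverse (fact n) *\<^sub>R (c * r\<^sup>2) ^ n) \<le> (\<Sum>n. inverse (fact n) *\<^sub>R (c * r\<^sup>2) ^ n)"
        using assms by (intro sum_le_suminf summable_exp_generic) auto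
      then show ?thesis by (simp add: exp_def divide_inverse mult.commute)
    qed
    then have "(c * r\<^sup>2) ^ j * exp (- c * r\<^sup>2) \<le> fact j" by (simp add: exp_minus field_simps)
    then show ?thesis using assms by (simp add: field_simps power_mult_distrib)
  qed
  have "r ^ j * exp (- c * r\<^sup>2) \<le> 1 + fact j / c ^ j" if "r \<ge> 0" for r
  proof (cases "r \<le> 1")
    case True
    then have "r ^ j \<le> 1" "exp (- c * r\<^sup>2) \<le> 1" using that assms by (auto simp: power_le_one)
    then have "r ^ j * exp (- c * r\<^sup>2) \<le> 1" using that by (simp add: mult_le_one)
    then show ?thesis using assms by (smt (verit) divide_nonneg_nonneg fact_ge_zero zero_le_power)
  next
    case False
    then have "r ^ j \<le> (r\<^sup>2) ^ j" by (intro power_mono) (auto simp: power2_eq_square)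
    then have "r ^ j * exp (- c * r\<^sup>2) \<le> (r\<^sup>2) ^ j * exp (- c * r\<^sup>2)" by (intro mult_right_mono) auto
    also note b[of r]
    finally show ?thesis by linarith
  qed
  then show ?thesis using assms by (intro exI[of _ "1 + fact j / c ^ j"]) (auto intro!: add_pos_nonneg)
qed

lemma Re_of_real_mult: "Re (complex_of_real a * w) = a * Re w"
  by simp

text \<open>Half of the true rate Re(1/\<nu>)/4 of exp(-x^2/(4 \<nu>)). The other half is spent on
  absorbing polynomial factors.\<close>

definition gauss_rate :: "complex \<Rightarrow> real" where "gauss_rate \<nu> = Re (inverse \<nu>) / 8"

lemma gauss_rate_pos: "Re \<nu> > 0 \<Longrightarrow> gauss_rate \<nu> > 0"
  by (auto simp: gauss_rate_def power2_eq_square sum_squares_gt_zero_iff intro!: divide_pos_pos add_pos_nonneg)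

lemma herm_gauss_bound:
  assumes "Re \<nu> > 0"
  shows "\<exists>C>0. \<forall>x. norm (herm_gauss \<nu> N x) \<le> C * exp (- gauss_rate \<nu> * x\<^sup>2)"
proof -
  have "\<exists>C. \<forall>j. C j > 0 \<and> (\<forall>r\<ge>0. r ^ j * exp (- gauss_rate \<nu> * r\<^sup>2) \<le> C j)"
    using power_times_exp_bound[OF gauss_rate_pos[OF assms]] by metis
  then obtain C where C: "\<And>j. C j > 0" "\<And>j r. r \<ge> 0 \<Longrightarrow> r ^ j * exp (- gauss_rate \<nu> * r\<^sup>2) \<le> C j" by blast
  define D where "D = (\<Sum>l\<le>N. norm (hcoeff \<nu> N l) * C (N - 2 * l))"
  have e: "norm (exp (- (complex_of_real (x\<^sup>2) / (4 * \<nu>)))) = exp (- gauss_rate \<nu> * x\<^sup>2) * exp (- gauss_rate \<nu> * x\<^sup>2)" for x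
  proof -
    have "Re (complex_of_real (x\<^sup>2) / (4 * \<nu>)) = Re (complex_of_real (x\<^sup>2 / 4) * inverse \<nu>)" by (simp add: field_simps)
    also have "\<dots> = x\<^sup>2 / 4 * Re (inverse \<nu>)" by (rule Re_of_real_mult)
    also have "\<dots> = 2 * gauss_rate \<nu> * x\<^sup>2" by (simp add: gauss_rate_def del: inverse_complex.sel)
    finally show ?thesis by (simp add: norm_exp_eq_Re exp_add[symmetric])
  qed
  have "norm (herm_gauss \<nu> N x) \<le> (D + 1) * exp (- gauss_rate \<nu> * x\<^sup>2)" for x
  proof -
    have "norm (herm_gauss \<nu> N x) \<le> norm (herm \<nu> N x) * exp (- gauss_rate \<nu> * x\<^sup>2) * exp (- gauss_rate \<nu> * x\<^sup>2)"
      unfolding herm_gauss_def norm_mult norm_divide e using one_le_power[of "2::real" N]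
      by (auto simp: mult.assoc norm_power intro!: mult_right_mono divide_left_mono[of 1 "2^N", THEN order_trans])
    also have "norm (herm \<nu> N x) * exp (- gauss_rate \<nu> * x\<^sup>2) \<le> (\<Sum>l\<le>N. norm (hcoeff \<nu> N l) * \<bar>x\<bar> ^ (N - 2 * l)) * exp (- gauss_rate \<nu> * x\<^sup>2)"
      unfolding herm_eq_sum_hcoeff[OF order_refl]
      by (intro mult_right_mono order_trans[OF norm_sum]) (auto simp: norm_mult norm_power)
    also have "\<dots> = (\<Sum>l\<le>N. norm (hcoeff \<nu> N l) * (\<bar>x\<bar> ^ (N - 2 * l) * exp (- gauss_rate \<nu> * \<bar>x\<bar>\<^sup>2)))"
      by (simp add: sum_distrib_right mult.assoc)
    also have "\<dots> \<le> D" unfolding D_def by (intro sum_mono mult_left_mono C) auto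
    finally have "norm (herm_gauss \<nu> N x) \<le> D * exp (- gauss_rate \<nu> * x\<^sup>2)" by (simp add: mult_right_mono)
    \<comment> \<open>Enlarging the constant by 1 makes it visibly positive; the same device recurs
      below.\<close>
    also have "\<dots> \<le> (D + 1) * exp (- gauss_rate \<nu> * x\<^sup>2)" by (intro mult_right_mono) auto
    finally show ?thesis .
  qed
  moreover have "D \<ge> 0" unfolding D_def using C(1) by (intro sum_nonneg mult_nonneg_nonneg) (auto intro: less_imp_le)
  ultimately show ?thesis by (intro exI[of _ "D + 1"]) auto
qed

section \<open>Derivatives of the complex heat kernel\<close>

definition mpowc :: "('n::finite \<Rightarrow> complex) \<Rightarrow> ('n \<Rightarrow> nat) \<Rightarrow> complex" where
  "mpowc c \<beta> = (\<Prod>i\<in>UNIV. c i ^ \<beta> i)"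

lemma mpowc_of_real: "mpowc (\<lambda>i. of_real (y $ i)) \<beta> = of_real (mpow y \<beta>)"
  by (simp add: mpowc_def mpow_def)

lemma mpowc_const: "mpowc (\<lambda>i. c) \<beta> = c ^ mdeg \<beta>"
  by (simp add: mpowc_def mdeg_def power_sum)

lemma mdeg_upd: "mdeg (\<beta>(i := Suc (\<beta> i))) = Suc (mdeg \<beta>)"
proof -
  have "(\<Sum>j\<in>UNIV. (\<beta>(i := Suc (\<beta> i))) j) = (\<Sum>j\<in>UNIV. \<beta> j + (if j = i then 1 else 0))"
    by (intro sum.cong) auto
  then show ?thesis by (simp add: mdeg_def sum.distrib)
qed

lemma mpowc_upd: "mpowc c (\<beta>(i := Suc (\<beta> i))) = c i * mpowc c \<beta>"
proof -
  have "(\<Prod>j\<in>UNIV. c j ^ (\<beta>(i := Suc (\<beta> i))) j) = (\<Prod>j\<in>UNIV. c j ^ \<beta> j * (if j = i then c i else 1))"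
    by (intro prod.cong) auto
  then show ?thesis by (simp add: mpowc_def prod.distrib mult.commute)
qed

lemma mfact_upd: "mfact (\<beta>(i := Suc (\<beta> i))) = Suc (\<beta> i) * mfact \<beta>"
proof -
  have "(\<Prod>j\<in>UNIV. fact ((\<beta>(i := Suc (\<beta> i))) j)) = (\<Prod>j\<in>UNIV. fact (\<beta> j) * (if j = i then Suc (\<beta> i) else 1))"
    by (intro prod.cong) auto
  then show ?thesis by (simp add: mfact_def prod.distrib mult.commute)
qed

lemma mfact_ge_1: "mfact \<beta> \<ge> 1"
  unfolding mfact_def by (intro prod_ge_1) auto

lemma le_mdeg: "\<beta> i \<le> mdeg \<beta>"
  unfolding mdeg_def by (intro member_le_sum) auto

lemma finite_mdeg_le: "finite {\<beta> :: 'n::finite \<Rightarrow> nat. mdeg \<beta> \<le> N}"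
proof (rule finite_subset)
  show "{\<beta> :: 'n \<Rightarrow> nat. mdeg \<beta> \<le> N} \<subseteq> PiE UNIV (\<lambda>_. {..N})"
    using le_mdeg order_trans by (fastforce simp: PiE_def)
qed (auto intro: finite_PiE)

lemma finite_mdeg_eq: "finite {\<beta> :: 'n::finite \<Rightarrow> nat. mdeg \<beta> = N}"
  by (rule finite_subset[OF _ finite_mdeg_le[of N]]) auto

text \<open>Write j + 1 = |\<beta>| as the sum of the entries of \<beta> and lower one entry by one.
  This is the combinatorial identity behind differentiating a multi-index Taylor sum.\<close>

lemma sum_mdeg_Suc:
  fixes F :: "('n::finite \<Rightarrow> nat) \<Rightarrow> complex"
  shows "(\<Sum>\<beta>\<in>{\<beta>. mdeg \<beta> = Suc j}. of_nat (Suc j) * F \<beta>) =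
    (\<Sum>\<beta>\<in>{\<beta>. mdeg \<beta> = j}. \<Sum>i\<in>UNIV. of_nat (Suc (\<beta> i)) * F (\<beta>(i := Suc (\<beta> i))))"
proof -
  have "(\<Sum>\<beta>\<in>{\<beta>. mdeg \<beta> = Suc j}. of_nat (Suc j) * F \<beta>) = (\<Sum>\<beta>\<in>{\<beta>. mdeg \<beta> = Suc j}. \<Sum>i\<in>UNIV. of_nat (\<beta> i) * F \<beta>)"
  proof (intro sum.cong refl)
    fix \<beta> :: "'n \<Rightarrow> nat" assume "\<beta> \<in> {\<beta>. mdeg \<beta> = Suc j}"
    then have "complex_of_nat (Suc j) = (\<Sum>i\<in>UNIV. of_nat (\<beta> i))" by (simp add: mdeg_def flip: of_nat_sum)
    then show "of_nat (Suc j) * F \<beta> = (\<Sum>i\<in>UNIV. of_nat (\<beta> i) * F \<beta>)" by (simp only: sum_distrib_right)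
  qed
  also have "\<dots> = (\<Sum>i\<in>UNIV. \<Sum>\<beta>\<in>{\<beta>. mdeg \<beta> = Suc j}. of_nat (\<beta> i) * F \<beta>)" by (rule sum.swap)
  also have "\<dots> = (\<Sum>i\<in>UNIV. \<Sum>\<beta>\<in>{\<beta>. mdeg \<beta> = j}. of_nat (Suc (\<beta> i)) * F (\<beta>(i := Suc (\<beta> i))))"
  proof (rule sum.cong[OF refl])
    fix i :: 'n
    have inj: "inj_on (\<lambda>\<beta>. \<beta>(i := Suc (\<beta> i))) {\<beta>. mdeg \<beta> = j}"
    proof (rule inj_onI)
      fix \<beta> \<gamma> :: "'n \<Rightarrow> nat" assume e: "\<beta>(i := Suc (\<beta> i)) = \<gamma>(i := Suc (\<gamma> i))"
      show "\<beta> = \<gamma>"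
      proof
        fix j show "\<beta> j = \<gamma> j" using fun_cong[OF e, of j] by (cases "j = i") auto
      qed
    qed
    have im: "(\<lambda>\<beta>. \<beta>(i := Suc (\<beta> i))) ` {\<beta>. mdeg \<beta> = j} = {\<beta>. mdeg \<beta> = Suc j \<and> \<beta> i > 0}"
    proof (intro set_eqI iffI)
      fix \<beta> :: "'n \<Rightarrow> nat" assume b: "\<beta> \<in> {\<beta>. mdeg \<beta> = Suc j \<and> \<beta> i > 0}"
      define \<beta>' where "\<beta>' = \<beta>(i := \<beta> i - 1)"
      have "\<beta> = \<beta>'(i := Suc (\<beta>' i))" using b by (auto simp: \<beta>'_def)
      moreover from this have "mdeg \<beta>' = j" using b mdeg_upd[of \<beta>' i] by auto
      ultimately show "\<beta> \<in> (\<lambda>\<beta>. \<beta>(i := Suc (\<beta> i))) ` {\<beta>. mdeg \<beta> = j}" by blast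
    qed (auto simp: mdeg_upd)
    \<comment> \<open>Multi-indices with \<beta> i = 0 lie outside the image of the shift, but they
      carry the weight 0.\<close>
    have "(\<Sum>\<beta>\<in>{\<beta>. mdeg \<beta> = Suc j}. of_nat (\<beta> i) * F \<beta>) = (\<Sum>\<beta>\<in>{\<beta>. mdeg \<beta> = Suc j \<and> \<beta> i > 0}. of_nat (\<beta> i) * F \<beta>)"
      by (intro sum.mono_neutral_right finite_mdeg_eq) auto
    also have "\<dots> = (\<Sum>\<beta>\<in>{\<beta>. mdeg \<beta> = j}. of_nat (Suc (\<beta> i)) * F (\<beta>(i := Suc (\<beta> i))))"
      unfolding im[symmetric] by (subst sum.reindex[OF inj]) (simp add: o_def)
    finally show "(\<Sum>\<beta>\<in>{\<beta>. mdeg \<beta> = Suc j}. of_nat (\<beta> i) * F \<beta>) = (\<Sum>\<beta>\<in>{\<beta>. mdeg \<beta> = j}. of_nat (Suc (\<beta> i)) * F (\<beta>(i := Suc (\<beta> i))))" .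
  qed
  also have "\<dots> = (\<Sum>\<beta>\<in>{\<beta>. mdeg \<beta> = j}. \<Sum>i\<in>UNIV. of_nat (Suc (\<beta> i)) * F (\<beta>(i := Suc (\<beta> i))))" by (rule sum.swap)
  finally show ?thesis .
qed

text \<open>Taylor's formula along a curve on which the multi-indexed family is closed under
  differentiation. It is applied to the heat kernel both in time and in space.\<close>

lemma multi_index_taylor:
  fixes Q :: "('n::finite \<Rightarrow> nat) \<Rightarrow> real \<Rightarrow> complex" and c :: "'n \<Rightarrow> complex"
  assumes der: "\<And>\<beta> l. 0 \<le> l \<Longrightarrow> l \<le> 1 \<Longrightarrow>
      (Q \<beta> has_vector_derivative (\<Sum>i\<in>UNIV. c i * Q (\<beta>(i := Suc (\<beta> i))) l)) (at l within {0..1})"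
    and B: "\<And>\<beta> l. mdeg \<beta> = N \<Longrightarrow> 0 \<le> l \<Longrightarrow> l \<le> 1 \<Longrightarrow> norm (Q \<beta> l) \<le> B"
    and r: "\<And>i. norm (c i) \<le> r" and N: "N > 0"
  shows "norm (Q (\<lambda>i. 0) 1 - (\<Sum>\<beta>\<in>{\<beta>. mdeg \<beta> < N}. mpowc c \<beta> / of_nat (mfact \<beta>) * Q \<beta> 0))
     \<le> real N * real (card {\<beta> :: 'n \<Rightarrow> nat. mdeg \<beta> = N}) * r ^ N * B"
proof -
  \<comment> \<open>\<open>Df j\<close> will be the j-th derivative of the curve
    \<open>Q (\<lambda>i. 0)\<close>; j!/\<beta>! is the multinomial coefficient.\<close>
  define Df where "Df j l = (\<Sum>\<beta>\<in>{\<beta>. mdeg \<beta> = j}. fact j * mpowc c \<beta> / of_nat (mfact \<beta>) * Q \<beta> l)" for j l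
  have r0: "r \<ge> 0" using r norm_ge_zero order_trans by blast
  have m0: "{\<beta> :: 'n \<Rightarrow> nat. mdeg \<beta> = 0} = {\<lambda>i. 0}" by (auto simp: mdeg_def)
  have Df0: "Df 0 = Q (\<lambda>i. 0)" unfolding Df_def m0 by (auto simp: mpowc_def mfact_def)
  have nz: "of_nat (mfact \<beta>) \<noteq> (0::complex)" for \<beta> :: "'n \<Rightarrow> nat" using mfact_ge_1[of \<beta>] by simp
  have dDf: "(Df j has_vector_derivative Df (Suc j) l) (at l within {0..1})" if "0 \<le> l" "l \<le> 1" for j l
  proof -
    let ?F = "\<lambda>\<beta>. fact j * mpowc c \<beta> / of_nat (mfact \<beta>) * Q \<beta> l"
    have "(Df j has_vector_derivative (\<Sum>\<beta>\<in>{\<beta>. mdeg \<beta> = j}. fact j * mpowc c \<beta> / of_nat (mfact \<beta>) * (\<Sum>i\<in>UNIV. c i * Q (\<beta>(i := Suc (\<beta> i))) l))) (at l within {0..1})"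
      unfolding Df_def by (intro has_vector_derivative_sum has_vector_derivative_mult_right der that)
    also have "(\<Sum>\<beta>\<in>{\<beta>. mdeg \<beta> = j}. fact j * mpowc c \<beta> / of_nat (mfact \<beta>) * (\<Sum>i\<in>UNIV. c i * Q (\<beta>(i := Suc (\<beta> i))) l))
       = (\<Sum>\<beta>\<in>{\<beta>. mdeg \<beta> = j}. \<Sum>i\<in>UNIV. of_nat (Suc (\<beta> i)) * ?F (\<beta>(i := Suc (\<beta> i))))"
      unfolding sum_distrib_left mpowc_upd mfact_upd of_nat_mult
      using nz by (intro sum.cong refl) (simp del: of_nat_Suc)
    also have "\<dots> = (\<Sum>\<beta>\<in>{\<beta>. mdeg \<beta> = Suc j}. of_nat (Suc j) * ?F \<beta>)" by (rule sum_mdeg_Suc[symmetric])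
    also have "\<dots> = Df (Suc j) l" unfolding Df_def by (intro sum.cong) (simp_all add: algebra_simps)
    finally show ?thesis .
  qed
  \<comment> \<open>Taylor's formula on [0, 1] with integral remainder, which is available for
    complex values.\<close>
  have I: "((\<lambda>l. ((1 - l) ^ (N - 1) / fact (N - 1)) *\<^sub>R Df N l) has_integral
       Df 0 1 - (\<Sum>j<N. ((1 - 0) ^ j / fact j) *\<^sub>R Df j 0)) {0..1}"
    by (rule Taylor_has_integral[where Df=Df and f="Df 0"]) (use N dDf in auto)
  \<comment> \<open>The weight (1 - l)^(N-1) is simply bounded by 1, so the factor N!/(N-1)! = N
    remains.\<close>
  have bd: "norm (((1 - l) ^ (N - 1) / fact (N - 1)) *\<^sub>R Df N l) \<le> real N * real (card {\<beta> :: 'n \<Rightarrow> nat. mdeg \<beta> = N}) * r ^ N * B"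
    if "l \<in> cbox 0 1" for l :: real
  proof -
    have l: "0 \<le> l" "l \<le> 1" using that by auto
    have t: "norm (fact N * mpowc c \<beta> / of_nat (mfact \<beta>) * Q \<beta> l) \<le> fact N * (r ^ N * B)" if "mdeg \<beta> = N" for \<beta>
    proof -
      have "norm (mpowc c \<beta>) \<le> (\<Prod>i\<in>UNIV. r ^ \<beta> i)" unfolding mpowc_def
        by (intro norm_prod_le[THEN order_trans] prod_mono) (auto simp: norm_power intro!: power_mono r)
      also have "\<dots> = r ^ N" using that by (simp add: mdeg_def power_sum[symmetric])
      finally have 1: "norm (mpowc c \<beta>) \<le> r ^ N" .
      have "norm (fact N * mpowc c \<beta> / of_nat (mfact \<beta>) * Q \<beta> l) = fact N * (norm (mpowc c \<beta>) / real (mfact \<beta>) * norm (Q \<beta> l))"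
        by (simp add: norm_mult norm_divide)
      also have "\<dots> \<le> fact N * (norm (mpowc c \<beta>) / 1 * norm (Q \<beta> l))"
        using mfact_ge_1[of \<beta>] by (intro mult_left_mono mult_right_mono divide_left_mono) auto
      also have "\<dots> \<le> fact N * (r ^ N * B)" using B[OF that l] 1 r0
        by (intro mult_left_mono) (auto intro!: mult_mono)
      finally show ?thesis .
    qed
    have "norm (Df N l) \<le> (\<Sum>\<beta>\<in>{\<beta> :: 'n \<Rightarrow> nat. mdeg \<beta> = N}. fact N * (r ^ N * B))"
      unfolding Df_def by (intro order_trans[OF norm_sum] sum_mono t) auto
    then have d: "norm (Df N l) \<le> real (card {\<beta> :: 'n \<Rightarrow> nat. mdeg \<beta> = N}) * (fact N * (r ^ N * B))" by simp
    have "norm (((1 - l) ^ (N - 1) / fact (N - 1)) *\<^sub>R Df N l) = (1 - l) ^ (N - 1) / fact (N - 1) * norm (Df N l)"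
      using l by (simp add: power_abs)
    also have "\<dots> \<le> 1 / fact (N - 1) * (real (card {\<beta> :: 'n \<Rightarrow> nat. mdeg \<beta> = N}) * (fact N * (r ^ N * B)))"
      using l d by (intro mult_mono divide_right_mono power_le_one) auto
    also have "\<dots> = real N * real (card {\<beta> :: 'n \<Rightarrow> nat. mdeg \<beta> = N}) * r ^ N * B"
      using N by (cases N) (auto simp: field_simps)
    finally show ?thesis .
  qed
  have B0: "0 \<le> real N * real (card {\<beta> :: 'n \<Rightarrow> nat. mdeg \<beta> = N}) * r ^ N * B"
    using order_trans[OF norm_ge_zero bd[of 0]] by simp
  have "norm (Df 0 1 - (\<Sum>j<N. ((1 - 0) ^ j / fact j) *\<^sub>R Df j 0)) \<le> real N * real (card {\<beta> :: 'n \<Rightarrow> nat. mdeg \<beta> = N}) * r ^ N * B"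
    using has_integral_bound[OF B0 I[unfolded box_real[symmetric]] bd] by simp
  also have "(\<Sum>j<N. ((1 - 0) ^ j / fact j) *\<^sub>R Df j 0) = (\<Sum>j<N. \<Sum>\<beta>\<in>{\<beta>. mdeg \<beta> = j}. mpowc c \<beta> / of_nat (mfact \<beta>) * Q \<beta> 0)"
    unfolding Df_def scaleR_sum_right by (intro sum.cong refl) (simp add: scaleR_conv_of_real field_simps)
  also have "\<dots> = (\<Sum>\<beta>\<in>(\<Union>j\<in>{..<N}. {\<beta>. mdeg \<beta> = j}). mpowc c \<beta> / of_nat (mfact \<beta>) * Q \<beta> 0)"
    by (intro sum.UNION_disjoint[symmetric]) (auto simp: finite_mdeg_eq)
  also have "(\<Union>j\<in>{..<N}. {\<beta> :: 'n \<Rightarrow> nat. mdeg \<beta> = j}) = {\<beta>. mdeg \<beta> < N}" by auto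
  finally show ?thesis unfolding Df0 .
qed

text \<open>This is (-\<partial>)^\<alpha> of the heat kernel at complex time t \<nu>. The complex
  power is taken of 4 \<pi> \<nu> alone while the powers of t are real, so the principal branch
  never involves t.\<close>

definition heat_deriv :: "complex \<Rightarrow> ('n::finite \<Rightarrow> nat) \<Rightarrow> real \<Rightarrow> real ^ 'n \<Rightarrow> complex" where
  "heat_deriv \<nu> \<alpha> t x = (4 * of_real pi * \<nu>) powr (- (of_nat CARD('n) / 2)) * (\<Prod>i\<in>UNIV. herm_kernel \<nu> (\<alpha> i) t (x $ i))"

lemma prod_exp_norm2:
  fixes x :: "real ^ 'n::finite"
  shows "(\<Prod>i\<in>UNIV. exp (a * complex_of_real ((x $ i)\<^sup>2))) = exp (a * of_real ((norm x)\<^sup>2))"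
  by (simp add: exp_sum[symmetric] sum_distrib_left[symmetric] norm_vec_def L2_set_def sum_nonneg)

lemma rexp_norm2:
  fixes x :: "real ^ 'n::finite"
  shows "(\<Prod>i\<in>UNIV. exp (a * (x $ i)\<^sup>2)) = exp (a * (norm x)\<^sup>2)"
  by (simp add: exp_sum[symmetric] sum_distrib_left[symmetric] norm_vec_def L2_set_def sum_nonneg)

lemma prod_powr: 
  assumes "t > 0"
  shows "(\<Prod>i\<in>(UNIV::'n::finite set). t powr (- (real (Suc (\<alpha> i)) / 2))) = t powr (- (real CARD('n) / 2)) * t powr (- (real (mdeg \<alpha>) / 2))"
proof -
  have "(\<Prod>i\<in>(UNIV::'n set). t powr (- (real (Suc (\<alpha> i)) / 2))) = t powr (\<Sum>i\<in>UNIV. - (real (Suc (\<alpha> i)) / 2))"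
    using assms by (simp add: powr_sum)
  also have "(\<Sum>i\<in>(UNIV::'n set). - (real (Suc (\<alpha> i)) / 2)) = - (real CARD('n) / 2) + - (real (mdeg \<alpha>) / 2)"
  proof -
    have "(\<Sum>i\<in>(UNIV::'n set). real (Suc (\<alpha> i))) = real CARD('n) + real (mdeg \<alpha>)"
      by (simp add: mdeg_def sum.distrib)
    then show ?thesis by (simp only: sum_negf sum_divide_distrib[symmetric] add_divide_distrib minus_add_distrib)
  qed
  finally show ?thesis by (simp only: powr_add)
qed

lemma powr_half_sq: "t > 0 \<Longrightarrow> (t powr (- (1 / 2)))\<^sup>2 = 1 / t" for t :: real
  by (simp add: power2_eq_square powr_add[symmetric] powr_minus_divide)

lemma heat_deriv_eq:
  fixes x :: "real ^ 'n::finite"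
  assumes "t > 0"
  shows "heat_deriv \<nu> \<alpha> t x = (4 * of_real pi * \<nu>) powr (- (of_nat CARD('n) / 2)) * of_real (t powr (- (real CARD('n) / 2)) * t powr (- (real (mdeg \<alpha>) / 2)))
    * (\<Prod>i\<in>UNIV. herm_gauss \<nu> (\<alpha> i) (t powr (- (1 / 2)) * x $ i))"
  unfolding heat_deriv_def herm_kernel_def prod.distrib of_real_prod[symmetric] prod_powr[OF assms] by (simp add: mult.assoc)

text \<open>Multiplication by t > 0 does not change the argument of a complex number, so
  \<open>Ln\<close> splits additively and the principal power factorises.\<close>

lemma gauss_eq_heat_deriv:
  fixes x :: "real ^ 'n::finite"
  assumes "t > 0" "\<nu> \<noteq> 0"
  shows "gauss (of_real t * \<nu>) x = heat_deriv \<nu> (\<lambda>i. 0) t x"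
proof -
  have 1: "(of_real t * w) powr (- (of_nat CARD('n) / 2)) = w powr (- (of_nat CARD('n) / 2)) * of_real (t powr (- (real CARD('n) / 2)))"
    if "w \<noteq> 0" for w :: complex
  proof -
    have L: "Ln (of_real t * w) = of_real (ln t) + Ln w" using that assms by (simp add: Ln_times_of_real Ln_of_real)
    have "complex_of_real (t powr (- (real CARD('n) / 2))) = exp (- (of_nat CARD('n) / 2) * of_real (ln t))"
      using assms by (simp add: powr_def exp_of_real[symmetric])
    then show ?thesis using that assms unfolding powr_def L by (simp add: exp_add[symmetric] algebra_simps add_divide_distrib)
  qed
  have 2: "4 * complex_of_real pi * (of_real t * \<nu>) = of_real t * (4 * of_real pi * \<nu>)" by simp
  have 3: "(\<Prod>i\<in>UNIV. herm_gauss \<nu> 0 (t powr (- (1 / 2)) * x $ i)) = exp (- (complex_of_real ((norm x)\<^sup>2) / (4 * (of_real t * \<nu>))))"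
  proof -
    have "herm_gauss \<nu> 0 (t powr (- (1 / 2)) * x $ i) = exp ((- 1 / (4 * (of_real t * \<nu>))) * complex_of_real ((x $ i)\<^sup>2))" for i
      unfolding herm_gauss_def power_mult_distrib powr_half_sq[OF assms(1)] using assms by (simp add: herm_0 field_simps)
    then have "(\<Prod>i\<in>UNIV. herm_gauss \<nu> 0 (t powr (- (1 / 2)) * x $ i)) = exp ((- 1 / (4 * (of_real t * \<nu>))) * of_real ((norm x)\<^sup>2))"
      by (simp only: prod_exp_norm2)
    then show ?thesis by simp
  qed
  have m0: "mdeg (\<lambda>i::'n. 0) = 0" by (simp add: mdeg_def)
  have nz: "4 * complex_of_real pi * \<nu> \<noteq> 0" using assms by simp
  show ?thesis unfolding gauss_def 2 1[OF nz] heat_deriv_eq[OF assms(1)] 3 m0 using assms(1) by simp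
qed

text \<open>Links the derivatives of the kernel to the dilated expressions that occur in
  \<open>Lam\<close>.\<close>

lemma heat_deriv_eq_dilate:
  fixes x :: "real ^ 'n::finite"
  assumes "t > 0" "\<nu> \<noteq> 0"
  shows "heat_deriv \<nu> \<alpha> t x = of_real (t powr (- (real (mdeg \<alpha>) / 2))) * inverse 2 ^ mdeg \<alpha> * dilate t (\<lambda>y. hpoly \<nu> \<alpha> y * gauss \<nu> y) x"
proof -
  have g: "gauss \<nu> y = (4 * of_real pi * \<nu>) powr (- (of_nat CARD('n) / 2)) * (\<Prod>i\<in>UNIV. exp (- (of_real ((y $ i)\<^sup>2) / (4 * \<nu>))))" for y :: "real ^ 'n"
  proof -
    have e: "- 1 / (4 * \<nu>) * z = - (z / (4 * \<nu>))" for z by simp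
    show ?thesis unfolding gauss_def using prod_exp_norm2[of "- 1 / (4 * \<nu>)" y] by (simp only: e)
  qed
  have "(\<Prod>i\<in>UNIV. herm_gauss \<nu> (\<alpha> i) (y $ i)) = inverse 2 ^ mdeg \<alpha> * hpoly \<nu> \<alpha> y * (\<Prod>i\<in>UNIV. exp (- (of_real ((y $ i)\<^sup>2) / (4 * \<nu>))))" for y :: "real ^ 'n"
  proof -
    have "herm_gauss \<nu> (\<alpha> i) (y $ i) = inverse 2 ^ \<alpha> i * herm \<nu> (\<alpha> i) (y $ i) * exp (- (of_real ((y $ i)\<^sup>2) / (4 * \<nu>)))" for i
      unfolding herm_gauss_def divide_inverse power_inverse by (simp only: mult_ac)
    then show ?thesis by (simp only: hpoly_eq_prod_herm prod.distrib mdeg_def power_sum)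
  qed
  from this[of "t powr (- (1 / 2)) *\<^sub>R x"] show ?thesis
    unfolding heat_deriv_eq[OF assms(1)] dilate_def g by (simp only: vector_scaleR_component real_scaleR_def of_real_mult mult_ac)
qed

text \<open>Left unnormalised in c: its integral depends on c but not on t, which is what the L^1
  estimates use.\<close>

definition gauss_bound :: "real \<Rightarrow> real \<Rightarrow> real ^ 'n::finite \<Rightarrow> real" where
  "gauss_bound c t x = t powr (- (real CARD('n) / 2)) * exp (- c * (norm x)\<^sup>2 / t)"

lemma gauss_bound_nonneg: "gauss_bound c t x \<ge> 0"
  by (simp add: gauss_bound_def)

lemma heat_deriv_bound:
  assumes "Re \<nu> > 0"
  shows "\<exists>C>0. \<forall>t>0. \<forall>x :: real ^ 'n::finite. norm (heat_deriv \<nu> \<alpha> t x) \<le> C * t powr (- (real (mdeg \<alpha>) / 2)) * gauss_bound (gauss_rate \<nu>) t x"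
proof -
  obtain C where C: "\<And>N. C N > 0" "\<And>N x. norm (herm_gauss \<nu> N x) \<le> C N * exp (- gauss_rate \<nu> * x\<^sup>2)"
    using herm_gauss_bound[OF assms] by metis
  define D where "D = norm ((4 * of_real pi * \<nu>) powr (- (of_nat CARD('n) / 2))) * (\<Prod>i\<in>UNIV. C (\<alpha> i))"
  have "norm (heat_deriv \<nu> \<alpha> t x) \<le> (D + 1) * t powr (- (real (mdeg \<alpha>) / 2)) * gauss_bound (gauss_rate \<nu>) t x" if t: "t > 0" for t and x :: "real ^ 'n"
  proof -
    have "norm (\<Prod>i\<in>UNIV. herm_gauss \<nu> (\<alpha> i) (t powr (- (1 / 2)) * x $ i)) \<le> (\<Prod>i\<in>UNIV. C (\<alpha> i) * exp (- gauss_rate \<nu> * (t powr (- (1 / 2)) * x $ i)\<^sup>2))"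
      by (intro norm_prod_le[THEN order_trans] prod_mono conjI norm_ge_zero C(2))
    also have "\<dots> = (\<Prod>i\<in>UNIV. C (\<alpha> i)) * exp (- gauss_rate \<nu> * (norm x)\<^sup>2 / t)"
      unfolding prod.distrib power_mult_distrib powr_half_sq[OF t] using rexp_norm2[of "- gauss_rate \<nu> / t" x] by simp
    finally have 1: "norm (\<Prod>i\<in>UNIV. herm_gauss \<nu> (\<alpha> i) (t powr (- (1 / 2)) * x $ i)) \<le> (\<Prod>i\<in>UNIV. C (\<alpha> i)) * exp (- gauss_rate \<nu> * (norm x)\<^sup>2 / t)" .
    have "norm (heat_deriv \<nu> \<alpha> t x) \<le> D * t powr (- (real (mdeg \<alpha>) / 2)) * gauss_bound (gauss_rate \<nu>) t x"
      unfolding heat_deriv_eq[OF t] norm_mult norm_of_real D_def gauss_bound_def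
      using mult_left_mono[OF 1, of "norm ((4 * complex_of_real pi * \<nu>) powr (- (of_nat CARD('n) / 2))) * (t powr (- (real CARD('n) / 2)) * t powr (- (real (mdeg \<alpha>) / 2)))"]
      by (simp add: mult_ac)
    also have "\<dots> \<le> (D + 1) * t powr (- (real (mdeg \<alpha>) / 2)) * gauss_bound (gauss_rate \<nu>) t x"
      by (intro mult_right_mono gauss_bound_nonneg) auto
    finally show ?thesis .
  qed
  moreover have "D \<ge> 0" unfolding D_def using C(1) by (intro mult_nonneg_nonneg prod_nonneg) (auto intro: less_imp_le)
  ultimately show ?thesis by (intro exI[of _ "D + 1"]) auto
qed

lemma prod_upd:
  "(\<Prod>j\<in>(UNIV :: 'n::finite set). herm_kernel \<nu> ((\<alpha>(i := N)) j) t (x j)) = herm_kernel \<nu> N t (x i) * (\<Prod>j\<in>UNIV - {i}. herm_kernel \<nu> (\<alpha> j) t (x j))"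
proof -
  have "(\<Prod>j\<in>UNIV - {i}. herm_kernel \<nu> ((\<alpha>(i := N)) j) t (x j)) = (\<Prod>j\<in>UNIV - {i}. herm_kernel \<nu> (\<alpha> j) t (x j))"
    by (rule prod.cong) auto
  then show ?thesis using prod.remove[of UNIV i "\<lambda>j. herm_kernel \<nu> ((\<alpha>(i := N)) j) t (x j)"] by simp
qed

text \<open>Every coordinate factor solves the one-dimensional heat equation, so the product rule
  yields \<nu> times the Laplacian.\<close>

lemma has_vector_derivative_heat_deriv_time:
  assumes "\<nu> \<noteq> 0" "t > 0"
  shows "((\<lambda>t. heat_deriv \<nu> \<alpha> t x) has_vector_derivative (\<Sum>i\<in>UNIV. \<nu> * heat_deriv \<nu> (\<alpha>(i := Suc (Suc (\<alpha> i)))) t x)) (at t within S)"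
proof -
  let ?c = "(4 * complex_of_real pi * \<nu>) powr (- (of_nat CARD('a) / 2))"
  have "((\<lambda>t. \<Prod>i\<in>UNIV. herm_kernel \<nu> (\<alpha> i) t (x $ i)) has_derivative
      (\<lambda>h. \<Sum>i\<in>UNIV. (h *\<^sub>R (\<nu> * herm_kernel \<nu> (Suc (Suc (\<alpha> i))) t (x $ i))) * (\<Prod>j\<in>UNIV - {i}. herm_kernel \<nu> (\<alpha> j) t (x $ j)))) (at t within S)"
    by (intro has_derivative_prod has_vector_derivative_herm_kernel_time[OF assms, unfolded has_vector_derivative_def])
  then have "((\<lambda>t. \<Prod>i\<in>UNIV. herm_kernel \<nu> (\<alpha> i) t (x $ i)) has_vector_derivative
     (\<Sum>i\<in>UNIV. (\<nu> * herm_kernel \<nu> (Suc (Suc (\<alpha> i))) t (x $ i)) * (\<Prod>j\<in>UNIV - {i}. herm_kernel \<nu> (\<alpha> j) t (x $ j)))) (at t within S)"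
    unfolding has_vector_derivative_def by (simp add: scaleR_sum_right)
  from has_vector_derivative_mult_right[OF this, of ?c]
  have "((\<lambda>t. heat_deriv \<nu> \<alpha> t x) has_vector_derivative ?c * (\<Sum>i\<in>UNIV. (\<nu> * herm_kernel \<nu> (Suc (Suc (\<alpha> i))) t (x $ i)) * (\<Prod>j\<in>UNIV - {i}. herm_kernel \<nu> (\<alpha> j) t (x $ j)))) (at t within S)"
    unfolding heat_deriv_def .
  moreover have "?c * (\<nu> * herm_kernel \<nu> (Suc (Suc (\<alpha> i))) t (x $ i) * (\<Prod>j\<in>UNIV - {i}. herm_kernel \<nu> (\<alpha> j) t (x $ j))) = \<nu> * heat_deriv \<nu> (\<alpha>(i := Suc (Suc (\<alpha> i)))) t x" for i
    unfolding heat_deriv_def prod_upd by (simp only: mult_ac)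
  ultimately show ?thesis by (simp only: sum_distrib_left)
qed

text \<open>Moving along -y cancels the sign in (-\<partial>)^\<alpha>, so the Taylor coefficients
  in y are y^\<beta>/\<beta>! without signs.\<close>

lemma has_vector_derivative_heat_deriv_line:
  assumes "\<nu> \<noteq> 0" "t > 0"
  shows "((\<lambda>l. heat_deriv \<nu> \<alpha> t (x - l *\<^sub>R y)) has_vector_derivative (\<Sum>i\<in>UNIV. of_real (y $ i) * heat_deriv \<nu> (\<alpha>(i := Suc (\<alpha> i))) t (x - l *\<^sub>R y))) (at l within S)"
proof -
  let ?c = "(4 * complex_of_real pi * \<nu>) powr (- (of_nat CARD('a) / 2))"
  have k: "((\<lambda>l. herm_kernel \<nu> (\<alpha> i) t ((x - l *\<^sub>R y) $ i)) has_vector_derivative of_real (y $ i) * herm_kernel \<nu> (Suc (\<alpha> i)) t ((x - l *\<^sub>R y) $ i)) (at l within S)" for i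
  proof -
    have "((\<lambda>l. (x - l *\<^sub>R y) $ i) has_vector_derivative - (y $ i)) (at l within S)"
      unfolding has_real_derivative_iff_has_vector_derivative[symmetric] by (auto intro!: derivative_eq_intros)
    from vector_diff_chain_within[OF this has_vector_derivative_herm_kernel_space[OF assms]]
    show ?thesis by (simp add: o_def scaleR_conv_of_real)
  qed
  have "((\<lambda>l. \<Prod>i\<in>UNIV. herm_kernel \<nu> (\<alpha> i) t ((x - l *\<^sub>R y) $ i)) has_derivative
      (\<lambda>h. \<Sum>i\<in>UNIV. (h *\<^sub>R (of_real (y $ i) * herm_kernel \<nu> (Suc (\<alpha> i)) t ((x - l *\<^sub>R y) $ i))) * (\<Prod>j\<in>UNIV - {i}. herm_kernel \<nu> (\<alpha> j) t ((x - l *\<^sub>R y) $ j)))) (at l within S)"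
    by (intro has_derivative_prod k[unfolded has_vector_derivative_def])
  then have "((\<lambda>l. \<Prod>i\<in>UNIV. herm_kernel \<nu> (\<alpha> i) t ((x - l *\<^sub>R y) $ i)) has_vector_derivative
     (\<Sum>i\<in>UNIV. (of_real (y $ i) * herm_kernel \<nu> (Suc (\<alpha> i)) t ((x - l *\<^sub>R y) $ i)) * (\<Prod>j\<in>UNIV - {i}. herm_kernel \<nu> (\<alpha> j) t ((x - l *\<^sub>R y) $ j)))) (at l within S)"
    unfolding has_vector_derivative_def by (simp add: scaleR_sum_right)
  from has_vector_derivative_mult_right[OF this, of ?c]
  have "((\<lambda>l. heat_deriv \<nu> \<alpha> t (x - l *\<^sub>R y)) has_vector_derivative ?c * (\<Sum>i\<in>UNIV. (of_real (y $ i) * herm_kernel \<nu> (Suc (\<alpha> i)) t ((x - l *\<^sub>R y) $ i)) * (\<Prod>j\<in>UNIV - {i}. herm_kernel \<nu> (\<alpha> j) t ((x - l *\<^sub>R y) $ j)))) (at l within S)"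
    unfolding heat_deriv_def .
  moreover have "?c * (of_real (y $ i) * herm_kernel \<nu> (Suc (\<alpha> i)) t ((x - l *\<^sub>R y) $ i) * (\<Prod>j\<in>UNIV - {i}. herm_kernel \<nu> (\<alpha> j) t ((x - l *\<^sub>R y) $ j))) = of_real (y $ i) * heat_deriv \<nu> (\<alpha>(i := Suc (\<alpha> i))) t (x - l *\<^sub>R y)" for i
    unfolding heat_deriv_def prod_upd by (simp only: mult_ac)
  ultimately show ?thesis by (simp only: sum_distrib_left)
qed

section \<open>Parabolic Taylor expansion of the heat kernel\<close>

lemma powr_half_pow: "t > 0 \<Longrightarrow> t powr (- (real m / 2)) = (t powr (- (1 / 2))) ^ m" for t :: real
  by (simp add: powr_power)

lemma mpow_bound: "\<bar>mpow y \<beta>\<bar> \<le> norm y ^ mdeg \<beta>"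
proof -
  have "\<bar>mpow y \<beta>\<bar> = (\<Prod>i\<in>UNIV. \<bar>y $ i\<bar> ^ \<beta> i)" by (simp add: mpow_def abs_prod power_abs)
  also have "\<dots> \<le> (\<Prod>i\<in>UNIV. norm y ^ \<beta> i)"
    by (intro prod_mono conjI zero_le_power power_mono component_le_norm_cart abs_ge_zero)
  finally show ?thesis by (simp add: mdeg_def power_sum)
qed

text \<open>A Taylor remainder involves finitely many multi-indices, and one constant has to serve
  them all.\<close>

lemma heat_deriv_bound_uniform:
  assumes "Re \<nu> > 0" "finite A"
  shows "\<exists>C>0. \<forall>\<alpha>\<in>A. \<forall>t>0. \<forall>x :: real ^ 'n::finite. norm (heat_deriv \<nu> \<alpha> t x) \<le> C * (t powr (- (1 / 2))) ^ mdeg \<alpha> * gauss_bound (gauss_rate \<nu>) t x"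
proof -
  obtain C where C: "\<And>\<alpha>. C \<alpha> > 0" "\<And>\<alpha> t x. t > 0 \<Longrightarrow> norm (heat_deriv \<nu> \<alpha> t (x :: real ^ 'n)) \<le> C \<alpha> * t powr (- (real (mdeg \<alpha>) / 2)) * gauss_bound (gauss_rate \<nu>) t x"
    using heat_deriv_bound[OF assms(1), where 'n='n] by metis
  define D where "D = 1 + sum C A"
  have D: "C \<alpha> \<le> D" if "\<alpha> \<in> A" for \<alpha>
    using member_le_sum[of \<alpha> A C] that assms(2) C(1) unfolding D_def by (smt (verit) less_imp_le DiffD1)
  have "norm (heat_deriv \<nu> \<alpha> t x) \<le> D * (t powr (- (1 / 2))) ^ mdeg \<alpha> * gauss_bound (gauss_rate \<nu>) t x" if "\<alpha> \<in> A" "t > 0" for \<alpha> t and x :: "real ^ 'n"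
  proof -
    have "norm (heat_deriv \<nu> \<alpha> t x) \<le> C \<alpha> * (t powr (- (1 / 2))) ^ mdeg \<alpha> * gauss_bound (gauss_rate \<nu>) t x"
      using C(2)[OF that(2)] powr_half_pow[OF that(2)] by simp
    also have "\<dots> \<le> D * (t powr (- (1 / 2))) ^ mdeg \<alpha> * gauss_bound (gauss_rate \<nu>) t x"
      by (intro mult_right_mono gauss_bound_nonneg D that) auto
    finally show ?thesis .
  qed
  moreover have "D > 0" unfolding D_def using C(1) by (intro add_pos_nonneg sum_nonneg) (auto intro: less_imp_le)
  ultimately show ?thesis by blast
qed

text \<open>\<open>multi_index_taylor\<close> for the even derivatives along the path t - l s: by
  the heat equation, moving back in time by s raises \<gamma> i by one with weight -\<nu> s. For s
  \<le> t/2 the path stays in [t/2, t], where all bounds compare with those at time t.\<close>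

lemma heat_kernel_time_taylor:
  assumes nu: "Re \<nu> > 0" and N: "N > 0"
  shows "\<exists>C>0. \<forall>t>0. \<forall>s. 0 \<le> s \<and> s \<le> t / 2 \<longrightarrow> (\<forall>x :: real ^ 'n::finite.
    norm (heat_deriv \<nu> (\<lambda>i. 0) (t - s) x - (\<Sum>\<gamma>\<in>{\<gamma>. mdeg \<gamma> < N}. (- \<nu> * of_real s) ^ mdeg \<gamma> / of_nat (mfact \<gamma>) * heat_deriv \<nu> (\<lambda>i. 2 * \<gamma> i) t x))
     \<le> C * (s / t) ^ N * gauss_bound (gauss_rate \<nu>) t x)"
proof -
  have nz: "\<nu> \<noteq> 0" using nu by auto
  have fin: "finite ((\<lambda>\<gamma> i. 2 * \<gamma> i) ` {\<gamma> :: 'n \<Rightarrow> nat. mdeg \<gamma> = N})" by (intro finite_imageI finite_mdeg_eq)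
  have m2: "mdeg (\<lambda>i. 2 * \<gamma> i) = 2 * mdeg \<gamma>" for \<gamma> :: "'n \<Rightarrow> nat" by (simp add: mdeg_def sum_distrib_left)
  obtain C where C: "C > 0" "\<And>\<gamma> t x. mdeg \<gamma> = N \<Longrightarrow> t > 0 \<Longrightarrow> norm (heat_deriv \<nu> (\<lambda>i. 2 * \<gamma> i) t (x :: real ^ 'n)) \<le> C * (t powr (- (1 / 2))) ^ (2 * N) * gauss_bound (gauss_rate \<nu>) t x"
  proof -
    obtain C where C: "C > 0" "\<forall>\<alpha>\<in>(\<lambda>\<gamma> i. 2 * \<gamma> i) ` {\<gamma> :: 'n \<Rightarrow> nat. mdeg \<gamma> = N}. \<forall>t>0. \<forall>x :: real ^ 'n. norm (heat_deriv \<nu> \<alpha> t x) \<le> C * (t powr (- (1 / 2))) ^ mdeg \<alpha> * gauss_bound (gauss_rate \<nu>) t x"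
      using heat_deriv_bound_uniform[OF nu fin] by blast
    show thesis
    proof (rule that[OF C(1)])
      fix \<gamma> :: "'n \<Rightarrow> nat" and t :: real and x :: "real ^ 'n" assume "mdeg \<gamma> = N" "t > 0"
      then show "norm (heat_deriv \<nu> (\<lambda>i. 2 * \<gamma> i) t x) \<le> C * (t powr (- (1 / 2))) ^ (2 * N) * gauss_bound (gauss_rate \<nu>) t x"
        using bspec[OF C(2), of "\<lambda>i. 2 * \<gamma> i"] m2[of \<gamma>] by auto
    qed
  qed
  \<comment> \<open>Collects the Taylor constant, |\<nu>|^N, and the factors 2^N and 2^(n/2) lost in
    passing from times in [t/2, t] to t.\<close>
  define D where "D = real N * real (card {\<gamma> :: 'n \<Rightarrow> nat. mdeg \<gamma> = N}) * norm \<nu> ^ N * C * 2 ^ N * 2 powr (real CARD('n) / 2)"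
  have D0: "D \<ge> 0" unfolding D_def using C(1) by (intro mult_nonneg_nonneg) auto
  have "norm (heat_deriv \<nu> (\<lambda>i. 0) (t - s) x - (\<Sum>\<gamma>\<in>{\<gamma>. mdeg \<gamma> < N}. (- \<nu> * of_real s) ^ mdeg \<gamma> / of_nat (mfact \<gamma>) * heat_deriv \<nu> (\<lambda>i. 2 * \<gamma> i) t x))
     \<le> (D + 1) * (s / t) ^ N * gauss_bound (gauss_rate \<nu>) t x" if t: "t > 0" and s: "0 \<le> s" "s \<le> t / 2" for t s and x :: "real ^ 'n"
  proof -
    define Q where "Q \<gamma> l = heat_deriv \<nu> (\<lambda>i. 2 * \<gamma> i) (t - l * s) x" for \<gamma> :: "'n \<Rightarrow> nat" and l
    define B where "B = C * (2 / t) ^ N * (2 powr (real CARD('n) / 2) * gauss_bound (gauss_rate \<nu>) t x)"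
    have tl: "t / 2 \<le> t - l * s" "t - l * s \<le> t" if "0 \<le> l" "l \<le> 1" for l
      using mult_right_mono[of l 1 s] that s by auto
    have der: "(Q \<gamma> has_vector_derivative (\<Sum>i\<in>UNIV. (- \<nu> * of_real s) * Q (\<gamma>(i := Suc (\<gamma> i))) l)) (at l within {0..1})"
      if "0 \<le> l" "l \<le> 1" for \<gamma> l
    proof -
      have 1: "((\<lambda>l. t - l * s) has_vector_derivative - s) (at l within {0..1})"
        unfolding has_real_derivative_iff_has_vector_derivative[symmetric] by (auto intro!: derivative_eq_intros)
      have e: "(\<lambda>j. 2 * (\<gamma>(i := Suc (\<gamma> i))) j) = (\<lambda>j. 2 * \<gamma> j)(i := Suc (Suc (2 * \<gamma> i)))" for i by auto
      have pos: "t - l * s > 0" using tl[OF that] t by linarith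
      from vector_diff_chain_within[OF 1 has_vector_derivative_heat_deriv_time[OF nz pos]]
      have "(Q \<gamma> has_vector_derivative (- s) *\<^sub>R (\<Sum>i\<in>UNIV. \<nu> * heat_deriv \<nu> ((\<lambda>j. 2 * \<gamma> j)(i := Suc (Suc (2 * \<gamma> i)))) (t - l * s) x)) (at l within {0..1})"
        by (simp only: Q_def[abs_def] o_def)
      then show ?thesis unfolding Q_def e by (simp add: scaleR_conv_of_real sum_distrib_left sum_negf mult_ac)
    qed
    have Bd: "norm (Q \<gamma> l) \<le> B" if "mdeg \<gamma> = N" "0 \<le> l" "l \<le> 1" for \<gamma> l
    proof -
      define t' where "t' = t - l * s"
      have t': "t / 2 \<le> t'" "t' \<le> t" "t' > 0" using tl[OF that(2,3)] t unfolding t'_def by linarith+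
      have "norm (Q \<gamma> l) \<le> C * (t' powr (- (1 / 2))) ^ (2 * N) * gauss_bound (gauss_rate \<nu>) t' x"
        unfolding Q_def t'_def[symmetric] by (intro C that t')
      also have "(t' powr (- (1 / 2))) ^ (2 * N) = (1 / t') ^ N" by (simp add: power_mult powr_half_sq[OF t'(3)])
      also have "(1 / t') ^ N \<le> (2 / t) ^ N" using t t' by (intro power_mono) (auto simp: field_simps)
      also have "gauss_bound (gauss_rate \<nu>) t' x \<le> 2 powr (real CARD('n) / 2) * gauss_bound (gauss_rate \<nu>) t x"
      proof -
        have "t' powr (- (real CARD('n) / 2)) \<le> (t / 2) powr (- (real CARD('n) / 2))"
          using t t' by (intro powr_mono2') auto
        also have "\<dots> = 2 powr (real CARD('n) / 2) * t powr (- (real CARD('n) / 2))"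
          using t by (simp add: powr_divide powr_minus field_simps)
        finally have 1: "t' powr (- (real CARD('n) / 2)) \<le> 2 powr (real CARD('n) / 2) * t powr (- (real CARD('n) / 2))" .
        have "gauss_rate \<nu> * (norm x)\<^sup>2 / t \<le> gauss_rate \<nu> * (norm x)\<^sup>2 / t'"
          using t' t gauss_rate_pos[OF nu] by (intro divide_left_mono) auto
        then have 2: "exp (- gauss_rate \<nu> * (norm x)\<^sup>2 / t') \<le> exp (- gauss_rate \<nu> * (norm x)\<^sup>2 / t)" by simp
        show ?thesis unfolding gauss_bound_def using mult_mono[OF 1 2] by (simp add: mult.assoc)
      qed
      finally show ?thesis unfolding B_def using C(1) t by (simp add: mult_left_mono mult_right_mono gauss_bound_nonneg)
    qed
    have "norm (Q (\<lambda>i. 0) 1 - (\<Sum>\<beta>\<in>{\<beta>. mdeg \<beta> < N}. mpowc (\<lambda>i. - \<nu> * of_real s) \<beta> / of_nat (mfact \<beta>) * Q \<beta> 0))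
     \<le> real N * real (card {\<beta> :: 'n \<Rightarrow> nat. mdeg \<beta> = N}) * (norm \<nu> * s) ^ N * B"
      by (rule multi_index_taylor[OF der Bd _ N]) (use s in \<open>auto simp: norm_mult\<close>)
    also have "\<dots> = D * (s / t) ^ N * gauss_bound (gauss_rate \<nu>) t x"
      unfolding B_def D_def by (simp add: power_mult_distrib power_divide field_simps)
    also have "\<dots> \<le> (D + 1) * (s / t) ^ N * gauss_bound (gauss_rate \<nu>) t x"
      using s t by (intro mult_right_mono gauss_bound_nonneg) auto
    finally show ?thesis unfolding Q_def mpowc_const by simp
  qed
  then show ?thesis using D0 by (intro exI[of _ "D + 1"]) auto
qed

lemma gauss_bound_mono: "c \<le> c' \<Longrightarrow> t > 0 \<Longrightarrow> gauss_bound c' t x \<le> gauss_bound c t x"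
  unfolding gauss_bound_def by (intro mult_left_mono) (auto intro!: divide_right_mono mult_right_mono)

text \<open>With z = |y|/sqrt t, the factor z^N min 1 z matches two regimes. For z \<le> 1 it is the
  Taylor remainder of order N + 1; for z > 1 no cancellation is used and every term is bounded
  separately by z^N.\<close>

lemma heat_kernel_space_taylor:
  assumes nu: "Re \<nu> > 0"
  shows "\<exists>C>0. \<forall>t>0. \<forall>x y :: real ^ 'n::finite.
    norm (heat_deriv \<nu> \<alpha> t (x - y) - (\<Sum>\<beta>\<in>{\<beta>. mdeg \<beta> \<le> N}. of_real (mpow y \<beta>) / of_nat (mfact \<beta>) * heat_deriv \<nu> (\<lambda>i. \<alpha> i + \<beta> i) t x))
     \<le> C * (t powr (- (1 / 2))) ^ mdeg \<alpha> * ((norm y * t powr (- (1 / 2))) ^ N * min 1 (norm y * t powr (- (1 / 2)))) * (gauss_bound (gauss_rate \<nu> / 2) t (x - y) + gauss_bound (gauss_rate \<nu> / 2) t x)"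
proof -
  have nz: "\<nu> \<noteq> 0" using nu by auto
  have h: "gauss_rate \<nu> / 2 \<le> gauss_rate \<nu>" "gauss_rate \<nu> > 0" using gauss_rate_pos[OF nu] by auto
  have fin: "finite ((\<lambda>\<beta> i. \<alpha> i + \<beta> i) ` {\<beta> :: 'n \<Rightarrow> nat. mdeg \<beta> \<le> Suc N})" by (intro finite_imageI finite_mdeg_le)
  have ma: "mdeg (\<lambda>i. \<alpha> i + \<beta> i) = mdeg \<alpha> + mdeg \<beta>" for \<beta> :: "'n \<Rightarrow> nat" by (simp add: mdeg_def sum.distrib)
  obtain C where C: "C > 0" "\<And>\<beta> t x. mdeg \<beta> \<le> Suc N \<Longrightarrow> t > 0 \<Longrightarrow> norm (heat_deriv \<nu> (\<lambda>i. \<alpha> i + \<beta> i) t (x :: real ^ 'n)) \<le> C * (t powr (- (1 / 2))) ^ (mdeg \<alpha> + mdeg \<beta>) * gauss_bound (gauss_rate \<nu>) t x"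
  proof -
    obtain C where C: "C > 0" "\<forall>\<alpha>\<in>(\<lambda>\<beta> i. \<alpha> i + \<beta> i) ` {\<beta> :: 'n \<Rightarrow> nat. mdeg \<beta> \<le> Suc N}. \<forall>t>0. \<forall>x :: real ^ 'n. norm (heat_deriv \<nu> \<alpha> t x) \<le> C * (t powr (- (1 / 2))) ^ mdeg \<alpha> * gauss_bound (gauss_rate \<nu>) t x"
      using heat_deriv_bound_uniform[OF nu fin] by blast
    show thesis
    proof (rule that[OF C(1)])
      fix \<beta> :: "'n \<Rightarrow> nat" and t :: real and x :: "real ^ 'n" assume "mdeg \<beta> \<le> Suc N" "t > 0"
      then show "norm (heat_deriv \<nu> (\<lambda>i. \<alpha> i + \<beta> i) t x) \<le> C * (t powr (- (1 / 2))) ^ (mdeg \<alpha> + mdeg \<beta>) * gauss_bound (gauss_rate \<nu>) t x"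
        using bspec[OF C(2), of "\<lambda>i. \<alpha> i + \<beta> i"] ma[of \<beta>] by auto
    qed
  qed
  define D1 where "D1 = real (Suc N) * real (card {\<gamma> :: 'n \<Rightarrow> nat. mdeg \<gamma> = Suc N}) * C * exp (gauss_rate \<nu>)"
  define D2 where "D2 = C + real (card {\<gamma> :: 'n \<Rightarrow> nat. mdeg \<gamma> \<le> N}) * C"
  have D0: "D1 \<ge> 0" "D2 > 0" unfolding D1_def D2_def using C(1) by (auto intro!: mult_nonneg_nonneg add_pos_nonneg)
  have "norm (heat_deriv \<nu> \<alpha> t (x - y) - (\<Sum>\<beta>\<in>{\<beta>. mdeg \<beta> \<le> N}. of_real (mpow y \<beta>) / of_nat (mfact \<beta>) * heat_deriv \<nu> (\<lambda>i. \<alpha> i + \<beta> i) t x))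
     \<le> (D1 + D2) * (t powr (- (1 / 2))) ^ mdeg \<alpha> * ((norm y * t powr (- (1 / 2))) ^ N * min 1 (norm y * t powr (- (1 / 2)))) * (gauss_bound (gauss_rate \<nu> / 2) t (x - y) + gauss_bound (gauss_rate \<nu> / 2) t x)"
    (is "?L \<le> _") if t: "t > 0" for t and x y :: "real ^ 'n"
  proof -
    define r where "r = t powr (- (1 / 2))"
    have r: "r > 0" "r\<^sup>2 = 1 / t" unfolding r_def using t by (auto simp: powr_half_sq)
    define z where "z = norm y * r"
    have z0: "z \<ge> 0" unfolding z_def using r by auto
    define g where "g = gauss_bound (gauss_rate \<nu> / 2) t (x - y) + gauss_bound (gauss_rate \<nu> / 2) t x"
    have g: "g \<ge> 0" "gauss_bound (gauss_rate \<nu> / 2) t x \<le> g" "gauss_bound (gauss_rate \<nu>) t (x - y) \<le> g" "gauss_bound (gauss_rate \<nu>) t x \<le> g"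
      unfolding g_def using gauss_bound_nonneg[of "gauss_rate \<nu> / 2" t x] gauss_bound_nonneg[of "gauss_rate \<nu> / 2" t "x - y"] gauss_bound_mono[OF h(1) t, of x] gauss_bound_mono[OF h(1) t, of "x - y"] by linarith+
    have "?L \<le> (D1 + D2) * r ^ mdeg \<alpha> * (z ^ N * min 1 z) * g"
    proof (cases "z \<le> 1")
      case True
      define Q where "Q \<beta> l = heat_deriv \<nu> (\<lambda>i. \<alpha> i + \<beta> i) t (x - l *\<^sub>R y)" for \<beta> :: "'n \<Rightarrow> nat" and l
      define B where "B = C * r ^ (mdeg \<alpha> + Suc N) * (exp (gauss_rate \<nu>) * gauss_bound (gauss_rate \<nu> / 2) t x)"
      have der: "(Q \<beta> has_vector_derivative (\<Sum>i\<in>UNIV. of_real (y $ i) * Q (\<beta>(i := Suc (\<beta> i))) l)) (at l within {0..1})" for \<beta> l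
      proof -
        have e: "(\<lambda>j. \<alpha> j + (\<beta>(i := Suc (\<beta> i))) j) = (\<lambda>j. \<alpha> j + \<beta> j)(i := Suc (\<alpha> i + \<beta> i))" for i by auto
        show ?thesis unfolding Q_def e by (rule has_vector_derivative_heat_deriv_line[OF nz t])
      qed
      have Bd: "norm (Q \<beta> l) \<le> B" if "mdeg \<beta> = Suc N" "0 \<le> l" "l \<le> 1" for \<beta> l
      proof -
        \<comment> \<open>Since |y|^2 \<le> t, the Gaussian at the intermediate point is controlled
          by the one at x with half the rate, at the price of a constant factor.\<close>
        have "gauss_bound (gauss_rate \<nu>) t (x - l *\<^sub>R y) \<le> exp (gauss_rate \<nu>) * gauss_bound (gauss_rate \<nu> / 2) t x"
        proof -
          have "norm x \<le> norm (x - l *\<^sub>R y) + norm (l *\<^sub>R y)" by (metis diff_add_cancel norm_triangle_ineq)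
          also have "norm (l *\<^sub>R y) \<le> norm y" using that by (simp add: mult_left_le_one_le)
          finally have "(norm x)\<^sup>2 \<le> (norm (x - l *\<^sub>R y) + norm y)\<^sup>2" by (intro power_mono) auto
          also have "\<dots> \<le> 2 * (norm (x - l *\<^sub>R y))\<^sup>2 + 2 * (norm y)\<^sup>2"
            using sum_squares_ge_zero[of "norm (x - l *\<^sub>R y) - norm y" 0] by (simp add: power2_eq_square algebra_simps)
          finally have a: "(norm x)\<^sup>2 \<le> 2 * (norm (x - l *\<^sub>R y))\<^sup>2 + 2 * (norm y)\<^sup>2" .
          have b: "(norm y)\<^sup>2 \<le> t"
          proof -
            have "z\<^sup>2 \<le> 1" using True z0 by (simp add: power_le_one)
            then show ?thesis unfolding z_def power_mult_distrib r(2) using t by (simp add: field_simps)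
          qed
          have "(norm x)\<^sup>2 / 2 \<le> (norm (x - l *\<^sub>R y))\<^sup>2 + t" using a b by linarith
          then have "gauss_rate \<nu> / t * ((norm x)\<^sup>2 / 2) \<le> gauss_rate \<nu> / t * ((norm (x - l *\<^sub>R y))\<^sup>2 + t)"
            using t h by (intro mult_left_mono) auto
          then have "- gauss_rate \<nu> * (norm (x - l *\<^sub>R y))\<^sup>2 / t \<le> gauss_rate \<nu> + (- (gauss_rate \<nu> / 2) * (norm x)\<^sup>2 / t)"
            using t by (simp add: field_simps)
          then have "exp (- gauss_rate \<nu> * (norm (x - l *\<^sub>R y))\<^sup>2 / t) \<le> exp (gauss_rate \<nu>) * exp (- (gauss_rate \<nu> / 2) * (norm x)\<^sup>2 / t)"
            by (simp only: exp_add[symmetric] exp_le_cancel_iff)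
          from mult_left_mono[OF this, of "t powr (- (real CARD('n) / 2))"] show ?thesis
            unfolding gauss_bound_def by (simp add: mult_ac)
        qed
        then have "C * r ^ (mdeg \<alpha> + mdeg \<beta>) * gauss_bound (gauss_rate \<nu>) t (x - l *\<^sub>R y) \<le> B"
          unfolding B_def that(1) using C(1) r by (intro mult_left_mono) auto
        moreover have "norm (Q \<beta> l) \<le> C * r ^ (mdeg \<alpha> + mdeg \<beta>) * gauss_bound (gauss_rate \<nu>) t (x - l *\<^sub>R y)"
          unfolding Q_def r_def by (intro C) (use that t in auto)
        ultimately show ?thesis by linarith
      qed
      have "norm (Q (\<lambda>i. 0) 1 - (\<Sum>\<beta>\<in>{\<beta>. mdeg \<beta> < Suc N}. mpowc (\<lambda>i. of_real (y $ i)) \<beta> / of_nat (mfact \<beta>) * Q \<beta> 0))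
         \<le> real (Suc N) * real (card {\<beta> :: 'n \<Rightarrow> nat. mdeg \<beta> = Suc N}) * norm y ^ Suc N * B"
        by (rule multi_index_taylor[OF der Bd]) (auto simp: component_le_norm_cart)
      also have "\<dots> = D1 * r ^ mdeg \<alpha> * (z ^ N * z) * gauss_bound (gauss_rate \<nu> / 2) t x"
        unfolding B_def D1_def z_def by (simp add: power_add power_mult_distrib mult_ac)
      also have "\<dots> \<le> (D1 + D2) * r ^ mdeg \<alpha> * (z ^ N * z) * g"
        using r z0 g D0 gauss_bound_nonneg[of "gauss_rate \<nu> / 2" t x] by (intro mult_mono) auto
      finally show ?thesis using True by (simp add: Q_def mpowc_of_real less_Suc_eq_le min_def)
    next
      case False
      have "norm (of_real (mpow y \<beta>) / of_nat (mfact \<beta>) * heat_deriv \<nu> (\<lambda>i. \<alpha> i + \<beta> i) t x) \<le> C * r ^ mdeg \<alpha> * z ^ N * g" if "mdeg \<beta> \<le> N" for \<beta>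
      proof -
        have "norm (of_real (mpow y \<beta>) / of_nat (mfact \<beta>) * heat_deriv \<nu> (\<lambda>i. \<alpha> i + \<beta> i) t x) = \<bar>mpow y \<beta>\<bar> / real (mfact \<beta>) * norm (heat_deriv \<nu> (\<lambda>i. \<alpha> i + \<beta> i) t x)"
          by (simp add: norm_mult norm_divide)
        also have "\<dots> \<le> (norm y ^ mdeg \<beta> / 1) * (C * r ^ (mdeg \<alpha> + mdeg \<beta>) * g)"
        proof (intro mult_mono frac_le)
          have "norm (heat_deriv \<nu> (\<lambda>i. \<alpha> i + \<beta> i) t x) \<le> C * r ^ (mdeg \<alpha> + mdeg \<beta>) * gauss_bound (gauss_rate \<nu>) t x"
            unfolding r_def using that t by (intro C) auto
          also have "\<dots> \<le> C * r ^ (mdeg \<alpha> + mdeg \<beta>) * g" using C(1) r g by (intro mult_left_mono) auto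
          finally show "norm (heat_deriv \<nu> (\<lambda>i. \<alpha> i + \<beta> i) t x) \<le> C * r ^ (mdeg \<alpha> + mdeg \<beta>) * g" .
        qed (use mfact_ge_1[of \<beta>] mpow_bound[of y \<beta>] in \<open>auto\<close>)
        also have "\<dots> = C * r ^ mdeg \<alpha> * z ^ mdeg \<beta> * g" by (simp add: z_def power_add power_mult_distrib mult_ac)
        also have "\<dots> \<le> C * r ^ mdeg \<alpha> * z ^ N * g"
          using False that C(1) r g by (intro mult_right_mono mult_left_mono power_increasing) auto
        finally show ?thesis .
      qed
      then have "norm (\<Sum>\<beta>\<in>{\<beta>. mdeg \<beta> \<le> N}. of_real (mpow y \<beta>) / of_nat (mfact \<beta>) * heat_deriv \<nu> (\<lambda>i. \<alpha> i + \<beta> i) t x) \<le> (\<Sum>\<beta>\<in>{\<beta> :: 'n \<Rightarrow> nat. mdeg \<beta> \<le> N}. C * r ^ mdeg \<alpha> * z ^ N * g)"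
        by (intro order_trans[OF norm_sum] sum_mono) auto
      moreover have "norm (heat_deriv \<nu> \<alpha> t (x - y)) \<le> C * r ^ mdeg \<alpha> * z ^ N * g"
      proof -
        have "norm (heat_deriv \<nu> \<alpha> t (x - y)) \<le> C * r ^ mdeg \<alpha> * gauss_bound (gauss_rate \<nu>) t (x - y)"
          using C(2)[of "\<lambda>i. 0" t "x - y"] t by (simp add: r_def mdeg_def)
        also have "\<dots> \<le> C * r ^ mdeg \<alpha> * 1 * g" using C(1) r g by (simp add: mult_left_mono)
        also have "\<dots> \<le> C * r ^ mdeg \<alpha> * z ^ N * g" using C(1) r g False by (intro mult_right_mono mult_left_mono one_le_power) auto
        finally show ?thesis .
      qed
      ultimately have "?L \<le> C * r ^ mdeg \<alpha> * z ^ N * g + real (card {\<gamma> :: 'n \<Rightarrow> nat. mdeg \<gamma> \<le> N}) * (C * r ^ mdeg \<alpha> * z ^ N * g)"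
        by (intro order_trans[OF norm_triangle_ineq4] add_mono) auto
      also have "\<dots> = D2 * r ^ mdeg \<alpha> * (z ^ N * min 1 z) * g" using False by (simp add: D2_def algebra_simps min_def)
      also have "\<dots> \<le> (D1 + D2) * r ^ mdeg \<alpha> * (z ^ N * min 1 z) * g" using D0 r z0 g by (intro mult_right_mono) auto
      finally show ?thesis .
    qed
    then show ?thesis unfolding z_def r_def g_def .
  qed
  moreover have "D1 + D2 > 0" using D0 by linarith
  ultimately show ?thesis by blast
qed

text \<open>Powers of s are expanded over \<gamma> because the j-th time derivative is \<nu>^j times
  the j-th power of the Laplacian. The space degree left over is k - 2|\<gamma>|, without truncation
  on the range of the outer sum.\<close>

definition heat_taylor :: "complex \<Rightarrow> nat \<Rightarrow> real \<Rightarrow> real \<Rightarrow> real ^ 'n::finite \<Rightarrow> real ^ 'n \<Rightarrow> complex" where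
  "heat_taylor \<nu> k t s x y = (\<Sum>\<gamma>\<in>{\<gamma>. 2 * mdeg \<gamma> \<le> k}. (- \<nu> * of_real s) ^ mdeg \<gamma> / of_nat (mfact \<gamma>) *
     (\<Sum>\<beta>\<in>{\<beta>. mdeg \<beta> \<le> k - 2 * mdeg \<gamma>}. of_real (mpow y \<beta>) / of_nat (mfact \<beta>) * heat_deriv \<nu> (\<lambda>i. 2 * \<gamma> i + \<beta> i) t x))"

text \<open>The extension by 0 to t \<le> 0 lets Duhamel integrals over s < t be written over all
  times.\<close>

definition heat_kernel :: "complex \<Rightarrow> real \<Rightarrow> real ^ 'n::finite \<Rightarrow> complex" where
  "heat_kernel \<nu> t x = (if t > 0 then heat_deriv \<nu> (\<lambda>i. 0) t x else 0)"

lemma finite_2mdeg_le: "finite {\<gamma> :: 'n::finite \<Rightarrow> nat. 2 * mdeg \<gamma> \<le> k}"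
  by (rule finite_subset[OF _ finite_mdeg_le[of k]]) auto

text \<open>With $\rho = (\sqrt s + |y|)/\sqrt t$, the parabolic Taylor polynomial of order \<open>k\<close> has an error of order
  $\rho^{k+1}$ for small $\rho$ and of order $\rho^k$ in general. Only for $s > t/2$, where the kernel is close to
  its singularity, it has to be kept.\<close>

lemma heat_kernel_expansion:
  assumes nu: "Re \<nu> > 0"
  shows "\<exists>C>0. \<forall>t>0. \<forall>s\<ge>0. \<forall>x y :: real ^ 'n::finite.
    norm (heat_kernel \<nu> (t - s) (x - y) - heat_taylor \<nu> k t s x y)
     \<le> C * (((sqrt s + norm y) * t powr (- (1 / 2))) ^ k * min 1 ((sqrt s + norm y) * t powr (- (1 / 2))))
         * (gauss_bound (gauss_rate \<nu> / 2) t (x - y) + gauss_bound (gauss_rate \<nu> / 2) t x)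
       + (if t / 2 < s then norm (heat_kernel \<nu> (t - s) (x - y)) else 0)"
proof -
  have h: "gauss_rate \<nu> / 2 \<le> gauss_rate \<nu>" "gauss_rate \<nu> > 0" using gauss_rate_pos[OF nu] by auto
  define S where "S = {\<gamma> :: 'n \<Rightarrow> nat. 2 * mdeg \<gamma> \<le> k}"
  have finS: "finite S" unfolding S_def by (rule finite_2mdeg_le)
  \<comment> \<open>The least number of time terms with 2J \<ge> k + 1; the degrees |\<gamma>| < J
    are exactly those with 2|\<gamma>| \<le> k.\<close>
  define J where "J = Suc (k div 2)"
  have SJ: "S = {\<gamma>. mdeg \<gamma> < J}" unfolding S_def J_def by (auto simp: less_Suc_eq_le)
  have "J > 0" by (simp add: J_def)
  from heat_kernel_time_taylor[OF nu this, where 'n='n, folded SJ]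
  obtain C1 where C1p: "C1 > 0" and C1': "\<forall>t>0. \<forall>s. 0 \<le> s \<and> s \<le> t / 2 \<longrightarrow> (\<forall>x :: real ^ 'n.
    norm (heat_deriv \<nu> (\<lambda>i. 0) (t - s) x - (\<Sum>\<gamma>\<in>S. (- \<nu> * of_real s) ^ mdeg \<gamma> / of_nat (mfact \<gamma>) * heat_deriv \<nu> (\<lambda>i. 2 * \<gamma> i) t x))
     \<le> C1 * (s / t) ^ J * gauss_bound (gauss_rate \<nu>) t x)" by (elim exE conjE)
  note C1 = C1p C1'[rule_format, OF _ conjI]
  define P where "P t x y \<gamma> = (\<Sum>\<beta>\<in>{\<beta>. mdeg \<beta> \<le> k - 2 * mdeg \<gamma>}. of_real (mpow y \<beta>) / of_nat (mfact \<beta>) * heat_deriv \<nu> (\<lambda>i. 2 * \<gamma> i + \<beta> i) t x)"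
    for t :: real and x y :: "real ^ 'n" and \<gamma>
  have m2: "mdeg (\<lambda>i. 2 * \<gamma> i) = 2 * mdeg \<gamma>" for \<gamma> :: "'n \<Rightarrow> nat" by (simp add: mdeg_def sum_distrib_left)
  have "\<exists>C>0. \<forall>t>0. \<forall>x y. norm (heat_deriv \<nu> (\<lambda>i. 2 * \<gamma> i) t (x - y) - P t x y \<gamma>)
      \<le> C * (t powr (- (1 / 2))) ^ (2 * mdeg \<gamma>) * ((norm y * t powr (- (1 / 2))) ^ (k - 2 * mdeg \<gamma>) * min 1 (norm y * t powr (- (1 / 2)))) * (gauss_bound (gauss_rate \<nu> / 2) t (x - y) + gauss_bound (gauss_rate \<nu> / 2) t x)" for \<gamma>
    using heat_kernel_space_taylor[OF nu, of "\<lambda>i. 2 * \<gamma> i" "k - 2 * mdeg \<gamma>"] by (simp only: P_def m2)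
  then have "\<forall>\<gamma>. \<exists>C. C > 0 \<and> (\<forall>t>0. \<forall>x y. norm (heat_deriv \<nu> (\<lambda>i. 2 * \<gamma> i) t (x - y) - P t x y \<gamma>)
      \<le> C * (t powr (- (1 / 2))) ^ (2 * mdeg \<gamma>) * ((norm y * t powr (- (1 / 2))) ^ (k - 2 * mdeg \<gamma>) * min 1 (norm y * t powr (- (1 / 2)))) * (gauss_bound (gauss_rate \<nu> / 2) t (x - y) + gauss_bound (gauss_rate \<nu> / 2) t x))" by (rule allI)
  from choice[OF this] obtain C2 where C2': "\<forall>\<gamma>. C2 \<gamma> > 0 \<and> (\<forall>t>0. \<forall>x y. norm (heat_deriv \<nu> (\<lambda>i. 2 * \<gamma> i) t (x - y) - P t x y \<gamma>)
      \<le> C2 \<gamma> * (t powr (- (1 / 2))) ^ (2 * mdeg \<gamma>) * ((norm y * t powr (- (1 / 2))) ^ (k - 2 * mdeg \<gamma>) * min 1 (norm y * t powr (- (1 / 2)))) * (gauss_bound (gauss_rate \<nu> / 2) t (x - y) + gauss_bound (gauss_rate \<nu> / 2) t x))" by (rule exE)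
  have C2: "C2 \<gamma> > 0" "t > 0 \<Longrightarrow> norm (heat_deriv \<nu> (\<lambda>i. 2 * \<gamma> i) t (x - y) - P t x y \<gamma>)
    \<le> C2 \<gamma> * (t powr (- (1 / 2))) ^ (2 * mdeg \<gamma>) * ((norm y * t powr (- (1 / 2))) ^ (k - 2 * mdeg \<gamma>) * min 1 (norm y * t powr (- (1 / 2)))) * (gauss_bound (gauss_rate \<nu> / 2) t (x - y) + gauss_bound (gauss_rate \<nu> / 2) t x)" for \<gamma> t x y
    by (rule C2'[THEN spec, THEN conjunct1], rule C2'[rule_format, THEN conjunct2, rule_format])
  define A where "A = (\<lambda>(\<gamma> :: 'n \<Rightarrow> nat, \<beta> :: 'n \<Rightarrow> nat) i. 2 * \<gamma> i + \<beta> i) ` (S \<times> {\<beta>. mdeg \<beta> \<le> k})"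
  have "finite A" unfolding A_def by (intro finite_imageI finite_cartesian_product finS finite_mdeg_le)
  from heat_deriv_bound_uniform[OF nu this] obtain C3 where C3: "C3 > 0"
    "\<And>\<alpha> t x. \<alpha> \<in> A \<Longrightarrow> t > 0 \<Longrightarrow> norm (heat_deriv \<nu> \<alpha> t (x :: real ^ 'n)) \<le> C3 * (t powr (- (1 / 2))) ^ mdeg \<alpha> * gauss_bound (gauss_rate \<nu>) t x" by blast
  define C2' where "C2' = (\<Sum>\<gamma>\<in>S. norm \<nu> ^ mdeg \<gamma> * C2 \<gamma>)"
  \<comment> \<open>For s > t/2: the factor 2^k raises lower powers of \<rho> \<ge> 1/2 to the k-th,
    and the last factor 2 compensates for min 1 \<rho> \<ge> 1/2.\<close>
  define C3' where "C3' = (\<Sum>\<gamma>\<in>S. norm \<nu> ^ mdeg \<gamma> * (real (card {\<beta> :: 'n \<Rightarrow> nat. mdeg \<beta> \<le> k - 2 * mdeg \<gamma>}) * C3)) * 2 ^ k * 2"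
  have C0: "C2' \<ge> 0" "C3' \<ge> 0" unfolding C2'_def C3'_def using C2(1) C3(1) by (auto intro!: sum_nonneg mult_nonneg_nonneg less_imp_le[OF C2(1)])
  have "norm (heat_kernel \<nu> (t - s) (x - y) - heat_taylor \<nu> k t s x y)
     \<le> (C1 + C2' + C3') * (((sqrt s + norm y) * t powr (- (1 / 2))) ^ k * min 1 ((sqrt s + norm y) * t powr (- (1 / 2))))
         * (gauss_bound (gauss_rate \<nu> / 2) t (x - y) + gauss_bound (gauss_rate \<nu> / 2) t x)
       + (if t / 2 < s then norm (heat_kernel \<nu> (t - s) (x - y)) else 0)" if t: "t > 0" and s: "s \<ge> 0" for t s and x y :: "real ^ 'n"
  proof -
    define r where "r = t powr (- (1 / 2))"
    have r: "r > 0" "r\<^sup>2 = 1 / t" unfolding r_def using t by (auto simp: powr_half_sq)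
    define z where "z = norm y * r"
    define w where "w = sqrt s * r"
    define \<rho> where "\<rho> = (sqrt s + norm y) * r"
    have z0: "z \<ge> 0" "w \<ge> 0" unfolding z_def w_def using r s by auto
    have \<rho>: "\<rho> = w + z" by (simp add: \<rho>_def w_def z_def algebra_simps)
    have w2: "w\<^sup>2 = s / t" unfolding w_def power_mult_distrib r(2) using s by simp
    define g where "g = gauss_bound (gauss_rate \<nu> / 2) t (x - y) + gauss_bound (gauss_rate \<nu> / 2) t x"
    have g: "g \<ge> 0" "gauss_bound (gauss_rate \<nu>) t (x - y) \<le> g" "gauss_bound (gauss_rate \<nu>) t x \<le> g"
      unfolding g_def using gauss_bound_nonneg[of "gauss_rate \<nu> / 2" t x] gauss_bound_nonneg[of "gauss_rate \<nu> / 2" t "x - y"] gauss_bound_mono[OF h(1) t, of x] gauss_bound_mono[OF h(1) t, of "x - y"] by linarith+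
    have kp: "heat_taylor \<nu> k t s x y = (\<Sum>\<gamma>\<in>S. (- \<nu> * of_real s) ^ mdeg \<gamma> / of_nat (mfact \<gamma>) * P t x y \<gamma>)"
      unfolding heat_taylor_def P_def S_def ..
    \<comment> \<open>The factor s^|\<gamma>| of the polynomial and the t^(-|\<gamma>|) of a kernel
      derivative of order 2|\<gamma>| combine to w^(2|\<gamma>|).\<close>
    have coef: "norm ((- \<nu> * of_real s) ^ mdeg \<gamma> / of_nat (mfact \<gamma>)) * r ^ (2 * mdeg \<gamma>) \<le> norm \<nu> ^ mdeg \<gamma> * w ^ (2 * mdeg \<gamma>)" for \<gamma> :: "'n \<Rightarrow> nat"
    proof -
      have "norm ((- \<nu> * of_real s) ^ mdeg \<gamma> / of_nat (mfact \<gamma>)) = (norm \<nu> * s) ^ mdeg \<gamma> / real (mfact \<gamma>)"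
        using s by (simp add: norm_divide norm_power norm_mult)
      also have "\<dots> \<le> (norm \<nu> * s) ^ mdeg \<gamma> / 1" using mfact_ge_1[of \<gamma>] s by (intro divide_left_mono) auto
      finally have a: "norm ((- \<nu> * of_real s) ^ mdeg \<gamma> / of_nat (mfact \<gamma>)) \<le> (norm \<nu> * s) ^ mdeg \<gamma>" by (simp only: div_by_1)
      have "norm ((- \<nu> * of_real s) ^ mdeg \<gamma> / of_nat (mfact \<gamma>)) * r ^ (2 * mdeg \<gamma>) \<le> (norm \<nu> * s) ^ mdeg \<gamma> * (1 / t) ^ mdeg \<gamma>"
        unfolding power_mult r(2) using a t by (intro mult_right_mono) auto
      also have "\<dots> = norm \<nu> ^ mdeg \<gamma> * w ^ (2 * mdeg \<gamma>)" unfolding power_mult w2 by (simp add: power_mult_distrib power_divide)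
      finally show ?thesis .
    qed
    show ?thesis
    proof (cases "s \<le> t / 2")
      case True
      have w1: "w \<le> 1"
      proof -
        have "w\<^sup>2 \<le> 1\<^sup>2" unfolding w2 using True t by (simp add: field_simps)
        then show ?thesis by (rule power2_le_imp_le) simp
      qed
      have kf: "heat_kernel \<nu> (t - s) (x - y) = heat_deriv \<nu> (\<lambda>i. 0) (t - s) (x - y)" using True t by (simp add: heat_kernel_def)
      \<comment> \<open>The intermediate object: expanded in time, but not yet in space.\<close>
      let ?T = "\<Sum>\<gamma>\<in>S. (- \<nu> * of_real s) ^ mdeg \<gamma> / of_nat (mfact \<gamma>) * heat_deriv \<nu> (\<lambda>i. 2 * \<gamma> i) t (x - y)"
      have 1: "norm (heat_kernel \<nu> (t - s) (x - y) - ?T) \<le> C1 * (\<rho> ^ k * min 1 \<rho>) * g"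
      proof -
        have "(s / t) ^ J = w ^ (2 * J)" by (simp add: power_mult w2)
        also have "\<dots> \<le> w ^ Suc k" using w1 z0 unfolding J_def by (intro power_decreasing) auto
        also have "\<dots> = w ^ k * w" by simp
        also have "\<dots> \<le> \<rho> ^ k * min 1 \<rho>" using z0 w1 unfolding \<rho> by (intro mult_mono power_mono) auto
        finally have "C1 * (s / t) ^ J * gauss_bound (gauss_rate \<nu>) t (x - y) \<le> C1 * (\<rho> ^ k * min 1 \<rho>) * g"
          using C1(1) g s t gauss_bound_nonneg by (intro mult_mono) (auto simp: \<rho> z0)
        then show ?thesis using C1(2)[OF t s True, of "x - y"] unfolding kf by linarith
      qed
      have 2: "norm (?T - heat_taylor \<nu> k t s x y) \<le> C2' * (\<rho> ^ k * min 1 \<rho>) * g"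
      proof -
        have "norm (?T - heat_taylor \<nu> k t s x y) = norm (\<Sum>\<gamma>\<in>S. (- \<nu> * of_real s) ^ mdeg \<gamma> / of_nat (mfact \<gamma>) * (heat_deriv \<nu> (\<lambda>i. 2 * \<gamma> i) t (x - y) - P t x y \<gamma>))"
          unfolding kp by (simp add: sum_subtractf right_diff_distrib)
        also have "\<dots> \<le> (\<Sum>\<gamma>\<in>S. norm \<nu> ^ mdeg \<gamma> * C2 \<gamma> * ((\<rho> ^ k * min 1 \<rho>) * g))"
        proof (intro order_trans[OF norm_sum] sum_mono)
          fix \<gamma> assume "\<gamma> \<in> S"
          then have k: "2 * mdeg \<gamma> \<le> k" by (simp add: S_def)
          let ?c = "norm ((- \<nu> * of_real s) ^ mdeg \<gamma> / of_nat (mfact \<gamma>))"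
          let ?z = "z ^ (k - 2 * mdeg \<gamma>) * min 1 z"
          have "norm ((- \<nu> * of_real s) ^ mdeg \<gamma> / of_nat (mfact \<gamma>) * (heat_deriv \<nu> (\<lambda>i. 2 * \<gamma> i) t (x - y) - P t x y \<gamma>))
             \<le> ?c * (C2 \<gamma> * r ^ (2 * mdeg \<gamma>) * ?z * g)"
            unfolding norm_mult using C2(2)[OF t, of \<gamma> x y] by (intro mult_left_mono) (auto simp: r_def z_def g_def)
          also have "\<dots> = (?c * r ^ (2 * mdeg \<gamma>)) * (C2 \<gamma> * ?z * g)" by simp
          also have "\<dots> \<le> (norm \<nu> ^ mdeg \<gamma> * w ^ (2 * mdeg \<gamma>)) * (C2 \<gamma> * ?z * g)"
            using z0 C2(1)[of \<gamma>] g by (intro mult_right_mono coef) auto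
          also have "\<dots> = norm \<nu> ^ mdeg \<gamma> * C2 \<gamma> * ((w ^ (2 * mdeg \<gamma>) * ?z) * g)" by simp
          also have "w ^ (2 * mdeg \<gamma>) * ?z \<le> \<rho> ^ (2 * mdeg \<gamma>) * (\<rho> ^ (k - 2 * mdeg \<gamma>) * min 1 \<rho>)"
            using z0 unfolding \<rho> by (intro mult_mono power_mono) auto
          also have "\<dots> = \<rho> ^ k * min 1 \<rho>" using k by (simp add: power_add[symmetric] mult.assoc[symmetric])
          finally show "norm ((- \<nu> * of_real s) ^ mdeg \<gamma> / of_nat (mfact \<gamma>) * (heat_deriv \<nu> (\<lambda>i. 2 * \<gamma> i) t (x - y) - P t x y \<gamma>))
             \<le> norm \<nu> ^ mdeg \<gamma> * C2 \<gamma> * ((\<rho> ^ k * min 1 \<rho>) * g)"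
            using C2(1)[of \<gamma>] g by (simp add: mult_left_mono mult_right_mono less_imp_le)
        qed
        also have "\<dots> = C2' * (\<rho> ^ k * min 1 \<rho>) * g" unfolding C2'_def sum_distrib_right by (simp only: mult.assoc)
        finally show ?thesis .
      qed
      have "norm (heat_kernel \<nu> (t - s) (x - y) - heat_taylor \<nu> k t s x y) \<le> norm (heat_kernel \<nu> (t - s) (x - y) - ?T) + norm (?T - heat_taylor \<nu> k t s x y)"
        using norm_triangle_ineq[of "heat_kernel \<nu> (t - s) (x - y) - ?T" "?T - heat_taylor \<nu> k t s x y"] by simp
      also have "\<dots> \<le> C1 * (\<rho> ^ k * min 1 \<rho>) * g + C2' * (\<rho> ^ k * min 1 \<rho>) * g" by (intro add_mono 1 2)
      also have "\<dots> = (C1 + C2') * (\<rho> ^ k * min 1 \<rho>) * g" by (simp add: algebra_simps)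
      also have "\<dots> \<le> (C1 + C2' + C3') * (\<rho> ^ k * min 1 \<rho>) * g"
        using C0 g z0 by (intro mult_right_mono) (auto simp: \<rho>)
      finally show ?thesis using True unfolding \<rho>_def g_def r_def by simp
    next
      case False
      \<comment> \<open>In this range \<rho> is bounded below, so the polynomial alone has the size
        of the claimed bound.\<close>
      have wh: "w \<ge> 1 / 2"
      proof -
        have "(1 / 2)\<^sup>2 \<le> w\<^sup>2" unfolding w2 using False t by (simp add: field_simps power2_eq_square)
        then show ?thesis by (rule power2_le_imp_le) (simp add: z0)
      qed
      then have ph: "\<rho> \<ge> 1 / 2" using z0 by (simp add: \<rho>)
      have "norm (heat_taylor \<nu> k t s x y) \<le> (\<Sum>\<gamma>\<in>S. norm \<nu> ^ mdeg \<gamma> * (real (card {\<beta> :: 'n \<Rightarrow> nat. mdeg \<beta> \<le> k - 2 * mdeg \<gamma>}) * C3) * (\<rho> ^ k * 2 ^ k * g))"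
        unfolding kp
      proof (intro order_trans[OF norm_sum] sum_mono)
        fix \<gamma> assume "\<gamma> \<in> S"
        then have k: "2 * mdeg \<gamma> \<le> k" by (simp add: S_def)
        let ?c = "norm ((- \<nu> * of_real s) ^ mdeg \<gamma> / of_nat (mfact \<gamma>))"
        have "?c * norm (of_real (mpow y \<beta>) / of_nat (mfact \<beta>) * heat_deriv \<nu> (\<lambda>i. 2 * \<gamma> i + \<beta> i) t x) \<le> norm \<nu> ^ mdeg \<gamma> * (C3 * (\<rho> ^ k * 2 ^ k * g))"
          if b: "mdeg \<beta> \<le> k - 2 * mdeg \<gamma>" for \<beta>
        proof -
          have e: "mdeg (\<lambda>i. 2 * \<gamma> i + \<beta> i) = 2 * mdeg \<gamma> + mdeg \<beta>" by (simp add: mdeg_def sum.distrib sum_distrib_left)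
          have "(\<lambda>i. 2 * \<gamma> i + \<beta> i) \<in> A" unfolding A_def using \<open>\<gamma> \<in> S\<close> b by (auto intro!: image_eqI[of _ _ "(\<gamma>, \<beta>)"])
          from C3(2)[OF this t, of x] have K: "norm (heat_deriv \<nu> (\<lambda>i. 2 * \<gamma> i + \<beta> i) t x) \<le> C3 * r ^ (2 * mdeg \<gamma> + mdeg \<beta>) * gauss_bound (gauss_rate \<nu>) t x"
            unfolding e r_def .
          also have "\<dots> \<le> C3 * r ^ (2 * mdeg \<gamma> + mdeg \<beta>) * g" using C3(1) r g by (intro mult_left_mono) auto
          finally have K: "norm (heat_deriv \<nu> (\<lambda>i. 2 * \<gamma> i + \<beta> i) t x) \<le> C3 * r ^ (2 * mdeg \<gamma> + mdeg \<beta>) * g" .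
          have "norm (of_real (mpow y \<beta>) / of_nat (mfact \<beta>) * heat_deriv \<nu> (\<lambda>i. 2 * \<gamma> i + \<beta> i) t x) = \<bar>mpow y \<beta>\<bar> / real (mfact \<beta>) * norm (heat_deriv \<nu> (\<lambda>i. 2 * \<gamma> i + \<beta> i) t x)"
            by (simp add: norm_mult norm_divide)
          also have "\<dots> \<le> (norm y ^ mdeg \<beta> / 1) * (C3 * r ^ (2 * mdeg \<gamma> + mdeg \<beta>) * g)"
            using mfact_ge_1[of \<beta>] mpow_bound[of y \<beta>] K by (intro mult_mono frac_le) auto
          finally have "?c * norm (of_real (mpow y \<beta>) / of_nat (mfact \<beta>) * heat_deriv \<nu> (\<lambda>i. 2 * \<gamma> i + \<beta> i) t x) \<le> ?c * ((norm y ^ mdeg \<beta> / 1) * (C3 * r ^ (2 * mdeg \<gamma> + mdeg \<beta>) * g))"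
            by (rule mult_left_mono) simp
          also have "\<dots> = (?c * r ^ (2 * mdeg \<gamma>)) * (C3 * z ^ mdeg \<beta> * g)" by (simp add: z_def power_add power_mult_distrib mult_ac)
          also have "\<dots> \<le> (norm \<nu> ^ mdeg \<gamma> * w ^ (2 * mdeg \<gamma>)) * (C3 * z ^ mdeg \<beta> * g)"
            using z0 C3(1) g by (intro mult_right_mono coef) auto
          also have "\<dots> = norm \<nu> ^ mdeg \<gamma> * (C3 * (w ^ (2 * mdeg \<gamma>) * z ^ mdeg \<beta> * g))" by simp
          also have "\<dots> \<le> norm \<nu> ^ mdeg \<gamma> * (C3 * (\<rho> ^ k * 2 ^ k * g))"
          proof (intro mult_left_mono mult_right_mono g)
            have "w ^ (2 * mdeg \<gamma>) * z ^ mdeg \<beta> \<le> \<rho> ^ (2 * mdeg \<gamma>) * \<rho> ^ mdeg \<beta>"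
              using z0 unfolding \<rho> by (intro mult_mono power_mono) auto
            also have "\<dots> = \<rho> ^ (2 * mdeg \<gamma> + mdeg \<beta>) * 1" by (simp add: power_add)
            also have "\<dots> \<le> \<rho> ^ (2 * mdeg \<gamma> + mdeg \<beta>) * (2 * \<rho>) ^ (k - (2 * mdeg \<gamma> + mdeg \<beta>))"
              using ph by (intro mult_left_mono one_le_power) auto
            also have "\<dots> = \<rho> ^ k * 2 ^ (k - (2 * mdeg \<gamma> + mdeg \<beta>))"
              using k b by (simp add: power_mult_distrib mult_ac flip: power_add) 
            also have "\<dots> \<le> \<rho> ^ k * 2 ^ k" using ph by (intro mult_left_mono power_increasing) auto
            finally show "w ^ (2 * mdeg \<gamma>) * z ^ mdeg \<beta> \<le> \<rho> ^ k * 2 ^ k" .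
          qed (use C3(1) in auto)
          finally show ?thesis .
        qed
        note b = this
        have "norm ((- \<nu> * of_real s) ^ mdeg \<gamma> / of_nat (mfact \<gamma>) * P t x y \<gamma>) \<le> (\<Sum>\<beta>\<in>{\<beta> :: 'n \<Rightarrow> nat. mdeg \<beta> \<le> k - 2 * mdeg \<gamma>}. norm \<nu> ^ mdeg \<gamma> * (C3 * (\<rho> ^ k * 2 ^ k * g)))"
          unfolding P_def sum_distrib_left
        proof (intro order_trans[OF norm_sum] sum_mono)
          fix \<beta> :: "'n \<Rightarrow> nat" assume "\<beta> \<in> {\<beta>. mdeg \<beta> \<le> k - 2 * mdeg \<gamma>}"
          then show "norm ((- \<nu> * of_real s) ^ mdeg \<gamma> / of_nat (mfact \<gamma>) * (of_real (mpow y \<beta>) / of_nat (mfact \<beta>) * heat_deriv \<nu> (\<lambda>i. 2 * \<gamma> i + \<beta> i) t x)) \<le> norm \<nu> ^ mdeg \<gamma> * (C3 * (\<rho> ^ k * 2 ^ k * g))"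
            using b[of \<beta>] by (subst norm_mult) simp
        qed
        then show "norm ((- \<nu> * of_real s) ^ mdeg \<gamma> / of_nat (mfact \<gamma>) * P t x y \<gamma>) \<le> norm \<nu> ^ mdeg \<gamma> * (real (card {\<beta> :: 'n \<Rightarrow> nat. mdeg \<beta> \<le> k - 2 * mdeg \<gamma>}) * C3) * (\<rho> ^ k * 2 ^ k * g)"
          by (simp add: mult_ac)
      qed
      also have "\<dots> = C3' * (\<rho> ^ k * (1 / 2)) * g" unfolding C3'_def sum_distrib_right[symmetric] by simp
      also have "\<dots> \<le> C3' * (\<rho> ^ k * min 1 \<rho>) * g"
        using ph C0 g by (intro mult_right_mono mult_left_mono) auto
      also have "\<dots> \<le> (C1 + C2' + C3') * (\<rho> ^ k * min 1 \<rho>) * g"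
        using C0 C1(1) g z0 by (intro mult_right_mono) (auto simp: \<rho>)
      finally have "norm (heat_taylor \<nu> k t s x y) \<le> (C1 + C2' + C3') * (\<rho> ^ k * min 1 \<rho>) * g" .
      then show ?thesis using False norm_triangle_ineq4[of "heat_kernel \<nu> (t - s) (x - y)" "heat_taylor \<nu> k t s x y"] unfolding \<rho>_def g_def r_def by simp
    qed
  qed
  moreover have "C1 + C2' + C3' > 0" using C0 C1 by linarith
  ultimately show ?thesis by blast
qed

section \<open>Lebesgue norms and Bochner integrals\<close>

lemma sigma_finite_lebesgue: "sigma_finite_measure (lebesgue :: 'a::euclidean_space measure)"
proof
  obtain A :: "'a set set" where A: "countable A" "A \<subseteq> sets lborel" "\<Union>A = space lborel" "\<forall>a\<in>A. emeasure lborel a \<noteq> \<infinity>"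
    using lborel.sigma_finite_countable by auto
  show "\<exists>A::'a set set. countable A \<and> A \<subseteq> sets lebesgue \<and> \<Union>A = space lebesgue \<and> (\<forall>a\<in>A. emeasure lebesgue a \<noteq> \<infinity>)"
    using A by (intro exI[of _ A]) (auto simp: subset_iff)
qed

lemma sigma_finite_lebesgue_on:
  assumes "A \<in> sets lebesgue"
  shows "sigma_finite_measure (lebesgue_on A)"
  by (rule sigma_finite_measure_restrict_space[OF sigma_finite_lebesgue assms])

lemma ennreal_norm_diff_measurable:
  fixes a b :: "'a \<Rightarrow> complex"
  assumes "a \<in> borel_measurable M" "b \<in> borel_measurable M"
  shows "(\<lambda>x. ennreal (norm (a x - b x))) \<in> borel_measurable M"
  using assms by measurable

lemma recip_1: "recip 1 = 1" by (simp add: recip_def)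

lemma lq_norm_1: "lq_norm 1 \<phi> = (\<integral>\<^sup>+ x. ennreal (norm (\<phi> x)) \<partial>lebesgue)"
  unfolding lq_norm_def recip_1 by (auto simp: Let_def less_top)

lemma lq_norm_inf: "lq_norm \<infinity> \<phi> = esssup lebesgue (\<lambda>x. ennreal (norm (\<phi> x)))"
  by (simp add: lq_norm_def)

lemma lq_norm_inf_AE: "AE x in lebesgue. ennreal (norm (\<phi> x)) \<le> lq_norm \<infinity> \<phi>"
  unfolding lq_norm_inf by (rule esssup_AE)

lemma lq_norm_inf_le:
  assumes "\<phi> \<in> borel_measurable lebesgue" "AE x in lebesgue. ennreal (norm (\<phi> x)) \<le> c"
  shows "lq_norm \<infinity> \<phi> \<le> c"
  unfolding lq_norm_inf using assms by (intro esssup_I) auto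

lemma Lq_measurable: "\<phi> \<in> Lq q \<Longrightarrow> \<phi> \<in> borel_measurable lebesgue"
  by (simp add: Lq_def)

text \<open>By real and imaginary parts. It mediates between functions measurable for the completed
  measure and products of \<open>lborel\<close>, on which Fubini is used.\<close>

lemma complex_borel_version:
  fixes \<phi> :: "'a::euclidean_space \<Rightarrow> complex"
  assumes "\<phi> \<in> borel_measurable lebesgue"
  shows "\<exists>\<psi>\<in>borel_measurable lborel. AE x in lborel. \<phi> x = \<psi> x"
proof -
  obtain a where a: "a \<in> borel_measurable lborel" "AE x in lborel. Re (\<phi> x) = a x"
    using completion_ex_borel_measurable_real[of "\<lambda>x. Re (\<phi> x)" lborel] assms by auto
  obtain b where b: "b \<in> borel_measurable lborel" "AE x in lborel. Im (\<phi> x) = b x"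
    using completion_ex_borel_measurable_real[of "\<lambda>x. Im (\<phi> x)" lborel] assms by auto
  define c where "c x = complex_of_real (a x) + \<i> * complex_of_real (b x)" for x
  have "c \<in> borel_measurable lborel"
    unfolding c_def using a b by measurable
  moreover have "AE x in lborel. \<phi> x = c x"
    using a(2) b(2) by eventually_elim (simp add: complex_eq_iff c_def)
  ultimately show ?thesis by blast
qed

text \<open>The representatives \<open>u s\<close> need not be jointly measurable in \<open>(s, x)\<close>, but continuity in $L^1$
  yields a jointly measurable representative: approximate \<open>u s\<close> by \<open>u q\<close> with \<open>q\<close> rational, at distance
  less than $2^{-k}$.\<close>

lemma joint_representative:
  fixes u :: "real \<Rightarrow> real ^ 'n::finite \<Rightarrow> complex"
  assumes L1: "\<And>t. t > 0 \<Longrightarrow> u t \<in> Lq 1"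
    and cont: "\<And>t. t > 0 \<Longrightarrow> ((\<lambda>s. lq_norm 1 (\<lambda>x. u s x - u t x)) \<longlongrightarrow> 0) (at t)"
  shows "\<exists>v. (\<lambda>z. v (fst z) (snd z)) \<in> borel_measurable (lborel \<Otimes>\<^sub>M lborel) \<and> (\<forall>s>0. AE x in lborel. v s x = u s x)"
proof -
  \<comment> \<open>An enumeration, with repetitions, of the positive rationals through the pairing
    of natural numbers.\<close>
  define r :: "nat \<Rightarrow> real" where "r i = real (fst (prod_decode i) + 1) / real (snd (prod_decode i) + 1)" for i
  have r_pos: "r i > 0" for i by (simp add: r_def add_pos_nonneg)
  have r_dense: "\<exists>i. a < r i \<and> r i < b" if ab: "0 < a" "a < b" for a b
  proof -
    obtain q where q: "a < of_rat q" "of_rat q < b" using of_rat_dense[OF ab(2)] by blast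
    then have "q > 0" using ab(1) by (metis less_trans zero_less_of_rat_iff)
    then obtain m n where mn: "q = of_int m / of_int n" "m > 0" "n > 0"
    proof -
      obtain m n where q: "quotient_of q = (m, n)" by (cases "quotient_of q") auto
      have "n > 0" "q = of_int m / of_int n" using q by (auto simp: quotient_of_denom_pos quotient_of_div)
      moreover from this have "m > 0" using \<open>q > 0\<close> by (simp add: zero_less_divide_iff)
      ultimately show thesis using that by blast
    qed
    have "r (prod_encode (nat m - 1, nat n - 1)) = of_rat q"
      unfolding r_def using mn by (simp add: of_rat_divide of_nat_diff)
    then show ?thesis using q by metis
  qed
  have "\<forall>i. \<exists>\<psi>\<in>borel_measurable lborel. AE x in lborel. u (r i) x = \<psi> x"
    using complex_borel_version[OF Lq_measurable[OF L1[OF r_pos]]] by (rule allI)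
  then have "\<forall>i. \<exists>\<psi>. \<psi> \<in> borel_measurable lborel \<and> (AE x in lborel. u (r i) x = \<psi> x)" by blast
  from choice[OF this] obtain U where "\<forall>i. U i \<in> borel_measurable lborel \<and> (AE x in lborel. u (r i) x = U i x)" by (rule exE)
  then have U: "\<And>i. U i \<in> borel_measurable lborel" "\<And>i. AE x in lborel. u (r i) x = U i x" by blast+
  define d where "d s t = lq_norm 1 (\<lambda>x. u s x - u t x)" for s t
  have meas: "(\<lambda>x. ennreal (norm (u s x - u t x))) \<in> borel_measurable lebesgue" if "s > 0" "t > 0" for s t
    by (intro ennreal_norm_diff_measurable Lq_measurable[OF L1[OF that(1)]] Lq_measurable[OF L1[OF that(2)]])
  have tri: "d s t \<le> d s s' + d s' t" if "s > 0" "s' > 0" "t > 0" for s s' t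
  proof -
    have "d s t \<le> (\<integral>\<^sup>+ x. ennreal (norm (u s x - u s' x)) + ennreal (norm (u s' x - u t x)) \<partial>lebesgue)"
      unfolding d_def lq_norm_1
    proof (intro nn_integral_mono)
      fix x
      show "ennreal (norm (u s x - u t x)) \<le> ennreal (norm (u s x - u s' x)) + ennreal (norm (u s' x - u t x))"
        using norm_triangle_ineq[of "u s x - u s' x" "u s' x - u t x"] by (simp add: ennreal_plus[symmetric] del: ennreal_plus)
    qed
    also have "\<dots> = d s s' + d s' t" unfolding d_def lq_norm_1 by (intro nn_integral_add meas that)
    finally show ?thesis .
  qed
  \<comment> \<open>The times s that sample i approximates within 2^(-k). Openness will make the
    choice of a sample Borel measurable in s.\<close>
  define B where "B k i = {s. s > 0 \<and> d s (r i) < ennreal (inverse 2 ^ k)}" for k i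
  have "open (B k i)" for k i
    unfolding open_dist
  proof
    fix s assume "s \<in> B k i"
    then have s: "s > 0" "d s (r i) < ennreal (inverse 2 ^ k)" by (auto simp: B_def)
    \<comment> \<open>The strict gap at s; times that are closer than e to s in L^1 cannot exhaust
      it.\<close>
    define e where "e = ennreal (inverse 2 ^ k) - d s (r i)"
    have e: "e > 0" using s(2) by (simp add: e_def diff_gt_0_iff_gt_ennreal)
    have "\<forall>\<^sub>F s' in at s. d s' s < e" using order_tendstoD(2)[OF cont[OF s(1)] e] unfolding d_def .
    moreover have "\<forall>\<^sub>F s' in at s. s' > 0" using s(1) by (intro order_tendstoD(1)[OF tendsto_ident_at])
    ultimately have "\<forall>\<^sub>F s' in at s. s' \<in> B k i"
    proof eventually_elim
      case (elim s')
      have "d s' (r i) \<le> d s' s + d s (r i)" by (rule tri) (use elim s r_pos in auto)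
      also have "\<dots> < ennreal (inverse 2 ^ k)"
        using elim(1) less_diff_eq_ennreal[of "ennreal (inverse 2 ^ k)" "d s (r i)" "d s' s"] by (simp add: e_def)
      finally show ?case using elim by (auto simp: B_def)
    qed
    with \<open>s \<in> B k i\<close> have "\<forall>\<^sub>F s' in nhds s. s' \<in> B k i" by (simp add: eventually_nhds_conv_at)
    then show "\<exists>e>0. \<forall>y. dist y s < e \<longrightarrow> y \<in> B k i" by (simp add: eventually_nhds_metric)
  qed
  then have Bm: "B k i \<in> sets borel" for k i by (rule borel_open)
  have Bex: "\<exists>i. s \<in> B k i" if s: "s > 0" for k s
  proof -
    have "\<forall>\<^sub>F s' in at s. d s' s < ennreal (inverse 2 ^ k)" using order_tendstoD(2)[OF cont[OF s], of "ennreal (inverse 2 ^ k)"] unfolding d_def by simp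
    then obtain e where e: "e > 0" "\<And>s'. s' \<noteq> s \<Longrightarrow> dist s' s < e \<Longrightarrow> d s' s < ennreal (inverse 2 ^ k)"
      unfolding eventually_at by blast
    obtain i where i: "s < r i" "r i < s + e" using r_dense[OF s, of "s + e"] e(1) by auto
    have "d s (r i) = d (r i) s" unfolding d_def lq_norm_1 by (simp add: norm_minus_commute)
    also have "\<dots> < ennreal (inverse 2 ^ k)" using i by (intro e) (auto simp: dist_real_def)
    finally show ?thesis using s by (auto simp: B_def)
  qed
  \<comment> \<open>Taking the least admissible sample is a measurable selection with countable
    range, so \<open>w k\<close> below is jointly measurable.\<close>
  define j where "j k s = (LEAST i. s \<in> B k i)" for k s
  have j: "s \<in> B k (j k s)" if "s > 0" for s k unfolding j_def using Bex[OF that] by (rule LeastI_ex)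
  have jm[measurable]: "j k \<in> measurable borel (count_space UNIV)" for k
    unfolding j_def by (rule measurable_Least) (use Bm in measurable)
  define w where "w k z = U (j k (fst z)) (snd z)" for k and z :: "real \<times> (real ^ 'n)"
  have wm[measurable]: "w k \<in> borel_measurable (lborel \<Otimes>\<^sub>M lborel)" for k
    unfolding w_def
  proof (rule measurable_compose_countable)
    show "(\<lambda>z. U i (snd z)) \<in> borel_measurable (lborel \<Otimes>\<^sub>M lborel)" for i using U(1)[of i] by measurable
    show "(\<lambda>z. j k (fst z)) \<in> measurable (lborel \<Otimes>\<^sub>M lborel) (count_space UNIV)" by measurable
  qed
  define v where "v s x = lim (\<lambda>k. w k (s, x))" for s x
  have "(\<lambda>z. v (fst z) (snd z)) \<in> borel_measurable (lborel \<Otimes>\<^sub>M lborel)" unfolding v_def by measurable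
  moreover have "AE x in lborel. v s x = u s x" if s: "s > 0" for s
  proof -
    have um: "u s \<in> borel_measurable lebesgue" by (rule Lq_measurable[OF L1[OF s]])
    have k: "(\<integral>\<^sup>+ x. ennreal (norm (w k (s, x) - u s x)) \<partial>lebesgue) \<le> ennreal (inverse 2 ^ k)" for k
    proof -
      have "(\<integral>\<^sup>+ x. ennreal (norm (w k (s, x) - u s x)) \<partial>lebesgue) = d s (r (j k s))"
        unfolding d_def lq_norm_1 w_def fst_conv snd_conv
      proof (rule nn_integral_cong_AE)
        show "AE x in lebesgue. ennreal (norm (U (j k s) x - u s x)) = ennreal (norm (u s x - u (r (j k s)) x))"
          using AE_completion[OF U(2)[of "j k s"]] by eventually_elim (simp add: norm_minus_commute)
      qed
      also have "\<dots> \<le> ennreal (inverse 2 ^ k)" using j[OF s, of k] by (auto simp: B_def less_imp_le)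
      finally show ?thesis .
    qed
    have wl: "(\<lambda>x. w k (s, x)) \<in> borel_measurable lebesgue" for k
      using U(1)[of "j k s"] by (simp add: w_def measurable_completion)
    have wu[measurable]: "(\<lambda>x. ennreal (norm (w k (s, x) - u s x))) \<in> borel_measurable lebesgue" for k
      by (intro ennreal_norm_diff_measurable wl um)
    \<comment> \<open>The errors 2^(-k) are summable, so for fixed s the samples converge almost
      everywhere and not merely in L^1.\<close>
    have "(\<integral>\<^sup>+ x. (\<Sum>k. ennreal (norm (w k (s, x) - u s x))) \<partial>lebesgue) = (\<Sum>k. \<integral>\<^sup>+ x. ennreal (norm (w k (s, x) - u s x)) \<partial>lebesgue)"
      by (rule nn_integral_suminf) (rule wu)
    also have "\<dots> \<le> (\<Sum>k. ennreal (inverse 2 ^ k))" by (intro suminf_le k) auto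
    also have "\<dots> = ennreal (\<Sum>k. inverse 2 ^ k)" by (intro suminf_ennreal2 summable_geometric) auto
    also have "\<dots> < \<infinity>" by simp
    finally have "AE x in lebesgue. (\<Sum>k. ennreal (norm (w k (s, x) - u s x))) \<noteq> \<infinity>"
      by (intro nn_integral_PInf_AE borel_measurable_suminf wu) auto
    then have "AE x in lebesgue. v s x = u s x"
    proof eventually_elim
      case (elim x)
      then have "summable (\<lambda>k. norm (w k (s, x) - u s x))"
        by (intro summable_suminf_not_top) (auto simp: top_ennreal_def)
      then have "(\<lambda>k. norm (w k (s, x) - u s x)) \<longlonglongrightarrow> 0" by (rule summable_LIMSEQ_zero)
      then have "(\<lambda>k. w k (s, x)) \<longlonglongrightarrow> u s x" by (simp add: tendsto_norm_zero_iff LIM_zero_iff)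
      then show ?case unfolding v_def by (rule limI)
    qed
    then show ?thesis by (simp add: AE_completion_iff)
  qed
  ultimately show ?thesis by blast
qed

text \<open>Completion only adds measurable sets, so joint Borel measurability carries over to the
  product on which the time integral over A and the space integral are exchanged.\<close>

lemma lebesgue_pair_measurable:
  assumes "(\<lambda>z. h (fst z) (snd z)) \<in> borel_measurable (lborel \<Otimes>\<^sub>M lborel)"
  shows "(\<lambda>z. h (fst z) (snd z)) \<in> borel_measurable (lebesgue_on A \<Otimes>\<^sub>M lebesgue)"
proof -
  have "(\<lambda>z. (fst z, snd z)) \<in> measurable (lebesgue_on A \<Otimes>\<^sub>M lebesgue) (lborel \<Otimes>\<^sub>M lborel)"
  proof (rule measurable_Pair)
    have "(\<lambda>x. x) \<in> measurable (lebesgue_on A) lborel"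
      by (intro measurable_restrict_space1 measurable_completion) simp
    then show "fst \<in> measurable (lebesgue_on A \<Otimes>\<^sub>M lebesgue) lborel" using measurable_compose[OF measurable_fst] by blast
    have "(\<lambda>x. x) \<in> measurable lebesgue lborel"
      by (intro measurable_completion) simp
    then show "snd \<in> measurable (lebesgue_on A \<Otimes>\<^sub>M lebesgue) lborel" using measurable_compose[OF measurable_snd] by blast
  qed
  from measurable_compose[OF this assms] show ?thesis by simp
qed

text \<open>There are finitely many function values on measurable pieces of time, so the joint
  function is a finite sum of products of an indicator in s and a function of x.\<close>

lemma simple_function_joint_measurable:
  assumes "simple_function M S" "\<And>s. s \<in> space M \<Longrightarrow> S s \<in> borel_measurable L"
  shows "(\<lambda>z. (S (fst z) (snd z) :: complex)) \<in> borel_measurable (M \<Otimes>\<^sub>M L)"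
proof -
  have fin: "finite (S ` space M)" using assms(1) by (simp add: simple_function_def)
  have sets: "S -` {f} \<inter> space M \<in> sets M" for f using assms(1) by (rule simple_functionD)
  have "(\<lambda>z. \<Sum>f\<in>S ` space M. indicator (S -` {f} \<inter> space M) (fst z) *\<^sub>R f (snd z)) \<in> borel_measurable (M \<Otimes>\<^sub>M L)"
  proof (intro borel_measurable_sum borel_measurable_scaleR)
    fix f assume "f \<in> S ` space M"
    then have "f \<in> borel_measurable L" using assms(2) by auto
    then show "(\<lambda>z. f (snd z)) \<in> borel_measurable (M \<Otimes>\<^sub>M L)" by measurable
    show "(\<lambda>z. indicator (S -` {f} \<inter> space M) (fst z)) \<in> borel_measurable (M \<Otimes>\<^sub>M L)"
      using sets[of f] by measurable
  qed
  also have "(\<lambda>z. \<Sum>f\<in>S ` space M. indicator (S -` {f} \<inter> space M) (fst z) *\<^sub>R f (snd z)) \<in> borel_measurable (M \<Otimes>\<^sub>M L) \<longleftrightarrow> ?thesis"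
  proof (rule measurable_cong)
    fix z assume "z \<in> space (M \<Otimes>\<^sub>M L)"
    then have z: "fst z \<in> space M" by (auto simp: space_pair_measure)
    have "(\<Sum>f\<in>S ` space M. indicator (S -` {f} \<inter> space M) (fst z) *\<^sub>R f (snd z)) = (\<Sum>f\<in>S ` space M. if f = S (fst z) then f (snd z) else 0)"
      using z by (intro sum.cong) (auto simp: indicator_def)
    also have "\<dots> = S (fst z) (snd z)" using z fin by simp
    finally show "(\<Sum>f\<in>S ` space M. indicator (S -` {f} \<inter> space M) (fst z) *\<^sub>R f (snd z)) = S (fst z) (snd z)" .
  qed
  finally show ?thesis .
qed

text \<open>Minkowski's inequality for integrals in L^1, that is Tonelli: the distance between the
  two integrals is at most the integrated distance between the integrands.\<close>

lemma simple_bochner_distance: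
  fixes h :: "real \<Rightarrow> real ^ 'n::finite \<Rightarrow> complex"
  assumes A: "A \<in> sets borel"
    and h: "(\<lambda>z. h (fst z) (snd z)) \<in> borel_measurable (lborel \<Otimes>\<^sub>M lborel)"
    and fin: "(\<integral>\<^sup>+ s. (\<integral>\<^sup>+ x. ennreal (norm (h s x)) \<partial>lebesgue) \<partial>lebesgue_on A) < \<infinity>"
    and S: "simple_function (lebesgue_on A) S" "\<forall>s\<in>A. S s \<in> borel_measurable lebesgue"
      "emeasure (lebesgue_on A) {s \<in> space (lebesgue_on A). S s \<noteq> (\<lambda>x. 0)} < \<infinity>"
  shows "(\<integral>\<^sup>+ x. ennreal (norm (Bochner_Integration.simple_bochner_integral (lebesgue_on A) (\<lambda>s. S s x) - (\<integral>s. h s x \<partial>lebesgue_on A))) \<partial>lebesgue)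
     \<le> (\<integral>\<^sup>+ s. (\<integral>\<^sup>+ x. ennreal (norm (h s x - S s x)) \<partial>lebesgue) \<partial>lebesgue_on A)" (is "?lhs \<le> ?rhs")
    and "(\<lambda>s. \<integral>\<^sup>+ x. ennreal (norm (h s x - S s x)) \<partial>lebesgue) \<in> borel_measurable (lebesgue_on A)"
    and "(\<lambda>x. Bochner_Integration.simple_bochner_integral (lebesgue_on A) (\<lambda>s. S s x)) \<in> borel_measurable lebesgue"
    and "(\<lambda>x. \<integral>s. h s x \<partial>lebesgue_on A) \<in> borel_measurable lebesgue"
    and "(\<integral>\<^sup>+ x. ennreal (norm (\<integral>s. h s x \<partial>lebesgue_on A)) \<partial>lebesgue) < \<infinity>"
proof -
  let ?M = "lebesgue_on A" and ?L = "lebesgue :: (real ^ 'n) measure"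
  interpret M: sigma_finite_measure ?M using A by (intro sigma_finite_lebesgue_on) auto
  interpret L: sigma_finite_measure ?L by (rule sigma_finite_lebesgue)
  interpret P: pair_sigma_finite ?M ?L ..
  note hm[measurable] = lebesgue_pair_measurable[OF h, of A]
  have Sm[measurable]: "(\<lambda>z. S (fst z) (snd z)) \<in> borel_measurable (?M \<Otimes>\<^sub>M ?L)"
    by (rule simple_function_joint_measurable[OF S(1)]) (use S(2) in \<open>simp add: space_restrict_space\<close>)
  have hs: "(\<lambda>z. h (snd z) (fst z)) \<in> borel_measurable (?L \<Otimes>\<^sub>M ?M)"
    using measurable_compose[OF measurable_pair_swap' hm] by (simp add: case_prod_beta)
  have Ss: "(\<lambda>z. S (snd z) (fst z)) \<in> borel_measurable (?L \<Otimes>\<^sub>M ?M)"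
    using measurable_compose[OF measurable_pair_swap' Sm] by (simp add: case_prod_beta)
  have sx: "Bochner_Integration.simple_bochner_integrable ?M (\<lambda>s. S s x)" for x
  proof (rule simple_bochner_integrable.intros)
    show "simple_function ?M (\<lambda>s. S s x)" using simple_function_compose2[OF S(1) simple_function_const[of ?M x], of "\<lambda>f x. f x"] by simp
    have "emeasure ?M {s \<in> space ?M. S s x \<noteq> 0} \<le> emeasure ?M {s \<in> space ?M. S s \<noteq> (\<lambda>x. 0)}"
    proof (rule emeasure_mono)
      have "{s \<in> space ?M. S s \<noteq> (\<lambda>x. 0)} = space ?M - (S -` {\<lambda>x. 0} \<inter> space ?M)" by auto
      then show "{s \<in> space ?M. S s \<noteq> (\<lambda>x. 0)} \<in> sets ?M" using simple_functionD(2)[OF S(1)] by auto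
    qed auto
    then show "emeasure ?M {s \<in> space ?M. S s x \<noteq> 0} \<noteq> \<infinity>" using S(3) by (auto simp: top_unique)
  qed
  have sbi: "Bochner_Integration.simple_bochner_integral ?M (\<lambda>s. S s x) = (\<integral>s. S s x \<partial>?M)" "integrable ?M (\<lambda>s. S s x)" for x
    using has_bochner_integral_integral_eq[OF has_bochner_integral_simple_bochner_integrable[OF sx[of x]]]
      integrable.intros[OF has_bochner_integral_simple_bochner_integrable[OF sx[of x]]] by simp_all
  show hb: "(\<lambda>x. \<integral>s. h s x \<partial>?M) \<in> borel_measurable ?L" by (rule M.borel_measurable_lebesgue_integral) (use hs in \<open>simp add: case_prod_beta'\<close>)
  show sb: "(\<lambda>x. Bochner_Integration.simple_bochner_integral ?M (\<lambda>s. S s x)) \<in> borel_measurable ?L"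
    unfolding sbi(1) by (rule M.borel_measurable_lebesgue_integral) (use Ss in \<open>simp add: case_prod_beta'\<close>)
  show "(\<lambda>s. \<integral>\<^sup>+ x. ennreal (norm (h s x - S s x)) \<partial>?L) \<in> borel_measurable ?M"
  proof (rule L.borel_measurable_nn_integral)
    show "(\<lambda>(s, x). ennreal (norm (h s x - S s x))) \<in> borel_measurable (?M \<Otimes>\<^sub>M ?L)"
      using hm Sm unfolding case_prod_beta by measurable
  qed
  have fub: "(\<integral>\<^sup>+ x. (\<integral>\<^sup>+ s. ennreal (norm (h s x)) \<partial>?M) \<partial>?L) = (\<integral>\<^sup>+ s. (\<integral>\<^sup>+ x. ennreal (norm (h s x)) \<partial>?L) \<partial>?M)"
    by (rule P.Fubini') (use hm in \<open>unfold case_prod_beta, measurable\<close>)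
  have "AE x in ?L. (\<integral>\<^sup>+ s. ennreal (norm (h s x)) \<partial>?M) \<noteq> \<infinity>"
  proof (rule nn_integral_PInf_AE)
    show "(\<lambda>x. \<integral>\<^sup>+ s. ennreal (norm (h s x)) \<partial>?M) \<in> borel_measurable ?L"
      by (rule M.borel_measurable_nn_integral) (use hs in \<open>unfold case_prod_beta, measurable\<close>)
    show "(\<integral>\<^sup>+ x. (\<integral>\<^sup>+ s. ennreal (norm (h s x)) \<partial>?M) \<partial>?L) \<noteq> \<infinity>"
      using fin unfolding fub by auto
  qed
  then have hi: "AE x in ?L. integrable ?M (\<lambda>s. h s x)"
  proof eventually_elim
    case (elim x)
    have "(\<lambda>s. (s, x)) \<in> measurable ?M (?M \<Otimes>\<^sub>M ?L)" by (intro measurable_Pair) auto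
    from measurable_compose[OF this hm] have "(\<lambda>s. h s x) \<in> borel_measurable ?M" by simp
    then show ?case using elim by (auto simp: integrable_iff_bounded less_top)
  qed
  have "?lhs \<le> (\<integral>\<^sup>+ x. (\<integral>\<^sup>+ s. ennreal (norm (h s x - S s x)) \<partial>?M) \<partial>?L)"
  proof (rule nn_integral_mono_AE)
    show "AE x in ?L. ennreal (norm (Bochner_Integration.simple_bochner_integral ?M (\<lambda>s. S s x) - (\<integral>s. h s x \<partial>?M))) \<le> (\<integral>\<^sup>+ s. ennreal (norm (h s x - S s x)) \<partial>?M)"
      using hi
    proof eventually_elim
      case (elim x)
      have "Bochner_Integration.simple_bochner_integral ?M (\<lambda>s. S s x) - (\<integral>s. h s x \<partial>?M) = (\<integral>s. S s x - h s x \<partial>?M)"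
        unfolding sbi(1) by (rule Bochner_Integration.integral_diff[OF sbi(2) elim, symmetric])
      also have "ennreal (norm \<dots>) \<le> (\<integral>\<^sup>+ s. ennreal (norm (S s x - h s x)) \<partial>?M)"
        by (rule integral_norm_bound_ennreal) (use sbi(2) elim in auto)
      finally show ?case by (simp add: norm_minus_commute)
    qed
  qed
  also have "\<dots> = ?rhs"
    by (rule P.Fubini') (use hm Sm in \<open>unfold case_prod_beta, measurable\<close>)
  finally show "?lhs \<le> ?rhs" .
  have "(\<integral>\<^sup>+ x. ennreal (norm (\<integral>s. h s x \<partial>?M)) \<partial>?L) \<le> (\<integral>\<^sup>+ x. (\<integral>\<^sup>+ s. ennreal (norm (h s x)) \<partial>?M) \<partial>?L)"
  proof (rule nn_integral_mono_AE)
    show "AE x in ?L. ennreal (norm (\<integral>s. h s x \<partial>?M)) \<le> (\<integral>\<^sup>+ s. ennreal (norm (h s x)) \<partial>?M)"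
      using hi by eventually_elim (rule integral_norm_bound_ennreal)
  qed
  then show "(\<integral>\<^sup>+ x. ennreal (norm (\<integral>s. h s x \<partial>?M)) \<partial>?L) < \<infinity>" using fin unfolding fub by (rule order_le_less_trans)
qed

text \<open>Makes an abstract Bochner integral computable. The simple integrals tend to I by
  definition and, by \<open>simple_bochner_distance\<close>, to the pointwise integral of h in L^1.
  As N only has to dominate the L^1 norm, this applies both to L^1 and to its intersection with
  L^\<infinity>.\<close>

lemma has_bochner_integral_in_pointwise:
  fixes h :: "real \<Rightarrow> real ^ 'n::finite \<Rightarrow> complex"
  assumes B: "has_bochner_integral_in E N (lebesgue_on A) F I"
    and E: "E \<subseteq> Lq 1" and N: "\<And>\<phi>. lq_norm 1 \<phi> \<le> N \<phi>"
    and A: "A \<in> sets borel"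
    and h: "(\<lambda>z. h (fst z) (snd z)) \<in> borel_measurable (lborel \<Otimes>\<^sub>M lborel)"
    and fin: "(\<integral>\<^sup>+ s. (\<integral>\<^sup>+ x. ennreal (norm (h s x)) \<partial>lebesgue) \<partial>lebesgue_on A) < \<infinity>"
    and F: "AE s in lebesgue_on A. AE x in lebesgue. F s x = h s x"
  shows "AE x in lebesgue. I x = (\<integral>s. h s x \<partial>lebesgue_on A)"
proof -
  let ?M = "lebesgue_on A" and ?L = "lebesgue :: (real ^ 'n) measure"
  from B[unfolded has_bochner_integral_in_def]
  obtain S where S': "\<forall>k. simple_function ?M (S k) \<and> (\<forall>s\<in>space ?M. S k s \<in> E) \<and> emeasure ?M {s \<in> space ?M. S k s \<noteq> (\<lambda>x. 0)} < \<infinity>"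
    and l1: "(\<lambda>k. \<integral>\<^sup>+ s. N (\<lambda>x. F s x - S k s x) \<partial>?M) \<longlonglongrightarrow> 0"
    and l2: "(\<lambda>k. N (\<lambda>x. Bochner_Integration.simple_bochner_integral ?M (\<lambda>s. S k s x) - I x)) \<longlonglongrightarrow> 0"
    and I: "I \<in> E"
    by (elim conjE exE)
  have S: "simple_function ?M (S k)" "\<forall>s\<in>space ?M. S k s \<in> E" "emeasure ?M {s \<in> space ?M. S k s \<noteq> (\<lambda>x. 0)} < \<infinity>" for k
    using S'[THEN spec, of k] by - (elim conjE, assumption)+
  have Sk: "\<forall>s\<in>A. S k s \<in> borel_measurable ?L" for k
    using S(2) E by (auto simp: space_restrict_space intro!: Lq_measurable)
  note sb = simple_bochner_distance[OF A h fin S(1) Sk S(3)]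
  let ?H = "\<lambda>x. \<integral>s. h s x \<partial>?M"
  let ?s = "\<lambda>k x. Bochner_Integration.simple_bochner_integral ?M (\<lambda>s. S k s x)"
  have Im: "I \<in> borel_measurable ?L" using I E by (auto intro!: Lq_measurable)
  have "(\<integral>\<^sup>+ x. ennreal (norm (I x - ?H x)) \<partial>?L) \<le> N (\<lambda>x. ?s k x - I x) + (\<integral>\<^sup>+ s. N (\<lambda>x. F s x - S k s x) \<partial>?M)" for k
  proof -
    have "(\<integral>\<^sup>+ x. ennreal (norm (I x - ?H x)) \<partial>?L) \<le> (\<integral>\<^sup>+ x. ennreal (norm (?s k x - I x)) + ennreal (norm (?s k x - ?H x)) \<partial>?L)"
    proof (intro nn_integral_mono)
      fix x show "ennreal (norm (I x - ?H x)) \<le> ennreal (norm (?s k x - I x)) + ennreal (norm (?s k x - ?H x))"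
        using norm_triangle_ineq[of "I x - ?s k x" "?s k x - ?H x"] by (simp add: norm_minus_commute ennreal_plus[symmetric] del: ennreal_plus)
    qed
    also have "\<dots> = (\<integral>\<^sup>+ x. ennreal (norm (?s k x - I x)) \<partial>?L) + (\<integral>\<^sup>+ x. ennreal (norm (?s k x - ?H x)) \<partial>?L)"
      by (intro nn_integral_add ennreal_norm_diff_measurable sb(3)[of k] sb(4) Im)
    also have "\<dots> \<le> N (\<lambda>x. ?s k x - I x) + (\<integral>\<^sup>+ s. N (\<lambda>x. F s x - S k s x) \<partial>?M)"
    proof (rule add_mono)
      show "(\<integral>\<^sup>+ x. ennreal (norm (?s k x - I x)) \<partial>?L) \<le> N (\<lambda>x. ?s k x - I x)"
        using N[of "\<lambda>x. ?s k x - I x"] unfolding lq_norm_1 .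
      have "(\<integral>\<^sup>+ x. ennreal (norm (?s k x - ?H x)) \<partial>?L) \<le> (\<integral>\<^sup>+ s. (\<integral>\<^sup>+ x. ennreal (norm (h s x - S k s x)) \<partial>?L) \<partial>?M)" by (rule sb(1))
      also have "\<dots> \<le> (\<integral>\<^sup>+ s. N (\<lambda>x. F s x - S k s x) \<partial>?M)"
      proof (rule nn_integral_mono_AE)
        show "AE s in ?M. (\<integral>\<^sup>+ x. ennreal (norm (h s x - S k s x)) \<partial>?L) \<le> N (\<lambda>x. F s x - S k s x)"
          using F
        proof eventually_elim
          case (elim s)
          then have "(\<integral>\<^sup>+ x. ennreal (norm (h s x - S k s x)) \<partial>?L) = (\<integral>\<^sup>+ x. ennreal (norm (F s x - S k s x)) \<partial>?L)"
            by (intro nn_integral_cong_AE) auto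
          also have "\<dots> \<le> N (\<lambda>x. F s x - S k s x)" using N unfolding lq_norm_1 .
          finally show ?case .
        qed
      qed
      finally show "(\<integral>\<^sup>+ x. ennreal (norm (?s k x - ?H x)) \<partial>?L) \<le> (\<integral>\<^sup>+ s. N (\<lambda>x. F s x - S k s x) \<partial>?M)" .
    qed
    finally show ?thesis .
  qed
  moreover have "(\<lambda>k. N (\<lambda>x. ?s k x - I x) + (\<integral>\<^sup>+ s. N (\<lambda>x. F s x - S k s x) \<partial>?M)) \<longlonglongrightarrow> 0 + 0"
    by (intro tendsto_add l1 l2)
  ultimately have "(\<integral>\<^sup>+ x. ennreal (norm (I x - ?H x)) \<partial>?L) \<le> 0"
    by (intro LIMSEQ_le_const[of _ 0]) auto
  then have "(\<integral>\<^sup>+ x. ennreal (norm (I x - ?H x)) \<partial>?L) = 0" by simp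
  with nn_integral_0_iff_AE[OF ennreal_norm_diff_measurable[OF Im sb(4)]]
  have "AE x in ?L. ennreal (norm (I x - ?H x)) = 0" by (rule iffD1)
  then show ?thesis by eventually_elim simp
qed


section \<open>Existence of Bochner integrals in L^1\<close>

lemma lq_norm_1_zero: "lq_norm 1 (\<lambda>x. 0) = 0"
  by (simp add: lq_norm_1)

lemma lq_norm_minus_commute: "lq_norm q (\<lambda>x. a x - b x) = lq_norm q (\<lambda>x. b x - a x)"
  by (simp add: lq_norm_def norm_minus_commute)

lemma lq_norm_1_diff_le:
  assumes "a \<in> borel_measurable lebesgue" "b \<in> borel_measurable lebesgue"
  shows "lq_norm 1 (\<lambda>x. a x - b x) \<le> lq_norm 1 a + lq_norm 1 b"
proof -
  have "lq_norm 1 (\<lambda>x. a x - b x) \<le> (\<integral>\<^sup>+ x. ennreal (norm (a x)) + ennreal (norm (b x)) \<partial>lebesgue)"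
    unfolding lq_norm_1
    by (intro nn_integral_mono) (simp add: norm_triangle_ineq4 ennreal_plus[symmetric] del: ennreal_plus)
  also have "\<dots> = lq_norm 1 a + lq_norm 1 b" unfolding lq_norm_1 using assms by (intro nn_integral_add) auto
  finally show ?thesis .
qed

text \<open>The approximating simple functions sample \<open>F\<close> at the grid points to the right, so that the
  decreasing bound \<open>b\<close> dominates them.\<close>

lemma has_bochner_integral_in_L1_exists:
  fixes h :: "real \<Rightarrow> real ^ 'n::finite \<Rightarrow> complex" and b :: "real \<Rightarrow> ennreal"
  assumes h: "(\<lambda>z. h (fst z) (snd z)) \<in> borel_measurable (lborel \<Otimes>\<^sub>M lborel)"
    and F: "\<And>s. s > 0 \<Longrightarrow> AE x in lebesgue. F s x = h s x"
    and L1: "\<And>s. s > 0 \<Longrightarrow> F s \<in> Lq 1"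
    and cont: "\<And>s. s > 0 \<Longrightarrow> ((\<lambda>r. lq_norm 1 (\<lambda>x. F r x - F s x)) \<longlongrightarrow> 0) (at s)"
    and bound: "\<And>s. s > 0 \<Longrightarrow> lq_norm 1 (F s) \<le> b s"
    and anti: "\<And>r s. 0 < r \<Longrightarrow> r \<le> s \<Longrightarrow> b s \<le> b r"
    and bm: "b \<in> borel_measurable borel"
    and bfin: "(\<integral>\<^sup>+ s. b s \<partial>lebesgue_on {0..}) < \<infinity>"
  shows "has_bochner_integral_in (Lq 1) (lq_norm 1) (lebesgue_on {0..}) F (\<lambda>x. \<integral>s. h s x \<partial>lebesgue_on {0..})"
proof -
  let ?M = "lebesgue_on {0::real..}" and ?L = "lebesgue :: (real ^ 'n) measure"
  have pos: "AE s in ?M. s > 0"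
  proof -
    have "AE s in lebesgue. s \<noteq> (0::real)" using AE_completion[OF AE_lborel_singleton[of 0]] .
    then have "AE s in ?M. s \<noteq> 0" by (subst AE_restrict_space_iff) auto
    moreover have "AE s in ?M. s \<in> {0..}" by (rule AE_I2) (simp add: space_restrict_space)
    ultimately show ?thesis by eventually_elim auto
  qed
  have hn: "(\<integral>\<^sup>+ x. ennreal (norm (h s x)) \<partial>?L) = lq_norm 1 (F s)" if "s > 0" for s
    unfolding lq_norm_1 using F[OF that] by (intro nn_integral_cong_AE) auto
  have fin: "(\<integral>\<^sup>+ s. (\<integral>\<^sup>+ x. ennreal (norm (h s x)) \<partial>?L) \<partial>?M) < \<infinity>"
  proof -
    have "(\<integral>\<^sup>+ s. (\<integral>\<^sup>+ x. ennreal (norm (h s x)) \<partial>?L) \<partial>?M) \<le> (\<integral>\<^sup>+ s. b s \<partial>?M)"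
    proof (rule nn_integral_mono_AE)
      show "AE s in ?M. (\<integral>\<^sup>+ x. ennreal (norm (h s x)) \<partial>?L) \<le> b s"
        using pos by eventually_elim (simp add: hn bound)
    qed
    then show ?thesis using bfin by (rule order_le_less_trans)
  qed
  \<comment> \<open>For s in (0, k+1] this is the right end of the cell of width 1/(k+1) containing
    s. The value 0 elsewhere is a code that \<open>G\<close> sends to the zero function.\<close>
  define c where "c k s = (if 0 < s \<and> s \<le> real (Suc k) then of_int \<lceil>s * real (Suc k)\<rceil> / real (Suc k) else 0)" for k and s :: real
  define G where "G s = (if s > 0 then F s else (\<lambda>x. 0))" for s
  define S where "S k s = G (c k s)" for k s
  have c_ge: "s \<le> c k s" if "0 < s" "s \<le> real (Suc k)" for k s
    using that le_of_int_ceiling[of "s * real (Suc k)"] unfolding c_def by (simp add: field_simps del: of_nat_Suc)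
  have c_le: "c k s \<le> s + 1 / real (Suc k)" if "0 < s" "s \<le> real (Suc k)" for k s
    using that of_int_ceiling_le_add_one[of "s * real (Suc k)"] unfolding c_def by (simp add: field_simps del: of_nat_Suc)
  have S0: "S k s = (\<lambda>x. 0)" if "\<not> (0 < s \<and> s \<le> real (Suc k))" for k s
    unfolding S_def G_def c_def if_not_P[OF that] by simp
  have SF: "S k s = F (c k s)" "c k s > 0" if "0 < s" "s \<le> real (Suc k)" for k s
    unfolding S_def G_def using c_ge[OF that] that by auto
  have G_L1: "G s \<in> Lq 1" for s using L1[of s] by (auto simp: G_def Lq_def lq_norm_1_zero)
  have sf: "simple_function ?M (S k)" for k
    unfolding S_def
  proof (rule simple_function_compose1[where g=G])
    have "c k ` space ?M \<subseteq> (\<lambda>i. real i / real (Suc k)) ` {..Suc k * Suc k}"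
    proof (rule image_subsetI)
      fix s assume "s \<in> space ?M"
      show "c k s \<in> (\<lambda>i. real i / real (Suc k)) ` {..Suc k * Suc k}"
      proof (cases "0 < s \<and> s \<le> real (Suc k)")
        case True
        have "s * real (Suc k) \<le> real (Suc k) * real (Suc k)" using True by (intro mult_right_mono) auto
        then have "\<lceil>s * real (Suc k)\<rceil> \<le> int (Suc k * Suc k)" by (intro ceiling_le) (simp only: of_int_of_nat_eq of_nat_mult of_int_mult)
        moreover have "0 < s * real (Suc k)" using True by (intro mult_pos_pos) auto
        then have "\<lceil>s * real (Suc k)\<rceil> \<ge> 0" by linarith
        ultimately have "nat \<lceil>s * real (Suc k)\<rceil> \<in> {..Suc k * Suc k}" "c k s = real (nat \<lceil>s * real (Suc k)\<rceil>) / real (Suc k)"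
          unfolding c_def if_P[OF True] atMost_iff nat_le_iff by - (assumption, simp only: of_nat_nat)
        then show ?thesis by blast
      next
        case False
        then have "c k s = 0" unfolding c_def by auto
        then show ?thesis by (intro image_eqI[of _ _ 0]) auto
      qed
    qed
    then have "finite (c k ` space ?M)" by (rule finite_subset) simp
    moreover have "c k \<in> borel_measurable ?M"
    proof -
      have "c k \<in> borel_measurable borel" unfolding c_def by measurable
      then show ?thesis by (intro measurable_restrict_space1 measurable_completion) simp
    qed
    ultimately show "simple_function ?M (c k)" by (intro simple_function_borel_measurable)
  qed
  have Sm: "\<forall>s\<in>{0..}. S k s \<in> borel_measurable ?L" for k
    using Lq_measurable[OF G_L1] unfolding S_def by blast
  have Sfin: "emeasure ?M {s \<in> space ?M. S k s \<noteq> (\<lambda>x. 0)} < \<infinity>" for k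
  proof -
    have "emeasure ?M {s \<in> space ?M. S k s \<noteq> (\<lambda>x. 0)} \<le> emeasure ?M {0..real (Suc k)}"
    proof (rule emeasure_mono)
      show "{s \<in> space ?M. S k s \<noteq> (\<lambda>x. 0)} \<subseteq> {0..real (Suc k)}" using S0[of _ k] by fastforce
      show "{0..real (Suc k)} \<in> sets ?M" by (subst sets_restrict_space_iff) auto
    qed
    also have "\<dots> = emeasure lebesgue {0..real (Suc k)}" by (subst emeasure_restrict_space) auto
    also have "\<dots> < \<infinity>" by simp
    finally show ?thesis .
  qed
  note sb = simple_bochner_distance[OF _ h fin sf Sm Sfin, simplified]
  let ?e = "\<lambda>k s. lq_norm 1 (\<lambda>x. F s x - S k s x)"
  have hS: "(\<integral>\<^sup>+ x. ennreal (norm (h s x - S k s x)) \<partial>?L) = ?e k s" if "s > 0" for k s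
    unfolding lq_norm_1 using F[OF that] by (intro nn_integral_cong_AE) auto
  have conv: "(\<lambda>k. ?e k s) \<longlonglongrightarrow> 0" if s: "s > 0" for s
  proof -
    have "(\<lambda>k. c k s) \<longlonglongrightarrow> s"
    proof (rule tendsto_sandwich[of "\<lambda>_. s" _ _ "\<lambda>k. s + 1 / real (Suc k)"])
      have ev: "\<forall>\<^sub>F k in sequentially. s \<le> real (Suc k)"
        using eventually_ge_at_top[of "nat \<lceil>s\<rceil>"] by eventually_elim linarith
      show "\<forall>\<^sub>F k in sequentially. s \<le> c k s" using ev by eventually_elim (rule c_ge[OF s])
      show "\<forall>\<^sub>F k in sequentially. c k s \<le> s + 1 / real (Suc k)" using ev by eventually_elim (rule c_le[OF s])
      show "(\<lambda>k. s + 1 / real (Suc k)) \<longlonglongrightarrow> s" using tendsto_add[OF tendsto_const[of s] LIMSEQ_inverse_real_of_nat] by (simp add: divide_inverse)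
    qed simp
    moreover have "((\<lambda>r. lq_norm 1 (\<lambda>x. F r x - F s x)) \<longlongrightarrow> 0) (nhds s)"
      using cont[OF s] tendsto_at_iff_tendsto_nhds[of "\<lambda>r. lq_norm 1 (\<lambda>x. F r x - F s x)" s] by (simp add: lq_norm_1_zero)
    ultimately have "(\<lambda>k. lq_norm 1 (\<lambda>x. F (c k s) x - F s x)) \<longlonglongrightarrow> 0" by (rule filterlim_compose[rotated])
    moreover have "\<forall>\<^sub>F k in sequentially. lq_norm 1 (\<lambda>x. F (c k s) x - F s x) = ?e k s"
      using eventually_ge_at_top[of "nat \<lceil>s\<rceil>"]
    proof eventually_elim
      case (elim k)
      then have "s \<le> real (Suc k)" by linarith
      then show ?case using SF(1)[OF s] by (simp add: lq_norm_minus_commute del: of_nat_Suc)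
    qed
    ultimately show ?thesis by (rule Lim_transform_eventually)
  qed
  \<comment> \<open>As \<open>c k s\<close> \<ge> s inside the grid and b is decreasing, the single
    bound 2 b s serves all k.\<close>
  have dom: "?e k s \<le> 2 * b s" if s: "s > 0" for k s
  proof -
    have "?e k s \<le> lq_norm 1 (F s) + lq_norm 1 (S k s)"
      unfolding S_def by (intro lq_norm_1_diff_le Lq_measurable[OF L1[OF s]] Lq_measurable[OF G_L1])
    also have "\<dots> \<le> b s + b s"
    proof (rule add_mono[OF bound[OF s]])
      show "lq_norm 1 (S k s) \<le> b s"
      proof (cases "s \<le> real (Suc k)")
        case True
        have "lq_norm 1 (S k s) \<le> b (c k s)" unfolding SF(1)[OF s True] by (rule bound[OF SF(2)[OF s True]])
        also have "\<dots> \<le> b s" by (rule anti[OF s c_ge[OF s True]])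
        finally show ?thesis .
      next
        case False
        then show ?thesis using S0[of s k] by (simp add: lq_norm_1_zero del: of_nat_Suc)
      qed
    qed
    also have "\<dots> = 2 * b s" by (simp add: mult_2)
    finally show ?thesis .
  qed
  have int0: "(\<lambda>k. \<integral>\<^sup>+ s. (\<integral>\<^sup>+ x. ennreal (norm (h s x - S k s x)) \<partial>?L) \<partial>?M) \<longlonglongrightarrow> (\<integral>\<^sup>+ s. 0 \<partial>?M)"
  proof (rule nn_integral_dominated_convergence[where w="\<lambda>s. 2 * b s"])
    show "(\<lambda>s. \<integral>\<^sup>+ x. ennreal (norm (h s x - S k s x)) \<partial>?L) \<in> borel_measurable ?M" for k by (rule sb(2))
    show bm': "(\<lambda>s. 2 * b s) \<in> borel_measurable ?M"
    proof -
      have "(\<lambda>s. 2 * b s) \<in> borel_measurable lborel" using bm by simp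
      then show ?thesis by (intro measurable_restrict_space1 measurable_completion)
    qed
    show "AE s in ?M. (\<integral>\<^sup>+ x. ennreal (norm (h s x - S k s x)) \<partial>?L) \<le> 2 * b s" for k
      using pos by eventually_elim (simp add: hS dom)
    have "(\<integral>\<^sup>+ s. 2 * b s \<partial>?M) = 2 * (\<integral>\<^sup>+ s. b s \<partial>?M)"
    proof (rule nn_integral_cmult)
      have "b \<in> borel_measurable lborel" using bm by simp
      then show "b \<in> borel_measurable ?M" by (intro measurable_restrict_space1 measurable_completion)
    qed
    also have "\<dots> < \<infinity>" using bfin by (simp add: ennreal_mult_less_top)
    finally show "(\<integral>\<^sup>+ s. 2 * b s \<partial>?M) < \<infinity>" .
    show "AE s in ?M. (\<lambda>k. \<integral>\<^sup>+ x. ennreal (norm (h s x - S k s x)) \<partial>?L) \<longlonglongrightarrow> 0"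
      using pos by eventually_elim (simp add: hS conv)
  qed auto
  have eq: "(\<integral>\<^sup>+ s. ?e k s \<partial>?M) = (\<integral>\<^sup>+ s. (\<integral>\<^sup>+ x. ennreal (norm (h s x - S k s x)) \<partial>?L) \<partial>?M)" for k
    by (rule nn_integral_cong_AE) (use pos in eventually_elim, simp add: hS)
  show ?thesis
    unfolding has_bochner_integral_in_def
  proof (intro conjI exI[of _ S] allI)
    show "(\<lambda>x. \<integral>s. h s x \<partial>?M) \<in> Lq 1" unfolding Lq_def using sb(4,5) by (simp add: lq_norm_1)
    show "AE s in ?M. F s \<in> Lq 1" using pos by eventually_elim (rule L1)
    show "simple_function ?M (S k)" for k by (rule sf)
    show "\<forall>s\<in>space ?M. S k s \<in> Lq 1" for k unfolding S_def using G_L1 by blast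
    show "emeasure ?M {s \<in> space ?M. S k s \<noteq> (\<lambda>x. 0)} < \<infinity>" for k by (rule Sfin)
    show "AE s in ?M. (\<lambda>k. ?e k s) \<longlonglongrightarrow> 0" using pos by eventually_elim (rule conv)
    show "(\<lambda>k. \<integral>\<^sup>+ s. ?e k s \<partial>?M) \<longlonglongrightarrow> 0" unfolding eq using int0 by simp
    show "(\<lambda>k. lq_norm 1 (\<lambda>x. Bochner_Integration.simple_bochner_integral ?M (\<lambda>s. S k s x) - (\<integral>s. h s x \<partial>?M))) \<longlonglongrightarrow> 0"
    proof (rule tendsto_sandwich[OF _ _ tendsto_const])
      show "\<forall>\<^sub>F k in sequentially. lq_norm 1 (\<lambda>x. Bochner_Integration.simple_bochner_integral ?M (\<lambda>s. S k s x) - (\<integral>s. h s x \<partial>?M)) \<le> (\<integral>\<^sup>+ s. (\<integral>\<^sup>+ x. ennreal (norm (h s x - S k s x)) \<partial>?L) \<partial>?M)"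
        unfolding lq_norm_1 using sb(1) by (intro always_eventually allI)
      show "(\<lambda>k. \<integral>\<^sup>+ s. (\<integral>\<^sup>+ x. ennreal (norm (h s x - S k s x)) \<partial>?L) \<partial>?M) \<longlonglongrightarrow> 0" using int0 by simp
    qed auto
  qed
qed

section \<open>Integral bounds for the remainder\<close>

text \<open>The integrand is a multiple of the normal density with variance t/(2c), with a factor
  that does not depend on t.\<close>

lemma nn_integral_gauss1:
  assumes "c > 0" "t > 0"
  shows "(\<integral>\<^sup>+ y. ennreal (t powr (- (1 / 2)) * exp (- c * y\<^sup>2 / t)) \<partial>lborel) = ennreal (sqrt (pi / c))"
proof -
  define \<sigma> where "\<sigma> = sqrt (t / (2 * c))"
  have s: "\<sigma> > 0" "\<sigma>\<^sup>2 = t / (2 * c)" using assms by (simp_all add: \<sigma>_def)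
  interpret N: prob_space "density lborel (normal_density 0 \<sigma>)" by (rule prob_space_normal_density[OF s(1)])
  have 1: "(\<integral>\<^sup>+ y. ennreal (normal_density 0 \<sigma> y) \<partial>lborel) = 1"
    using N.emeasure_space_1 by (simp add: emeasure_density)
  have "t powr (- (1 / 2)) * exp (- c * y\<^sup>2 / t) = sqrt (pi / c) * normal_density 0 \<sigma> y" for y
  proof -
    have "sqrt (2 * pi * (t / (2 * c))) = sqrt (pi / c) * sqrt t" using assms by (simp add: real_sqrt_mult[symmetric])
    moreover have "t powr (- (1 / 2)) = 1 / sqrt t" using assms by (simp add: powr_minus_divide powr_half_sqrt)
    moreover have "- (y - 0)\<^sup>2 / (2 * (t / (2 * c))) = - c * y\<^sup>2 / t" using assms by (simp add: field_simps)
    ultimately show ?thesis unfolding normal_density_def s(2) using assms by simp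
  qed
  then have "(\<integral>\<^sup>+ y. ennreal (t powr (- (1 / 2)) * exp (- c * y\<^sup>2 / t)) \<partial>lborel) = (\<integral>\<^sup>+ y. ennreal (sqrt (pi / c)) * ennreal (normal_density 0 \<sigma> y) \<partial>lborel)"
    using assms by (simp add: ennreal_mult)
  also have "\<dots> = ennreal (sqrt (pi / c))" by (subst nn_integral_cmult) (simp_all add: 1)
  finally show ?thesis .
qed

lemma nn_integral_gauss_bound:
  assumes "c > 0" "t > 0"
  shows "(\<integral>\<^sup>+ x. ennreal (gauss_bound c t (x :: real ^ 'n::finite)) \<partial>lborel) = ennreal (sqrt (pi / c) ^ CARD('n))"
proof -
  have "gauss_bound c t x = (\<Prod>b\<in>Basis. t powr (- (1 / 2)) * exp (- c * (x \<bullet> b)\<^sup>2 / t))" for x :: "real ^ 'n"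
  proof -
    have "(norm x)\<^sup>2 = (\<Sum>b\<in>Basis. (x \<bullet> b)\<^sup>2)" unfolding power2_norm_eq_inner by (subst euclidean_inner) (simp add: power2_eq_square)
    then have "exp (- c * (norm x)\<^sup>2 / t) = (\<Prod>b\<in>Basis. exp (- c * (x \<bullet> b)\<^sup>2 / t))"
      by (simp add: exp_sum[symmetric] sum_divide_distrib sum_distrib_left sum_negf)
    moreover have "t powr (- (real CARD('n) / 2)) = (\<Prod>b\<in>(Basis :: (real ^ 'n) set). t powr (- (1 / 2)))"
      using assms by (simp add: powr_power)
    ultimately show ?thesis unfolding gauss_bound_def by (simp only: prod.distrib)
  qed
  then have "(\<integral>\<^sup>+ x. ennreal (gauss_bound c t x) \<partial>(lborel :: (real ^ 'n) measure)) = (\<integral>\<^sup>+ x. (\<Prod>b\<in>Basis. ennreal (t powr (- (1 / 2)) * exp (- c * (x \<bullet> b)\<^sup>2 / t))) \<partial>(lborel :: (real ^ 'n) measure))"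
    by (simp add: prod_ennreal)
  also have "\<dots> = (\<Prod>b\<in>(Basis :: (real ^ 'n) set). \<integral>\<^sup>+ y. ennreal (t powr (- (1 / 2)) * exp (- c * y\<^sup>2 / t)) \<partial>lborel)"
    by (rule nn_integral_lborel_prod) auto
  also have "\<dots> = ennreal (sqrt (pi / c) ^ CARD('n))"
    unfolding nn_integral_gauss1[OF assms] using assms by (simp add: ennreal_power)
  finally show ?thesis .
qed

lemma nn_integral_lborel_translate:
  fixes f :: "'a::euclidean_space \<Rightarrow> ennreal"
  assumes "f \<in> borel_measurable borel"
  shows "(\<integral>\<^sup>+ x. f (x - a) \<partial>lborel) = (\<integral>\<^sup>+ x. f x \<partial>lborel)"
proof -
  have "(\<integral>\<^sup>+ x. f x \<partial>lborel) = (\<integral>\<^sup>+ x. f x \<partial>distr lborel borel ((+) (- a)))" by (simp only: lborel_distr_plus)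
  also have "\<dots> = (\<integral>\<^sup>+ x. f (- a + x) \<partial>lborel)" by (rule nn_integral_distr) (use assms in auto)
  finally show ?thesis by simp
qed

lemma gauss_bound_measurable[measurable]: "gauss_bound c t \<in> borel_measurable borel"
  unfolding gauss_bound_def[abs_def] by measurable

lemma nn_integral_gauss_bound_shift:
  assumes "c > 0" "t > 0"
  shows "(\<integral>\<^sup>+ x. ennreal (gauss_bound c t (x - y :: real ^ 'n::finite)) \<partial>lborel) = ennreal (sqrt (pi / c) ^ CARD('n))"
    "(\<integral>\<^sup>+ x. ennreal (gauss_bound c t (y - x :: real ^ 'n::finite)) \<partial>lborel) = ennreal (sqrt (pi / c) ^ CARD('n))"
proof -
  show 1: "(\<integral>\<^sup>+ x. ennreal (gauss_bound c t (x - y :: real ^ 'n::finite)) \<partial>lborel) = ennreal (sqrt (pi / c) ^ CARD('n))" for y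
    using nn_integral_lborel_translate[of "\<lambda>x. ennreal (gauss_bound c t x)" y] nn_integral_gauss_bound[OF assms] by simp
  have "gauss_bound c t (y - x) = gauss_bound c t (x - y)" for x by (simp add: gauss_bound_def norm_minus_commute)
  then show "(\<integral>\<^sup>+ x. ennreal (gauss_bound c t (y - x :: real ^ 'n::finite)) \<partial>lborel) = ennreal (sqrt (pi / c) ^ CARD('n))" using 1[of y] by simp
qed

lemma heat_kernel_bound:
  assumes "Re \<nu> > 0"
  shows "\<exists>C>0. \<forall>t. \<forall>x :: real ^ 'n::finite. norm (heat_kernel \<nu> t x) \<le> (if t > 0 then C * gauss_bound (gauss_rate \<nu>) t x else 0)"
proof -
  obtain C where "C > 0" "\<forall>t>0. \<forall>x :: real ^ 'n. norm (heat_deriv \<nu> (\<lambda>i. 0) t x) \<le> C * t powr (- (real (mdeg (\<lambda>i :: 'n. 0)) / 2)) * gauss_bound (gauss_rate \<nu>) t x"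
    using heat_deriv_bound[OF assms, of "\<lambda>i::'n. 0"] by blast
  then show ?thesis by (intro exI[of _ C]) (auto simp: heat_kernel_def mdeg_def)
qed

text \<open>The mass of \<open>gauss_bound\<close> is independent of t, so one constant works for
  all times. Both orientations are recorded: x - y for Fubini in x, and y - x for pointwise bounds
  of a convolution.\<close>

lemma nn_integral_heat_kernel:
  assumes "Re \<nu> > 0"
  shows "\<exists>C\<ge>0. \<forall>t. \<forall>y :: real ^ 'n::finite. (\<integral>\<^sup>+ x. ennreal (norm (heat_kernel \<nu> t (x - y))) \<partial>lborel) \<le> ennreal C \<and>
     (\<integral>\<^sup>+ x. ennreal (norm (heat_kernel \<nu> t (y - x))) \<partial>lborel) \<le> ennreal C"
proof -
  obtain C where C: "C > 0" "\<forall>t. \<forall>x :: real ^ 'n. norm (heat_kernel \<nu> t x) \<le> (if t > 0 then C * gauss_bound (gauss_rate \<nu>) t x else 0)"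
    using heat_kernel_bound[OF assms, where 'n='n] by blast
  define D where "D = C * sqrt (pi / gauss_rate \<nu>) ^ CARD('n)"
  have h: "gauss_rate \<nu> > 0" by (rule gauss_rate_pos[OF assms])
  have "(\<integral>\<^sup>+ x. ennreal (norm (heat_kernel \<nu> t (x - y))) \<partial>lborel) \<le> ennreal D \<and>
     (\<integral>\<^sup>+ x. ennreal (norm (heat_kernel \<nu> t (y - x))) \<partial>lborel) \<le> ennreal D" for t and y :: "real ^ 'n"
  proof (cases "t > 0")
    case True
    have b: "ennreal (norm (heat_kernel \<nu> t x)) \<le> ennreal C * ennreal (gauss_bound (gauss_rate \<nu>) t x)" for x :: "real ^ 'n"
      using C(2)[rule_format, of t x] True C(1) by (simp add: ennreal_mult''[symmetric] gauss_bound_nonneg ennreal_leI)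
    have "(\<integral>\<^sup>+ x. ennreal (norm (heat_kernel \<nu> t (x - y))) \<partial>lborel) \<le> (\<integral>\<^sup>+ x. ennreal C * ennreal (gauss_bound (gauss_rate \<nu>) t (x - y)) \<partial>lborel)"
      by (intro nn_integral_mono b)
    also have "\<dots> = ennreal D" unfolding D_def
      by (subst nn_integral_cmult) (use C(1) h True in \<open>auto simp: nn_integral_gauss_bound_shift ennreal_mult\<close>)
    finally have 1: "(\<integral>\<^sup>+ x. ennreal (norm (heat_kernel \<nu> t (x - y))) \<partial>lborel) \<le> ennreal D" .
    have "(\<integral>\<^sup>+ x. ennreal (norm (heat_kernel \<nu> t (y - x))) \<partial>lborel) \<le> (\<integral>\<^sup>+ x. ennreal C * ennreal (gauss_bound (gauss_rate \<nu>) t (y - x)) \<partial>lborel)"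
      by (intro nn_integral_mono b)
    also have "\<dots> = ennreal D" unfolding D_def
      by (subst nn_integral_cmult) (use C(1) h True in \<open>auto simp: nn_integral_gauss_bound_shift ennreal_mult\<close>)
    finally show ?thesis using 1 by blast
  next
    case False
    then show ?thesis by (simp add: heat_kernel_def)
  qed
  moreover have "D \<ge> 0" using C(1) h by (simp add: D_def)
  ultimately show ?thesis by blast
qed

lemma gauss_bound_le: "c > 0 \<Longrightarrow> t > 0 \<Longrightarrow> gauss_bound c t (x :: real ^ 'n::finite) \<le> t powr (- (real CARD('n) / 2))"
  unfolding gauss_bound_def by (simp add: mult_le_cancel_left1)

lemma herm_gauss_continuous:
  assumes "\<nu> \<noteq> 0"
  shows "continuous_on UNIV (herm_gauss \<nu> N)"
  using has_vector_derivative_herm_gauss[OF assms] by (auto intro!: continuous_at_imp_continuous_on has_vector_derivative_continuous)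

lemma vec_nth_measurable[measurable]: "(\<lambda>x :: real ^ 'n::finite. x $ i) \<in> borel_measurable borel"
  by (intro borel_measurable_continuous_onI continuous_intros)

lemma heat_deriv_measurable:
  assumes "\<nu> \<noteq> 0" and [measurable]: "a \<in> borel_measurable M" "b \<in> borel_measurable M"
  shows "(\<lambda>z. heat_deriv \<nu> \<alpha> (a z) (b z :: real ^ 'n::finite)) \<in> borel_measurable M"
proof -
  have [measurable]: "herm_gauss \<nu> N \<in> borel_measurable borel" for N
    by (rule borel_measurable_continuous_onI[OF herm_gauss_continuous[OF assms(1)]])
  have [measurable]: "(\<lambda>z. b z $ i) \<in> borel_measurable M" for i
    by (rule measurable_compose[OF assms(3) vec_nth_measurable])
  show ?thesis unfolding heat_deriv_def herm_kernel_def by measurable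
qed

lemma heat_kernel_measurable:
  assumes "\<nu> \<noteq> 0" and [measurable]: "a \<in> borel_measurable M" "b \<in> borel_measurable M"
  shows "(\<lambda>z. heat_kernel \<nu> (a z) (b z :: real ^ 'n::finite)) \<in> borel_measurable M"
proof -
  note [measurable] = heat_deriv_measurable[OF assms]
  show ?thesis unfolding heat_kernel_def by measurable
qed

lemma mpow_measurable:
  assumes "b \<in> borel_measurable M"
  shows "(\<lambda>z. mpow (b z :: real ^ 'n::finite) \<beta>) \<in> borel_measurable M"
proof -
  have [measurable]: "(\<lambda>z. b z $ i) \<in> borel_measurable M" for i
    by (rule measurable_compose[OF assms vec_nth_measurable])
  show ?thesis unfolding mpow_def by measurable
qed

lemma heat_taylor_measurable:
  assumes "\<nu> \<noteq> 0" and [measurable]: "a \<in> borel_measurable M" "b \<in> borel_measurable M" "c \<in> borel_measurable M" "e \<in> borel_measurable M"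
  shows "(\<lambda>z. heat_taylor \<nu> k (e z) (a z) (b z) (c z :: real ^ 'n::finite)) \<in> borel_measurable M"
proof -
  note [measurable] = heat_deriv_measurable[OF assms(1), of _ M] mpow_measurable[of _ M]
  show ?thesis unfolding heat_taylor_def by measurable
qed

text \<open>Dominated convergence: the factor min 1 (w t^(-1/2)) is at most 1 and tends to 0 as t
  grows, so finiteness of the k-th moment alone gives decay.\<close>

lemma weighted_tail_tendsto_0:
  fixes w :: "'a \<Rightarrow> real" and G :: "'a \<Rightarrow> ennreal"
  assumes [measurable]: "w \<in> borel_measurable M" "G \<in> borel_measurable M"
    and w: "\<And>z. w z \<ge> 0"
    and fin: "(\<integral>\<^sup>+ z. ennreal (w z ^ k) * G z \<partial>M) < \<infinity>"
  shows "((\<lambda>t. \<integral>\<^sup>+ z. ennreal (w z ^ k * min 1 (w z * t powr (- (1 / 2)))) * G z \<partial>M) \<longlongrightarrow> 0) at_top"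
proof (rule tendsto_at_topI_sequentially)
  fix X :: "nat \<Rightarrow> real" assume X: "filterlim X at_top sequentially"
  have X0: "(\<lambda>n. X n powr (- (1 / 2))) \<longlonglongrightarrow> 0" by (rule tendsto_neg_powr[OF _ X]) simp
  have "(\<lambda>n. \<integral>\<^sup>+ z. ennreal (w z ^ k * min 1 (w z * X n powr (- (1 / 2)))) * G z \<partial>M) \<longlonglongrightarrow> (\<integral>\<^sup>+ z. 0 \<partial>M)"
  proof (rule nn_integral_dominated_convergence[where w="\<lambda>z. ennreal (w z ^ k) * G z"])
    show "AE z in M. ennreal (w z ^ k * min 1 (w z * X n powr (- (1 / 2)))) * G z \<le> ennreal (w z ^ k) * G z" for n
    proof (rule AE_I2, intro mult_right_mono ennreal_leI)
      fix z show "w z ^ k * min 1 (w z * X n powr (- (1 / 2))) \<le> w z ^ k"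
        using w[of z] by (intro mult_left_le) auto
    qed simp
    have "AE z in M. ennreal (w z ^ k) * G z \<noteq> \<infinity>" using fin by (intro nn_integral_PInf_AE) auto
    then show "AE z in M. (\<lambda>n. ennreal (w z ^ k * min 1 (w z * X n powr (- (1 / 2)))) * G z) \<longlonglongrightarrow> 0"
    proof eventually_elim
      case (elim z)
      have "(\<lambda>n. w z ^ k * min 1 (w z * X n powr (- (1 / 2)))) \<longlonglongrightarrow> w z ^ k * min 1 (w z * 0)"
        by (intro tendsto_intros X0)
      then have l: "(\<lambda>n. ennreal (w z ^ k * min 1 (w z * X n powr (- (1 / 2))))) \<longlonglongrightarrow> 0"
        using tendsto_ennrealI by fastforce
      \<comment> \<open>Where G is infinite, finiteness of the product forces w^k = 0, so every term
        vanishes.\<close>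
      show ?case
      proof (cases "G z = \<infinity>")
        case True
        then have "w z ^ k = 0" using elim w[of z] by (auto simp: ennreal_mult_eq_top_iff)
        then show ?thesis by simp
      next
        case False
        have "(\<lambda>n. ennreal (w z ^ k * min 1 (w z * X n powr (- (1 / 2)))) * G z) \<longlonglongrightarrow> G z * 0"
          using ennreal_tendsto_cmult[OF _ l, of "G z"] False by (simp add: mult.commute less_top)
        then show ?thesis by simp
      qed
    qed
    show "(\<integral>\<^sup>+ z. ennreal (w z ^ k) * G z \<partial>M) < \<infinity>" by (rule fin)
  qed auto
  then show "(\<lambda>n. \<integral>\<^sup>+ z. ennreal (w z ^ k * min 1 (w z * X n powr (- (1 / 2)))) * G z \<partial>M) \<longlonglongrightarrow> 0" by simp
qed

lemma gauss_bound_shift_measurable: "(\<lambda>x. ennreal (gauss_bound c t (x - a :: real ^ 'n::finite))) \<in> borel_measurable lborel"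
proof -
  have "(\<lambda>x. x - a) \<in> measurable lborel borel" by measurable
  from measurable_compose[OF this gauss_bound_measurable] show ?thesis by measurable
qed

lemma heat_kernel_shift_measurable:
  assumes "\<nu> \<noteq> 0"
  shows "(\<lambda>x. ennreal (norm (heat_kernel \<nu> t (x - a :: real ^ 'n::finite)))) \<in> borel_measurable lborel"
proof -
  have "(\<lambda>x. heat_kernel \<nu> t (x - a)) \<in> borel_measurable lborel" by (rule heat_kernel_measurable[OF assms]) measurable
  then show ?thesis by measurable
qed

lemma nn_integral_three_terms:
  fixes f g h :: "'b \<Rightarrow> ennreal"
  assumes m: "f \<in> borel_measurable L" "g \<in> borel_measurable L" "h \<in> borel_measurable L"
    and i: "integral\<^sup>N L f = i" "integral\<^sup>N L g = i" "integral\<^sup>N L h \<le> j"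
  shows "(\<integral>\<^sup>+ x. (c * f x + c * g x) + d * h x \<partial>L) \<le> (c * i + c * i) + d * j"
proof -
  have "(\<integral>\<^sup>+ x. (c * f x + c * g x) + d * h x \<partial>L) = (c * i + c * i) + d * integral\<^sup>N L h"
    using m by (simp add: nn_integral_add nn_integral_cmult i)
  also have "\<dots> \<le> (c * i + c * i) + d * j" by (intro add_left_mono mult_left_mono i) simp
  finally show ?thesis .
qed

text \<open>Applied with \<open>\<sigma> = 0\<close> to the initial datum and with the coordinates \<open>(s, y)\<close> to the source term.\<close>

lemma expansion_remainder:
  assumes nu: "Re \<nu> > 0"
  shows "\<exists>C\<ge>0. \<forall>M \<sigma> (\<eta> :: 'a \<Rightarrow> real ^ 'n::finite) G. sigma_finite_measure M \<longrightarrow>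
    \<sigma> \<in> borel_measurable M \<longrightarrow> \<eta> \<in> borel_measurable M \<longrightarrow> G \<in> borel_measurable M \<longrightarrow> (\<forall>z. \<sigma> z \<ge> 0) \<longrightarrow>
    (\<forall>t>0. (\<integral>\<^sup>+ x. (\<integral>\<^sup>+ z. ennreal (norm (heat_kernel \<nu> (t - \<sigma> z) (x - \<eta> z) - heat_taylor \<nu> k t (\<sigma> z) x (\<eta> z))) * G z \<partial>M) \<partial>lborel)
       \<le> ennreal (C * t powr (- (real k / 2))) * (\<integral>\<^sup>+ z. ennreal ((sqrt (\<sigma> z) + norm (\<eta> z)) ^ k * min 1 ((sqrt (\<sigma> z) + norm (\<eta> z)) * t powr (- (1 / 2)))) * G z \<partial>M)
         + ennreal C * (\<integral>\<^sup>+ z. indicator {z. t / 2 < \<sigma> z \<and> \<sigma> z < t} z * G z \<partial>M))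
    \<and> (\<forall>t>0. \<forall>x. (\<integral>\<^sup>+ z. ennreal (norm (heat_kernel \<nu> (t - \<sigma> z) (x - \<eta> z) - heat_taylor \<nu> k t (\<sigma> z) x (\<eta> z))) * G z \<partial>M)
       \<le> ennreal (C * t powr (- (real k / 2)) * t powr (- (real CARD('n) / 2))) * (\<integral>\<^sup>+ z. ennreal ((sqrt (\<sigma> z) + norm (\<eta> z)) ^ k * min 1 ((sqrt (\<sigma> z) + norm (\<eta> z)) * t powr (- (1 / 2)))) * G z \<partial>M)
         + (\<integral>\<^sup>+ z. indicator {z. t / 2 < \<sigma> z \<and> \<sigma> z < t} z * ennreal (norm (heat_kernel \<nu> (t - \<sigma> z) (x - \<eta> z))) * G z \<partial>M))"
proof -
  have nz: "\<nu> \<noteq> 0" using nu by auto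
  have h: "gauss_rate \<nu> / 2 > 0" using gauss_rate_pos[OF nu] by auto
  obtain C1 where C1: "C1 > 0" "\<forall>t>0. \<forall>s\<ge>0. \<forall>x y :: real ^ 'n.
    norm (heat_kernel \<nu> (t - s) (x - y) - heat_taylor \<nu> k t s x y)
     \<le> C1 * (((sqrt s + norm y) * t powr (- (1 / 2))) ^ k * min 1 ((sqrt s + norm y) * t powr (- (1 / 2))))
         * (gauss_bound (gauss_rate \<nu> / 2) t (x - y) + gauss_bound (gauss_rate \<nu> / 2) t x)
       + (if t / 2 < s then norm (heat_kernel \<nu> (t - s) (x - y)) else 0)"
    using heat_kernel_expansion[OF nu, of k, where 'n='n] by (elim exE conjE)
  obtain C2 where C2: "C2 \<ge> 0" "\<forall>t. \<forall>y :: real ^ 'n. (\<integral>\<^sup>+ x. ennreal (norm (heat_kernel \<nu> t (x - y))) \<partial>lborel) \<le> ennreal C2 \<and>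
     (\<integral>\<^sup>+ x. ennreal (norm (heat_kernel \<nu> t (y - x))) \<partial>lborel) \<le> ennreal C2"
    using nn_integral_heat_kernel[OF nu, where 'n='n] by (elim exE conjE)
  define g0 where "g0 = sqrt (pi / (gauss_rate \<nu> / 2)) ^ CARD('n)"
  have g0: "g0 \<ge> 0" using h by (simp add: g0_def)
  define C where "C = C2 + 2 * C1 + 2 * C1 * g0"
  have CC: "C \<ge> 0" "C2 \<le> C" "2 * C1 \<le> C" "2 * C1 * g0 \<le> C" using C1(1) C2(1) g0 by (auto simp: C_def)
  show ?thesis
  proof (intro exI[of _ C] conjI allI impI)
    show "C \<ge> 0" by (rule CC)
    fix M and \<sigma> :: "'a \<Rightarrow> real" and \<eta> :: "'a \<Rightarrow> real ^ 'n" and G :: "'a \<Rightarrow> ennreal"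
    assume M: "sigma_finite_measure M" and \<sigma>m[measurable]: "\<sigma> \<in> borel_measurable M" and \<eta>m[measurable]: "\<eta> \<in> borel_measurable M"
      and Gm[measurable]: "G \<in> borel_measurable M" and s0: "\<forall>z. \<sigma> z \<ge> 0"
    interpret M: sigma_finite_measure M by (rule M)
    interpret P: pair_sigma_finite M "lborel :: (real ^ 'n) measure" ..
    fix t :: real assume t: "t > 0"
    let ?r = "t powr (- (1 / 2))"
    define W where "W z = (sqrt (\<sigma> z) + norm (\<eta> z)) ^ k * min 1 ((sqrt (\<sigma> z) + norm (\<eta> z)) * ?r)" for z
    have Wm[measurable]: "W \<in> borel_measurable M" unfolding W_def[abs_def] by measurable
    have W0: "W z \<ge> 0" for z using s0 by (simp add: W_def)
    \<comment> \<open>The zone in which the kernel is estimated by itself. For \<sigma> \<ge> t the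
      kernel is 0 by definition, so the zone ends at t.\<close>
    define T where "T = {z. t / 2 < \<sigma> z \<and> \<sigma> z < t}"
    have Tm: "{z \<in> space M. z \<in> T} \<in> sets M" unfolding T_def by measurable
    have Ti[measurable]: "(indicator T :: 'a \<Rightarrow> ennreal) \<in> borel_measurable M"
      using Tm by (simp add: borel_measurable_indicator_iff Int_def conj_commute)
    have tk: "?r ^ k = t powr (- (real k / 2))" by (rule powr_half_pow[OF t, symmetric])
    have pt: "norm (heat_kernel \<nu> (t - \<sigma> z) (x - \<eta> z) - heat_taylor \<nu> k t (\<sigma> z) x (\<eta> z))
       \<le> C1 * t powr (- (real k / 2)) * W z * (gauss_bound (gauss_rate \<nu> / 2) t (x - \<eta> z) + gauss_bound (gauss_rate \<nu> / 2) t x) + indicator T z * norm (heat_kernel \<nu> (t - \<sigma> z) (x - \<eta> z))" for x z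
    proof -
      have "norm (heat_kernel \<nu> (t - \<sigma> z) (x - \<eta> z) - heat_taylor \<nu> k t (\<sigma> z) x (\<eta> z))
        \<le> C1 * (((sqrt (\<sigma> z) + norm (\<eta> z)) * ?r) ^ k * min 1 ((sqrt (\<sigma> z) + norm (\<eta> z)) * ?r)) * (gauss_bound (gauss_rate \<nu> / 2) t (x - \<eta> z) + gauss_bound (gauss_rate \<nu> / 2) t x)
       + (if t / 2 < \<sigma> z then norm (heat_kernel \<nu> (t - \<sigma> z) (x - \<eta> z)) else 0)"
        using C1(2)[rule_format, OF t, of "\<sigma> z" x "\<eta> z"] s0 by blast
      also have "(if t / 2 < \<sigma> z then norm (heat_kernel \<nu> (t - \<sigma> z) (x - \<eta> z)) else 0) = indicator T z * norm (heat_kernel \<nu> (t - \<sigma> z) (x - \<eta> z))"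
        by (auto simp: T_def heat_kernel_def indicator_def)
      also have "C1 * (((sqrt (\<sigma> z) + norm (\<eta> z)) * ?r) ^ k * min 1 ((sqrt (\<sigma> z) + norm (\<eta> z)) * ?r)) = C1 * t powr (- (real k / 2)) * W z"
        unfolding W_def power_mult_distrib tk by simp
      finally show ?thesis .
    qed
    have g: "gauss_bound (gauss_rate \<nu> / 2) t x \<ge> 0" for x :: "real ^ 'n" by (rule gauss_bound_nonneg)
    {
      have "(\<integral>\<^sup>+ x. (\<integral>\<^sup>+ z. ennreal (norm (heat_kernel \<nu> (t - \<sigma> z) (x - \<eta> z) - heat_taylor \<nu> k t (\<sigma> z) x (\<eta> z))) * G z \<partial>M) \<partial>lborel)
        = (\<integral>\<^sup>+ z. (\<integral>\<^sup>+ x. ennreal (norm (heat_kernel \<nu> (t - \<sigma> z) (x - \<eta> z) - heat_taylor \<nu> k t (\<sigma> z) x (\<eta> z))) * G z \<partial>lborel) \<partial>M)"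
      proof (rule P.Fubini')
        note [measurable] = heat_kernel_measurable[OF nz, of _ "M \<Otimes>\<^sub>M lborel"] heat_taylor_measurable[OF nz, of _ "M \<Otimes>\<^sub>M lborel"]
        show "(\<lambda>(z, x). ennreal (norm (heat_kernel \<nu> (t - \<sigma> z) (x - \<eta> z) - heat_taylor \<nu> k t (\<sigma> z) x (\<eta> z))) * G z) \<in> borel_measurable (M \<Otimes>\<^sub>M lborel)"
          unfolding case_prod_beta by measurable
      qed
      also have "\<dots> \<le> (\<integral>\<^sup>+ z. ennreal (C * t powr (- (real k / 2))) * (ennreal (W z) * G z) + ennreal C * (indicator T z * G z) \<partial>M)"
      proof (rule nn_integral_mono)
        fix z
        let ?c = "C1 * t powr (- (real k / 2)) * W z"
        have gk0: "(\<lambda>x. ennreal (gauss_bound (gauss_rate \<nu> / 2) t x)) \<in> borel_measurable (lborel :: (real ^ 'n) measure)"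
          using gauss_bound_shift_measurable[of "gauss_rate \<nu> / 2" t 0] by simp
        have c0: "?c \<ge> 0" using C1(1) W0[of z] by simp
        note [measurable] = heat_kernel_measurable[OF nz, of _ "lborel :: (real ^ 'n) measure"] heat_taylor_measurable[OF nz, of _ "lborel :: (real ^ 'n) measure"]
        have mG: "(\<integral>\<^sup>+ x. ennreal (norm (heat_kernel \<nu> (t - \<sigma> z) (x - \<eta> z) - heat_taylor \<nu> k t (\<sigma> z) x (\<eta> z))) * G z \<partial>lborel)
          = (\<integral>\<^sup>+ x. ennreal (norm (heat_kernel \<nu> (t - \<sigma> z) (x - \<eta> z) - heat_taylor \<nu> k t (\<sigma> z) x (\<eta> z))) \<partial>lborel) * G z"
          by (rule nn_integral_multc) measurable
        have "(\<integral>\<^sup>+ x. ennreal (norm (heat_kernel \<nu> (t - \<sigma> z) (x - \<eta> z) - heat_taylor \<nu> k t (\<sigma> z) x (\<eta> z))) \<partial>lborel)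
          \<le> (\<integral>\<^sup>+ x. (ennreal ?c * ennreal (gauss_bound (gauss_rate \<nu> / 2) t (x - \<eta> z)) + ennreal ?c * ennreal (gauss_bound (gauss_rate \<nu> / 2) t x)) + indicator T z * ennreal (norm (heat_kernel \<nu> (t - \<sigma> z) (x - \<eta> z))) \<partial>lborel)"
        proof (rule nn_integral_mono)
          fix x
          have "ennreal (norm (heat_kernel \<nu> (t - \<sigma> z) (x - \<eta> z) - heat_taylor \<nu> k t (\<sigma> z) x (\<eta> z)))
            \<le> ennreal (?c * (gauss_bound (gauss_rate \<nu> / 2) t (x - \<eta> z) + gauss_bound (gauss_rate \<nu> / 2) t x) + indicator T z * norm (heat_kernel \<nu> (t - \<sigma> z) (x - \<eta> z)))"
            by (rule ennreal_leI[OF pt])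
          also have "\<dots> = ennreal (?c * (gauss_bound (gauss_rate \<nu> / 2) t (x - \<eta> z) + gauss_bound (gauss_rate \<nu> / 2) t x)) + ennreal (indicator T z * norm (heat_kernel \<nu> (t - \<sigma> z) (x - \<eta> z)))"
            using c0 g by (intro ennreal_plus) auto
          also have c1: "ennreal (?c * (gauss_bound (gauss_rate \<nu> / 2) t (x - \<eta> z) + gauss_bound (gauss_rate \<nu> / 2) t x)) = ennreal ?c * ennreal (gauss_bound (gauss_rate \<nu> / 2) t (x - \<eta> z)) + ennreal ?c * ennreal (gauss_bound (gauss_rate \<nu> / 2) t x)"
            using c0 g by (simp add: ennreal_mult distrib_left)
          also have "ennreal (indicator T z * norm (heat_kernel \<nu> (t - \<sigma> z) (x - \<eta> z))) = indicator T z * ennreal (norm (heat_kernel \<nu> (t - \<sigma> z) (x - \<eta> z)))"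
            by (simp add: indicator_def)
          finally show "ennreal (norm (heat_kernel \<nu> (t - \<sigma> z) (x - \<eta> z) - heat_taylor \<nu> k t (\<sigma> z) x (\<eta> z)))
            \<le> (ennreal ?c * ennreal (gauss_bound (gauss_rate \<nu> / 2) t (x - \<eta> z)) + ennreal ?c * ennreal (gauss_bound (gauss_rate \<nu> / 2) t x)) + indicator T z * ennreal (norm (heat_kernel \<nu> (t - \<sigma> z) (x - \<eta> z)))" .
        qed
        also have "\<dots> \<le> (ennreal ?c * ennreal g0 + ennreal ?c * ennreal g0) + indicator T z * ennreal C"
          by (rule nn_integral_three_terms[OF gauss_bound_shift_measurable gk0 heat_kernel_shift_measurable[OF nz]])
            (auto simp: nn_integral_gauss_bound_shift[OF h t] nn_integral_gauss_bound[OF h t] g0_def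
              intro: order_trans[OF conjunct1[OF C2(2)[rule_format]] ennreal_leI[OF CC(2)]])
        also have "\<dots> \<le> ennreal (C * t powr (- (real k / 2)) * W z) + indicator T z * ennreal C"
        proof (rule add_right_mono)
          have "ennreal ?c * ennreal g0 + ennreal ?c * ennreal g0 = ennreal (2 * C1 * g0 * t powr (- (real k / 2)) * W z)"
          proof -
            have "ennreal ?c * ennreal g0 + ennreal ?c * ennreal g0 = ennreal (?c * g0 + ?c * g0)"
              using c0 g0 by (simp only: ennreal_mult ennreal_plus mult_nonneg_nonneg)
            also have "?c * g0 + ?c * g0 = 2 * C1 * g0 * t powr (- (real k / 2)) * W z" by simp
            finally show ?thesis .
          qed
          also have "\<dots> \<le> ennreal (C * t powr (- (real k / 2)) * W z)"
            by (intro ennreal_leI mult_right_mono CC W0) auto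
          finally show "ennreal ?c * ennreal g0 + ennreal ?c * ennreal g0 \<le> ennreal (C * t powr (- (real k / 2)) * W z)" .
        qed
        finally have kk: "(\<integral>\<^sup>+ x. ennreal (norm (heat_kernel \<nu> (t - \<sigma> z) (x - \<eta> z) - heat_taylor \<nu> k t (\<sigma> z) x (\<eta> z))) \<partial>lborel)
            \<le> ennreal (C * t powr (- (real k / 2)) * W z) + indicator T z * ennreal C" .
        have "(\<integral>\<^sup>+ x. ennreal (norm (heat_kernel \<nu> (t - \<sigma> z) (x - \<eta> z) - heat_taylor \<nu> k t (\<sigma> z) x (\<eta> z))) * G z \<partial>lborel)
            \<le> (ennreal (C * t powr (- (real k / 2)) * W z) + indicator T z * ennreal C) * G z"
          unfolding mG by (rule mult_right_mono[OF kk]) simp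
        also have "\<dots> = ennreal (C * t powr (- (real k / 2))) * (ennreal (W z) * G z) + ennreal C * (indicator T z * G z)"
          using CC(1) W0[of z] by (simp add: ennreal_mult distrib_left mult_ac)
        finally show "(\<integral>\<^sup>+ x. ennreal (norm (heat_kernel \<nu> (t - \<sigma> z) (x - \<eta> z) - heat_taylor \<nu> k t (\<sigma> z) x (\<eta> z))) * G z \<partial>lborel) \<le> ennreal (C * t powr (- (real k / 2))) * (ennreal (W z) * G z) + ennreal C * (indicator T z * G z)" .
      qed
      also have "\<dots> = ennreal (C * t powr (- (real k / 2))) * (\<integral>\<^sup>+ z. ennreal (W z) * G z \<partial>M) + ennreal C * (\<integral>\<^sup>+ z. indicator T z * G z \<partial>M)"
        by (subst nn_integral_add, measurable, subst (1 2) nn_integral_cmult) auto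
      finally show "(\<integral>\<^sup>+ x. (\<integral>\<^sup>+ z. ennreal (norm (heat_kernel \<nu> (t - \<sigma> z) (x - \<eta> z) - heat_taylor \<nu> k t (\<sigma> z) x (\<eta> z))) * G z \<partial>M) \<partial>lborel)
       \<le> ennreal (C * t powr (- (real k / 2))) * (\<integral>\<^sup>+ z. ennreal ((sqrt (\<sigma> z) + norm (\<eta> z)) ^ k * min 1 ((sqrt (\<sigma> z) + norm (\<eta> z)) * ?r)) * G z \<partial>M)
         + ennreal C * (\<integral>\<^sup>+ z. indicator {z. t / 2 < \<sigma> z \<and> \<sigma> z < t} z * G z \<partial>M)" unfolding W_def T_def .
    }
    \<comment> \<open>In the pointwise estimate the kernel has to stay under the integral, since its
      supremum blows up as \<sigma> z approaches t.\<close>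
    fix x
    let ?c = "C * t powr (- (real k / 2)) * t powr (- (real CARD('n) / 2))"
    note [measurable] = heat_kernel_measurable[OF nz, of _ M] heat_taylor_measurable[OF nz, of _ M]
    have "(\<integral>\<^sup>+ z. ennreal (norm (heat_kernel \<nu> (t - \<sigma> z) (x - \<eta> z) - heat_taylor \<nu> k t (\<sigma> z) x (\<eta> z))) * G z \<partial>M)
      \<le> (\<integral>\<^sup>+ z. ennreal ?c * (ennreal (W z) * G z) + indicator T z * ennreal (norm (heat_kernel \<nu> (t - \<sigma> z) (x - \<eta> z))) * G z \<partial>M)"
    proof (rule nn_integral_mono)
      fix z
      have "gauss_bound (gauss_rate \<nu> / 2) t (x - \<eta> z) + gauss_bound (gauss_rate \<nu> / 2) t x \<le> 2 * t powr (- (real CARD('n) / 2))"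
        using gauss_bound_le[OF h t, of x] gauss_bound_le[OF h t, of "x - \<eta> z"] by linarith
      then have "C1 * t powr (- (real k / 2)) * W z * (gauss_bound (gauss_rate \<nu> / 2) t (x - \<eta> z) + gauss_bound (gauss_rate \<nu> / 2) t x) \<le> C1 * t powr (- (real k / 2)) * W z * (2 * t powr (- (real CARD('n) / 2)))"
        using C1(1) W0[of z] by (intro mult_left_mono) auto
      also have "\<dots> = (2 * C1) * (t powr (- (real k / 2)) * t powr (- (real CARD('n) / 2)) * W z)" by simp
      also have "\<dots> \<le> C * (t powr (- (real k / 2)) * t powr (- (real CARD('n) / 2)) * W z)" using W0[of z] by (intro mult_right_mono CC) auto
      finally have "norm (heat_kernel \<nu> (t - \<sigma> z) (x - \<eta> z) - heat_taylor \<nu> k t (\<sigma> z) x (\<eta> z)) \<le> ?c * W z + indicator T z * norm (heat_kernel \<nu> (t - \<sigma> z) (x - \<eta> z))"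
        using pt[of z x] by (simp add: mult_ac)
      from ennreal_leI[OF this] have "ennreal (norm (heat_kernel \<nu> (t - \<sigma> z) (x - \<eta> z) - heat_taylor \<nu> k t (\<sigma> z) x (\<eta> z))) \<le> ennreal ?c * ennreal (W z) + indicator T z * ennreal (norm (heat_kernel \<nu> (t - \<sigma> z) (x - \<eta> z)))"
        using CC(1) W0[of z] by (cases "z \<in> T") (simp_all add: ennreal_mult)
      then have "ennreal (norm (heat_kernel \<nu> (t - \<sigma> z) (x - \<eta> z) - heat_taylor \<nu> k t (\<sigma> z) x (\<eta> z))) * G z \<le> (ennreal ?c * ennreal (W z) + indicator T z * ennreal (norm (heat_kernel \<nu> (t - \<sigma> z) (x - \<eta> z)))) * G z"
        by (rule mult_right_mono) simp
      then show "ennreal (norm (heat_kernel \<nu> (t - \<sigma> z) (x - \<eta> z) - heat_taylor \<nu> k t (\<sigma> z) x (\<eta> z))) * G z \<le> ennreal ?c * (ennreal (W z) * G z) + indicator T z * ennreal (norm (heat_kernel \<nu> (t - \<sigma> z) (x - \<eta> z))) * G z"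
        by (simp only: distrib_right mult.assoc)
    qed
    also have "\<dots> = ennreal ?c * (\<integral>\<^sup>+ z. ennreal (W z) * G z \<partial>M) + (\<integral>\<^sup>+ z. indicator T z * ennreal (norm (heat_kernel \<nu> (t - \<sigma> z) (x - \<eta> z))) * G z \<partial>M)"
      by (subst nn_integral_add, measurable, subst nn_integral_cmult) auto
    finally show "(\<integral>\<^sup>+ z. ennreal (norm (heat_kernel \<nu> (t - \<sigma> z) (x - \<eta> z) - heat_taylor \<nu> k t (\<sigma> z) x (\<eta> z))) * G z \<partial>M)
       \<le> ennreal (C * t powr (- (real k / 2)) * t powr (- (real CARD('n) / 2))) * (\<integral>\<^sup>+ z. ennreal ((sqrt (\<sigma> z) + norm (\<eta> z)) ^ k * min 1 ((sqrt (\<sigma> z) + norm (\<eta> z)) * ?r)) * G z \<partial>M)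
         + (\<integral>\<^sup>+ z. indicator {z. t / 2 < \<sigma> z \<and> \<sigma> z < t} z * ennreal (norm (heat_kernel \<nu> (t - \<sigma> z) (x - \<eta> z))) * G z \<partial>M)" unfolding W_def T_def .
  qed
qed

section \<open>Moments of a decaying source\<close>

lemma nn_integral_powr_decay:
  assumes "b > 1"
  shows "(\<integral>\<^sup>+ s. indicator {0<..} s * ennreal ((1 + s) powr (- b)) \<partial>lborel) < \<infinity>"
proof -
  have "(\<integral>\<^sup>+ s. indicator {0<..} s * ennreal ((1 + s) powr (- b)) \<partial>lborel) \<le> (\<integral>\<^sup>+ s. ennreal ((1 + s) powr (- b)) * indicator {0..} s \<partial>lborel)"
    by (intro nn_integral_mono) (auto simp: indicator_def)
  also have "\<dots> = 0 - ((1 + 0) powr (1 - b) / (1 - b))"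
  proof (rule nn_integral_FTC_atLeast)
    show "(\<lambda>s. (1 + s) powr (- b)) \<in> borel_measurable borel" by measurable
    show "DERIV (\<lambda>s. (1 + s) powr (1 - b) / (1 - b)) s :> (1 + s) powr (- b)" if "0 \<le> s" for s
      using that assms by (auto intro!: derivative_eq_intros)
    show "((\<lambda>s. (1 + s) powr (1 - b) / (1 - b)) \<longlongrightarrow> 0) at_top"
    proof -
      have "((\<lambda>s. (1 + s) powr (1 - b)) \<longlongrightarrow> 0) at_top"
        by (rule tendsto_neg_powr) (use assms in \<open>auto intro: filterlim_tendsto_add_at_top[OF tendsto_const filterlim_ident]\<close>)
      from tendsto_divide[OF this tendsto_const[of "1 - b"]] show ?thesis using assms by simp
    qed
  qed auto
  also have "\<dots> < \<infinity>" by simp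
  finally show ?thesis .
qed

lemma add_power_le:
  fixes a b :: real
  assumes "a \<ge> 0" "b \<ge> 0"
  shows "(a + b) ^ k \<le> 2 ^ k * (a ^ k + b ^ k)"
proof -
  have "(a + b) ^ k \<le> (2 * max a b) ^ k" using assms by (intro power_mono) auto
  also have "\<dots> = 2 ^ k * max a b ^ k" by (simp add: power_mult_distrib)
  also have "max a b ^ k \<le> a ^ k + b ^ k" using assms by (cases "a \<le> b") (auto simp: max_def)
  finally show ?thesis by simp
qed

text \<open>Isolates what the limit needs from the equation. The rates are those of (1+s)^(-a) times
  a function of bounded mass, with supremum of order (1+s)^(-n/2) and k-th moment of order
  (1+s)^(k/2). The margin a > k/2 + 1 makes the k-th parabolic moment integrable in time.\<close>

locale decaying_source =
  fixes \<nu> :: complex and k :: nat and a C0 :: real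
    and u0 :: "real ^ 'n::finite \<Rightarrow> complex" and g :: "real \<Rightarrow> real ^ 'n \<Rightarrow> complex"
  assumes nu: "Re \<nu> > 0" and a: "a > real k / 2 + 1" and C0: "C0 \<ge> 0"
    and u0m: "u0 \<in> borel_measurable borel"
    and u01: "(\<integral>\<^sup>+ y. ennreal (norm (u0 y)) \<partial>lborel) < \<infinity>"
    and u0k: "(\<integral>\<^sup>+ y. ennreal (norm y ^ k) * ennreal (norm (u0 y)) \<partial>lborel) < \<infinity>"
    and gm: "(\<lambda>z. g (fst z) (snd z)) \<in> borel_measurable (lborel \<Otimes>\<^sub>M lborel)"
    and g0: "\<And>s y. s \<le> 0 \<Longrightarrow> g s y = 0"
    and g1: "\<And>s. s > 0 \<Longrightarrow> (\<integral>\<^sup>+ y. ennreal (norm (g s y)) \<partial>lborel) \<le> ennreal (C0 * (1 + s) powr (- a))"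
    and g_moment: "\<And>s. s > 0 \<Longrightarrow> (\<integral>\<^sup>+ y. ennreal (norm y ^ k) * ennreal (norm (g s y)) \<partial>lborel) \<le> ennreal (C0 * (1 + s) powr (real k / 2 - a))"
    and ginf: "\<And>s. s > 0 \<Longrightarrow> AE y in lborel. norm (g s y) \<le> C0 * (1 + s) powr (- a - real CARD('n) / 2)"
begin

abbreviation P :: "(real \<times> (real ^ 'n)) measure" where "P \<equiv> lborel \<Otimes>\<^sub>M lborel"
abbreviation G :: "real \<times> (real ^ 'n) \<Rightarrow> ennreal" where "G z \<equiv> ennreal (norm (g (fst z) (snd z)))"

lemma nu0: "\<nu> \<noteq> 0" using nu by auto

lemma Gm: "G \<in> borel_measurable P" using gm by measurable

lemma g_slice_measurable: "(\<lambda>y. g s y) \<in> borel_measurable lborel"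
proof -
  have "(\<lambda>y. (s, y)) \<in> measurable lborel P" by measurable
  from measurable_compose[OF this gm] show ?thesis by simp
qed

lemma nn_integral_P:
  assumes [measurable]: "f \<in> borel_measurable P"
  shows "(\<integral>\<^sup>+ z. f z * G z \<partial>P) = (\<integral>\<^sup>+ s. indicator {0<..} s * (\<integral>\<^sup>+ y. f (s, y) * ennreal (norm (g s y)) \<partial>lborel) \<partial>lborel)"
proof -
  note [measurable] = Gm
  have "(\<integral>\<^sup>+ z. f z * G z \<partial>P) = (\<integral>\<^sup>+ s. \<integral>\<^sup>+ y. f (s, y) * G (s, y) \<partial>lborel \<partial>lborel)"
    by (rule lborel.nn_integral_fst[symmetric]) measurable
  also have "\<dots> = (\<integral>\<^sup>+ s. indicator {0<..} s * (\<integral>\<^sup>+ y. f (s, y) * ennreal (norm (g s y)) \<partial>lborel) \<partial>lborel)"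
    by (intro nn_integral_cong) (auto simp: indicator_def g0)
  finally show ?thesis .
qed

lemma nn_integral_P_le:
  assumes f: "f \<in> borel_measurable P" and b: "\<And>s. s > 0 \<Longrightarrow> (\<integral>\<^sup>+ y. f (s, y) * ennreal (norm (g s y)) \<partial>lborel) \<le> h s"
  shows "(\<integral>\<^sup>+ z. f z * G z \<partial>P) \<le> (\<integral>\<^sup>+ s. indicator {0<..} s * h s \<partial>lborel)"
  unfolding nn_integral_P[OF f] using b by (intro nn_integral_mono) (auto simp: indicator_def)

lemma decay_finite:
  assumes "b > 1" "c \<ge> 0"
  shows "(\<integral>\<^sup>+ s. indicator {0<..} s * ennreal (c * (1 + s) powr (- b)) \<partial>lborel) < \<infinity>"
proof -
  have "(\<integral>\<^sup>+ s. indicator {0<..} s * ennreal (c * (1 + s) powr (- b)) \<partial>lborel) = (\<integral>\<^sup>+ s. ennreal c * (indicator {0<..} s * ennreal ((1 + s) powr (- b))) \<partial>lborel)"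
    using assms by (intro nn_integral_cong) (simp add: ennreal_mult mult_ac)
  also have "\<dots> = ennreal c * (\<integral>\<^sup>+ s. indicator {0<..} s * ennreal ((1 + s) powr (- b)) \<partial>lborel)"
    by (rule nn_integral_cmult) measurable
  also have "\<dots> < \<infinity>" using nn_integral_powr_decay[OF assms(1)] by (simp add: ennreal_mult_less_top)
  finally show ?thesis .
qed

text \<open>The parabolic distance of (s, y) from the origin; \<open>max\<close> keeps it
  nonnegative for s < 0, where the source vanishes.\<close>

definition w :: "real \<times> (real ^ 'n) \<Rightarrow> real" where "w z = sqrt (max 0 (fst z)) + norm (snd z)"

lemma wm[measurable]: "w \<in> borel_measurable P"
  unfolding w_def by measurable

lemma w0: "w z \<ge> 0" by (simp add: w_def)

text \<open>After expanding the weight, s^(k/2) times the mass and the k-th moment of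
  \<open>g s\<close> both decay like (1+s)^(k/2 - a), which is integrable because a - k/2 >
  1.\<close>

lemma weight_finite: "(\<integral>\<^sup>+ z. ennreal (w z ^ k) * G z \<partial>P) < \<infinity>"
proof -
  have "(\<integral>\<^sup>+ z. ennreal (w z ^ k) * G z \<partial>P) \<le> (\<integral>\<^sup>+ s. indicator {0<..} s * ennreal (2 ^ k * (2 * C0) * (1 + s) powr (- (a - real k / 2))) \<partial>lborel)"
  proof (rule nn_integral_P_le)
    show "(\<lambda>z. ennreal (w z ^ k)) \<in> borel_measurable P" by measurable
    fix s :: real assume s: "s > 0"
    note [measurable] = g_slice_measurable[of s]
    have sk: "sqrt s ^ k \<le> (1 + s) powr (real k / 2)"
    proof -
      have "sqrt s ^ k = s powr (real k / 2)" using s by (simp add: powr_half_sqrt[symmetric] powr_power)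
      also have "\<dots> \<le> (1 + s) powr (real k / 2)" using s by (intro powr_mono2) auto
      finally show ?thesis .
    qed
    have "(\<integral>\<^sup>+ y. ennreal (w (s, y) ^ k) * ennreal (norm (g s y)) \<partial>lborel)
      \<le> (\<integral>\<^sup>+ y. ennreal (2 ^ k * (1 + s) powr (real k / 2)) * ennreal (norm (g s y)) + ennreal (2 ^ k) * (ennreal (norm y ^ k) * ennreal (norm (g s y))) \<partial>lborel)"
    proof (rule nn_integral_mono)
      fix y
      have "w (s, y) ^ k \<le> 2 ^ k * (sqrt s ^ k + norm y ^ k)" unfolding w_def using s add_power_le[of "sqrt s" "norm y" k] by simp
      also have "\<dots> \<le> 2 ^ k * ((1 + s) powr (real k / 2) + norm y ^ k)" using sk by simp
      finally have "ennreal (w (s, y) ^ k) \<le> ennreal (2 ^ k * (1 + s) powr (real k / 2) + 2 ^ k * norm y ^ k)" by (intro ennreal_leI) (simp add: distrib_left)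
      also have "\<dots> = ennreal (2 ^ k * (1 + s) powr (real k / 2)) + ennreal (2 ^ k) * ennreal (norm y ^ k)"
        by (subst ennreal_plus) (auto simp: ennreal_mult)
      finally have "ennreal (w (s, y) ^ k) * ennreal (norm (g s y)) \<le> (ennreal (2 ^ k * (1 + s) powr (real k / 2)) + ennreal (2 ^ k) * ennreal (norm y ^ k)) * ennreal (norm (g s y))"
        by (rule mult_right_mono) simp
      then show "ennreal (w (s, y) ^ k) * ennreal (norm (g s y)) \<le> ennreal (2 ^ k * (1 + s) powr (real k / 2)) * ennreal (norm (g s y)) + ennreal (2 ^ k) * (ennreal (norm y ^ k) * ennreal (norm (g s y)))"
        by (simp only: distrib_right mult.assoc)
    qed
    also have "\<dots> = ennreal (2 ^ k * (1 + s) powr (real k / 2)) * (\<integral>\<^sup>+ y. ennreal (norm (g s y)) \<partial>lborel) + ennreal (2 ^ k) * (\<integral>\<^sup>+ y. ennreal (norm y ^ k) * ennreal (norm (g s y)) \<partial>lborel)"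
      by (simp add: nn_integral_add nn_integral_cmult)
    also have "\<dots> \<le> ennreal (2 ^ k * (1 + s) powr (real k / 2)) * ennreal (C0 * (1 + s) powr (- a)) + ennreal (2 ^ k) * ennreal (C0 * (1 + s) powr (real k / 2 - a))"
      by (intro add_mono mult_left_mono g1 g_moment s) auto
    also have "\<dots> = ennreal (2 ^ k * (1 + s) powr (real k / 2) * (C0 * (1 + s) powr (- a)) + 2 ^ k * (C0 * (1 + s) powr (real k / 2 - a)))"
      using C0 by (simp add: ennreal_mult ennreal_plus)
    also have "2 ^ k * (1 + s) powr (real k / 2) * (C0 * (1 + s) powr (- a)) + 2 ^ k * (C0 * (1 + s) powr (real k / 2 - a)) = 2 ^ k * (2 * C0) * (1 + s) powr (- (a - real k / 2))"
    proof -
      have e: "(1 + s) powr (real k / 2) * (1 + s) powr (- a) = (1 + s) powr (- (a - real k / 2))" "real k / 2 - a = - (a - real k / 2)"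
        by (simp_all add: powr_add[symmetric])
      show ?thesis unfolding e(2) e(1)[symmetric] by simp
    qed
    finally show "(\<integral>\<^sup>+ y. ennreal (w (s, y) ^ k) * ennreal (norm (g s y)) \<partial>lborel) \<le> ennreal (2 ^ k * (2 * C0) * (1 + s) powr (- (a - real k / 2)))" .
  qed
  also have "\<dots> < \<infinity>" by (rule decay_finite) (use a C0 in auto)
  finally show ?thesis .
qed

lemma source_finite: "(\<integral>\<^sup>+ z. G z \<partial>P) < \<infinity>"
proof -
  have "(\<integral>\<^sup>+ z. 1 * G z \<partial>P) \<le> (\<integral>\<^sup>+ s. indicator {0<..} s * ennreal (C0 * (1 + s) powr (- a)) \<partial>lborel)"
    by (rule nn_integral_P_le) (use g1 in auto)
  also have "\<dots> < \<infinity>" by (rule decay_finite) (use a C0 in auto)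
  finally show ?thesis by simp
qed

text \<open>In parabolic counting s^j y^\<beta> has degree 2j + |\<beta>| \<le> k, so it is bounded
  by (1 + w)^k.\<close>

lemma integrable_moment_source:
  assumes "2 * j + mdeg \<beta> \<le> k"
  shows "integrable P (\<lambda>z. of_real (fst z ^ j * mpow (snd z) \<beta>) * g (fst z) (snd z))"
proof (rule integrableI_bounded)
  note [measurable] = gm
  have [measurable]: "(\<lambda>z. mpow (snd z) \<beta>) \<in> borel_measurable P" by (rule mpow_measurable) measurable
  show "(\<lambda>z. of_real (fst z ^ j * mpow (snd z) \<beta>) * g (fst z) (snd z)) \<in> borel_measurable P" by measurable
  have "(\<integral>\<^sup>+ z. ennreal (norm (of_real (fst z ^ j * mpow (snd z) \<beta>) * g (fst z) (snd z))) \<partial>P)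
    \<le> (\<integral>\<^sup>+ z. ennreal (2 ^ k) * G z + ennreal (2 ^ k) * (ennreal (w z ^ k) * G z) \<partial>P)"
  proof (rule nn_integral_mono)
    fix z
    show "ennreal (norm (of_real (fst z ^ j * mpow (snd z) \<beta>) * g (fst z) (snd z))) \<le> ennreal (2 ^ k) * G z + ennreal (2 ^ k) * (ennreal (w z ^ k) * G z)"
    proof (cases "fst z > 0")
      case False
      then show ?thesis by (simp add: g0)
    next
      case True
      have "\<bar>fst z ^ j * mpow (snd z) \<beta>\<bar> \<le> sqrt (fst z) ^ (2 * j) * norm (snd z) ^ mdeg \<beta>"
        using True mpow_bound[of "snd z" \<beta>] by (simp add: abs_mult power_mult mult_left_mono)
      also have "\<dots> \<le> (1 + w z) ^ (2 * j) * (1 + w z) ^ mdeg \<beta>"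
        using True by (intro mult_mono power_mono) (auto simp: w_def)
      also have "\<dots> \<le> (1 + w z) ^ k" unfolding power_add[symmetric] using assms w0[of z] by (intro power_increasing) auto
      also have "\<dots> \<le> 2 ^ k * (1 ^ k + w z ^ k)" by (intro add_power_le w0) simp
      finally have "\<bar>fst z ^ j * mpow (snd z) \<beta>\<bar> * norm (g (fst z) (snd z)) \<le> (2 ^ k + 2 ^ k * w z ^ k) * norm (g (fst z) (snd z))"
        by (intro mult_right_mono) (auto simp: distrib_left)
      then have "ennreal (norm (of_real (fst z ^ j * mpow (snd z) \<beta>) * g (fst z) (snd z))) \<le> ennreal ((2 ^ k + 2 ^ k * w z ^ k) * norm (g (fst z) (snd z)))"
        by (intro ennreal_leI) (simp only: norm_mult norm_of_real)
      also have "\<dots> = ennreal (2 ^ k) * G z + ennreal (2 ^ k) * (ennreal (w z ^ k) * G z)"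
        using w0[of z] by (simp add: distrib_right ennreal_plus ennreal_mult mult.assoc)
      finally show ?thesis .
    qed
  qed
  also have "\<dots> = ennreal (2 ^ k) * (\<integral>\<^sup>+ z. G z \<partial>P) + ennreal (2 ^ k) * (\<integral>\<^sup>+ z. ennreal (w z ^ k) * G z \<partial>P)"
    using Gm by (simp add: nn_integral_add nn_integral_cmult)
  also have "\<dots> < \<infinity>" using source_finite weight_finite by (simp add: ennreal_mult_less_top ennreal_add_less_top)
  finally show "(\<integral>\<^sup>+ z. ennreal (norm (of_real (fst z ^ j * mpow (snd z) \<beta>) * g (fst z) (snd z))) \<partial>P) < \<infinity>" .
qed

text \<open>Moments of order between 0 and k are dominated through 1 + |y|^k.\<close>

lemma integrable_moment_datum:
  assumes "mdeg \<beta> \<le> k"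
  shows "integrable lborel (\<lambda>y. of_real (mpow y \<beta>) * u0 y)"
proof (rule integrableI_bounded)
  note [measurable] = u0m
  have [measurable]: "(\<lambda>z. mpow z \<beta>) \<in> borel_measurable (lborel :: (real ^ 'n) measure)" by (rule mpow_measurable) measurable
  show "(\<lambda>y. of_real (mpow y \<beta>) * u0 y) \<in> borel_measurable lborel" by measurable
  have "(\<integral>\<^sup>+ y. ennreal (norm (of_real (mpow y \<beta>) * u0 y)) \<partial>lborel)
    \<le> (\<integral>\<^sup>+ y. ennreal (norm (u0 y)) + ennreal (norm y ^ k) * ennreal (norm (u0 y)) \<partial>lborel)"
  proof (rule nn_integral_mono)
    fix y
    have "\<bar>mpow y \<beta>\<bar> \<le> norm y ^ mdeg \<beta>" by (rule mpow_bound)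
    also have "\<dots> \<le> 1 + norm y ^ k"
    proof (cases "norm y \<le> 1")
      case True
      then have "norm y ^ mdeg \<beta> \<le> 1" by (intro power_le_one) auto
      then show ?thesis by (simp add: add_increasing2)
    next
      case False
      then have "norm y ^ mdeg \<beta> \<le> norm y ^ k" using assms by (intro power_increasing) auto
      then show ?thesis by simp
    qed
    finally have "\<bar>mpow y \<beta>\<bar> * norm (u0 y) \<le> (1 + norm y ^ k) * norm (u0 y)" by (rule mult_right_mono) simp
    then have "ennreal (norm (of_real (mpow y \<beta>) * u0 y)) \<le> ennreal ((1 + norm y ^ k) * norm (u0 y))"
      by (intro ennreal_leI) (simp add: norm_mult)
    also have "\<dots> = ennreal (norm (u0 y)) + ennreal (norm y ^ k) * ennreal (norm (u0 y))"
      by (simp add: distrib_right ennreal_plus ennreal_mult)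
    finally show "ennreal (norm (of_real (mpow y \<beta>) * u0 y)) \<le> ennreal (norm (u0 y)) + ennreal (norm y ^ k) * ennreal (norm (u0 y))" .
  qed
  also have "\<dots> = (\<integral>\<^sup>+ y. ennreal (norm (u0 y)) \<partial>lborel) + (\<integral>\<^sup>+ y. ennreal (norm y ^ k) * ennreal (norm (u0 y)) \<partial>lborel)"
    by (rule nn_integral_add) measurable
  also have "\<dots> < \<infinity>" using u01 u0k by (simp add: ennreal_add_less_top)
  finally show "(\<integral>\<^sup>+ y. ennreal (norm (of_real (mpow y \<beta>) * u0 y)) \<partial>lborel) < \<infinity>" .
qed

lemma integrable_heat_taylor_source:
  "integrable P (\<lambda>z. heat_taylor \<nu> k t (fst z) x (snd z) * g (fst z) (snd z))"
  "(\<integral>z. heat_taylor \<nu> k t (fst z) x (snd z) * g (fst z) (snd z) \<partial>P) =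
    (\<Sum>\<gamma>\<in>{\<gamma>. 2 * mdeg \<gamma> \<le> k}. (- \<nu>) ^ mdeg \<gamma> / of_nat (mfact \<gamma>) * (\<Sum>\<beta>\<in>{\<beta>. mdeg \<beta> \<le> k - 2 * mdeg \<gamma>}.
       heat_deriv \<nu> (\<lambda>i. 2 * \<gamma> i + \<beta> i) t x / of_nat (mfact \<beta>) * (\<integral>z. of_real (fst z ^ mdeg \<gamma> * mpow (snd z) \<beta>) * g (fst z) (snd z) \<partial>P)))"
proof -
  let ?I = "\<lambda>\<gamma> \<beta> z. of_real (fst z ^ mdeg (\<gamma> :: 'n \<Rightarrow> nat) * mpow (snd z) \<beta>) * g (fst z) (snd z)"
  have e: "heat_taylor \<nu> k t (fst z) x (snd z) * g (fst z) (snd z) =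
    (\<Sum>\<gamma>\<in>{\<gamma>. 2 * mdeg \<gamma> \<le> k}. (- \<nu>) ^ mdeg \<gamma> / of_nat (mfact \<gamma>) * (\<Sum>\<beta>\<in>{\<beta>. mdeg \<beta> \<le> k - 2 * mdeg \<gamma>}.
       heat_deriv \<nu> (\<lambda>i. 2 * \<gamma> i + \<beta> i) t x / of_nat (mfact \<beta>) * ?I \<gamma> \<beta> z))" for z
    unfolding heat_taylor_def sum_distrib_right sum_distrib_left power_mult_distrib of_real_mult of_real_power
    by (intro sum.cong refl) (simp add: field_simps)
  have i: "integrable P (?I \<gamma> \<beta>)" if "\<gamma> \<in> {\<gamma>. 2 * mdeg \<gamma> \<le> k}" "\<beta> \<in> {\<beta>. mdeg \<beta> \<le> k - 2 * mdeg \<gamma>}" for \<gamma> \<beta> :: "'n \<Rightarrow> nat"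
    by (rule integrable_moment_source) (use that in auto)
  show "integrable P (\<lambda>z. heat_taylor \<nu> k t (fst z) x (snd z) * g (fst z) (snd z))"
    unfolding e by (intro Bochner_Integration.integrable_sum integrable_mult_right i)
  show "(\<integral>z. heat_taylor \<nu> k t (fst z) x (snd z) * g (fst z) (snd z) \<partial>P) =
    (\<Sum>\<gamma>\<in>{\<gamma>. 2 * mdeg \<gamma> \<le> k}. (- \<nu>) ^ mdeg \<gamma> / of_nat (mfact \<gamma>) * (\<Sum>\<beta>\<in>{\<beta>. mdeg \<beta> \<le> k - 2 * mdeg \<gamma>}.
       heat_deriv \<nu> (\<lambda>i. 2 * \<gamma> i + \<beta> i) t x / of_nat (mfact \<beta>) * integral\<^sup>L P (?I \<gamma> \<beta>)))"
    unfolding e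
    by (subst Bochner_Integration.integral_sum, intro integrable_mult_right Bochner_Integration.integrable_sum i, assumption, assumption, rule sum.cong[OF refl],
        subst integral_mult_right_zero, subst Bochner_Integration.integral_sum, intro integrable_mult_right i, assumption, assumption, simp only: integral_mult_right_zero)
qed

lemma integrable_heat_taylor_datum:
  "integrable lborel (\<lambda>y. heat_taylor \<nu> k t 0 x y * u0 y)"
  "(\<integral>y. heat_taylor \<nu> k t 0 x y * u0 y \<partial>lborel) =
    (\<Sum>\<beta>\<in>{\<beta>. mdeg \<beta> \<le> k}. heat_deriv \<nu> \<beta> t x / of_nat (mfact \<beta>) * (\<integral>y. of_real (mpow y \<beta>) * u0 y \<partial>lborel))"
proof -
  have e: "heat_taylor \<nu> k t 0 x y * u0 y = (\<Sum>\<beta>\<in>{\<beta>. mdeg \<beta> \<le> k}. heat_deriv \<nu> \<beta> t x / of_nat (mfact \<beta>) * (of_real (mpow y \<beta>) * u0 y))" for y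
  proof -
    \<comment> \<open>At s = 0 only \<gamma> = 0 survives: 0 ^ 0 = 1, and all higher powers of s
      vanish.\<close>
    have "heat_taylor \<nu> k t 0 x y = (\<Sum>\<gamma>\<in>{\<lambda>i. 0}. (- \<nu> * of_real 0) ^ mdeg \<gamma> / of_nat (mfact \<gamma>) *
     (\<Sum>\<beta>\<in>{\<beta>. mdeg \<beta> \<le> k - 2 * mdeg \<gamma>}. of_real (mpow y \<beta>) / of_nat (mfact \<beta>) * heat_deriv \<nu> (\<lambda>i. 2 * \<gamma> i + \<beta> i) t x))"
      unfolding heat_taylor_def
    proof (rule sum.mono_neutral_right)
      show "\<forall>\<gamma>\<in>{\<gamma>. 2 * mdeg \<gamma> \<le> k} - {\<lambda>i. 0}. (- \<nu> * of_real 0) ^ mdeg \<gamma> / of_nat (mfact \<gamma>) *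
     (\<Sum>\<beta>\<in>{\<beta>. mdeg \<beta> \<le> k - 2 * mdeg \<gamma>}. of_real (mpow y \<beta>) / of_nat (mfact \<beta>) * heat_deriv \<nu> (\<lambda>i. 2 * \<gamma> i + \<beta> i) t x) = 0"
      proof
        fix \<gamma> assume "\<gamma> \<in> {\<gamma> :: 'n \<Rightarrow> nat. 2 * mdeg \<gamma> \<le> k} - {\<lambda>i. 0}"
        then have "mdeg \<gamma> \<noteq> 0" by (auto simp: mdeg_def fun_eq_iff)
        then show "(- \<nu> * of_real 0) ^ mdeg \<gamma> / of_nat (mfact \<gamma>) *
     (\<Sum>\<beta>\<in>{\<beta>. mdeg \<beta> \<le> k - 2 * mdeg \<gamma>}. of_real (mpow y \<beta>) / of_nat (mfact \<beta>) * heat_deriv \<nu> (\<lambda>i. 2 * \<gamma> i + \<beta> i) t x) = 0" by simp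
      qed
    qed (simp_all add: finite_2mdeg_le, simp add: mdeg_def)
    also have "\<dots> = (\<Sum>\<beta>\<in>{\<beta>. mdeg \<beta> \<le> k}. of_real (mpow y \<beta>) / of_nat (mfact \<beta>) * heat_deriv \<nu> \<beta> t x)"
    proof -
      have z: "mdeg (\<lambda>i :: 'n. 0) = 0" "mfact (\<lambda>i :: 'n. 0) = 1" by (simp_all add: mdeg_def mfact_def)
      show ?thesis by (simp add: z)
    qed
    finally have e: "heat_taylor \<nu> k t 0 x y = (\<Sum>\<beta>\<in>{\<beta>. mdeg \<beta> \<le> k}. of_real (mpow y \<beta>) / of_nat (mfact \<beta>) * heat_deriv \<nu> \<beta> t x)" .
    show ?thesis unfolding e sum_distrib_right by (intro sum.cong refl) (simp add: mult_ac)
  qed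
  have i: "integrable lborel (\<lambda>y. of_real (mpow y \<beta>) * u0 y)" if "\<beta> \<in> {\<beta>. mdeg \<beta> \<le> k}" for \<beta>
    using that integrable_moment_datum by simp
  show "integrable lborel (\<lambda>y. heat_taylor \<nu> k t 0 x y * u0 y)"
    unfolding e by (intro Bochner_Integration.integrable_sum integrable_mult_right i)
  show "(\<integral>y. heat_taylor \<nu> k t 0 x y * u0 y \<partial>lborel) =
    (\<Sum>\<beta>\<in>{\<beta>. mdeg \<beta> \<le> k}. heat_deriv \<nu> \<beta> t x / of_nat (mfact \<beta>) * (\<integral>y. of_real (mpow y \<beta>) * u0 y \<partial>lborel))"
    unfolding e by (subst Bochner_Integration.integral_sum, intro integrable_mult_right i, assumption, simp only: integral_mult_right_zero)
qed


text \<open>On t/2 < s < t the decay factor is at most (t/2)^(-b), and the interval has length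
  t/2.\<close>

lemma tail_mass:
  assumes t: "t > 0" and f: "f \<in> borel_measurable P" and b: "b \<ge> 0" "c \<ge> 0"
    and fb: "\<And>s. s > 0 \<Longrightarrow> (\<integral>\<^sup>+ y. f (s, y) * ennreal (norm (g s y)) \<partial>lborel) \<le> ennreal (c * (1 + s) powr (- b))"
  shows "(\<integral>\<^sup>+ z. indicator {z. t / 2 < max 0 (fst z) \<and> max 0 (fst z) < t} z * f z * G z \<partial>P) \<le> ennreal (c * (t / 2) powr (1 - b))"
proof -
  let ?T = "{z :: real \<times> (real ^ 'n). t / 2 < max 0 (fst z) \<and> max 0 (fst z) < t}"
  have Tm: "?T \<inter> space P \<in> sets P" by measurable
  have [measurable]: "(indicator ?T :: _ \<Rightarrow> ennreal) \<in> borel_measurable P" using Tm by (simp add: borel_measurable_indicator_iff)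
  note [measurable] = f
  have "(\<integral>\<^sup>+ z. (indicator ?T z * f z) * G z \<partial>P) \<le> (\<integral>\<^sup>+ s. indicator {0<..} s * (ennreal (c * (t / 2) powr (- b)) * indicator {t / 2 .. t} s) \<partial>lborel)"
  proof (rule nn_integral_P_le)
    show "(\<lambda>z. indicator ?T z * f z) \<in> borel_measurable P" by measurable
    fix s :: real assume s: "s > 0"
    show "(\<integral>\<^sup>+ y. (indicator ?T (s, y) * f (s, y)) * ennreal (norm (g s y)) \<partial>lborel) \<le> ennreal (c * (t / 2) powr (- b)) * indicator {t / 2 .. t} s"
    proof (cases "t / 2 < s \<and> s < t")
      case True
      have "(\<integral>\<^sup>+ y. (indicator ?T (s, y) * f (s, y)) * ennreal (norm (g s y)) \<partial>lborel) \<le> (\<integral>\<^sup>+ y. f (s, y) * ennreal (norm (g s y)) \<partial>lborel)"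
        by (intro nn_integral_mono) (simp add: indicator_def)
      also have "\<dots> \<le> ennreal (c * (1 + s) powr (- b))" by (rule fb[OF s])
      also have "\<dots> \<le> ennreal (c * (t / 2) powr (- b))"
        using True t b by (intro ennreal_leI mult_left_mono powr_mono2') auto
      finally show ?thesis using True by simp
    next
      case False
      then have "indicator ?T (s, y) = (0 :: ennreal)" for y using s by (auto simp: indicator_def max_def)
      then show ?thesis by simp
    qed
  qed
  also have "\<dots> \<le> (\<integral>\<^sup>+ s. ennreal (c * (t / 2) powr (- b)) * indicator {t / 2 .. t} s \<partial>lborel)"
    by (intro nn_integral_mono) (simp add: indicator_def)
  also have "\<dots> = ennreal (c * (t / 2) powr (- b)) * ennreal (t / 2)"
    using t by (subst nn_integral_cmult_indicator) auto
  also have "\<dots> = ennreal (c * (t / 2) powr (1 - b))"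
  proof -
    have "(t / 2) powr (- b) * (t / 2) = (t / 2) powr (1 - b)" using powr_add[of "t / 2" "- b" 1] t by simp
    then show ?thesis using b t by (simp add: ennreal_mult[symmetric] mult.assoc)
  qed
  finally show ?thesis .
qed

text \<open>Duhamel's formula minus its integrated expansion, with absolute values inside both
  integrals; it will dominate the difference between solution and profile.\<close>

definition R :: "real \<Rightarrow> real ^ 'n \<Rightarrow> ennreal" where
  "R t x = (\<integral>\<^sup>+ y. ennreal (norm (heat_kernel \<nu> (t - 0) (x - y) - heat_taylor \<nu> k t 0 x y)) * ennreal (norm (u0 y)) \<partial>lborel)
     + (\<integral>\<^sup>+ z. ennreal (norm (heat_kernel \<nu> (t - max 0 (fst z)) (x - snd z) - heat_taylor \<nu> k t (max 0 (fst z)) x (snd z))) * G z \<partial>P)"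

definition I0 :: "real \<Rightarrow> ennreal" where
  "I0 t = (\<integral>\<^sup>+ y. ennreal ((sqrt 0 + norm y) ^ k * min 1 ((sqrt 0 + norm y) * t powr (- (1 / 2)))) * ennreal (norm (u0 y)) \<partial>lborel)"

definition I1 :: "real \<Rightarrow> ennreal" where
  "I1 t = (\<integral>\<^sup>+ z. ennreal ((sqrt (max 0 (fst z)) + norm (snd z)) ^ k * min 1 ((sqrt (max 0 (fst z)) + norm (snd z)) * t powr (- (1 / 2)))) * G z \<partial>P)"

lemma I0_tendsto: "(I0 \<longlongrightarrow> 0) at_top"
  unfolding I0_def
proof (rule weighted_tail_tendsto_0)
  show "(\<lambda>y. ennreal (norm (u0 y))) \<in> borel_measurable lborel" using u0m by measurable
  show "(\<integral>\<^sup>+ y. ennreal ((sqrt 0 + norm y) ^ k) * ennreal (norm (u0 y)) \<partial>lborel) < \<infinity>" using u0k by simp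
qed auto

lemma I1_tendsto: "(I1 \<longlongrightarrow> 0) at_top"
  unfolding I1_def
  by (rule weighted_tail_tendsto_0[of "\<lambda>z. sqrt (max 0 (fst z)) + norm (snd z)"])
    (use Gm weight_finite in \<open>simp_all add: w_def\<close>)

text \<open>Used with d = k/2, b = a and with d = k/2 + n/2, b = a + n/2; in both cases the
  condition is a > k/2 + 1.\<close>

lemma powr_tail_tendsto:
  assumes "d + 1 < b"
  shows "((\<lambda>t. ennreal (t powr d * (c * (t / 2) powr (1 - b)))) \<longlongrightarrow> 0) at_top"
proof -
  have "((\<lambda>t. c * 2 powr (b - 1) * t powr (d + 1 - b)) \<longlongrightarrow> c * 2 powr (b - 1) * 0) at_top"
    by (intro tendsto_intros tendsto_neg_powr filterlim_ident) (use assms in auto)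
  moreover have "\<forall>\<^sub>F t in at_top. c * 2 powr (b - 1) * t powr (d + 1 - b) = t powr d * (c * (t / 2) powr (1 - b))"
    using eventually_gt_at_top[of 0]
  proof eventually_elim
    case (elim t)
    have "(t / 2) powr (1 - b) = t powr (1 - b) * 2 powr (b - 1)"
      using elim by (simp add: powr_divide powr_diff field_simps)
    moreover have "t powr d * t powr (1 - b) = t powr (d + 1 - b)" using elim by (simp add: powr_add[symmetric] algebra_simps)
    ultimately show ?case by (simp add: mult_ac)
  qed
  ultimately have "((\<lambda>t. t powr d * (c * (t / 2) powr (1 - b))) \<longlongrightarrow> c * 2 powr (b - 1) * 0) at_top"
    by (rule Lim_transform_eventually)
  from tendsto_ennrealI[OF this] show ?thesis by simp
qed

text \<open>After scaling, the regular part becomes a constant times \<open>I0\<close> and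
  \<open>I1\<close>, which vanish in the limit by dominated convergence. The singular zone is small
  by \<open>tail_mass\<close>, applied to the mass of \<open>g s\<close> for L^1 and to the kernel
  convolved with \<open>g s\<close> for the supremum.\<close>

lemma R_L1_tendsto: "((\<lambda>t. ennreal (t powr (real k / 2)) * (\<integral>\<^sup>+ x. R t x \<partial>lborel)) \<longlongrightarrow> 0) at_top"
  and R_inf_bound: "\<exists>e. (e \<longlongrightarrow> 0) at_top \<and> (\<forall>t>0. \<forall>x. ennreal (t powr (real k / 2 + real CARD('n) / 2)) * R t x \<le> e t)"
proof -
  obtain C1 where C1: "C1 \<ge> 0" and C1': "\<forall>M \<sigma> (\<eta> :: real ^ 'n \<Rightarrow> real ^ 'n) G. sigma_finite_measure M \<longrightarrow>
    \<sigma> \<in> borel_measurable M \<longrightarrow> \<eta> \<in> borel_measurable M \<longrightarrow> G \<in> borel_measurable M \<longrightarrow> (\<forall>z. \<sigma> z \<ge> 0) \<longrightarrow>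
    (\<forall>t>0. (\<integral>\<^sup>+ x. (\<integral>\<^sup>+ z. ennreal (norm (heat_kernel \<nu> (t - \<sigma> z) (x - \<eta> z) - heat_taylor \<nu> k t (\<sigma> z) x (\<eta> z))) * G z \<partial>M) \<partial>lborel)
       \<le> ennreal (C1 * t powr (- (real k / 2))) * (\<integral>\<^sup>+ z. ennreal ((sqrt (\<sigma> z) + norm (\<eta> z)) ^ k * min 1 ((sqrt (\<sigma> z) + norm (\<eta> z)) * t powr (- (1 / 2)))) * G z \<partial>M)
         + ennreal C1 * (\<integral>\<^sup>+ z. indicator {z. t / 2 < \<sigma> z \<and> \<sigma> z < t} z * G z \<partial>M))
    \<and> (\<forall>t>0. \<forall>x. (\<integral>\<^sup>+ z. ennreal (norm (heat_kernel \<nu> (t - \<sigma> z) (x - \<eta> z) - heat_taylor \<nu> k t (\<sigma> z) x (\<eta> z))) * G z \<partial>M)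
       \<le> ennreal (C1 * t powr (- (real k / 2)) * t powr (- (real CARD('n) / 2))) * (\<integral>\<^sup>+ z. ennreal ((sqrt (\<sigma> z) + norm (\<eta> z)) ^ k * min 1 ((sqrt (\<sigma> z) + norm (\<eta> z)) * t powr (- (1 / 2)))) * G z \<partial>M)
         + (\<integral>\<^sup>+ z. indicator {z. t / 2 < \<sigma> z \<and> \<sigma> z < t} z * ennreal (norm (heat_kernel \<nu> (t - \<sigma> z) (x - \<eta> z))) * G z \<partial>M))"
    using expansion_remainder[OF nu, of k, where 'a="real ^ 'n" and 'n='n] by (elim exE conjE)
  obtain C2 where C2: "C2 \<ge> 0" and C2': "\<forall>M \<sigma> (\<eta> :: real \<times> (real ^ 'n) \<Rightarrow> real ^ 'n) G. sigma_finite_measure M \<longrightarrow>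
    \<sigma> \<in> borel_measurable M \<longrightarrow> \<eta> \<in> borel_measurable M \<longrightarrow> G \<in> borel_measurable M \<longrightarrow> (\<forall>z. \<sigma> z \<ge> 0) \<longrightarrow>
    (\<forall>t>0. (\<integral>\<^sup>+ x. (\<integral>\<^sup>+ z. ennreal (norm (heat_kernel \<nu> (t - \<sigma> z) (x - \<eta> z) - heat_taylor \<nu> k t (\<sigma> z) x (\<eta> z))) * G z \<partial>M) \<partial>lborel)
       \<le> ennreal (C2 * t powr (- (real k / 2))) * (\<integral>\<^sup>+ z. ennreal ((sqrt (\<sigma> z) + norm (\<eta> z)) ^ k * min 1 ((sqrt (\<sigma> z) + norm (\<eta> z)) * t powr (- (1 / 2)))) * G z \<partial>M)
         + ennreal C2 * (\<integral>\<^sup>+ z. indicator {z. t / 2 < \<sigma> z \<and> \<sigma> z < t} z * G z \<partial>M))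
    \<and> (\<forall>t>0. \<forall>x. (\<integral>\<^sup>+ z. ennreal (norm (heat_kernel \<nu> (t - \<sigma> z) (x - \<eta> z) - heat_taylor \<nu> k t (\<sigma> z) x (\<eta> z))) * G z \<partial>M)
       \<le> ennreal (C2 * t powr (- (real k / 2)) * t powr (- (real CARD('n) / 2))) * (\<integral>\<^sup>+ z. ennreal ((sqrt (\<sigma> z) + norm (\<eta> z)) ^ k * min 1 ((sqrt (\<sigma> z) + norm (\<eta> z)) * t powr (- (1 / 2)))) * G z \<partial>M)
         + (\<integral>\<^sup>+ z. indicator {z. t / 2 < \<sigma> z \<and> \<sigma> z < t} z * ennreal (norm (heat_kernel \<nu> (t - \<sigma> z) (x - \<eta> z))) * G z \<partial>M))"
    using expansion_remainder[OF nu, of k, where 'a="real \<times> (real ^ 'n)" and 'n='n] by (elim exE conjE)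
  obtain C3 where C3: "C3 \<ge> 0" and C3': "\<forall>t. \<forall>y :: real ^ 'n. (\<integral>\<^sup>+ x. ennreal (norm (heat_kernel \<nu> t (x - y))) \<partial>lborel) \<le> ennreal C3 \<and>
     (\<integral>\<^sup>+ x. ennreal (norm (heat_kernel \<nu> t (y - x))) \<partial>lborel) \<le> ennreal C3"
    using nn_integral_heat_kernel[OF nu, where 'n='n] by (elim exE conjE)
  have u0m': "(\<lambda>y. ennreal (norm (u0 y))) \<in> borel_measurable lborel" using u0m by measurable
  have sfP: "sigma_finite_measure P" unfolding lborel_prod by (rule sigma_finite_lborel)
  note D1 = C1'[rule_format, OF sigma_finite_lborel _ _ u0m', of "\<lambda>_. 0" "\<lambda>y. y"]
  note D2 = C2'[rule_format, OF sfP _ _ Gm, of "\<lambda>z. max 0 (fst z)" "\<lambda>z. snd z"]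
  have sm: "(\<lambda>z. max 0 (fst z)) \<in> borel_measurable P" "(\<lambda>z. snd z) \<in> borel_measurable P" by measurable
  have sm0: "(\<lambda>_ :: real ^ 'n. 0 :: real) \<in> borel_measurable lborel" "(\<lambda>y :: real ^ 'n. y) \<in> borel_measurable lborel" by simp_all
  define T1 where "T1 t = (\<integral>\<^sup>+ z. indicator {z. t / 2 < max 0 (fst z) \<and> max 0 (fst z) < t} z * G z \<partial>P)" for t
  have T1: "T1 t \<le> ennreal (C0 * (t / 2) powr (1 - a))" if "t > 0" for t
    using tail_mass[OF that, of "\<lambda>_. 1" a C0] g1 C0 a unfolding T1_def by simp
  have pm: "ennreal (t powr d) * ennreal (c * t powr (- d)) = ennreal c" if "t > 0" "c \<ge> 0" for t c d :: real
  proof -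
    have "t powr d * (c * t powr (- d)) = c" using that by (simp add: powr_minus)
    then show ?thesis using that by (simp add: ennreal_mult[symmetric])
  qed
  have km: "(\<lambda>(x, y). ennreal (norm (heat_kernel \<nu> (t - 0) (x - y) - heat_taylor \<nu> k t 0 x y)) * ennreal (norm (u0 y))) \<in> borel_measurable (lborel \<Otimes>\<^sub>M lborel)" for t
  proof -
    note [measurable] = heat_kernel_measurable[OF nu0, of _ "lborel \<Otimes>\<^sub>M lborel"] heat_taylor_measurable[OF nu0, of _ "lborel \<Otimes>\<^sub>M lborel"] u0m
    show ?thesis unfolding case_prod_beta by measurable
  qed
  have kmP: "(\<lambda>(x, z). ennreal (norm (heat_kernel \<nu> (t - max 0 (fst z)) (x - snd z) - heat_taylor \<nu> k t (max 0 (fst z)) x (snd z))) * G z) \<in> borel_measurable (lborel \<Otimes>\<^sub>M P)" for t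
  proof -
    note [measurable] = heat_kernel_measurable[OF nu0, of _ "lborel \<Otimes>\<^sub>M P"] heat_taylor_measurable[OF nu0, of _ "lborel \<Otimes>\<^sub>M P"]
    have [measurable]: "(\<lambda>p. G (snd p)) \<in> borel_measurable (lborel \<Otimes>\<^sub>M P)" by (rule measurable_compose[OF measurable_snd Gm])
    show ?thesis unfolding case_prod_beta by measurable
  qed
  {
    fix t :: real assume t: "t > 0"
    have "(\<integral>\<^sup>+ x. R t x \<partial>lborel) = (\<integral>\<^sup>+ x. \<integral>\<^sup>+ y. ennreal (norm (heat_kernel \<nu> (t - 0) (x - y) - heat_taylor \<nu> k t 0 x y)) * ennreal (norm (u0 y)) \<partial>lborel \<partial>lborel)
      + (\<integral>\<^sup>+ x. \<integral>\<^sup>+ z. ennreal (norm (heat_kernel \<nu> (t - max 0 (fst z)) (x - snd z) - heat_taylor \<nu> k t (max 0 (fst z)) x (snd z))) * G z \<partial>P \<partial>lborel)"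
      unfolding R_def by (rule nn_integral_add) (rule lborel.borel_measurable_nn_integral[OF km], rule sigma_finite_measure.borel_measurable_nn_integral[OF sfP kmP])
    also have "\<dots> \<le> ennreal (C1 * t powr (- (real k / 2))) * I0 t + (ennreal (C2 * t powr (- (real k / 2))) * I1 t + ennreal C2 * T1 t)"
    proof (rule add_mono)
      show "(\<integral>\<^sup>+ x. \<integral>\<^sup>+ y. ennreal (norm (heat_kernel \<nu> (t - 0) (x - y) - heat_taylor \<nu> k t 0 x y)) * ennreal (norm (u0 y)) \<partial>lborel \<partial>lborel) \<le> ennreal (C1 * t powr (- (real k / 2))) * I0 t"
        using conjunct1[OF D1[OF sm0], rule_format, OF _ t] t unfolding I0_def by simp
      show "(\<integral>\<^sup>+ x. \<integral>\<^sup>+ z. ennreal (norm (heat_kernel \<nu> (t - max 0 (fst z)) (x - snd z) - heat_taylor \<nu> k t (max 0 (fst z)) x (snd z))) * G z \<partial>P \<partial>lborel) \<le> ennreal (C2 * t powr (- (real k / 2))) * I1 t + ennreal C2 * T1 t"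
        using conjunct1[OF D2[OF sm], rule_format, OF _ t] unfolding I1_def T1_def by simp
    qed
    finally have "ennreal (t powr (real k / 2)) * (\<integral>\<^sup>+ x. R t x \<partial>lborel) \<le> ennreal (t powr (real k / 2)) * (ennreal (C1 * t powr (- (real k / 2))) * I0 t + (ennreal (C2 * t powr (- (real k / 2))) * I1 t + ennreal C2 * T1 t))"
      by (rule mult_left_mono) simp
    also have "\<dots> = ennreal C1 * I0 t + (ennreal C2 * I1 t + ennreal C2 * (ennreal (t powr (real k / 2)) * T1 t))"
      unfolding distrib_left mult.assoc[symmetric] pm[OF t C1] pm[OF t C2] by (simp add: mult_ac)
    also have "\<dots> \<le> ennreal C1 * I0 t + (ennreal C2 * I1 t + ennreal C2 * ennreal (t powr (real k / 2) * (C0 * (t / 2) powr (1 - a))))"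
      using T1[OF t] C0 by (intro add_left_mono mult_left_mono) (auto simp: ennreal_mult intro!: mult_left_mono)
    finally have "ennreal (t powr (real k / 2)) * (\<integral>\<^sup>+ x. R t x \<partial>lborel) \<le> ennreal C1 * I0 t + (ennreal C2 * I1 t + ennreal C2 * ennreal (t powr (real k / 2) * (C0 * (t / 2) powr (1 - a))))" .
  }
  note main1 = this
  have "((\<lambda>t. ennreal C1 * I0 t + (ennreal C2 * I1 t + ennreal C2 * ennreal (t powr (real k / 2) * (C0 * (t / 2) powr (1 - a))))) \<longlongrightarrow> ennreal C1 * 0 + (ennreal C2 * 0 + ennreal C2 * 0)) at_top"
    by (intro tendsto_add ennreal_tendsto_cmult I0_tendsto I1_tendsto powr_tail_tendsto) (use a in auto)
  then have lim1: "((\<lambda>t. ennreal C1 * I0 t + (ennreal C2 * I1 t + ennreal C2 * ennreal (t powr (real k / 2) * (C0 * (t / 2) powr (1 - a))))) \<longlongrightarrow> 0) at_top" by simp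
  show "((\<lambda>t. ennreal (t powr (real k / 2)) * (\<integral>\<^sup>+ x. R t x \<partial>lborel)) \<longlongrightarrow> 0) at_top"
    by (rule tendsto_sandwich[OF _ _ tendsto_const lim1]) (auto intro: eventually_mono[OF eventually_gt_at_top[of 0]] main1)
  let ?n = "real CARD('n) / 2"
  define e where "e t = ennreal C1 * I0 t + (ennreal C2 * I1 t + ennreal (t powr (real k / 2 + ?n) * (C3 * C0 * (t / 2) powr (1 - (a + ?n)))))" for t
  have "(e \<longlongrightarrow> ennreal C1 * 0 + (ennreal C2 * 0 + 0)) at_top"
    unfolding e_def by (intro tendsto_add ennreal_tendsto_cmult I0_tendsto I1_tendsto powr_tail_tendsto) (use a in auto)
  then have elim: "(e \<longlongrightarrow> 0) at_top" by simp
  have "ennreal (t powr (real k / 2 + ?n)) * R t x \<le> e t" if t: "t > 0" for t and x :: "real ^ 'n"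
  proof -
    have f: "(\<lambda>z. ennreal (norm (heat_kernel \<nu> (t - max 0 (fst z)) (x - snd z)))) \<in> borel_measurable P"
    proof -
      note [measurable] = heat_kernel_measurable[OF nu0, of _ P]
      show ?thesis by measurable
    qed
    \<comment> \<open>Near s = t only the mass of the kernel is under control, so the supremum of
      \<open>g s\<close> is taken out. It decays faster than the mass by (1+s)^(-n/2), as the target
      rate requires.\<close>
    have T2: "(\<integral>\<^sup>+ z. indicator {z. t / 2 < max 0 (fst z) \<and> max 0 (fst z) < t} z * ennreal (norm (heat_kernel \<nu> (t - max 0 (fst z)) (x - snd z))) * G z \<partial>P)
       \<le> ennreal (C3 * C0 * (t / 2) powr (1 - (a + ?n)))"
    proof (rule tail_mass[OF t f])
      fix s :: real assume s: "s > 0"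
      have "(\<integral>\<^sup>+ y. ennreal (norm (heat_kernel \<nu> (t - max 0 (fst (s, y))) (x - snd (s, y)))) * ennreal (norm (g s y)) \<partial>lborel)
         \<le> (\<integral>\<^sup>+ y. ennreal (norm (heat_kernel \<nu> (t - s) (x - y))) * ennreal (C0 * (1 + s) powr (- a - real CARD('n) / 2)) \<partial>lborel)"
      proof (rule nn_integral_mono_AE)
        show "AE y in lborel. ennreal (norm (heat_kernel \<nu> (t - max 0 (fst (s, y))) (x - snd (s, y)))) * ennreal (norm (g s y)) \<le> ennreal (norm (heat_kernel \<nu> (t - s) (x - y))) * ennreal (C0 * (1 + s) powr (- a - real CARD('n) / 2))"
          using ginf[OF s] by eventually_elim (use s in \<open>auto intro!: mult_left_mono ennreal_leI\<close>)
      qed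
      also have "\<dots> = (\<integral>\<^sup>+ y. ennreal (norm (heat_kernel \<nu> (t - s) (x - y))) \<partial>lborel) * ennreal (C0 * (1 + s) powr (- a - real CARD('n) / 2))"
      proof (rule nn_integral_multc)
        have "(\<lambda>y. heat_kernel \<nu> (t - s) (x - y)) \<in> borel_measurable lborel" by (rule heat_kernel_measurable[OF nu0]) measurable
        then show "(\<lambda>y. ennreal (norm (heat_kernel \<nu> (t - s) (x - y)))) \<in> borel_measurable lborel" by measurable
      qed
      also have "\<dots> \<le> ennreal C3 * ennreal (C0 * (1 + s) powr (- a - real CARD('n) / 2))"
        by (rule mult_right_mono[OF conjunct2[OF C3'[rule_format]]]) simp
      also have "\<dots> = ennreal (C3 * C0 * (1 + s) powr (- (a + ?n)))"
        using C3 C0 by (simp add: ennreal_mult[symmetric] mult.assoc)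
      finally show "(\<integral>\<^sup>+ y. ennreal (norm (heat_kernel \<nu> (t - max 0 (fst (s, y))) (x - snd (s, y)))) * ennreal (norm (g s y)) \<partial>lborel) \<le> ennreal (C3 * C0 * (1 + s) powr (- (a + ?n)))" .
    qed (use a C3 C0 in auto)
    have Rle: "R t x \<le> ennreal (C1 * t powr (- (real k / 2)) * t powr (- ?n)) * I0 t + (ennreal (C2 * t powr (- (real k / 2)) * t powr (- ?n)) * I1 t + ennreal (C3 * C0 * (t / 2) powr (1 - (a + ?n))))"
      unfolding R_def
    proof (rule add_mono)
      show "(\<integral>\<^sup>+ y. ennreal (norm (heat_kernel \<nu> (t - 0) (x - y) - heat_taylor \<nu> k t 0 x y)) * ennreal (norm (u0 y)) \<partial>lborel) \<le> ennreal (C1 * t powr (- (real k / 2)) * t powr (- ?n)) * I0 t"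
        using conjunct2[OF D1[OF sm0], rule_format, OF _ t, of x] t unfolding I0_def by simp
      show "(\<integral>\<^sup>+ z. ennreal (norm (heat_kernel \<nu> (t - max 0 (fst z)) (x - snd z) - heat_taylor \<nu> k t (max 0 (fst z)) x (snd z))) * G z \<partial>P) \<le> ennreal (C2 * t powr (- (real k / 2)) * t powr (- ?n)) * I1 t + ennreal (C3 * C0 * (t / 2) powr (1 - (a + ?n)))"
      proof (rule order_trans[OF _ add_left_mono[OF T2]])
        show "(\<integral>\<^sup>+ z. ennreal (norm (heat_kernel \<nu> (t - max 0 (fst z)) (x - snd z) - heat_taylor \<nu> k t (max 0 (fst z)) x (snd z))) * G z \<partial>P) \<le> ennreal (C2 * t powr (- (real k / 2)) * t powr (- ?n)) * I1 t
          + (\<integral>\<^sup>+ z. indicator {z. t / 2 < max 0 (fst z) \<and> max 0 (fst z) < t} z * ennreal (norm (heat_kernel \<nu> (t - max 0 (fst z)) (x - snd z))) * G z \<partial>P)"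
          unfolding I1_def by (rule conjunct2[OF D2[OF sm], rule_format, OF _ t]) simp
      qed
    qed
    have pp: "c * t powr (- (real k / 2)) * t powr (- ?n) = c * t powr (- (real k / 2 + ?n))" for c
      by (simp add: powr_add[symmetric])
    note Rle = Rle[unfolded pp]
    from Rle have "ennreal (t powr (real k / 2 + ?n)) * R t x \<le> ennreal (t powr (real k / 2 + ?n)) * (ennreal (C1 * t powr (- (real k / 2 + ?n))) * I0 t + (ennreal (C2 * t powr (- (real k / 2 + ?n))) * I1 t + ennreal (C3 * C0 * (t / 2) powr (1 - (a + ?n)))))"
      by (rule mult_left_mono) simp
    also have "\<dots> = ennreal C1 * I0 t + (ennreal C2 * I1 t + ennreal (t powr (real k / 2 + ?n)) * ennreal (C3 * C0 * (t / 2) powr (1 - (a + ?n))))"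
      unfolding distrib_left mult.assoc[symmetric] pm[OF t C1] pm[OF t C2] by simp
    also have "\<dots> = e t" unfolding e_def using C3 C0 by (simp add: ennreal_mult)
    finally show ?thesis .
  qed
  then show "\<exists>e. (e \<longlongrightarrow> 0) at_top \<and> (\<forall>t>0. \<forall>x. ennreal (t powr (real k / 2 + real CARD('n) / 2)) * R t x \<le> e t)" using elim by blast
qed

end

section \<open>Propagation of moments\<close>

lemma norm_integral_le_nn_integral:
  fixes f :: "'a \<Rightarrow> complex"
  shows "ennreal (norm (integral\<^sup>L M f)) \<le> (\<integral>\<^sup>+ x. ennreal (norm (f x)) \<partial>M)"
  by (cases "integrable M f") (auto intro: integral_norm_bound_ennreal simp: not_integrable_integral_eq)

text \<open>A contraction in a weighted norm: with \<beta>' = B (1+s)^(-a), the weight (1+t)^q exp(2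
  \<beta>) turns a bound M into A + M/2. Iteration from the a priori bound K leaves 2A. Independence
  of K is the point, as K depends on the truncation in the application.\<close>

lemma gronwall_decay:
  fixes N :: "real \<Rightarrow> ennreal"
  assumes bdd: "\<And>t. t > 0 \<Longrightarrow> N t \<le> ennreal K"
    and ineq: "\<And>t. t > 0 \<Longrightarrow> N t \<le> ennreal (A * (1 + t) powr q) + (\<integral>\<^sup>+ s. indicator {0<..<t} s * (ennreal (B * (1 + s) powr (- a)) * N s) \<partial>lborel)"
    and a: "a > 1" and q: "q \<ge> 0" and AB: "A \<ge> 0" "B \<ge> 0" "K \<ge> 0" and t: "t > 0"
  shows "N t \<le> ennreal (2 * A * exp (2 * (B / (a - 1))) * (1 + t) powr q)"
proof -
  \<comment> \<open>The antiderivative of B (1+s)^(-a) that vanishes at 0; it stays below B/(a - 1)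
    since a > 1.\<close>
  define \<beta> where "\<beta> t = B / (a - 1) * (1 - (1 + t) powr (1 - a))" for t
  define c where "c t = (1 + t) powr q * exp (2 * \<beta> t)" for t
  have \<beta>0: "\<beta> t \<ge> 0" if "t \<ge> 0" for t
  proof -
    have "(1 + t) powr (1 - a) \<le> (1 + t) powr 0" using that a by (intro powr_mono) auto
    then show ?thesis using AB a that by (auto simp: \<beta>_def intro!: mult_nonneg_nonneg)
  qed
  have c1: "c t \<ge> 1" if "t \<ge> 0" for t
  proof -
    have "1 * 1 \<le> (1 + t) powr q * exp (2 * \<beta> t)" using that q \<beta>0[OF that] by (intro mult_mono ge_one_powr_ge_zero) auto
    then show ?thesis by (simp add: c_def)
  qed
  \<comment> \<open>The exponent 2 \<beta> rather than \<beta> produces the factor 1/2 that makes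
    the iteration contract.\<close>
  have FTC: "(\<integral>\<^sup>+ s. ennreal (B * (1 + s) powr (- a) * exp (2 * \<beta> s)) * indicator {0..t} s \<partial>lborel) = ennreal (exp (2 * \<beta> t) / 2 - exp (2 * \<beta> 0) / 2)" if "t \<ge> 0" for t
  proof (rule nn_integral_FTC_Icc[where F="\<lambda>s. exp (2 * \<beta> s) / 2"])
    show "(\<lambda>s. B * (1 + s) powr (- a) * exp (2 * \<beta> s)) \<in> borel_measurable borel" unfolding \<beta>_def by measurable
    show "((\<lambda>s. exp (2 * \<beta> s) / 2) has_real_derivative B * (1 + s) powr (- a) * exp (2 * \<beta> s)) (at s)" if "s \<in> {0..t}" for s
    proof -
      have "1 + s \<noteq> 0" "1 + s > 0" "a - 1 \<noteq> 0" using that a by auto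
      then have "((\<lambda>s. (1 + s) powr (1 - a)) has_real_derivative (1 - a) * (1 + s) powr (- a)) (at s)"
        by (auto intro!: derivative_eq_intros)
      from DERIV_cmult[OF DERIV_diff[OF DERIV_const[of 1] this], of "B / (a - 1)"]
      have "(\<beta> has_real_derivative B * (1 + s) powr (- a)) (at s)"
        unfolding \<beta>_def by (rule DERIV_cong) (use a in \<open>simp add: field_simps\<close>)
      then show ?thesis by (auto intro!: derivative_eq_intros)
    qed
  qed (use AB that in auto)
  have step: "\<forall>t>0. N t \<le> ennreal ((A + M / 2) * c t)" if M: "M \<ge> 0" "\<forall>t>0. N t \<le> ennreal (M * c t)" for M
  proof (intro allI impI)
    fix t :: real assume t: "t > 0"
    have "(\<integral>\<^sup>+ s. indicator {0<..<t} s * (ennreal (B * (1 + s) powr (- a)) * N s) \<partial>lborel)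
      \<le> (\<integral>\<^sup>+ s. ennreal (M * (1 + t) powr q) * (ennreal (B * (1 + s) powr (- a) * exp (2 * \<beta> s)) * indicator {0..t} s) \<partial>lborel)"
    proof (rule nn_integral_mono)
      fix s
      show "indicator {0<..<t} s * (ennreal (B * (1 + s) powr (- a)) * N s) \<le> ennreal (M * (1 + t) powr q) * (ennreal (B * (1 + s) powr (- a) * exp (2 * \<beta> s)) * indicator {0..t} s)"
      proof (cases "0 < s \<and> s < t")
        case True
        have "ennreal (B * (1 + s) powr (- a)) * N s \<le> ennreal (B * (1 + s) powr (- a)) * ennreal (M * c s)"
          using M(2) True by (intro mult_left_mono) auto
        also have "\<dots> = ennreal (B * (1 + s) powr (- a) * (M * c s))" using AB M(1) by (simp add: ennreal_mult[symmetric] c_def)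
        also have "\<dots> \<le> ennreal (M * (1 + t) powr q * (B * (1 + s) powr (- a) * exp (2 * \<beta> s)))"
        proof (rule ennreal_leI)
          have "(1 + s) powr q \<le> (1 + t) powr q" using True q by (intro powr_mono2) auto
          then have "B * (1 + s) powr (- a) * M * exp (2 * \<beta> s) * (1 + s) powr q \<le> B * (1 + s) powr (- a) * M * exp (2 * \<beta> s) * (1 + t) powr q"
            using AB M(1) by (intro mult_left_mono) auto
          then show "B * (1 + s) powr (- a) * (M * c s) \<le> M * (1 + t) powr q * (B * (1 + s) powr (- a) * exp (2 * \<beta> s))"
            by (simp add: c_def mult_ac)
        qed
        also have "\<dots> = ennreal (M * (1 + t) powr q) * ennreal (B * (1 + s) powr (- a) * exp (2 * \<beta> s))"
          using M(1) AB by (intro ennreal_mult) auto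
        finally show ?thesis using True by simp
      next
        case False then show ?thesis by (auto simp: indicator_def)
      qed
    qed
    also have "\<dots> = ennreal (M * (1 + t) powr q) * ennreal (exp (2 * \<beta> t) / 2 - exp (2 * \<beta> 0) / 2)"
      using FTC[of t] t by (subst nn_integral_cmult) (auto simp: \<beta>_def)
    also have "\<dots> = ennreal (M * (1 + t) powr q * (exp (2 * \<beta> t) / 2 - 1 / 2))"
      using M(1) \<beta>0[of t] t by (simp add: ennreal_mult[symmetric] \<beta>_def)
    finally have "N t \<le> ennreal (A * (1 + t) powr q) + ennreal (M * (1 + t) powr q * (exp (2 * \<beta> t) / 2 - 1 / 2))"
      using ineq[OF t] by (meson add_left_mono order_trans)
    also have "\<dots> = ennreal (A * (1 + t) powr q + M * (1 + t) powr q * (exp (2 * \<beta> t) / 2 - 1 / 2))"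
      using AB M(1) \<beta>0[of t] t by (intro ennreal_plus[symmetric]) auto
    also have "\<dots> \<le> ennreal ((A + M / 2) * c t)"
    proof (rule ennreal_leI)
      have "A * (1 + t) powr q * 1 \<le> A * (1 + t) powr q * exp (2 * \<beta> t)" using AB \<beta>0[of t] t by (intro mult_left_mono) auto
      moreover have "M * (1 + t) powr q * (exp (2 * \<beta> t) / 2 - 1 / 2) \<le> M * (1 + t) powr q * (exp (2 * \<beta> t) / 2)" using M(1) by (intro mult_left_mono) auto
      ultimately show "A * (1 + t) powr q + M * (1 + t) powr q * (exp (2 * \<beta> t) / 2 - 1 / 2) \<le> (A + M / 2) * c t"
        unfolding c_def by (simp add: algebra_simps)
    qed
    finally show "N t \<le> ennreal ((A + M / 2) * c t)" .
  qed
  \<comment> \<open>The solution of M (j+1) = A + M j / 2 with M 0 = 2A + K, a start that the a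
    priori bound covers.\<close>
  define M where "M j = 2 * A + K * (1 / 2) ^ j" for j :: nat
  have "\<forall>t>0. N t \<le> ennreal (M j * c t)" for j
  proof (induction j)
    case 0
    show ?case
    proof (intro allI impI)
      fix t :: real assume t: "t > 0"
      have "K * 1 \<le> M 0 * c t" using AB c1[of t] t unfolding M_def by (intro mult_mono) auto
      then show "N t \<le> ennreal (M 0 * c t)" using order_trans[OF bdd[OF t] ennreal_leI] by simp
    qed
  next
    case (Suc j)
    have e: "M (Suc j) = A + M j / 2" by (simp add: M_def field_simps)
    have "M j \<ge> 0" using AB by (simp add: M_def)
    from step[OF this Suc] show ?case unfolding e .
  qed
  then have bd: "N t \<le> ennreal (M j * c t)" for j using t by blast
  have "(\<lambda>j. M j * c t) \<longlonglongrightarrow> (2 * A + K * 0) * c t"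
    unfolding M_def by (intro tendsto_intros LIMSEQ_power_zero) auto
  from tendsto_ennrealI[OF this] have "(\<lambda>j. ennreal (M j * c t)) \<longlonglongrightarrow> ennreal (2 * A * c t)" by simp
  then have "N t \<le> ennreal (2 * A * c t)" by (rule LIMSEQ_le_const) (use bd in blast)
  also have "\<dots> \<le> ennreal (2 * A * exp (2 * (B / (a - 1))) * (1 + t) powr q)"
  proof (rule ennreal_leI)
    have "\<beta> t \<le> B / (a - 1)" unfolding \<beta>_def using AB a by (intro mult_left_le) auto
    then have "2 * A * (1 + t) powr q * exp (2 * \<beta> t) \<le> 2 * A * (1 + t) powr q * exp (2 * (B / (a - 1)))"
      using AB by (intro mult_left_mono) auto
    then show "2 * A * c t \<le> 2 * A * exp (2 * (B / (a - 1))) * (1 + t) powr q" by (simp add: c_def mult_ac)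
  qed
  finally show ?thesis .
qed

text \<open>In the variable |x|/sqrt t half of the Gaussian rate absorbs the k-th power; undoing the
  scaling gives t^(k/2).\<close>

lemma nn_integral_heat_kernel_weighted:
  assumes nu: "Re \<nu> > 0"
  shows "\<exists>C\<ge>0. \<forall>t>0. \<forall>y :: real ^ 'n::finite. (\<integral>\<^sup>+ x. ennreal (norm (x - y) ^ k) * ennreal (norm (heat_kernel \<nu> t (x - y))) \<partial>lborel) \<le> ennreal (C * t powr (real k / 2))"
proof -
  have h: "gauss_rate \<nu> / 2 > 0" using gauss_rate_pos[OF nu] by simp
  obtain C where C: "C > 0" and C': "\<forall>t. \<forall>x :: real ^ 'n. norm (heat_kernel \<nu> t x) \<le> (if t > 0 then C * gauss_bound (gauss_rate \<nu>) t x else 0)"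
    using heat_kernel_bound[OF nu, where 'n='n] by (elim exE conjE)
  obtain E where E: "E > 0" and E': "\<forall>r\<ge>0. r ^ k * exp (- (gauss_rate \<nu> / 2) * r\<^sup>2) \<le> E"
    using power_times_exp_bound[OF h, of k] by (elim exE conjE)
  define g0 where "g0 = sqrt (pi / (gauss_rate \<nu> / 2)) ^ CARD('n)"
  have g0: "g0 \<ge> 0" using h by (simp add: g0_def)
  have "(\<integral>\<^sup>+ x. ennreal (norm (x - y) ^ k) * ennreal (norm (heat_kernel \<nu> t (x - y))) \<partial>lborel) \<le> ennreal (C * E * g0 * t powr (real k / 2))" if t: "t > 0" for t and y :: "real ^ 'n"
  proof -
    have pt: "norm x ^ k * norm (heat_kernel \<nu> t x) \<le> C * E * t powr (real k / 2) * gauss_bound (gauss_rate \<nu> / 2) t x" for x :: "real ^ 'n"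
    proof -
      define r where "r = norm x * t powr (- (1 / 2))"
      have r0: "r \<ge> 0" by (simp add: r_def)
      have r2: "r\<^sup>2 = (norm x)\<^sup>2 / t" unfolding r_def power_mult_distrib powr_half_sq[OF t] by simp
      have xr: "norm x = r * t powr (1 / 2)" unfolding r_def using t by (simp add: powr_minus field_simps)
      have xk: "norm x ^ k = r ^ k * t powr (real k / 2)"
        unfolding xr power_mult_distrib using t by (simp add: powr_power)
      have g: "gauss_bound (gauss_rate \<nu>) t x = exp (- (gauss_rate \<nu> / 2) * r\<^sup>2) * gauss_bound (gauss_rate \<nu> / 2) t x"
        unfolding gauss_bound_def r2 by (simp add: exp_add[symmetric] field_simps)
      have "norm x ^ k * norm (heat_kernel \<nu> t x) \<le> norm x ^ k * (C * gauss_bound (gauss_rate \<nu>) t x)"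
        using C'[rule_format, of t x] t by (intro mult_left_mono) auto
      also have "\<dots> = C * t powr (real k / 2) * gauss_bound (gauss_rate \<nu> / 2) t x * (r ^ k * exp (- (gauss_rate \<nu> / 2) * r\<^sup>2))"
        unfolding xk g by (simp add: mult_ac)
      also have "\<dots> \<le> C * t powr (real k / 2) * gauss_bound (gauss_rate \<nu> / 2) t x * E"
        using C E'[rule_format, OF r0] by (intro mult_left_mono mult_nonneg_nonneg gauss_bound_nonneg) auto
      finally show ?thesis by (simp add: mult_ac)
    qed
    have "(\<integral>\<^sup>+ x. ennreal (norm (x - y) ^ k) * ennreal (norm (heat_kernel \<nu> t (x - y))) \<partial>lborel) \<le> (\<integral>\<^sup>+ x. ennreal (C * E * t powr (real k / 2)) * ennreal (gauss_bound (gauss_rate \<nu> / 2) t (x - y)) \<partial>lborel)"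
    proof (rule nn_integral_mono)
      fix x :: "real ^ 'n"
      show "ennreal (norm (x - y) ^ k) * ennreal (norm (heat_kernel \<nu> t (x - y))) \<le> ennreal (C * E * t powr (real k / 2)) * ennreal (gauss_bound (gauss_rate \<nu> / 2) t (x - y))"
      proof -
        have "ennreal (norm (x - y) ^ k) * ennreal (norm (heat_kernel \<nu> t (x - y))) = ennreal (norm (x - y) ^ k * norm (heat_kernel \<nu> t (x - y)))"
          by (intro ennreal_mult[symmetric]) auto
        also have "\<dots> \<le> ennreal (C * E * t powr (real k / 2) * gauss_bound (gauss_rate \<nu> / 2) t (x - y))" by (rule ennreal_leI[OF pt])
        also have "\<dots> = ennreal (C * E * t powr (real k / 2)) * ennreal (gauss_bound (gauss_rate \<nu> / 2) t (x - y))"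
          using C E by (intro ennreal_mult gauss_bound_nonneg) auto
        finally show ?thesis .
      qed
    qed
    also have "\<dots> = ennreal (C * E * t powr (real k / 2)) * ennreal g0"
      by (subst nn_integral_cmult[OF gauss_bound_shift_measurable]) (simp only: g0_def nn_integral_gauss_bound_shift(1)[OF h t])
    also have "\<dots> = ennreal (C * E * g0 * t powr (real k / 2))" using C E g0 by (simp add: ennreal_mult[symmetric] mult_ac)
    finally show ?thesis .
  qed
  then show ?thesis using C E g0 by (intro exI[of _ "C * E * g0"]) auto
qed

text \<open>The truncated weight is controlled by 2^k |x - y|^k plus 2^k times its value at y,
  uniformly in R; the first part falls on the kernel, the second on \<phi>.\<close>

lemma truncated_weight_convolution:
  assumes nu: "Re \<nu> > 0"
  shows "\<exists>C\<ge>0. \<forall>t>0. \<forall>R\<ge>0. \<forall>\<phi> :: real ^ 'n::finite \<Rightarrow> complex. \<phi> \<in> borel_measurable lborel \<longrightarrow>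
    (\<integral>\<^sup>+ x. ennreal (min (norm x ^ k) R) * (\<integral>\<^sup>+ y. ennreal (norm (heat_kernel \<nu> t (x - y))) * ennreal (norm (\<phi> y)) \<partial>lborel) \<partial>lborel)
     \<le> ennreal (C * t powr (real k / 2)) * (\<integral>\<^sup>+ y. ennreal (norm (\<phi> y)) \<partial>lborel) + ennreal C * (\<integral>\<^sup>+ y. ennreal (min (norm y ^ k) R) * ennreal (norm (\<phi> y)) \<partial>lborel)"
proof -
  have nz: "\<nu> \<noteq> 0" using nu by auto
  obtain C1 where C1: "C1 \<ge> 0" and C1': "\<forall>t>0. \<forall>y :: real ^ 'n. (\<integral>\<^sup>+ x. ennreal (norm (x - y) ^ k) * ennreal (norm (heat_kernel \<nu> t (x - y))) \<partial>lborel) \<le> ennreal (C1 * t powr (real k / 2))"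
    using nn_integral_heat_kernel_weighted[OF nu, of k, where 'n='n] by (elim exE conjE)
  obtain C2 where C2: "C2 \<ge> 0" and C2': "\<forall>t. \<forall>y :: real ^ 'n. (\<integral>\<^sup>+ x. ennreal (norm (heat_kernel \<nu> t (x - y))) \<partial>lborel) \<le> ennreal C2 \<and>
     (\<integral>\<^sup>+ x. ennreal (norm (heat_kernel \<nu> t (y - x))) \<partial>lborel) \<le> ennreal C2"
    using nn_integral_heat_kernel[OF nu, where 'n='n] by (elim exE conjE)
  define C where "C = 2 ^ k * (C1 + C2)"
  have C: "C \<ge> 0" "2 ^ k * C1 \<le> C" "2 ^ k * C2 \<le> C" using C1 C2 by (auto simp: C_def)
  show ?thesis
  proof (intro exI[of _ C] conjI allI impI C(1))
    fix t R :: real and \<phi> :: "real ^ 'n \<Rightarrow> complex" assume t: "t > 0" and R: "R \<ge> 0" and \<phi>[measurable]: "\<phi> \<in> borel_measurable lborel"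
    define w where "w x = min (norm x ^ k) R" for x :: "real ^ 'n"
    have [measurable]: "w \<in> borel_measurable lborel" unfolding w_def[abs_def] by measurable
    have w0: "w x \<ge> 0" for x using R by (simp add: w_def)
    \<comment> \<open>If |y|^k exceeds R, then \<open>w y\<close> = R already bounds
      \<open>w x\<close>; otherwise the usual estimate of (|x - y| + |y|)^k applies.\<close>
    have wt: "w x \<le> 2 ^ k * norm (x - y) ^ k + 2 ^ k * w y" for x y
    proof (cases "norm y ^ k \<le> R")
      case True
      have "norm x ^ k \<le> (norm (x - y) + norm y) ^ k" by (intro power_mono) (use norm_triangle_ineq[of "x - y" y] in auto)
      also have "\<dots> \<le> 2 ^ k * (norm (x - y) ^ k + norm y ^ k)" by (intro add_power_le) auto
      finally show ?thesis using True by (simp add: w_def distrib_left min_def)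
    next
      case False
      have "R \<le> 2 ^ k * R" using R one_le_power[of "2::real" k] by (simp add: mult_le_cancel_right1)
      then have "w x \<le> 2 ^ k * w y" using False by (simp add: w_def)
      then show ?thesis by (simp add: add_increasing)
    qed
    have [measurable]: "(\<lambda>z. heat_kernel \<nu> t (fst z - snd z)) \<in> borel_measurable (lborel \<Otimes>\<^sub>M lborel)"
      by (rule heat_kernel_measurable[OF nz]) measurable
    have ky: "(\<integral>\<^sup>+ x. ennreal (w x) * ennreal (norm (heat_kernel \<nu> t (x - y))) \<partial>lborel) \<le> ennreal (C * t powr (real k / 2)) + ennreal C * ennreal (w y)" for y
    proof -
      note ks[measurable] = heat_kernel_shift_measurable[OF nz, of t y]
      have "(\<integral>\<^sup>+ x. ennreal (w x) * ennreal (norm (heat_kernel \<nu> t (x - y))) \<partial>lborel)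
        \<le> (\<integral>\<^sup>+ x. ennreal (2 ^ k) * (ennreal (norm (x - y) ^ k) * ennreal (norm (heat_kernel \<nu> t (x - y)))) + ennreal (2 ^ k * w y) * ennreal (norm (heat_kernel \<nu> t (x - y))) \<partial>lborel)"
      proof (rule nn_integral_mono)
        fix x :: "real ^ 'n"
        have "ennreal (w x) * ennreal (norm (heat_kernel \<nu> t (x - y))) \<le> ennreal (2 ^ k * norm (x - y) ^ k + 2 ^ k * w y) * ennreal (norm (heat_kernel \<nu> t (x - y)))"
          by (intro mult_right_mono ennreal_leI wt) simp
        also have "ennreal (2 ^ k * norm (x - y) ^ k + 2 ^ k * w y) = ennreal (2 ^ k) * ennreal (norm (x - y) ^ k) + ennreal (2 ^ k * w y)"
          using w0[of y] by (simp add: ennreal_plus ennreal_mult)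
        finally show "ennreal (w x) * ennreal (norm (heat_kernel \<nu> t (x - y))) \<le> ennreal (2 ^ k) * (ennreal (norm (x - y) ^ k) * ennreal (norm (heat_kernel \<nu> t (x - y)))) + ennreal (2 ^ k * w y) * ennreal (norm (heat_kernel \<nu> t (x - y)))"
          by (simp add: distrib_right mult.assoc)
      qed
      also have "\<dots> = ennreal (2 ^ k) * (\<integral>\<^sup>+ x. ennreal (norm (x - y) ^ k) * ennreal (norm (heat_kernel \<nu> t (x - y))) \<partial>lborel) + ennreal (2 ^ k * w y) * (\<integral>\<^sup>+ x. ennreal (norm (heat_kernel \<nu> t (x - y))) \<partial>lborel)"
      proof -
        have "(\<lambda>x. ennreal (norm (x - y) ^ k)) \<in> borel_measurable lborel" by measurable
        note m = borel_measurable_times_ennreal[OF this ks]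
        note add = nn_integral_add[OF borel_measurable_times_ennreal[OF borel_measurable_const m] borel_measurable_times_ennreal[OF borel_measurable_const ks]]
        show ?thesis unfolding add nn_integral_cmult[OF m] nn_integral_cmult[OF ks] ..
      qed
      also have "\<dots> \<le> ennreal (2 ^ k) * ennreal (C1 * t powr (real k / 2)) + ennreal (2 ^ k * w y) * ennreal C2"
        by (intro add_mono mult_left_mono C1'[rule_format, OF t] conjunct1[OF C2'[rule_format]]) auto
      also have "\<dots> = ennreal (2 ^ k * C1 * t powr (real k / 2)) + ennreal (2 ^ k * C2 * w y)"
        using C1 C2 w0[of y] by (simp add: ennreal_mult[symmetric] mult_ac)
      also have "\<dots> \<le> ennreal (C * t powr (real k / 2)) + ennreal (C * w y)"
        using C w0[of y] by (intro add_mono ennreal_leI mult_right_mono) auto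
      finally show ?thesis using C(1) w0[of y] by (simp add: ennreal_mult)
    qed
    have "(\<integral>\<^sup>+ x. ennreal (w x) * (\<integral>\<^sup>+ y. ennreal (norm (heat_kernel \<nu> t (x - y))) * ennreal (norm (\<phi> y)) \<partial>lborel) \<partial>lborel)
      = (\<integral>\<^sup>+ x. (\<integral>\<^sup>+ y. ennreal (w x) * ennreal (norm (heat_kernel \<nu> t (x - y))) * ennreal (norm (\<phi> y)) \<partial>lborel) \<partial>lborel)"
    proof (rule nn_integral_cong)
      fix x :: "real ^ 'n"
      have "(\<lambda>y. heat_kernel \<nu> t (x - y)) \<in> borel_measurable lborel" by (rule heat_kernel_measurable[OF nz]) measurable
      then have "(\<lambda>y. ennreal (norm (heat_kernel \<nu> t (x - y))) * ennreal (norm (\<phi> y))) \<in> borel_measurable lborel" by measurable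
      then show "ennreal (w x) * (\<integral>\<^sup>+ y. ennreal (norm (heat_kernel \<nu> t (x - y))) * ennreal (norm (\<phi> y)) \<partial>lborel) = (\<integral>\<^sup>+ y. ennreal (w x) * ennreal (norm (heat_kernel \<nu> t (x - y))) * ennreal (norm (\<phi> y)) \<partial>lborel)"
        unfolding mult.assoc by (rule nn_integral_cmult[symmetric])
    qed
    also have "\<dots> = (\<integral>\<^sup>+ y. (\<integral>\<^sup>+ x. ennreal (w x) * ennreal (norm (heat_kernel \<nu> t (x - y))) * ennreal (norm (\<phi> y)) \<partial>lborel) \<partial>lborel)"
    proof (rule lborel_pair.Fubini')
      show "(\<lambda>(y, x). ennreal (w x) * ennreal (norm (heat_kernel \<nu> t (x - y))) * ennreal (norm (\<phi> y))) \<in> borel_measurable (lborel \<Otimes>\<^sub>M lborel)"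
      proof -
        have [measurable]: "(\<lambda>z. heat_kernel \<nu> t (snd z - fst z)) \<in> borel_measurable (lborel \<Otimes>\<^sub>M lborel)"
          by (rule heat_kernel_measurable[OF nz]) measurable
        show ?thesis unfolding case_prod_beta by measurable
      qed
    qed
    also have "\<dots> \<le> (\<integral>\<^sup>+ y. ennreal (C * t powr (real k / 2)) * ennreal (norm (\<phi> y)) + ennreal C * (ennreal (w y) * ennreal (norm (\<phi> y))) \<partial>lborel)"
    proof (rule nn_integral_mono)
      fix y :: "real ^ 'n"
      have "(\<lambda>x. ennreal (w x) * ennreal (norm (heat_kernel \<nu> t (x - y)))) \<in> borel_measurable lborel"
        by (intro borel_measurable_times_ennreal heat_kernel_shift_measurable[OF nz]) measurable
      then have "(\<integral>\<^sup>+ x. ennreal (w x) * ennreal (norm (heat_kernel \<nu> t (x - y))) * ennreal (norm (\<phi> y)) \<partial>lborel) = (\<integral>\<^sup>+ x. ennreal (w x) * ennreal (norm (heat_kernel \<nu> t (x - y))) \<partial>lborel) * ennreal (norm (\<phi> y))"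
        by (rule nn_integral_multc)
      also have "\<dots> \<le> (ennreal (C * t powr (real k / 2)) + ennreal C * ennreal (w y)) * ennreal (norm (\<phi> y))"
        by (rule mult_right_mono[OF ky]) simp
      finally show "(\<integral>\<^sup>+ x. ennreal (w x) * ennreal (norm (heat_kernel \<nu> t (x - y))) * ennreal (norm (\<phi> y)) \<partial>lborel) \<le> ennreal (C * t powr (real k / 2)) * ennreal (norm (\<phi> y)) + ennreal C * (ennreal (w y) * ennreal (norm (\<phi> y)))"
        by (simp add: distrib_right mult.assoc)
    qed
    also have "\<dots> = ennreal (C * t powr (real k / 2)) * (\<integral>\<^sup>+ y. ennreal (norm (\<phi> y)) \<partial>lborel) + ennreal C * (\<integral>\<^sup>+ y. ennreal (w y) * ennreal (norm (\<phi> y)) \<partial>lborel)"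
      by (simp add: nn_integral_add nn_integral_cmult)
    finally show "(\<integral>\<^sup>+ x. ennreal (min (norm x ^ k) R) * (\<integral>\<^sup>+ y. ennreal (norm (heat_kernel \<nu> t (x - y))) * ennreal (norm (\<phi> y)) \<partial>lborel) \<partial>lborel)
     \<le> ennreal (C * t powr (real k / 2)) * (\<integral>\<^sup>+ y. ennreal (norm (\<phi> y)) \<partial>lborel) + ennreal C * (\<integral>\<^sup>+ y. ennreal (min (norm y ^ k) R) * ennreal (norm (\<phi> y)) \<partial>lborel)"
      unfolding w_def .
  qed
qed

text \<open>The bounded weights \<open>min |x|^k R\<close> are needed because the weighted norm of \<open>v t\<close> is not known to
  be finite beforehand.\<close>

lemma weighted_propagation:
  fixes u0 :: "real ^ 'n::finite \<Rightarrow> complex" and v g :: "real \<Rightarrow> real ^ 'n \<Rightarrow> complex"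
  assumes nu: "Re \<nu> > 0" and a: "a > 1" and B: "B \<ge> 0" and V: "V \<ge> 0"
    and u0m: "u0 \<in> borel_measurable lborel"
    and u01: "(\<integral>\<^sup>+ y. ennreal (norm (u0 y)) \<partial>lborel) < \<infinity>"
    and u0k: "(\<integral>\<^sup>+ y. ennreal (norm y ^ k) * ennreal (norm (u0 y)) \<partial>lborel) < \<infinity>"
    and vm: "(\<lambda>z. v (fst z) (snd z)) \<in> borel_measurable (lborel \<Otimes>\<^sub>M lborel)"
    and gm: "(\<lambda>z. g (fst z) (snd z)) \<in> borel_measurable (lborel \<Otimes>\<^sub>M lborel)"
    and v1: "\<And>t. t > 0 \<Longrightarrow> (\<integral>\<^sup>+ x. ennreal (norm (v t x)) \<partial>lborel) \<le> ennreal V"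
    and gv: "\<And>s. s > 0 \<Longrightarrow> AE y in lborel. norm (g s y) \<le> B * (1 + s) powr (- a) * norm (v s y)"
    and rep: "\<And>t. t > 0 \<Longrightarrow> AE x in lborel. ennreal (norm (v t x)) \<le> (\<integral>\<^sup>+ y. ennreal (norm (heat_kernel \<nu> t (x - y))) * ennreal (norm (u0 y)) \<partial>lborel)
       + (\<integral>\<^sup>+ s. indicator {0<..<t} s * (\<integral>\<^sup>+ y. ennreal (norm (heat_kernel \<nu> (t - s) (x - y))) * ennreal (norm (g s y)) \<partial>lborel) \<partial>lborel)"
  shows "\<exists>M\<ge>0. \<forall>t>0. (\<integral>\<^sup>+ x. ennreal (norm x ^ k) * ennreal (norm (v t x)) \<partial>lborel) \<le> ennreal (M * (1 + t) powr (real k / 2))"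
proof -
  have nz: "\<nu> \<noteq> 0" using nu by auto
  obtain C where C: "C \<ge> 0" and C': "\<forall>t>0. \<forall>R\<ge>0. \<forall>\<phi> :: real ^ 'n \<Rightarrow> complex. \<phi> \<in> borel_measurable lborel \<longrightarrow>
    (\<integral>\<^sup>+ x. ennreal (min (norm x ^ k) R) * (\<integral>\<^sup>+ y. ennreal (norm (heat_kernel \<nu> t (x - y))) * ennreal (norm (\<phi> y)) \<partial>lborel) \<partial>lborel)
     \<le> ennreal (C * t powr (real k / 2)) * (\<integral>\<^sup>+ y. ennreal (norm (\<phi> y)) \<partial>lborel) + ennreal C * (\<integral>\<^sup>+ y. ennreal (min (norm y ^ k) R) * ennreal (norm (\<phi> y)) \<partial>lborel)"
    using truncated_weight_convolution[OF nu, of k, where 'n='n] by (elim exE conjE)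
  define U1 where "U1 = enn2real (\<integral>\<^sup>+ y. ennreal (norm (u0 y)) \<partial>lborel)"
  define Uk where "Uk = enn2real (\<integral>\<^sup>+ y. ennreal (norm y ^ k) * ennreal (norm (u0 y)) \<partial>lborel)"
  define J where "J = enn2real (\<integral>\<^sup>+ s. indicator {0<..} s * ennreal ((1 + s) powr (- a)) \<partial>lborel)"
  have U: "(\<integral>\<^sup>+ y. ennreal (norm (u0 y)) \<partial>lborel) = ennreal U1" "(\<integral>\<^sup>+ y. ennreal (norm y ^ k) * ennreal (norm (u0 y)) \<partial>lborel) = ennreal Uk"
    "(\<integral>\<^sup>+ s. indicator {0<..} s * ennreal ((1 + s) powr (- a)) \<partial>lborel) = ennreal J"
    using u01 u0k nn_integral_powr_decay[OF a] unfolding U1_def Uk_def J_def by simp_all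
  have U0: "U1 \<ge> 0" "Uk \<ge> 0" "J \<ge> 0" by (simp_all add: U1_def Uk_def J_def)
  \<comment> \<open>C U1 and C Uk come from the datum. C B V J comes from the part of the source
    term in which the weight falls on the kernel, where only the mass bound V of \<open>v s\<close>
    enters.\<close>
  define A where "A = C * U1 + C * Uk + C * B * V * J"
  have A: "A \<ge> 0" using C U0 B V by (simp add: A_def)
  define q where "q = real k / 2"
  have q: "q \<ge> 0" by (simp add: q_def)
  note [measurable] = u0m
  have vt[measurable]: "v s \<in> borel_measurable lborel" for s
  proof -
    have "(\<lambda>y. (s, y)) \<in> measurable lborel (lborel \<Otimes>\<^sub>M lborel)" by measurable
    from measurable_compose[OF this vm] show ?thesis by simp
  qed
  have gs[measurable]: "g s \<in> borel_measurable lborel" for s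
  proof -
    have "(\<lambda>y. (s, y)) \<in> measurable lborel (lborel \<Otimes>\<^sub>M lborel)" by measurable
    from measurable_compose[OF this gm] show ?thesis by simp
  qed
  have bound: "(\<integral>\<^sup>+ x. ennreal (min (norm x ^ k) R) * ennreal (norm (v t x)) \<partial>lborel) \<le> ennreal (2 * A * exp (2 * (C * B / (a - 1))) * (1 + t) powr q)" if R: "R \<ge> 0" and t: "t > 0" for R t
  \<comment> \<open>The a priori bound R V is finite because the weight is truncated. It disappears
    from the conclusion, so R may tend to infinity afterwards.\<close>
  proof (rule gronwall_decay[where N="\<lambda>t. \<integral>\<^sup>+ x. ennreal (min (norm x ^ k) R) * ennreal (norm (v t x)) \<partial>lborel" and K="R * V", OF _ _ a q A _ _ t])
    let ?N = "\<lambda>t. \<integral>\<^sup>+ x. ennreal (min (norm x ^ k) R) * ennreal (norm (v t x)) \<partial>lborel"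
    show "C * B \<ge> 0" "R * V \<ge> 0" using C B R V by simp_all
    fix t :: real assume t: "t > 0"
    have "?N t \<le> (\<integral>\<^sup>+ x. ennreal R * ennreal (norm (v t x)) \<partial>lborel)"
      by (intro nn_integral_mono mult_right_mono ennreal_leI) auto
    also have "\<dots> = ennreal R * (\<integral>\<^sup>+ x. ennreal (norm (v t x)) \<partial>lborel)" by (rule nn_integral_cmult) measurable
    also have "\<dots> \<le> ennreal R * ennreal V" by (intro mult_left_mono v1 t) simp
    also have "\<dots> = ennreal (R * V)" using R V by (simp add: ennreal_mult)
    finally show "?N t \<le> ennreal (R * V)" .
    let ?w = "\<lambda>x :: real ^ 'n. ennreal (min (norm x ^ k) R)"
    let ?k0 = "\<lambda>x. \<integral>\<^sup>+ y. ennreal (norm (heat_kernel \<nu> t (x - y))) * ennreal (norm (u0 y)) \<partial>lborel"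
    let ?k1 = "\<lambda>s x. \<integral>\<^sup>+ y. ennreal (norm (heat_kernel \<nu> (t - s) (x - y))) * ennreal (norm (g s y)) \<partial>lborel"
    have k0m: "(\<lambda>x. ?w x * ?k0 x) \<in> borel_measurable lborel"
    proof -
      have [measurable]: "(\<lambda>z. heat_kernel \<nu> t (fst z - snd z)) \<in> borel_measurable (lborel \<Otimes>\<^sub>M lborel)" by (rule heat_kernel_measurable[OF nz]) measurable
      have "?k0 \<in> borel_measurable lborel" by (rule lborel.borel_measurable_nn_integral) (unfold case_prod_beta, measurable)
      then show ?thesis by measurable
    qed
    have k1m: "(\<lambda>z. ?k1 (fst z) (snd z)) \<in> borel_measurable (lborel \<Otimes>\<^sub>M lborel)"
    proof (rule lborel.borel_measurable_nn_integral)
      have 1: "(\<lambda>p. heat_kernel \<nu> (t - fst (fst p)) (snd (fst p) - snd p)) \<in> borel_measurable ((lborel \<Otimes>\<^sub>M lborel) \<Otimes>\<^sub>M (lborel :: (real ^ 'n) measure))" by (rule heat_kernel_measurable[OF nz]) measurable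
      have "(\<lambda>p. (fst (fst p), snd p)) \<in> measurable ((lborel \<Otimes>\<^sub>M lborel) \<Otimes>\<^sub>M lborel) (lborel \<Otimes>\<^sub>M lborel)" by measurable
      from measurable_compose[OF this gm] have 2: "(\<lambda>p. g (fst (fst p)) (snd p)) \<in> borel_measurable ((lborel \<Otimes>\<^sub>M lborel) \<Otimes>\<^sub>M lborel)" by simp
      show "(\<lambda>(z, y). ennreal (norm (heat_kernel \<nu> (t - fst z) (snd z - y))) * ennreal (norm (g (fst z) y))) \<in> borel_measurable ((lborel \<Otimes>\<^sub>M lborel) \<Otimes>\<^sub>M lborel)"
        using 1 2 unfolding case_prod_beta by measurable
    qed
    have k1x: "(\<lambda>s. indicator {0<..<t} s * ?k1 s x) \<in> borel_measurable lborel" for x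
    proof -
      have "(\<lambda>s. (s, x)) \<in> measurable lborel (lborel \<Otimes>\<^sub>M lborel)" by measurable
      from measurable_compose[OF this k1m] have "(\<lambda>s. ?k1 s x) \<in> borel_measurable lborel" by simp
      then show ?thesis by measurable
    qed
    have "?N t \<le> (\<integral>\<^sup>+ x. ?w x * ?k0 x + ?w x * (\<integral>\<^sup>+ s. indicator {0<..<t} s * ?k1 s x \<partial>lborel) \<partial>lborel)"
    proof (rule nn_integral_mono_AE)
      show "AE x in lborel. ?w x * ennreal (norm (v t x)) \<le> ?w x * ?k0 x + ?w x * (\<integral>\<^sup>+ s. indicator {0<..<t} s * ?k1 s x \<partial>lborel)"
        using rep[OF t] unfolding distrib_left[symmetric] by eventually_elim (rule mult_left_mono, simp_all)
    qed
    also have "\<dots> = (\<integral>\<^sup>+ x. ?w x * ?k0 x \<partial>lborel) + (\<integral>\<^sup>+ x. ?w x * (\<integral>\<^sup>+ s. indicator {0<..<t} s * ?k1 s x \<partial>lborel) \<partial>lborel)"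
    proof (rule nn_integral_add[OF k0m])
      have [measurable]: "(\<lambda>z. ?k1 (snd z) (fst z)) \<in> borel_measurable (lborel \<Otimes>\<^sub>M lborel)"
        using measurable_compose[OF measurable_pair_swap' k1m] by (simp add: case_prod_beta)
      have "(\<lambda>x. \<integral>\<^sup>+ s. indicator {0<..<t} s * ?k1 s x \<partial>lborel) \<in> borel_measurable lborel"
        by (rule lborel.borel_measurable_nn_integral) (unfold case_prod_beta, measurable)
      then show "(\<lambda>x. ?w x * (\<integral>\<^sup>+ s. indicator {0<..<t} s * ?k1 s x \<partial>lborel)) \<in> borel_measurable lborel" by measurable
    qed
    also have "(\<integral>\<^sup>+ x. ?w x * (\<integral>\<^sup>+ s. indicator {0<..<t} s * ?k1 s x \<partial>lborel) \<partial>lborel) = (\<integral>\<^sup>+ s. indicator {0<..<t} s * (\<integral>\<^sup>+ x. ?w x * ?k1 s x \<partial>lborel) \<partial>lborel)"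
    proof -
      have "(\<integral>\<^sup>+ x. ?w x * (\<integral>\<^sup>+ s. indicator {0<..<t} s * ?k1 s x \<partial>lborel) \<partial>lborel) = (\<integral>\<^sup>+ x. (\<integral>\<^sup>+ s. ?w x * (indicator {0<..<t} s * ?k1 s x) \<partial>lborel) \<partial>lborel)"
        by (intro nn_integral_cong nn_integral_cmult[symmetric] k1x)
      also have "\<dots> = (\<integral>\<^sup>+ s. (\<integral>\<^sup>+ x. ?w x * (indicator {0<..<t} s * ?k1 s x) \<partial>lborel) \<partial>lborel)"
      proof (rule lborel_pair.Fubini')
        show "(\<lambda>(s, x). ?w x * (indicator {0<..<t} s * ?k1 s x)) \<in> borel_measurable (lborel \<Otimes>\<^sub>M lborel)"
          using k1m unfolding case_prod_beta by measurable
      qed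
      also have "\<dots> = (\<integral>\<^sup>+ s. indicator {0<..<t} s * (\<integral>\<^sup>+ x. ?w x * ?k1 s x \<partial>lborel) \<partial>lborel)"
        by (intro nn_integral_cong) (simp add: indicator_def)
      finally show ?thesis .
    qed
    finally have N1: "?N t \<le> (\<integral>\<^sup>+ x. ?w x * ?k0 x \<partial>lborel) + (\<integral>\<^sup>+ s. indicator {0<..<t} s * (\<integral>\<^sup>+ x. ?w x * ?k1 s x \<partial>lborel) \<partial>lborel)" .
    have N2: "(\<integral>\<^sup>+ x. ?w x * ?k0 x \<partial>lborel) \<le> ennreal ((C * U1 + C * Uk) * (1 + t) powr q)"
    proof -
      have "(\<integral>\<^sup>+ y. ?w y * ennreal (norm (u0 y)) \<partial>lborel) \<le> ennreal Uk"
        unfolding U(2)[symmetric] by (intro nn_integral_mono mult_right_mono ennreal_leI) auto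
      then have "(\<integral>\<^sup>+ x. ?w x * ?k0 x \<partial>lborel) \<le> ennreal (C * t powr q) * ennreal U1 + ennreal C * ennreal Uk"
        using C'[rule_format, OF t R u0m] unfolding U(1) q_def by (meson add_left_mono mult_left_mono order_trans zero_le)
      also have "\<dots> = ennreal (C * U1 * t powr q + C * Uk)" using C U0 by (simp add: ennreal_mult[symmetric] ennreal_plus[symmetric] mult_ac del: ennreal_plus)
      also have "\<dots> \<le> ennreal ((C * U1 + C * Uk) * (1 + t) powr q)"
      proof (rule ennreal_leI)
        have "C * U1 * t powr q \<le> C * U1 * (1 + t) powr q" using C U0 q t by (intro mult_left_mono powr_mono2) auto
        moreover have "C * Uk * 1 \<le> C * Uk * (1 + t) powr q" using C U0 q t by (intro mult_left_mono ge_one_powr_ge_zero) auto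
        ultimately show "C * U1 * t powr q + C * Uk \<le> (C * U1 + C * Uk) * (1 + t) powr q" by (simp add: distrib_right)
      qed
      finally show ?thesis .
    qed
    \<comment> \<open>The kernel part of the weight meets the mass of \<open>g s\<close> and is
      integrated in time; the other part reproduces the truncated moment under the integral.\<close>
    have N3: "(\<integral>\<^sup>+ s. indicator {0<..<t} s * (\<integral>\<^sup>+ x. ?w x * ?k1 s x \<partial>lborel) \<partial>lborel)
      \<le> ennreal (C * B * V * J * (1 + t) powr q) + (\<integral>\<^sup>+ s. indicator {0<..<t} s * (ennreal (C * B * (1 + s) powr (- a)) * ?N s) \<partial>lborel)"
    proof -
      have "(\<integral>\<^sup>+ s. indicator {0<..<t} s * (\<integral>\<^sup>+ x. ?w x * ?k1 s x \<partial>lborel) \<partial>lborel)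
        \<le> (\<integral>\<^sup>+ s. ennreal (C * B * V * (1 + t) powr q) * (indicator {0<..} s * ennreal ((1 + s) powr (- a))) + indicator {0<..<t} s * (ennreal (C * B * (1 + s) powr (- a)) * ?N s) \<partial>lborel)"
      proof (rule nn_integral_mono)
        fix s :: real
        show "indicator {0<..<t} s * (\<integral>\<^sup>+ x. ?w x * ?k1 s x \<partial>lborel) \<le> ennreal (C * B * V * (1 + t) powr q) * (indicator {0<..} s * ennreal ((1 + s) powr (- a))) + indicator {0<..<t} s * (ennreal (C * B * (1 + s) powr (- a)) * ?N s)"
        proof (cases "0 < s \<and> s < t")
          case True
          then have s: "s > 0" "t - s > 0" by auto
          let ?b = "B * (1 + s) powr (- a)"
          have b0: "?b \<ge> 0" using B by simp
          have e1: "(\<integral>\<^sup>+ y. ennreal (norm (g s y)) \<partial>lborel) \<le> ennreal (?b * V)"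
          proof -
            have "(\<integral>\<^sup>+ y. ennreal (norm (g s y)) \<partial>lborel) \<le> (\<integral>\<^sup>+ y. ennreal ?b * ennreal (norm (v s y)) \<partial>lborel)"
            proof (rule nn_integral_mono_AE)
              show "AE y in lborel. ennreal (norm (g s y)) \<le> ennreal ?b * ennreal (norm (v s y))"
                using gv[OF s(1)] by eventually_elim (use b0 in \<open>simp add: ennreal_mult[symmetric] ennreal_leI\<close>)
            qed
            also have "\<dots> = ennreal ?b * (\<integral>\<^sup>+ y. ennreal (norm (v s y)) \<partial>lborel)" by (rule nn_integral_cmult) measurable
            also have "\<dots> \<le> ennreal ?b * ennreal V" by (intro mult_left_mono v1 s) simp
            also have "\<dots> = ennreal (?b * V)" using b0 V by (simp add: ennreal_mult)
            finally show ?thesis .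
          qed
          have e2: "(\<integral>\<^sup>+ y. ?w y * ennreal (norm (g s y)) \<partial>lborel) \<le> ennreal ?b * ?N s"
          proof -
            have "(\<integral>\<^sup>+ y. ?w y * ennreal (norm (g s y)) \<partial>lborel) \<le> (\<integral>\<^sup>+ y. ennreal ?b * (?w y * ennreal (norm (v s y))) \<partial>lborel)"
            proof (rule nn_integral_mono_AE)
              show "AE y in lborel. ?w y * ennreal (norm (g s y)) \<le> ennreal ?b * (?w y * ennreal (norm (v s y)))"
                using gv[OF s(1)]
              proof eventually_elim
                case (elim y)
                then have "ennreal (norm (g s y)) \<le> ennreal ?b * ennreal (norm (v s y))" using b0 by (simp add: ennreal_mult[symmetric] ennreal_leI)
                then have "?w y * ennreal (norm (g s y)) \<le> ?w y * (ennreal ?b * ennreal (norm (v s y)))" by (rule mult_left_mono) simp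
                then show ?case by (simp only: mult_ac)
              qed
            qed
            also have "\<dots> = ennreal ?b * ?N s" by (rule nn_integral_cmult) measurable
            finally show ?thesis .
          qed
          have "(\<integral>\<^sup>+ x. ?w x * ?k1 s x \<partial>lborel) \<le> ennreal (C * (t - s) powr (real k / 2)) * (\<integral>\<^sup>+ y. ennreal (norm (g s y)) \<partial>lborel) + ennreal C * (\<integral>\<^sup>+ y. ?w y * ennreal (norm (g s y)) \<partial>lborel)"
            by (rule C'[rule_format, OF s(2) R gs])
          also have "\<dots> \<le> ennreal (C * (1 + t) powr q) * ennreal (?b * V) + ennreal C * (ennreal ?b * ?N s)"
            using C s q unfolding q_def by (intro add_mono mult_mono e1 e2 ennreal_leI mult_left_mono powr_mono2) auto
          also have "\<dots> = ennreal (C * B * V * (1 + t) powr q) * ennreal ((1 + s) powr (- a)) + ennreal (C * B * (1 + s) powr (- a)) * ?N s"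
            using C B V by (simp add: ennreal_mult mult_ac)
          finally show ?thesis using True by simp
        next
          case False
          then have "s \<notin> {0<..<t}" by auto
          then show ?thesis by simp
        qed
      qed
      also have "\<dots> = ennreal (C * B * V * (1 + t) powr q) * ennreal J + (\<integral>\<^sup>+ s. indicator {0<..<t} s * (ennreal (C * B * (1 + s) powr (- a)) * ?N s) \<partial>lborel)"
      proof -
        have "?N \<in> borel_measurable lborel"
          by (rule lborel.borel_measurable_nn_integral) (use vm in \<open>unfold case_prod_beta, measurable\<close>)
        then have m1: "(\<lambda>s. indicator {0<..<t} s * (ennreal (C * B * (1 + s) powr (- a)) * ?N s)) \<in> borel_measurable lborel" by measurable
        have m2: "(\<lambda>s. indicator {0<..} s * ennreal ((1 + s) powr (- a))) \<in> borel_measurable lborel" by measurable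
        show ?thesis
          unfolding nn_integral_add[OF borel_measurable_times_ennreal[OF borel_measurable_const m2] m1] nn_integral_cmult[OF m2] U(3) ..
      qed
      also have "ennreal (C * B * V * (1 + t) powr q) * ennreal J = ennreal (C * B * V * J * (1 + t) powr q)"
        using C B V U0 by (simp add: ennreal_mult[symmetric] mult_ac)
      finally show ?thesis .
    qed
    have "?N t \<le> ennreal ((C * U1 + C * Uk) * (1 + t) powr q) + (ennreal (C * B * V * J * (1 + t) powr q) + (\<integral>\<^sup>+ s. indicator {0<..<t} s * (ennreal (C * B * (1 + s) powr (- a)) * ?N s) \<partial>lborel))"
      by (rule order_trans[OF N1 add_mono[OF N2 N3]])
    also have "\<dots> = ennreal (A * (1 + t) powr q) + (\<integral>\<^sup>+ s. indicator {0<..<t} s * (ennreal (C * B * (1 + s) powr (- a)) * ?N s) \<partial>lborel)"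
    proof -
      have "ennreal (A * (1 + t) powr q) = ennreal ((C * U1 + C * Uk) * (1 + t) powr q) + ennreal (C * B * V * J * (1 + t) powr q)"
        using C U0 B V by (subst ennreal_plus[symmetric]) (auto simp: A_def algebra_simps)
      then show ?thesis by (simp add: add.assoc)
    qed
    finally show "?N t \<le> ennreal (A * (1 + t) powr q) + (\<integral>\<^sup>+ s. indicator {0<..<t} s * (ennreal (C * B * (1 + s) powr (- a)) * ?N s) \<partial>lborel)" .
  qed
  show ?thesis
  proof (intro exI[of _ "2 * A * exp (2 * (C * B / (a - 1)))"] conjI allI impI)
    show "0 \<le> 2 * A * exp (2 * (C * B / (a - 1)))" using A by simp
    fix t :: real assume t: "t > 0"
    \<comment> \<open>Monotone convergence in R removes the truncation.\<close>
    have "(\<integral>\<^sup>+ x. ennreal (norm x ^ k) * ennreal (norm (v t x)) \<partial>lborel) = (\<integral>\<^sup>+ x. (SUP R :: nat. ennreal (min (norm x ^ k) (real R)) * ennreal (norm (v t x))) \<partial>lborel)"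
    proof (rule nn_integral_cong)
      fix x :: "real ^ 'n"
      show "ennreal (norm x ^ k) * ennreal (norm (v t x)) = (SUP R :: nat. ennreal (min (norm x ^ k) (real R)) * ennreal (norm (v t x)))"
      proof (rule antisym)
        obtain R :: nat where "norm x ^ k \<le> real R" using real_arch_simple by blast
        then show "ennreal (norm x ^ k) * ennreal (norm (v t x)) \<le> (SUP R :: nat. ennreal (min (norm x ^ k) (real R)) * ennreal (norm (v t x)))"
          by (intro SUP_upper2[of R]) (auto simp: min_def)
      qed (auto intro!: SUP_least mult_right_mono ennreal_leI)
    qed
    also have "\<dots> = (SUP R :: nat. \<integral>\<^sup>+ x. ennreal (min (norm x ^ k) (real R)) * ennreal (norm (v t x)) \<partial>lborel)"
      by (rule nn_integral_monotone_convergence_SUP) (auto simp: incseq_def le_fun_def intro!: mult_right_mono ennreal_leI min.mono)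
    also have "\<dots> \<le> ennreal (2 * A * exp (2 * (C * B / (a - 1))) * (1 + t) powr (real k / 2))"
      using bound[OF _ t] unfolding q_def by (intro SUP_least) simp
    finally show "(\<integral>\<^sup>+ x. ennreal (norm x ^ k) * ennreal (norm (v t x)) \<partial>lborel) \<le> ennreal (2 * A * exp (2 * (C * B / (a - 1))) * (1 + t) powr (real k / 2))" .
  qed
qed

section \<open>Decaying mild solutions\<close>

lemma integral_lebesgue_on_eq:
  fixes \<phi> :: "real \<Rightarrow> complex"
  assumes A: "A \<in> sets borel" and m: "\<phi> \<in> borel_measurable lborel" and z: "\<And>s. s \<notin> A \<Longrightarrow> \<phi> s = 0"
  shows "(\<integral>s. \<phi> s \<partial>lebesgue_on A) = (\<integral>s. \<phi> s \<partial>lborel)"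
proof -
  have "(\<integral>s. \<phi> s \<partial>lebesgue_on A) = (\<integral>s. indicator A s *\<^sub>R \<phi> s \<partial>lebesgue)"
    using A by (intro integral_restrict_space) auto
  also have "\<dots> = (\<integral>s. \<phi> s \<partial>lebesgue)" by (intro Bochner_Integration.integral_cong) (use z in \<open>auto simp: indicator_def\<close>)
  also have "\<dots> = (\<integral>s. \<phi> s \<partial>lborel)" by (rule integral_completion[OF m])
  finally show ?thesis .
qed

text \<open>\<open>L1_weighted\<close> is stated for monomials. The norm is at most n times the
  largest coordinate, whose k-th power is a pure monomial.\<close>

lemma norm_power_le_sum_mpow:
  fixes y :: "real ^ 'n::finite"
  shows "norm y ^ k \<le> real CARD('n) ^ k * (\<Sum>i\<in>UNIV. \<bar>mpow y (\<lambda>j. if j = i then k else 0)\<bar>)"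
proof -
  have mp: "mpow y (\<lambda>j. if j = i then k else 0) = (y $ i) ^ k" for i
    unfolding mpow_def by (simp add: prod.remove[of UNIV i])
  obtain i where i: "\<And>j. \<bar>y $ j\<bar> \<le> \<bar>y $ i\<bar>"
  proof -
    have "Max (range (\<lambda>j. \<bar>y $ j\<bar>)) \<in> range (\<lambda>j. \<bar>y $ j\<bar>)" by (rule Max_in) auto
    then obtain i where "Max (range (\<lambda>j. \<bar>y $ j\<bar>)) = \<bar>y $ i\<bar>" by (rule rangeE)
    then show thesis using that[of i] by (metis Max_ge finite_class.finite_UNIV finite_imageI rangeI)
  qed
  have "norm y \<le> (\<Sum>j\<in>UNIV. \<bar>y $ j\<bar>)" by (rule norm_le_l1_cart)
  also have "\<dots> \<le> real CARD('n) * \<bar>y $ i\<bar>" using sum_bounded_above[of UNIV "\<lambda>j. \<bar>y $ j\<bar>" "\<bar>y $ i\<bar>"] i by simp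
  finally have "norm y ^ k \<le> (real CARD('n) * \<bar>y $ i\<bar>) ^ k" by (intro power_mono) auto
  also have "\<dots> = real CARD('n) ^ k * \<bar>mpow y (\<lambda>j. if j = i then k else 0)\<bar>" by (simp add: mp power_mult_distrib power_abs)
  also have "\<dots> \<le> real CARD('n) ^ k * (\<Sum>i\<in>UNIV. \<bar>mpow y (\<lambda>j. if j = i then k else 0)\<bar>)"
    by (intro mult_left_mono member_le_sum) auto
  finally show ?thesis .
qed

text \<open>Carries the hypotheses of the theorem, so that auxiliary constants and representatives
  can be fixed once.\<close>

locale decaying_mild_solution =
  fixes \<nu> :: complex and p :: real and f :: "complex \<Rightarrow> complex" and m :: nat
    and u0 :: "real ^ 'n::finite \<Rightarrow> complex"
    and u :: "real \<Rightarrow> real ^ 'n \<Rightarrow> complex"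
  assumes nu: "Re \<nu> > 0"
    and p_gt_1: "p > 1"
    and f0: "f 0 = 0"
    and flip: "\<exists>K>0. \<forall>\<xi> \<eta>. norm (f \<xi> - f \<eta>)
           \<le> K * (norm \<xi> powr (p - 1) + norm \<eta> powr (p - 1)) * norm (\<xi> - \<eta>)"
    and pm: "p > 1 + (real m + 3) / real CARD('n)"
    and u0: "u0 \<in> L1_weighted (m + 1) \<inter> Lq \<infinity>"
    and mild: "global_mild_solution \<nu> f u0 u"
    and decay: "(SUP q\<in>{1..}. SUP t\<in>{0<..}.
            ennreal (t powr (real CARD('n) / 2 * (1 - recip q))) * lq_norm q (u t)) < \<infinity>"
begin

text \<open>The decay rate of |u|^(p-1) in the supremum norm, which the nonlinearity adds to the
  decay of u itself.\<close>

definition a :: real where "a = real CARD('n) / 2 * (p - 1)"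
abbreviation k :: nat where "k \<equiv> Suc m"

lemma nz: "\<nu> \<noteq> 0" using nu by auto

text \<open>This is where the lower bound for p in terms of m and n enters.\<close>

lemma a_gt: "a > real k / 2 + 1"
proof -
  have "(real m + 3) / real CARD('n) < p - 1" using pm by simp
  then have "real m + 3 < real CARD('n) * (p - 1)" by (simp add: divide_less_eq mult.commute)
  from divide_strict_right_mono[OF this, of 2]
  have "(real m + 3) / 2 < a" by (simp add: a_def)
  then show ?thesis by (simp add: field_simps)
qed

lemma a_gt_1: "a > 1"
  using a_gt of_nat_0_le_iff[of k, where 'a=real] by linarith

lemma u_L1: "t \<ge> 0 \<Longrightarrow> u t \<in> Lq 1"
  and u_cont: "t > 0 \<Longrightarrow> ((\<lambda>s. lq_norm 1 (\<lambda>x. u s x - u t x)) \<longlongrightarrow> 0) (at t)"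
proof -
  have S: "u \<in> solution_space" using mild by (simp add: global_mild_solution_def)
  show "t \<ge> 0 \<Longrightarrow> u t \<in> Lq 1" using S by (simp add: solution_space_def)
  assume t: "t > 0"
  have "((\<lambda>s. lq_norm 1 (\<lambda>x. u s x - u t x)) \<longlongrightarrow> 0) (at t within {0..})" using S t by (simp add: solution_space_def)
  moreover have "at t within {0..} = at t" using t by (intro at_within_interior) auto
  ultimately show "((\<lambda>s. lq_norm 1 (\<lambda>x. u s x - u t x)) \<longlongrightarrow> 0) (at t)" by simp
qed

lemma u_measurable: "t \<ge> 0 \<Longrightarrow> u t \<in> borel_measurable lebesgue"
  using Lq_measurable[OF u_L1] .

text \<open>The decay hypothesis with q = \<infinity> gives t^(-n/2), which says nothing near t = 0.
  There the bound from \<open>solution_space\<close> takes over, and together they allow 1 + t in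
  place of t.\<close>

lemma u_bounds: "\<exists>V\<ge>0. \<forall>t>0. lq_norm 1 (u t) \<le> ennreal V \<and> lq_norm \<infinity> (u t) \<le> ennreal (V * (1 + t) powr (- (real CARD('n) / 2)))"
proof -
  let ?n = "real CARD('n) / 2"
  define S where "S = (SUP q\<in>{1..}. SUP t\<in>{0<..}. ennreal (t powr (?n * (1 - recip q))) * lq_norm q (u t))"
  have S: "S < \<infinity>" using decay by (simp only: S_def)
  have Sle: "ennreal (t powr (?n * (1 - recip q))) * lq_norm q (u t) \<le> S" if "q \<ge> 1" "t > 0" for q t
    unfolding S_def using that by (intro SUP_upper2[of q] SUP_upper2[of t]) auto
  define S' where "S' = (SUP t\<in>{0<..}. lq_norm \<infinity> (u t))"
  have S': "S' < \<infinity>" using mild by (simp add: global_mild_solution_def solution_space_def S'_def)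
  have S'le: "lq_norm \<infinity> (u t) \<le> S'" if "t > 0" for t
    unfolding S'_def using that by (intro SUP_upper) auto
  define V where "V = enn2real S + 2 powr ?n * (enn2real S' + enn2real S)"
  have V0: "V \<ge> 0" by (simp add: V_def)
  have "lq_norm 1 (u t) \<le> ennreal V \<and> lq_norm \<infinity> (u t) \<le> ennreal (V * (1 + t) powr (- ?n))" if t: "t > 0" for t
  proof
    have "lq_norm 1 (u t) \<le> S" using Sle[of 1 t] t by (simp add: recip_1)
    also have "S = ennreal (enn2real S)" using S by simp
    also have "\<dots> \<le> ennreal V" unfolding V_def by (intro ennreal_leI) simp
    finally show "lq_norm 1 (u t) \<le> ennreal V" .
    have ri: "recip \<infinity> = 0" by (simp add: recip_def)
    define L where "L = enn2real (lq_norm \<infinity> (u t))"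
    have fin: "lq_norm \<infinity> (u t) < \<infinity>" using S'le[OF t] S' by (rule order_le_less_trans)
    then have L: "lq_norm \<infinity> (u t) = ennreal L" unfolding L_def by simp
    have L0: "L \<ge> 0" by (simp add: L_def)
    have 1: "L \<le> enn2real S'"
      using enn2real_mono[OF S'le[OF t]] S' unfolding L_def by simp
    have "ennreal (t powr ?n * L) \<le> S"
      using Sle[of \<infinity> t] t L0 unfolding ri L by (simp add: ennreal_mult)
    then have 2: "t powr ?n * L \<le> enn2real S"
      using enn2real_mono[of "ennreal (t powr ?n * L)" S] S L0 by simp
    \<comment> \<open>From 1 + t \<le> 2 max 1 t, which separates the regimes t \<le> 1 and t \<ge>
      1.\<close>
    have "(1 + t) powr ?n * L \<le> V"
    proof -
      have "(1 + t) powr ?n \<le> (2 * max 1 t) powr ?n" using t by (intro powr_mono2) auto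
      also have "\<dots> = 2 powr ?n * max 1 t powr ?n" using t by (simp add: powr_mult)
      also have "max 1 t powr ?n \<le> 1 + t powr ?n" by (simp add: max_def)
      finally have "(1 + t) powr ?n * L \<le> 2 powr ?n * (1 + t powr ?n) * L" using L0 by (intro mult_right_mono) auto
      also have "\<dots> = 2 powr ?n * (L + t powr ?n * L)" by (simp add: algebra_simps)
      also have "\<dots> \<le> 2 powr ?n * (enn2real S' + enn2real S)" by (intro mult_left_mono add_mono 1 2) auto
      also have "\<dots> \<le> V" by (simp add: V_def)
      finally show ?thesis .
    qed
    then have "L \<le> V * (1 + t) powr (- ?n)" using t by (simp add: powr_minus field_simps)
    then show "lq_norm \<infinity> (u t) \<le> ennreal (V * (1 + t) powr (- ?n))" unfolding L by (rule ennreal_leI)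
  qed
  then show ?thesis using V0 by blast
qed

text \<open>A constant of the locale, chosen once so that later bounds can refer to it; the same is
  done for \<open>K\<close>, \<open>v\<close>, \<open>u0b\<close> and \<open>Mw\<close>.\<close>

definition V :: real where "V = (SOME V. V \<ge> 0 \<and> (\<forall>t>0. lq_norm 1 (u t) \<le> ennreal V \<and> lq_norm \<infinity> (u t) \<le> ennreal (V * (1 + t) powr (- (real CARD('n) / 2)))))"

lemma V: "V \<ge> 0" "t > 0 \<Longrightarrow> lq_norm 1 (u t) \<le> ennreal V" "t > 0 \<Longrightarrow> lq_norm \<infinity> (u t) \<le> ennreal (V * (1 + t) powr (- (real CARD('n) / 2)))"
  using someI_ex[OF u_bounds] unfolding V_def[symmetric] by blast+

definition K :: real where "K = (SOME K. K > 0 \<and> (\<forall>\<xi> \<eta>. norm (f \<xi> - f \<eta>)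
           \<le> K * (norm \<xi> powr (p - 1) + norm \<eta> powr (p - 1)) * norm (\<xi> - \<eta>)))"

lemma K: "K > 0" "norm (f \<xi> - f \<eta>) \<le> K * (norm \<xi> powr (p - 1) + norm \<eta> powr (p - 1)) * norm (\<xi> - \<eta>)"
  using someI_ex[OF flip] unfolding K_def[symmetric] by blast+

lemma f_bound: "norm (f \<xi>) \<le> K * norm \<xi> powr (p - 1) * norm \<xi>"
  using K(2)[of \<xi> 0] p_gt_1 by (simp add: f0)

text \<open>The Lipschitz-type bound makes f continuous: as p > 1, the factor |\<eta>|^(p-1) is
  continuous, also at 0.\<close>

lemma f_measurable: "f \<in> borel_measurable borel"
proof (rule borel_measurable_continuous_onI, rule continuous_at_imp_continuous_on, rule ballI)
  fix \<xi> :: complex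
  have "((\<lambda>\<eta>. K * (norm \<eta> powr (p - 1) + norm \<xi> powr (p - 1)) * norm (\<eta> - \<xi>)) \<longlongrightarrow> K * (norm \<xi> powr (p - 1) + norm \<xi> powr (p - 1)) * norm (\<xi> - \<xi>)) (at \<xi>)"
    using p_gt_1 by (intro tendsto_intros tendsto_powr') auto
  then have l: "((\<lambda>\<eta>. K * (norm \<eta> powr (p - 1) + norm \<xi> powr (p - 1)) * norm (\<eta> - \<xi>)) \<longlongrightarrow> 0) (at \<xi>)" by simp
  have "((\<lambda>\<eta>. norm (f \<eta> - f \<xi>)) \<longlongrightarrow> 0) (at \<xi>)"
  proof (rule tendsto_sandwich[OF _ _ tendsto_const l])
    show "\<forall>\<^sub>F \<eta> in at \<xi>. norm (f \<eta> - f \<xi>) \<le> K * (norm \<eta> powr (p - 1) + norm \<xi> powr (p - 1)) * norm (\<eta> - \<xi>)"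
      using K(2) by (intro always_eventually allI)
  qed auto
  then show "isCont f \<xi>" unfolding isCont_def by (simp add: tendsto_norm_zero_iff LIM_zero_iff)
qed

definition v :: "real \<Rightarrow> real ^ 'n \<Rightarrow> complex" where
  "v = (SOME v. (\<lambda>z. v (fst z) (snd z)) \<in> borel_measurable (lborel \<Otimes>\<^sub>M lborel) \<and> (\<forall>s>0. AE x in lborel. v s x = u s x))"

lemma v: "(\<lambda>z. v (fst z) (snd z)) \<in> borel_measurable (lborel \<Otimes>\<^sub>M lborel)" "s > 0 \<Longrightarrow> AE x in lborel. v s x = u s x"
proof -
  have "\<exists>v. (\<lambda>z. v (fst z) (snd z)) \<in> borel_measurable (lborel \<Otimes>\<^sub>M lborel) \<and> (\<forall>s>0. AE x in lborel. v s x = u s x)"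
    by (rule joint_representative) (use u_L1 u_cont in auto)
  from someI_ex[OF this, folded v_def]
  show "(\<lambda>z. v (fst z) (snd z)) \<in> borel_measurable (lborel \<Otimes>\<^sub>M lborel)" "s > 0 \<Longrightarrow> AE x in lborel. v s x = u s x" by blast+
qed

lemma v_slice[measurable]: "v s \<in> borel_measurable lborel"
proof -
  have "(\<lambda>y. (s, y)) \<in> measurable lborel (lborel \<Otimes>\<^sub>M lborel)" by measurable
  from measurable_compose[OF this v(1)] show ?thesis by simp
qed

lemma v_L1: "s > 0 \<Longrightarrow> (\<integral>\<^sup>+ x. ennreal (norm (v s x)) \<partial>lborel) \<le> ennreal V"
proof -
  assume s: "s > 0"
  have "(\<integral>\<^sup>+ x. ennreal (norm (v s x)) \<partial>lborel) = (\<integral>\<^sup>+ x. ennreal (norm (u s x)) \<partial>lborel)"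
    using v(2)[OF s] by (intro nn_integral_cong_AE) auto
  also have "\<dots> = lq_norm 1 (u s)" unfolding lq_norm_1 by (rule nn_integral_completion[symmetric])
  also have "\<dots> \<le> ennreal V" by (rule V(2)[OF s])
  finally show ?thesis .
qed

lemma u_sup: "s > 0 \<Longrightarrow> AE x in lebesgue. norm (u s x) \<le> V * (1 + s) powr (- (real CARD('n) / 2))"
proof -
  assume s: "s > 0"
  show ?thesis using lq_norm_inf_AE[of "u s"]
  proof eventually_elim
    case (elim x)
    then have "ennreal (norm (u s x)) \<le> ennreal (V * (1 + s) powr (- (real CARD('n) / 2)))" using V(3)[OF s] by (rule order_trans)
    then show ?case using V(1) by simp
  qed
qed

lemma v_sup: "s > 0 \<Longrightarrow> AE x in lborel. norm (v s x) \<le> V * (1 + s) powr (- (real CARD('n) / 2))"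
  using u_sup[of s] v(2)[of s] unfolding AE_completion_iff by fastforce

text \<open>The source f(u(s)) through the jointly measurable \<open>v\<close>, cut off to s > 0 so
  that time integrals can run over the whole line.\<close>

definition g :: "real \<Rightarrow> real ^ 'n \<Rightarrow> complex" where "g s y = (if s > 0 then f (v s y) else 0)"

lemma g_measurable: "(\<lambda>z. g (fst z) (snd z)) \<in> borel_measurable (lborel \<Otimes>\<^sub>M lborel)"
proof -
  note [measurable] = measurable_compose[OF v(1) f_measurable]
  show ?thesis unfolding g_def by measurable
qed

lemma g_slice[measurable]: "g s \<in> borel_measurable lborel"
proof -
  have "(\<lambda>y. (s, y)) \<in> measurable lborel (lborel \<Otimes>\<^sub>M lborel)" by measurable
  from measurable_compose[OF this g_measurable] show ?thesis by simp
qed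

definition B :: real where "B = K * V powr (p - 1)"

lemma B0: "B \<ge> 0" using K(1) by (simp add: B_def)

lemma powr_decay: "s > 0 \<Longrightarrow> z \<ge> 0 \<Longrightarrow> z \<le> V * (1 + s) powr (- (real CARD('n) / 2)) \<Longrightarrow> z powr (p - 1) \<le> V powr (p - 1) * (1 + s) powr (- a)"
proof -
  assume s: "s > 0" and z: "z \<ge> 0" "z \<le> V * (1 + s) powr (- (real CARD('n) / 2))"
  have "z powr (p - 1) \<le> (V * (1 + s) powr (- (real CARD('n) / 2))) powr (p - 1)" using z p_gt_1 by (intro powr_mono2) auto
  also have "\<dots> = V powr (p - 1) * (1 + s) powr (- a)" using V(1) by (simp add: powr_mult powr_powr a_def)
  finally show ?thesis .
qed

text \<open>Superlinearity of f together with the decay of u: the source is linear in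
  \<open>v\<close> with a coefficient integrable in time, which is the form required by the Gronwall
  argument.\<close>

lemma g_v: "s > 0 \<Longrightarrow> AE y in lborel. norm (g s y) \<le> B * (1 + s) powr (- a) * norm (v s y)"
proof -
  assume s: "s > 0"
  show ?thesis using v_sup[OF s]
  proof eventually_elim
    case (elim y)
    have "norm (g s y) \<le> K * norm (v s y) powr (p - 1) * norm (v s y)" using s f_bound by (simp add: g_def)
    also have "\<dots> \<le> K * (V powr (p - 1) * (1 + s) powr (- a)) * norm (v s y)"
      using K(1) powr_decay[OF s _ elim] by (intro mult_right_mono mult_left_mono) auto
    finally show ?case by (simp add: B_def mult.assoc)
  qed
qed

lemma g_L1: "s > 0 \<Longrightarrow> (\<integral>\<^sup>+ y. ennreal (norm (g s y)) \<partial>lborel) \<le> ennreal (B * V * (1 + s) powr (- a))"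
proof -
  assume s: "s > 0"
  have "(\<integral>\<^sup>+ y. ennreal (norm (g s y)) \<partial>lborel) \<le> (\<integral>\<^sup>+ y. ennreal (B * (1 + s) powr (- a)) * ennreal (norm (v s y)) \<partial>lborel)"
  proof (rule nn_integral_mono_AE)
    show "AE y in lborel. ennreal (norm (g s y)) \<le> ennreal (B * (1 + s) powr (- a)) * ennreal (norm (v s y))"
      using g_v[OF s] by eventually_elim (use B0 in \<open>simp add: ennreal_mult[symmetric] ennreal_leI\<close>)
  qed
  also have "\<dots> = ennreal (B * (1 + s) powr (- a)) * (\<integral>\<^sup>+ y. ennreal (norm (v s y)) \<partial>lborel)"
    by (rule nn_integral_cmult) measurable
  also have "\<dots> \<le> ennreal (B * (1 + s) powr (- a)) * ennreal V" by (intro mult_left_mono v_L1 s) simp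
  also have "\<dots> = ennreal (B * V * (1 + s) powr (- a))" using B0 V(1) by (simp add: ennreal_mult[symmetric] mult_ac)
  finally show ?thesis .
qed

lemma f_u_eq_g: "s > 0 \<Longrightarrow> AE y in lebesgue. f (u s y) = g s y"
  using AE_completion[OF v(2)[of s]] by (auto simp: g_def)

definition u0b :: "real ^ 'n \<Rightarrow> complex" where
  "u0b = (SOME \<psi>. \<psi> \<in> borel_measurable lborel \<and> (AE x in lborel. u0 x = \<psi> x))"

lemma u0_measurable: "u0 \<in> borel_measurable lebesgue"
  using u0 by (auto intro: Lq_measurable[of _ \<infinity>])

lemma u0b: "u0b \<in> borel_measurable lborel" "AE x in lborel. u0 x = u0b x"
proof -
  have "\<exists>\<psi>. \<psi> \<in> borel_measurable lborel \<and> (AE x in lborel. u0 x = \<psi> x)"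
    using complex_borel_version[OF u0_measurable] by (simp only: Bex_def)
  from someI_ex[OF this, folded u0b_def] show "u0b \<in> borel_measurable lborel" "AE x in lborel. u0 x = u0b x" by blast+
qed

lemma u0b_L1: "(\<integral>\<^sup>+ y. ennreal (norm (u0b y)) \<partial>lborel) < \<infinity>"
proof -
  have "u0 \<in> Lq 1" using u0 by (auto simp: L1_weighted_def)
  then have "(\<integral>\<^sup>+ y. ennreal (norm (u0 y)) \<partial>lborel) < \<infinity>" by (simp add: Lq_def lq_norm_1 nn_integral_completion)
  moreover have "(\<integral>\<^sup>+ y. ennreal (norm (u0b y)) \<partial>lborel) = (\<integral>\<^sup>+ y. ennreal (norm (u0 y)) \<partial>lborel)"
    using u0b(2) by (intro nn_integral_cong_AE) auto
  ultimately show ?thesis by simp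
qed

lemma u0b_weighted: "(\<integral>\<^sup>+ y. ennreal (norm y ^ k) * ennreal (norm (u0b y)) \<partial>lborel) < \<infinity>"
proof -
  let ?\<alpha> = "\<lambda>i j :: 'n. if j = i then k else 0"
  have fin: "(\<integral>\<^sup>+ y. ennreal (\<bar>mpow y (?\<alpha> i)\<bar> * norm (u0b y)) \<partial>lborel) < \<infinity>" for i
  proof -
    have "mdeg (?\<alpha> i) \<le> m + 1" by (simp add: mdeg_def)
    then have "(\<lambda>x. complex_of_real (mpow x (?\<alpha> i)) * u0 x) \<in> Lq 1" using u0 by (auto simp: L1_weighted_def)
    then have "(\<integral>\<^sup>+ y. ennreal (\<bar>mpow y (?\<alpha> i)\<bar> * norm (u0 y)) \<partial>lborel) < \<infinity>" by (simp add: Lq_def lq_norm_1 nn_integral_completion norm_mult)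
    moreover have "(\<integral>\<^sup>+ y. ennreal (\<bar>mpow y (?\<alpha> i)\<bar> * norm (u0b y)) \<partial>lborel) = (\<integral>\<^sup>+ y. ennreal (\<bar>mpow y (?\<alpha> i)\<bar> * norm (u0 y)) \<partial>lborel)"
      using u0b(2) by (intro nn_integral_cong_AE) auto
    ultimately show ?thesis by simp
  qed
  note [measurable] = u0b(1)
  have [measurable]: "(\<lambda>y. mpow y (?\<alpha> i)) \<in> borel_measurable (lborel :: (real ^ 'n) measure)" for i by (rule mpow_measurable) measurable
  have "(\<integral>\<^sup>+ y. ennreal (norm y ^ k) * ennreal (norm (u0b y)) \<partial>lborel) \<le> (\<integral>\<^sup>+ y. ennreal (real CARD('n) ^ k) * (\<Sum>i\<in>UNIV. ennreal (\<bar>mpow y (?\<alpha> i)\<bar> * norm (u0b y))) \<partial>lborel)"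
  proof (rule nn_integral_mono)
    fix y :: "real ^ 'n"
    have "norm y ^ k * norm (u0b y) \<le> real CARD('n) ^ k * (\<Sum>i\<in>UNIV. \<bar>mpow y (?\<alpha> i)\<bar>) * norm (u0b y)"
      by (intro mult_right_mono norm_power_le_sum_mpow) auto
    also have "\<dots> = real CARD('n) ^ k * (\<Sum>i\<in>UNIV. \<bar>mpow y (?\<alpha> i)\<bar> * norm (u0b y))" by (simp add: sum_distrib_right mult.assoc)
    finally have "ennreal (norm y ^ k * norm (u0b y)) \<le> ennreal (real CARD('n) ^ k * (\<Sum>i\<in>UNIV. \<bar>mpow y (?\<alpha> i)\<bar> * norm (u0b y)))" by (rule ennreal_leI)
    also have "\<dots> = ennreal (real CARD('n) ^ k) * (\<Sum>i\<in>UNIV. ennreal (\<bar>mpow y (?\<alpha> i)\<bar> * norm (u0b y)))"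
      by (subst ennreal_mult) (auto intro!: sum_nonneg simp: sum_ennreal)
    finally show "ennreal (norm y ^ k) * ennreal (norm (u0b y)) \<le> ennreal (real CARD('n) ^ k) * (\<Sum>i\<in>UNIV. ennreal (\<bar>mpow y (?\<alpha> i)\<bar> * norm (u0b y)))"
      by (simp add: ennreal_mult)
  qed
  also have "\<dots> = ennreal (real CARD('n) ^ k) * (\<integral>\<^sup>+ y. (\<Sum>i\<in>UNIV. ennreal (\<bar>mpow y (?\<alpha> i)\<bar> * norm (u0b y))) \<partial>lborel)"
    by (rule nn_integral_cmult) measurable
  also have "(\<integral>\<^sup>+ y. (\<Sum>i\<in>UNIV. ennreal (\<bar>mpow y (?\<alpha> i)\<bar> * norm (u0b y))) \<partial>lborel) = (\<Sum>i\<in>UNIV. \<integral>\<^sup>+ y. ennreal (\<bar>mpow y (?\<alpha> i)\<bar> * norm (u0b y)) \<partial>lborel)"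
    by (rule nn_integral_sum) measurable
  also have "ennreal (real CARD('n) ^ k) * \<dots> < \<infinity>"
    using fin by (simp add: ennreal_mult_less_top)
  finally show ?thesis .
qed

text \<open>The Duhamel integrand as a function defined at every point and jointly measurable in
  time and space, in contrast to a family of classes.\<close>

definition H :: "real \<Rightarrow> real \<Rightarrow> real ^ 'n \<Rightarrow> complex" where
  "H t s x = (\<integral>y. heat_kernel \<nu> (t - s) (x - y) * g s y \<partial>lborel)"

lemma H_measurable: "(\<lambda>z. H t (fst z) (snd z)) \<in> borel_measurable (lborel \<Otimes>\<^sub>M lborel)"
  unfolding H_def
proof (rule lborel.borel_measurable_lebesgue_integral)
  have 1: "(\<lambda>p. heat_kernel \<nu> (t - fst (fst p)) (snd (fst p) - snd p)) \<in> borel_measurable ((lborel \<Otimes>\<^sub>M lborel) \<Otimes>\<^sub>M (lborel :: (real ^ 'n) measure))" by (rule heat_kernel_measurable[OF nz]) measurable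
  have "(\<lambda>p. (fst (fst p), snd p)) \<in> measurable ((lborel \<Otimes>\<^sub>M lborel) \<Otimes>\<^sub>M lborel) (lborel \<Otimes>\<^sub>M lborel)" by measurable
  from measurable_compose[OF this g_measurable] have 2: "(\<lambda>p. g (fst (fst p)) (snd p)) \<in> borel_measurable ((lborel \<Otimes>\<^sub>M lborel) \<Otimes>\<^sub>M lborel)" by simp
  show "(\<lambda>(z, y). heat_kernel \<nu> (t - fst z) (snd z - y) * g (fst z) y) \<in> borel_measurable ((lborel \<Otimes>\<^sub>M lborel) \<Otimes>\<^sub>M lborel)"
    using 1 2 unfolding case_prod_beta by measurable
qed

lemma H_zero: "s \<notin> {0<..<t} \<Longrightarrow> H t s x = 0"
  unfolding H_def heat_kernel_def g_def by (cases "s > 0") auto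

lemma H_L1: "\<exists>C\<ge>0. \<forall>t s. s > 0 \<longrightarrow> (\<integral>\<^sup>+ x. ennreal (norm (H t s x)) \<partial>lborel) \<le> ennreal C"
proof -
  obtain C3 where C3: "C3 \<ge> 0" and C3': "\<forall>t. \<forall>y :: real ^ 'n. (\<integral>\<^sup>+ x. ennreal (norm (heat_kernel \<nu> t (x - y))) \<partial>lborel) \<le> ennreal C3 \<and>
     (\<integral>\<^sup>+ x. ennreal (norm (heat_kernel \<nu> t (y - x))) \<partial>lborel) \<le> ennreal C3"
    using nn_integral_heat_kernel[OF nu, where 'n='n] by (elim exE conjE)
  have "(\<integral>\<^sup>+ x. ennreal (norm (H t s x)) \<partial>lborel) \<le> ennreal (C3 * (B * V))" if s: "s > 0" for t s
  proof -
    have "(\<integral>\<^sup>+ x. ennreal (norm (H t s x)) \<partial>lborel) \<le> (\<integral>\<^sup>+ x. (\<integral>\<^sup>+ y. ennreal (norm (heat_kernel \<nu> (t - s) (x - y) * g s y)) \<partial>lborel) \<partial>lborel)"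
      unfolding H_def by (intro nn_integral_mono norm_integral_le_nn_integral)
    also have "\<dots> = (\<integral>\<^sup>+ y. (\<integral>\<^sup>+ x. ennreal (norm (heat_kernel \<nu> (t - s) (x - y) * g s y)) \<partial>lborel) \<partial>lborel)"
    proof (rule lborel_pair.Fubini')
      have [measurable]: "(\<lambda>z. heat_kernel \<nu> (t - s) (snd z - fst z)) \<in> borel_measurable (lborel \<Otimes>\<^sub>M (lborel :: (real ^ 'n) measure))"
        by (rule heat_kernel_measurable[OF nz]) measurable
      show "(\<lambda>(y, x). ennreal (norm (heat_kernel \<nu> (t - s) (x - y) * g s y))) \<in> borel_measurable (lborel \<Otimes>\<^sub>M lborel)"
        unfolding case_prod_beta by measurable
    qed
    also have "\<dots> \<le> (\<integral>\<^sup>+ y. ennreal C3 * ennreal (norm (g s y)) \<partial>lborel)"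
    proof (rule nn_integral_mono)
      fix y :: "real ^ 'n"
      have "(\<integral>\<^sup>+ x. ennreal (norm (heat_kernel \<nu> (t - s) (x - y) * g s y)) \<partial>lborel) = (\<integral>\<^sup>+ x. ennreal (norm (heat_kernel \<nu> (t - s) (x - y))) * ennreal (norm (g s y)) \<partial>lborel)"
        by (simp add: norm_mult ennreal_mult)
      also have "\<dots> = (\<integral>\<^sup>+ x. ennreal (norm (heat_kernel \<nu> (t - s) (x - y))) \<partial>lborel) * ennreal (norm (g s y))"
        by (rule nn_integral_multc[OF heat_kernel_shift_measurable[OF nz]])
      also have "\<dots> \<le> ennreal C3 * ennreal (norm (g s y))"
        by (rule mult_right_mono[OF conjunct1[OF C3'[rule_format]]]) simp
      finally show "(\<integral>\<^sup>+ x. ennreal (norm (heat_kernel \<nu> (t - s) (x - y) * g s y)) \<partial>lborel) \<le> ennreal C3 * ennreal (norm (g s y))" .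
    qed
    also have "\<dots> = ennreal C3 * (\<integral>\<^sup>+ y. ennreal (norm (g s y)) \<partial>lborel)" by (rule nn_integral_cmult) measurable
    also have "\<dots> \<le> ennreal C3 * ennreal (B * V * (1 + s) powr (- a))" by (intro mult_left_mono g_L1 s) simp
    also have "\<dots> \<le> ennreal C3 * ennreal (B * V)"
    proof (intro mult_left_mono ennreal_leI)
      have "(1 + s) powr (- a) \<le> (1 + s) powr 0" using s a_gt_1 by (intro powr_mono) auto
      then show "B * V * (1 + s) powr (- a) \<le> B * V" using B0 V(1) s by (intro mult_left_le) auto
    qed simp
    also have "\<dots> = ennreal (C3 * (B * V))" using C3 B0 V(1) by (simp add: ennreal_mult)
    finally show ?thesis .
  qed
  then show ?thesis using C3 B0 V(1) by (intro exI[of _ "C3 * (B * V)"]) auto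
qed

lemma heat_eq:
  assumes \<tau>: "\<tau> > 0" and \<phi>: "\<phi> \<in> borel_measurable lebesgue" and \<psi>: "\<psi> \<in> borel_measurable lborel" and e: "AE y in lebesgue. \<phi> y = \<psi> y"
  shows "heat \<nu> \<tau> \<phi> x = (\<integral>y. heat_kernel \<nu> \<tau> (x - y) * \<psi> y \<partial>lborel)"
proof -
  have km: "(\<lambda>y. heat_kernel \<nu> \<tau> (x - y)) \<in> borel_measurable lborel" by (rule heat_kernel_measurable[OF nz]) measurable
  have "heat \<nu> \<tau> \<phi> x = (\<integral>y. heat_kernel \<nu> \<tau> (x - y) * \<phi> y \<partial>lebesgue)"
    using \<tau> unfolding heat_def heat_kernel_def by (simp add: gauss_eq_heat_deriv[OF \<tau> nz])
  also have "\<dots> = (\<integral>y. heat_kernel \<nu> \<tau> (x - y) * \<psi> y \<partial>lebesgue)"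
  proof (rule integral_cong_AE)
    show "(\<lambda>y. heat_kernel \<nu> \<tau> (x - y) * \<phi> y) \<in> borel_measurable lebesgue"
      using \<phi> measurable_completion[OF km] by measurable
    show "(\<lambda>y. heat_kernel \<nu> \<tau> (x - y) * \<psi> y) \<in> borel_measurable lebesgue"
      using measurable_completion[OF \<psi>] measurable_completion[OF km] by measurable
    show "AE y in lebesgue. heat_kernel \<nu> \<tau> (x - y) * \<phi> y = heat_kernel \<nu> \<tau> (x - y) * \<psi> y" using e by eventually_elim simp
  qed
  also have "\<dots> = (\<integral>y. heat_kernel \<nu> \<tau> (x - y) * \<psi> y \<partial>lborel)"
    by (rule integral_completion) (use km \<psi> in measurable)
  finally show ?thesis .
qed

text \<open>The Bochner integral in the definition of mild solution is identified by
  \<open>has_bochner_integral_in_pointwise\<close>; from here on the solution formula contains only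
  ordinary integrals.\<close>

lemma Duhamel:
  assumes t: "t > 0"
  shows "AE x in lborel. u t x = (\<integral>y. heat_kernel \<nu> t (x - y) * u0b y \<partial>lborel) + (\<integral>s. H t s x \<partial>lborel)"
proof -
  obtain I where I: "has_bochner_integral_in (Lq 1 \<inter> Lq \<infinity>) (\<lambda>\<phi>. lq_norm 1 \<phi> + lq_norm \<infinity> \<phi>)
        (lebesgue_on {0..t}) (\<lambda>s. heat \<nu> (t - s) (\<lambda>x. f (u s x))) I"
    and uI: "AE x in lebesgue. u t x = heat \<nu> t u0 x + I x"
    using mild t unfolding global_mild_solution_def by blast
  obtain C where C: "C \<ge> 0" "\<forall>t s. s > 0 \<longrightarrow> (\<integral>\<^sup>+ x. ennreal (norm (H t s x)) \<partial>lborel) \<le> ennreal C" using H_L1 by blast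
  have "AE x in lebesgue. I x = (\<integral>s. H t s x \<partial>lebesgue_on {0..t})"
  proof (rule has_bochner_integral_in_pointwise[OF I _ _ _ H_measurable])
    show "(\<integral>\<^sup>+ s. (\<integral>\<^sup>+ x. ennreal (norm (H t s x)) \<partial>lebesgue) \<partial>lebesgue_on {0..t}) < \<infinity>"
    proof -
      have "(\<integral>\<^sup>+ s. (\<integral>\<^sup>+ x. ennreal (norm (H t s x)) \<partial>lebesgue) \<partial>lebesgue_on {0..t}) \<le> (\<integral>\<^sup>+ s. ennreal C \<partial>lebesgue_on {0..t})"
      proof (rule nn_integral_mono)
        fix s show "(\<integral>\<^sup>+ x. ennreal (norm (H t s x)) \<partial>lebesgue) \<le> ennreal C"
          using C(2) by (cases "s > 0") (auto simp: nn_integral_completion H_zero)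
      qed
      also have "\<dots> = ennreal C * emeasure (lebesgue_on {0..t}) {0..t}" by (simp add: nn_integral_const space_restrict_space)
      also have "\<dots> = ennreal C * ennreal t" using t by (simp add: emeasure_restrict_space)
      also have "\<dots> < \<infinity>" by (simp add: ennreal_mult_less_top)
      finally show ?thesis .
    qed
    \<comment> \<open>Both endpoints are exceptional: \<open>v\<close> represents u only for s > 0,
      and at s = t the semigroup is the identity while \<open>H\<close> is 0.\<close>
    have "AE s in lebesgue. s \<noteq> 0 \<and> s \<noteq> t" using AE_completion[OF AE_lborel_singleton[of 0]] AE_completion[OF AE_lborel_singleton[of t]] by eventually_elim simp
    then have "AE s in lebesgue_on {0..t}. s \<noteq> 0 \<and> s \<noteq> t" by (subst AE_restrict_space_iff) auto
    moreover have "AE s in lebesgue_on {0..t}. s \<in> {0..t}" by (rule AE_I2) (simp add: space_restrict_space)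
    ultimately show "AE s in lebesgue_on {0..t}. AE x in lebesgue. heat \<nu> (t - s) (\<lambda>x. f (u s x)) x = H t s x"
    proof eventually_elim
      case (elim s)
      then have s: "s > 0" "t - s > 0" by auto
      have "heat \<nu> (t - s) (\<lambda>x. f (u s x)) x = H t s x" for x
        unfolding H_def by (rule heat_eq[OF s(2) _ _ f_u_eq_g[OF s(1)]])
          (use measurable_compose[OF u_measurable f_measurable] s in auto)
      then show ?case by simp
    qed
  qed auto
  moreover have "(\<integral>s. H t s x \<partial>lebesgue_on {0..t}) = (\<integral>s. H t s x \<partial>lborel)" for x
  proof (rule integral_lebesgue_on_eq)
    have "(\<lambda>s. (s, x)) \<in> measurable lborel (lborel \<Otimes>\<^sub>M lborel)" by measurable
    from measurable_compose[OF this H_measurable] show "(\<lambda>s. H t s x) \<in> borel_measurable lborel" by simp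
  qed (auto intro: H_zero)
  moreover have "heat \<nu> t u0 x = (\<integral>y. heat_kernel \<nu> t (x - y) * u0b y \<partial>lborel)" for x
    by (rule heat_eq[OF t u0_measurable u0b(1) AE_completion[OF u0b(2)]])
  ultimately have "AE x in lebesgue. u t x = (\<integral>y. heat_kernel \<nu> t (x - y) * u0b y \<partial>lborel) + (\<integral>s. H t s x \<partial>lborel)"
    using uI by (auto elim: eventually_elim2)
  then show ?thesis by (simp add: AE_completion_iff)
qed

lemma v_weighted: "\<exists>M\<ge>0. \<forall>t>0. (\<integral>\<^sup>+ x. ennreal (norm x ^ k) * ennreal (norm (v t x)) \<partial>lborel) \<le> ennreal (M * (1 + t) powr (real k / 2))"
proof (rule weighted_propagation[OF nu _ B0 V(1) u0b(1) u0b_L1 u0b_weighted v(1) g_measurable v_L1 g_v])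
  show "a > 1" by (rule a_gt_1)
  fix t :: real assume t: "t > 0"
  show "AE x in lborel. ennreal (norm (v t x)) \<le> (\<integral>\<^sup>+ y. ennreal (norm (heat_kernel \<nu> t (x - y))) * ennreal (norm (u0b y)) \<partial>lborel)
       + (\<integral>\<^sup>+ s. indicator {0<..<t} s * (\<integral>\<^sup>+ y. ennreal (norm (heat_kernel \<nu> (t - s) (x - y))) * ennreal (norm (g s y)) \<partial>lborel) \<partial>lborel)"
    using v(2)[OF t] Duhamel[OF t]
  proof eventually_elim
    case (elim x)
    have "ennreal (norm (v t x)) \<le> ennreal (norm (\<integral>y. heat_kernel \<nu> t (x - y) * u0b y \<partial>lborel)) + ennreal (norm (\<integral>s. H t s x \<partial>lborel))"
      using elim by (simp add: norm_triangle_ineq ennreal_plus[symmetric] del: ennreal_plus)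
    also have "\<dots> \<le> (\<integral>\<^sup>+ y. ennreal (norm (heat_kernel \<nu> t (x - y) * u0b y)) \<partial>lborel) + (\<integral>\<^sup>+ s. ennreal (norm (H t s x)) \<partial>lborel)"
      by (intro add_mono norm_integral_le_nn_integral)
    also have "\<dots> \<le> (\<integral>\<^sup>+ y. ennreal (norm (heat_kernel \<nu> t (x - y))) * ennreal (norm (u0b y)) \<partial>lborel)
       + (\<integral>\<^sup>+ s. indicator {0<..<t} s * (\<integral>\<^sup>+ y. ennreal (norm (heat_kernel \<nu> (t - s) (x - y))) * ennreal (norm (g s y)) \<partial>lborel) \<partial>lborel)"
    proof (intro add_mono nn_integral_mono)
      fix y show "ennreal (norm (heat_kernel \<nu> t (x - y) * u0b y)) \<le> ennreal (norm (heat_kernel \<nu> t (x - y))) * ennreal (norm (u0b y))"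
        by (simp add: norm_mult ennreal_mult)
    next
      fix s
      show "ennreal (norm (H t s x)) \<le> indicator {0<..<t} s * (\<integral>\<^sup>+ y. ennreal (norm (heat_kernel \<nu> (t - s) (x - y))) * ennreal (norm (g s y)) \<partial>lborel)"
      proof (cases "s \<in> {0<..<t}")
        case True
        then show ?thesis using norm_integral_le_nn_integral[of lborel "\<lambda>y. heat_kernel \<nu> (t - s) (x - y) * g s y"] by (simp add: H_def norm_mult ennreal_mult)
      next
        case False
        then show ?thesis by (simp add: H_zero)
      qed
    qed
    finally show ?case .
  qed
qed

end

section \<open>Profiles as integrated Taylor polynomials\<close>

text \<open>In the profiles \<alpha> is 0 or 2 \<gamma>, so |\<alpha>| is even and
  (-2)^(-|\<alpha>|) = 2^(-|\<alpha>|). Then the prefactors of \<open>Lam\<close> are exactly those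
  of \<open>heat_deriv_eq_dilate\<close>.\<close>

lemma Lam_eq_heat_deriv:
  fixes x :: "real ^ 'n::finite"
  assumes t: "t > 0" and nz: "\<nu> \<noteq> 0" and ev: "even (mdeg \<alpha>)"
  shows "Lam \<nu> \<alpha> N t \<phi> x = (\<Sum>\<beta>\<in>{\<beta>. mdeg \<beta> \<le> N}. moment \<beta> \<phi> * heat_deriv \<nu> (\<lambda>i. \<alpha> i + \<beta> i) t x)"
proof -
  have s: "(- 2 :: complex) powi (- int (mdeg \<alpha>)) = inverse 2 ^ mdeg \<alpha>"
  proof -
    have "inverse (- 2 :: complex) = - inverse 2" by simp
    then show ?thesis unfolding powi_minus_nat using ev by (simp only: power_minus_even)
  qed
  have K: "heat_deriv \<nu> (\<lambda>i. \<alpha> i + \<beta> i) t x = inverse 2 ^ mdeg \<alpha> * of_real (t powr (- (real (mdeg \<alpha>) / 2))) * (inverse 2 ^ mdeg \<beta> * of_real (t powr (- (real (mdeg \<beta>) / 2)))) * dilate t (\<lambda>y. hpoly \<nu> (\<lambda>i. \<alpha> i + \<beta> i) y * gauss \<nu> y) x"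
    for \<beta>
  proof -
    have m: "mdeg (\<lambda>i. \<alpha> i + \<beta> i) = mdeg \<alpha> + mdeg \<beta>" by (simp add: mdeg_def sum.distrib)
    have "t powr (- (real (mdeg \<alpha> + mdeg \<beta>) / 2)) = t powr (- (real (mdeg \<alpha>) / 2)) * t powr (- (real (mdeg \<beta>) / 2))"
      by (simp add: powr_add[symmetric] add_divide_distrib)
    then show ?thesis unfolding heat_deriv_eq_dilate[OF t nz] m by (simp only: power_add of_real_mult mult_ac)
  qed
  have "Lam \<nu> \<alpha> N t \<phi> x = (\<Sum>j\<in>{..N}. \<Sum>\<beta>\<in>{\<beta>. mdeg \<beta> = j}. moment \<beta> \<phi> * heat_deriv \<nu> (\<lambda>i. \<alpha> i + \<beta> i) t x)"
    unfolding Lam_def s unfolding sum_distrib_left powi_minus_nat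
    by (intro sum.cong) (auto simp: K mult_ac)
  also have "\<dots> = (\<Sum>\<beta>\<in>(\<Union>j\<in>{..N}. {\<beta>. mdeg \<beta> = j}). moment \<beta> \<phi> * heat_deriv \<nu> (\<lambda>i. \<alpha> i + \<beta> i) t x)"
    by (intro sum.UNION_disjoint[symmetric]) (auto simp: finite_mdeg_eq)
  also have "(\<Union>j\<in>{..N}. {\<beta> :: 'n \<Rightarrow> nat. mdeg \<beta> = j}) = {\<beta>. mdeg \<beta> \<le> N}" by auto
  finally show ?thesis .
qed

lemma mdeg_double: "mdeg (\<lambda>i. 2 * \<gamma> i) = 2 * mdeg \<gamma>"
  by (simp add: mdeg_def sum_distrib_left)

lemma profile_eq_heat_deriv:
  fixes x :: "real ^ 'n::finite"
  assumes t: "t > 0" and nz: "\<nu> \<noteq> 0"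
  shows "profile \<nu> f u0 u k t x = (\<Sum>\<beta>\<in>{\<beta>. mdeg \<beta> \<le> k}. moment \<beta> u0 * heat_deriv \<nu> \<beta> t x)
    + (\<Sum>\<gamma>\<in>{\<gamma>. 2 * mdeg \<gamma> \<le> k}. (- \<nu>) ^ mdeg \<gamma> / of_nat (mfact \<gamma>) *
        (\<Sum>\<beta>\<in>{\<beta>. mdeg \<beta> \<le> k - 2 * mdeg \<gamma>}. moment \<beta> (psi f u (mdeg \<gamma>)) * heat_deriv \<nu> (\<lambda>i. 2 * \<gamma> i + \<beta> i) t x))"
proof -
  have S: "{\<gamma> :: 'n \<Rightarrow> nat. real (mdeg \<gamma>) \<le> real k / 2} = {\<gamma>. 2 * mdeg \<gamma> \<le> k}" by auto
  have z: "mdeg (\<lambda>i :: 'n. 0) = 0" by (simp add: mdeg_def)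
  show ?thesis unfolding profile_def S
    by (simp add: Lam_eq_heat_deriv[OF t nz] mdeg_double z)
qed

section \<open>Integral form of the moments and of the profile\<close>

context decaying_mild_solution
begin

definition Mw :: real where "Mw = (SOME M. M \<ge> 0 \<and> (\<forall>t>0. (\<integral>\<^sup>+ x. ennreal (norm x ^ k) * ennreal (norm (v t x)) \<partial>lborel) \<le> ennreal (M * (1 + t) powr (real k / 2))))"

lemma Mw: "Mw \<ge> 0" "t > 0 \<Longrightarrow> (\<integral>\<^sup>+ x. ennreal (norm x ^ k) * ennreal (norm (v t x)) \<partial>lborel) \<le> ennreal (Mw * (1 + t) powr (real k / 2))"
  using someI_ex[OF v_weighted, folded Mw_def] by blast+

text \<open>One constant above those for mass, moment and supremum, as
  \<open>decaying_source\<close> asks for a common one.\<close>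

definition C0 :: real where "C0 = B * V + B * Mw"

lemma C0: "C0 \<ge> 0" "B * V \<le> C0" "B * Mw \<le> C0"
  using B0 V(1) Mw(1) by (simp_all add: C0_def)

lemma g_weighted:
  assumes s: "s > 0"
  shows "(\<integral>\<^sup>+ y. ennreal (norm y ^ k) * ennreal (norm (g s y)) \<partial>lborel) \<le> ennreal (C0 * (1 + s) powr (real k / 2 - a))"
proof -
  have "(\<integral>\<^sup>+ y. ennreal (norm y ^ k) * ennreal (norm (g s y)) \<partial>lborel) \<le> (\<integral>\<^sup>+ y. ennreal (B * (1 + s) powr (- a)) * (ennreal (norm y ^ k) * ennreal (norm (v s y))) \<partial>lborel)"
  proof (rule nn_integral_mono_AE)
    show "AE y in lborel. ennreal (norm y ^ k) * ennreal (norm (g s y)) \<le> ennreal (B * (1 + s) powr (- a)) * (ennreal (norm y ^ k) * ennreal (norm (v s y)))"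
      using g_v[OF s]
    proof eventually_elim
      case (elim y)
      then have "ennreal (norm (g s y)) \<le> ennreal (B * (1 + s) powr (- a)) * ennreal (norm (v s y))" using B0 by (simp add: ennreal_mult[symmetric] ennreal_leI)
      then have "ennreal (norm y ^ k) * ennreal (norm (g s y)) \<le> ennreal (norm y ^ k) * (ennreal (B * (1 + s) powr (- a)) * ennreal (norm (v s y)))" by (rule mult_left_mono) simp
      then show ?case by (simp only: mult_ac)
    qed
  qed
  also have "\<dots> = ennreal (B * (1 + s) powr (- a)) * (\<integral>\<^sup>+ y. ennreal (norm y ^ k) * ennreal (norm (v s y)) \<partial>lborel)"
    by (rule nn_integral_cmult) measurable
  also have "\<dots> \<le> ennreal (B * (1 + s) powr (- a)) * ennreal (Mw * (1 + s) powr (real k / 2))"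
    by (intro mult_left_mono Mw s) simp
  also have "\<dots> = ennreal (B * Mw * (1 + s) powr (real k / 2 - a))"
  proof -
    have "(1 + s) powr (- a) * (1 + s) powr (real k / 2) = (1 + s) powr (real k / 2 - a)" by (simp add: powr_add[symmetric])
    then have "B * (1 + s) powr (- a) * (Mw * (1 + s) powr (real k / 2)) = B * Mw * (1 + s) powr (real k / 2 - a)" by (metis mult.assoc mult.left_commute)
    moreover have "ennreal (B * (1 + s) powr (- a)) * ennreal (Mw * (1 + s) powr (real k / 2)) = ennreal (B * (1 + s) powr (- a) * (Mw * (1 + s) powr (real k / 2)))"
      using B0 Mw(1) by (intro ennreal_mult[symmetric]) auto
    ultimately show ?thesis by (simp only:)
  qed
  also have "\<dots> \<le> ennreal (C0 * (1 + s) powr (real k / 2 - a))" by (intro ennreal_leI mult_right_mono C0) simp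
  finally show ?thesis .
qed

lemma g_sup:
  assumes s: "s > 0"
  shows "AE y in lborel. norm (g s y) \<le> C0 * (1 + s) powr (- a - real CARD('n) / 2)"
  using g_v[OF s] v_sup[OF s]
proof eventually_elim
  case (elim y)
  have "norm (g s y) \<le> B * (1 + s) powr (- a) * (V * (1 + s) powr (- (real CARD('n) / 2)))"
    using elim B0 by (meson mult_left_mono mult_nonneg_nonneg order_trans powr_ge_zero)
  also have "\<dots> = B * V * (1 + s) powr (- a - real CARD('n) / 2)"
  proof -
    have "(1 + s) powr (- a) * (1 + s) powr (- (real CARD('n) / 2)) = (1 + s) powr (- a - real CARD('n) / 2)" by (simp add: powr_add[symmetric])
    then show ?thesis by (metis mult.assoc mult.left_commute)
  qed
  also have "\<dots> \<le> C0 * (1 + s) powr (- a - real CARD('n) / 2)" by (intro mult_right_mono C0) simp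
  finally show ?case .
qed

text \<open>The expansion order is m + 1, one beyond the profile in the theorem, so that the last
  term of the expansion becomes the limit.\<close>

sublocale S: decaying_source \<nu> "Suc m" a C0 u0b g
proof
  show "Re \<nu> > 0" by (rule nu)
  show "a > real (Suc m) / 2 + 1" by (rule a_gt)
  show "C0 \<ge> 0" by (rule C0)
  show "u0b \<in> borel_measurable borel" using u0b(1) by simp
  show "(\<integral>\<^sup>+ y. ennreal (norm (u0b y)) \<partial>lborel) < \<infinity>" by (rule u0b_L1)
  show "(\<integral>\<^sup>+ y. ennreal (norm y ^ Suc m) * ennreal (norm (u0b y)) \<partial>lborel) < \<infinity>" by (rule u0b_weighted)
  show "(\<lambda>z. g (fst z) (snd z)) \<in> borel_measurable (lborel \<Otimes>\<^sub>M lborel)" by (rule g_measurable)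
  show "\<And>s y. s \<le> 0 \<Longrightarrow> g s y = 0" by (simp add: g_def)
  show "(\<integral>\<^sup>+ y. ennreal (norm (g s y)) \<partial>lborel) \<le> ennreal (C0 * (1 + s) powr (- a))" if "s > 0" for s
    by (rule order_trans[OF g_L1[OF that]]) (intro ennreal_leI mult_right_mono C0, simp)
  show "\<And>s. s > 0 \<Longrightarrow> (\<integral>\<^sup>+ y. ennreal (norm y ^ Suc m) * ennreal (norm (g s y)) \<partial>lborel) \<le> ennreal (C0 * (1 + s) powr (real (Suc m) / 2 - a))" by (rule g_weighted)
  show "\<And>s. s > 0 \<Longrightarrow> AE y in lborel. norm (g s y) \<le> C0 * (1 + s) powr (- a - real CARD('n) / 2)" by (rule g_sup)
qed

lemma f_u_measurable: "s \<ge> 0 \<Longrightarrow> (\<lambda>x. f (u s x)) \<in> borel_measurable lebesgue"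
  by (rule measurable_compose[OF u_measurable f_measurable])

lemma f_u_L1: "s > 0 \<Longrightarrow> lq_norm 1 (\<lambda>x. f (u s x)) \<le> ennreal (B * V * (1 + s) powr (- a))"
proof -
  assume s: "s > 0"
  have "lq_norm 1 (\<lambda>x. f (u s x)) = (\<integral>\<^sup>+ x. ennreal (norm (g s x)) \<partial>lebesgue)"
    unfolding lq_norm_1 using f_u_eq_g[OF s] by (intro nn_integral_cong_AE) auto
  then show ?thesis using g_L1[OF s] by (simp add: nn_integral_completion)
qed

text \<open>The values of u are bounded uniformly in time by V, and on bounded sets f is Lipschitz,
  so L^1 continuity passes from u to f(u); the factor in time is continuous.\<close>

lemma f_u_continuous:
  assumes s: "s > 0"
  shows "((\<lambda>r. lq_norm 1 (\<lambda>x. of_real (r ^ j) * f (u r x) - of_real (s ^ j) * f (u s x))) \<longlongrightarrow> 0) (at s)"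
proof -
  define L where "L = 2 * K * V powr (p - 1)"
  have L0: "L \<ge> 0" using K(1) by (simp add: L_def)
  have lip: "AE x in lebesgue. norm (f (u r x) - f (u s x)) \<le> L * norm (u r x - u s x)" if r: "r > 0" for r
    using u_sup[OF r] u_sup[OF s]
  proof eventually_elim
    case (elim x)
    have b: "z powr (p - 1) \<le> V powr (p - 1)" if "z \<ge> 0" "z \<le> V * (1 + q) powr (- (real CARD('n) / 2))" "q > 0" for z q
    proof -
      have "z powr (p - 1) \<le> V powr (p - 1) * (1 + q) powr (- a)" by (rule powr_decay[OF that(3,1,2)])
      also have "(1 + q) powr (- a) \<le> (1 + q) powr 0" using that a_gt_1 by (intro powr_mono) auto
      then have "V powr (p - 1) * (1 + q) powr (- a) \<le> V powr (p - 1) * 1" using that by (intro mult_left_mono) auto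
      finally show ?thesis by simp
    qed
    have "norm (f (u r x) - f (u s x)) \<le> K * (norm (u r x) powr (p - 1) + norm (u s x) powr (p - 1)) * norm (u r x - u s x)" by (rule K(2))
    also have "\<dots> \<le> K * (V powr (p - 1) + V powr (p - 1)) * norm (u r x - u s x)"
      using K(1) b[OF norm_ge_zero elim(1) r] b[OF norm_ge_zero elim(2) s] by (intro mult_right_mono mult_left_mono add_mono) auto
    finally show ?case by (simp add: L_def)
  qed
  have bd: "lq_norm 1 (\<lambda>x. of_real (r ^ j) * f (u r x) - of_real (s ^ j) * f (u s x)) \<le> ennreal (r ^ j * L) * lq_norm 1 (\<lambda>x. u r x - u s x) + ennreal \<bar>r ^ j - s ^ j\<bar> * ennreal (B * V)"
    if r: "r > 0" for r
  proof -
    have m1: "(\<lambda>x. ennreal (norm (u r x - u s x))) \<in> borel_measurable lebesgue"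
      using r s by (intro ennreal_norm_diff_measurable u_measurable) auto
    have m2: "(\<lambda>x. ennreal (norm (f (u s x)))) \<in> borel_measurable lebesgue"
      using f_u_measurable[OF less_imp_le[OF s]] by measurable
    have "lq_norm 1 (\<lambda>x. of_real (r ^ j) * f (u r x) - of_real (s ^ j) * f (u s x)) \<le> (\<integral>\<^sup>+ x. ennreal (r ^ j * L) * ennreal (norm (u r x - u s x)) + ennreal \<bar>r ^ j - s ^ j\<bar> * ennreal (norm (f (u s x))) \<partial>lebesgue)"
      unfolding lq_norm_1
    proof (rule nn_integral_mono_AE)
      show "AE x in lebesgue. ennreal (norm (of_real (r ^ j) * f (u r x) - of_real (s ^ j) * f (u s x))) \<le> ennreal (r ^ j * L) * ennreal (norm (u r x - u s x)) + ennreal \<bar>r ^ j - s ^ j\<bar> * ennreal (norm (f (u s x)))"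
        using lip[OF r]
      proof eventually_elim
        case (elim x)
        have "of_real (r ^ j) * f (u r x) - of_real (s ^ j) * f (u s x) = of_real (r ^ j) * (f (u r x) - f (u s x)) + of_real (r ^ j - s ^ j) * f (u s x)" by (simp add: algebra_simps)
        then have "norm (of_real (r ^ j) * f (u r x) - of_real (s ^ j) * f (u s x)) \<le> norm (of_real (r ^ j) * (f (u r x) - f (u s x))) + norm (of_real (r ^ j - s ^ j) * f (u s x))"
          by (metis norm_triangle_ineq)
        also have "\<dots> = r ^ j * norm (f (u r x) - f (u s x)) + \<bar>r ^ j - s ^ j\<bar> * norm (f (u s x))" using r by (simp only: norm_mult norm_of_real abs_of_nonneg zero_le_power less_imp_le)
        also have "\<dots> \<le> r ^ j * L * norm (u r x - u s x) + \<bar>r ^ j - s ^ j\<bar> * norm (f (u s x))"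
          using mult_left_mono[OF elim, of "r ^ j"] r by (simp add: mult.assoc)
        finally have "ennreal (norm (of_real (r ^ j) * f (u r x) - of_real (s ^ j) * f (u s x))) \<le> ennreal (r ^ j * L * norm (u r x - u s x) + \<bar>r ^ j - s ^ j\<bar> * norm (f (u s x)))" by (rule ennreal_leI)
        also have "\<dots> = ennreal (r ^ j * L) * ennreal (norm (u r x - u s x)) + ennreal \<bar>r ^ j - s ^ j\<bar> * ennreal (norm (f (u s x)))"
          using r L0 by (subst ennreal_plus) (auto simp: ennreal_mult)
        finally show ?case .
      qed
    qed
    also have "\<dots> = ennreal (r ^ j * L) * lq_norm 1 (\<lambda>x. u r x - u s x) + ennreal \<bar>r ^ j - s ^ j\<bar> * lq_norm 1 (\<lambda>x. f (u s x))"
      unfolding lq_norm_1 nn_integral_add[OF borel_measurable_times_ennreal[OF borel_measurable_const m1] borel_measurable_times_ennreal[OF borel_measurable_const m2]] nn_integral_cmult[OF m1] nn_integral_cmult[OF m2] ..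
    also have "\<dots> \<le> ennreal (r ^ j * L) * lq_norm 1 (\<lambda>x. u r x - u s x) + ennreal \<bar>r ^ j - s ^ j\<bar> * ennreal (B * V)"
    proof (intro add_left_mono mult_left_mono)
      have "(1 + s) powr (- a) \<le> (1 + s) powr 0" using s a_gt_1 by (intro powr_mono) auto
      then have "B * V * (1 + s) powr (- a) \<le> B * V" using B0 V(1) s by (intro mult_left_le) auto
      then show "lq_norm 1 (\<lambda>x. f (u s x)) \<le> ennreal (B * V)" using f_u_L1[OF s] order_trans ennreal_leI by blast
    qed simp
    finally show ?thesis .
  qed
  have "((\<lambda>r. ennreal (r ^ j * L) * lq_norm 1 (\<lambda>x. u r x - u s x) + ennreal \<bar>r ^ j - s ^ j\<bar> * ennreal (B * V)) \<longlongrightarrow> 0 + 0) (at s)"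
  proof (rule tendsto_add)
    have "((\<lambda>r. ennreal ((s + 1) ^ j * L) * lq_norm 1 (\<lambda>x. u r x - u s x)) \<longlongrightarrow> ennreal ((s + 1) ^ j * L) * 0) (at s)"
      by (rule ennreal_tendsto_cmult[OF _ u_cont[OF s]]) simp
    then have l: "((\<lambda>r. ennreal ((s + 1) ^ j * L) * lq_norm 1 (\<lambda>x. u r x - u s x)) \<longlongrightarrow> 0) (at s)" by simp
    show "((\<lambda>r. ennreal (r ^ j * L) * lq_norm 1 (\<lambda>x. u r x - u s x)) \<longlongrightarrow> 0) (at s)"
    proof (rule tendsto_sandwich[OF _ _ tendsto_const l])
      have "\<forall>\<^sub>F r in at s. r < s + 1" by (rule order_tendstoD(2)[OF tendsto_ident_at]) simp
      moreover have "\<forall>\<^sub>F r in at s. r > 0" by (rule order_tendstoD(1)[OF tendsto_ident_at s])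
      ultimately show "\<forall>\<^sub>F r in at s. ennreal (r ^ j * L) * lq_norm 1 (\<lambda>x. u r x - u s x) \<le> ennreal ((s + 1) ^ j * L) * lq_norm 1 (\<lambda>x. u r x - u s x)"
        by eventually_elim (use L0 in \<open>intro mult_right_mono ennreal_leI power_mono, auto\<close>)
    qed auto
    have "((\<lambda>r. \<bar>r ^ j - s ^ j\<bar> * (B * V)) \<longlongrightarrow> \<bar>s ^ j - s ^ j\<bar> * (B * V)) (at s)" by (intro tendsto_intros)
    from tendsto_ennrealI[OF this] show "((\<lambda>r. ennreal \<bar>r ^ j - s ^ j\<bar> * ennreal (B * V)) \<longlongrightarrow> 0) (at s)"
      using B0 V(1) by (simp add: ennreal_mult)
  qed
  then have lim: "((\<lambda>r. ennreal (r ^ j * L) * lq_norm 1 (\<lambda>x. u r x - u s x) + ennreal \<bar>r ^ j - s ^ j\<bar> * ennreal (B * V)) \<longlongrightarrow> 0) (at s)" by simp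
  show ?thesis
  proof (rule tendsto_sandwich[OF _ _ tendsto_const lim])
    have "\<forall>\<^sub>F r in at s. r > 0" by (rule order_tendstoD(1)[OF tendsto_ident_at s])
    then show "\<forall>\<^sub>F r in at s. lq_norm 1 (\<lambda>x. of_real (r ^ j) * f (u r x) - of_real (s ^ j) * f (u s x)) \<le> ennreal (r ^ j * L) * lq_norm 1 (\<lambda>x. u r x - u s x) + ennreal \<bar>r ^ j - s ^ j\<bar> * ennreal (B * V)"
      by eventually_elim (rule bd)
  qed auto
qed

text \<open>As \<open>psi\<close> is a Hilbert choice, an integral first has to be shown to exist;
  then whichever one is chosen agrees almost everywhere with the pointwise integral.\<close>

lemma psi_eq:
  assumes j: "2 * j \<le> k"
  shows "AE x in lebesgue. psi f u j x = (\<integral>s. of_real (s ^ j) * g s x \<partial>lborel)"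
    and "psi f u j \<in> borel_measurable lebesgue"
proof -
  let ?F = "\<lambda>s x. complex_of_real (s ^ j) * f (u s x)"
  let ?h = "\<lambda>s x. complex_of_real (s ^ j) * g s x"
  let ?b = "\<lambda>s. ennreal (B * V * (1 + max 0 s) powr (- (a - real j)))"
  \<comment> \<open>From 2j \<le> k follows a - j > 1, so s^j f(u(s)) is still integrable in
    time.\<close>
  have "real (2 * j) \<le> real k" using j by (simp only: of_nat_le_iff)
  then have "1 + real j \<le> real k / 2 + 1" by (simp del: of_nat_Suc)
  from order_le_less_trans[OF this a_gt] have ja: "a - real j > 1" by simp
  have hm: "(\<lambda>z. ?h (fst z) (snd z)) \<in> borel_measurable (lborel \<Otimes>\<^sub>M lborel)"
    using g_measurable by measurable
  have Fh: "AE x in lebesgue. ?F s x = ?h s x" if "s > 0" for s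
    using f_u_eq_g[OF that] by eventually_elim simp
  have Fm: "?F s \<in> borel_measurable lebesgue" if "s > 0" for s
    using f_u_measurable[OF less_imp_le[OF that]] by measurable
  have Fb: "lq_norm 1 (?F s) \<le> ?b s" if s: "s > 0" for s
  proof -
    have "lq_norm 1 (?F s) = ennreal (s ^ j) * lq_norm 1 (\<lambda>x. f (u s x))"
    proof -
      have m: "(\<lambda>x. ennreal (norm (f (u s x)))) \<in> borel_measurable lebesgue" using f_u_measurable[OF less_imp_le[OF s]] by measurable
      show ?thesis unfolding lq_norm_1 nn_integral_cmult[OF m, symmetric]
        using s by (intro nn_integral_cong) (simp add: norm_mult norm_power ennreal_mult)
    qed
    also have "\<dots> \<le> ennreal (s ^ j) * ennreal (B * V * (1 + s) powr (- a))" by (intro mult_left_mono f_u_L1 s) simp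
    also have "\<dots> = ennreal (s ^ j * (B * V * (1 + s) powr (- a)))" using s B0 V(1) by (intro ennreal_mult[symmetric]) auto
    also have "\<dots> \<le> ennreal ((1 + s) powr real j * (B * V * (1 + s) powr (- a)))"
    proof (intro ennreal_leI mult_right_mono)
      have "s ^ j \<le> (1 + s) ^ j" using s by (intro power_mono) auto
      then show "s ^ j \<le> (1 + s) powr real j" using s by (simp add: powr_realpow)
    qed (use B0 V(1) in auto)
    also have "(1 + s) powr real j * (B * V * (1 + s) powr (- a)) = B * V * ((1 + s) powr real j * (1 + s) powr (- a))" by simp
    also have "(1 + s) powr real j * (1 + s) powr (- a) = (1 + max 0 s) powr (- (a - real j))" using s by (simp add: powr_add[symmetric])
    finally show ?thesis .
  qed
  have ex: "has_bochner_integral_in (Lq 1) (lq_norm 1) (lebesgue_on {0..}) ?F (\<lambda>x. \<integral>s. ?h s x \<partial>lebesgue_on {0..})"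
  proof (rule has_bochner_integral_in_L1_exists[where b="?b"])
    show "(\<lambda>z. ?h (fst z) (snd z)) \<in> borel_measurable (lborel \<Otimes>\<^sub>M lborel)" by (rule hm)
    show "\<And>s. s > 0 \<Longrightarrow> AE x in lebesgue. ?F s x = ?h s x" by (rule Fh)
    show "?F s \<in> Lq 1" if "s > 0" for s
      using Fm[OF that] order_le_less_trans[OF Fb[OF that]] by (simp add: Lq_def)
    show "((\<lambda>r. lq_norm 1 (\<lambda>x. ?F r x - ?F s x)) \<longlongrightarrow> 0) (at s)" if "s > 0" for s by (rule f_u_continuous[OF that])
    show "\<And>s. s > 0 \<Longrightarrow> lq_norm 1 (?F s) \<le> ?b s" by (rule Fb)
    show "?b s \<le> ?b r" if "0 < r" "r \<le> s" for r s
      using that ja B0 V(1) by (intro ennreal_leI mult_left_mono powr_mono2') auto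
    show "?b \<in> borel_measurable borel" by measurable
    show "(\<integral>\<^sup>+ s. ?b s \<partial>lebesgue_on {0..}) < \<infinity>"
    proof -
      have "(\<integral>\<^sup>+ s. ?b s \<partial>lebesgue_on {0..}) = (\<integral>\<^sup>+ s. ?b s * indicator {0..} s \<partial>lebesgue)" by (rule nn_integral_restrict_space) simp
      also have "\<dots> = (\<integral>\<^sup>+ s. ?b s * indicator {0..} s \<partial>lborel)" by (rule nn_integral_completion)
      also have "\<dots> = (\<integral>\<^sup>+ s. indicator {0<..} s * ennreal (B * V * (1 + s) powr (- (a - real j))) \<partial>lborel)"
      proof (rule nn_integral_cong_AE)
        show "AE s in lborel. ?b s * indicator {0..} s = indicator {0<..} s * ennreal (B * V * (1 + s) powr (- (a - real j)))"
          using AE_lborel_singleton[of 0] by eventually_elim (auto simp: indicator_def)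
      qed
      also have "\<dots> < \<infinity>" by (rule S.decay_finite[OF ja]) (use B0 V(1) in auto)
      finally show ?thesis .
    qed
  qed
  have psi: "has_bochner_integral_in (Lq 1) (lq_norm 1) (lebesgue_on {0..}) ?F (psi f u j)"
    unfolding psi_def by (rule someI[where P="has_bochner_integral_in (Lq 1) (lq_norm 1) (lebesgue_on {0..}) ?F", OF ex])
  then show "psi f u j \<in> borel_measurable lebesgue" unfolding has_bochner_integral_in_def by (auto intro: Lq_measurable)
  have pos: "AE s in lebesgue_on {0..}. s > (0::real)"
  proof -
    have "AE s in lebesgue. s \<noteq> (0::real)" using AE_completion[OF AE_lborel_singleton[of 0]] .
    then have "AE s in lebesgue_on {0::real..}. s \<noteq> 0" by (subst AE_restrict_space_iff) auto
    moreover have "AE s in lebesgue_on {0::real..}. s \<in> {0..}" by (rule AE_I2) (simp add: space_restrict_space)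
    ultimately show ?thesis by eventually_elim auto
  qed
  have "AE x in lebesgue. psi f u j x = (\<integral>s. ?h s x \<partial>lebesgue_on {0..})"
  proof (rule has_bochner_integral_in_pointwise[OF psi _ _ _ hm])
    show "AE s in lebesgue_on {0..}. AE x in lebesgue. ?F s x = ?h s x" using pos by eventually_elim (rule Fh)
    show "(\<integral>\<^sup>+ s. (\<integral>\<^sup>+ x. ennreal (norm (?h s x)) \<partial>lebesgue) \<partial>lebesgue_on {0..}) < \<infinity>"
    proof -
      have "(\<integral>\<^sup>+ s. (\<integral>\<^sup>+ x. ennreal (norm (?h s x)) \<partial>lebesgue) \<partial>lebesgue_on {0..}) = (\<integral>\<^sup>+ s. (\<integral>\<^sup>+ x. ennreal (norm (?h s x)) \<partial>lborel) * indicator {0..} s \<partial>lborel)"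
        by (simp add: nn_integral_restrict_space nn_integral_completion)
      also have "\<dots> \<le> (\<integral>\<^sup>+ s. (\<integral>\<^sup>+ x. ennreal (norm (?h s x)) \<partial>lborel) \<partial>lborel)" by (intro nn_integral_mono) (simp add: indicator_def)
      also have "\<dots> = (\<integral>\<^sup>+ z. ennreal (norm (?h (fst z) (snd z))) \<partial>(lborel \<Otimes>\<^sub>M lborel))"
        using lborel.nn_integral_fst[of "\<lambda>z. ennreal (norm (?h (fst z) (snd z)))" lborel] hm by simp
      also have "\<dots> < \<infinity>"
        using S.integrable_moment_source[of j "\<lambda>i. 0"] j by (simp add: integrable_iff_bounded mdeg_def mpow_def)
      finally show ?thesis .
    qed
  qed auto
  moreover have "(\<integral>s. ?h s x \<partial>lebesgue_on {0..}) = (\<integral>s. ?h s x \<partial>lborel)" for x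
  proof (rule integral_lebesgue_on_eq)
    have "(\<lambda>s. (s, x)) \<in> measurable lborel (lborel \<Otimes>\<^sub>M lborel)" by measurable
    from measurable_compose[OF this hm] show "(\<lambda>s. ?h s x) \<in> borel_measurable lborel" by simp
  qed (auto simp: g_def)
  ultimately show "AE x in lebesgue. psi f u j x = (\<integral>s. of_real (s ^ j) * g s x \<partial>lborel)" by simp
qed

text \<open>Fubini, justified by the integrability of the parabolic moment of degree 2j + |\<beta>|
  \<le> k.\<close>

lemma moment_psi:
  assumes j: "2 * j + mdeg \<beta> \<le> k"
  shows "moment \<beta> (psi f u j) = 1 / of_nat (mfact \<beta>) * (\<integral>z. of_real (fst z ^ j * mpow (snd z) \<beta>) * g (fst z) (snd z) \<partial>(lborel \<Otimes>\<^sub>M lborel))"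
proof -
  have j': "2 * j \<le> k" using j by simp
  let ?\<Psi> = "\<lambda>y. \<integral>s. of_real (s ^ j) * g s y \<partial>lborel"
  have mm: "(\<lambda>y. mpow y \<beta>) \<in> borel_measurable (lborel :: (real ^ 'n) measure)" by (rule mpow_measurable) measurable
  have \<Psi>m: "?\<Psi> \<in> borel_measurable lborel"
  proof (rule lborel.borel_measurable_lebesgue_integral)
    have [measurable]: "(\<lambda>z. g (snd z) (fst z)) \<in> borel_measurable (lborel \<Otimes>\<^sub>M lborel)"
      using measurable_compose[OF measurable_pair_swap' g_measurable] by (simp add: case_prod_beta)
    show "(\<lambda>(y, s). of_real (s ^ j) * g s y) \<in> borel_measurable (lborel \<Otimes>\<^sub>M lborel)" unfolding case_prod_beta by measurable
  qed
  have "(\<integral>y. complex_of_real (mpow y \<beta>) * psi f u j y \<partial>lebesgue) = (\<integral>y. complex_of_real (mpow y \<beta>) * ?\<Psi> y \<partial>lebesgue)"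
  proof (rule integral_cong_AE)
    show "(\<lambda>y. complex_of_real (mpow y \<beta>) * psi f u j y) \<in> borel_measurable lebesgue"
      using psi_eq(2)[OF j'] measurable_completion[OF mm] by measurable
    show "(\<lambda>y. complex_of_real (mpow y \<beta>) * ?\<Psi> y) \<in> borel_measurable lebesgue"
      using measurable_completion[OF \<Psi>m] measurable_completion[OF mm] by measurable
    show "AE y in lebesgue. complex_of_real (mpow y \<beta>) * psi f u j y = complex_of_real (mpow y \<beta>) * ?\<Psi> y"
      using psi_eq(1)[OF j'] by eventually_elim simp
  qed
  also have "\<dots> = (\<integral>y. complex_of_real (mpow y \<beta>) * ?\<Psi> y \<partial>lborel)" by (rule integral_completion) (use \<Psi>m mm in measurable)
  also have "\<dots> = (\<integral>y. (\<integral>s. of_real (s ^ j * mpow y \<beta>) * g s y \<partial>lborel) \<partial>lborel)"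
    by (intro Bochner_Integration.integral_cong refl) (simp add: mult_ac flip: integral_mult_right_zero)
  also have "\<dots> = (\<integral>z. of_real (fst z ^ j * mpow (snd z) \<beta>) * g (fst z) (snd z) \<partial>(lborel \<Otimes>\<^sub>M lborel))"
    using lborel_pair.integral_snd[of "\<lambda>s y. of_real (s ^ j * mpow y \<beta>) * g s y"] S.integrable_moment_source[OF j] by (simp add: case_prod_beta')
  finally show ?thesis unfolding moment_def by simp
qed

lemma moment_u0: "moment \<beta> u0 = 1 / of_nat (mfact \<beta>) * (\<integral>y. of_real (mpow y \<beta>) * u0b y \<partial>lborel)"
proof -
  have mm: "(\<lambda>y. mpow y \<beta>) \<in> borel_measurable (lborel :: (real ^ 'n) measure)" by (rule mpow_measurable) measurable
  have "(\<integral>y. complex_of_real (mpow y \<beta>) * u0 y \<partial>lebesgue) = (\<integral>y. complex_of_real (mpow y \<beta>) * u0b y \<partial>lebesgue)"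
  proof (rule integral_cong_AE)
    show "(\<lambda>y. complex_of_real (mpow y \<beta>) * u0 y) \<in> borel_measurable lebesgue"
      using u0_measurable measurable_completion[OF mm] by measurable
    show "(\<lambda>y. complex_of_real (mpow y \<beta>) * u0b y) \<in> borel_measurable lebesgue"
      using measurable_completion[OF u0b(1)] measurable_completion[OF mm] by measurable
    show "AE y in lebesgue. complex_of_real (mpow y \<beta>) * u0 y = complex_of_real (mpow y \<beta>) * u0b y"
      using AE_completion[OF u0b(2)] by eventually_elim simp
  qed
  also have "\<dots> = (\<integral>y. of_real (mpow y \<beta>) * u0b y \<partial>lborel)" by (rule integral_completion) (use u0b(1) mm in measurable)
  finally show ?thesis unfolding moment_def by simp
qed

text \<open>With all moments written as integrals over y or over (s, y), the finite sums of the
  profile are exactly the integrated Taylor sums, term by term.\<close>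

lemma profile_eq_heat_taylor:
  assumes t: "t > 0"
  shows "profile \<nu> f u0 u k t x = (\<integral>y. heat_taylor \<nu> k t 0 x y * u0b y \<partial>lborel) + (\<integral>z. heat_taylor \<nu> k t (fst z) x (snd z) * g (fst z) (snd z) \<partial>(lborel \<Otimes>\<^sub>M lborel))"
  unfolding profile_eq_heat_deriv[OF t nz] S.integrable_heat_taylor_datum(2) S.integrable_heat_taylor_source(2)
proof (rule arg_cong2[where f="(+)"])
  show "(\<Sum>\<beta>\<in>{\<beta>. mdeg \<beta> \<le> k}. moment \<beta> u0 * heat_deriv \<nu> \<beta> t x) = (\<Sum>\<beta>\<in>{\<beta>. mdeg \<beta> \<le> k}. heat_deriv \<nu> \<beta> t x / of_nat (mfact \<beta>) * (\<integral>y. of_real (mpow y \<beta>) * u0b y \<partial>lborel))"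
    by (intro sum.cong refl) (simp add: moment_u0)
  show "(\<Sum>\<gamma>\<in>{\<gamma>. 2 * mdeg \<gamma> \<le> k}. (- \<nu>) ^ mdeg \<gamma> / of_nat (mfact \<gamma>) *
        (\<Sum>\<beta>\<in>{\<beta>. mdeg \<beta> \<le> k - 2 * mdeg \<gamma>}. moment \<beta> (psi f u (mdeg \<gamma>)) * heat_deriv \<nu> (\<lambda>i. 2 * \<gamma> i + \<beta> i) t x)) =
     (\<Sum>\<gamma>\<in>{\<gamma>. 2 * mdeg \<gamma> \<le> k}. (- \<nu>) ^ mdeg \<gamma> / of_nat (mfact \<gamma>) * (\<Sum>\<beta>\<in>{\<beta>. mdeg \<beta> \<le> k - 2 * mdeg \<gamma>}.
       heat_deriv \<nu> (\<lambda>i. 2 * \<gamma> i + \<beta> i) t x / of_nat (mfact \<beta>) * (\<integral>z. of_real (fst z ^ mdeg \<gamma> * mpow (snd z) \<beta>) * g (fst z) (snd z) \<partial>(lborel \<Otimes>\<^sub>M lborel))))"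
  proof (rule sum.cong[OF refl], rule arg_cong2[where f="(*)", OF refl], rule sum.cong[OF refl])
    fix \<gamma> \<beta> :: "'n \<Rightarrow> nat" assume "\<gamma> \<in> {\<gamma>. 2 * mdeg \<gamma> \<le> k}" "\<beta> \<in> {\<beta>. mdeg \<beta> \<le> k - 2 * mdeg \<gamma>}"
    then have "2 * mdeg \<gamma> + mdeg \<beta> \<le> k" by auto
    from moment_psi[OF this]
    show "moment \<beta> (psi f u (mdeg \<gamma>)) * heat_deriv \<nu> (\<lambda>i. 2 * \<gamma> i + \<beta> i) t x = heat_deriv \<nu> (\<lambda>i. 2 * \<gamma> i + \<beta> i) t x / of_nat (mfact \<beta>) * (\<integral>z. of_real (fst z ^ mdeg \<gamma> * mpow (snd z) \<beta>) * g (fst z) (snd z) \<partial>(lborel \<Otimes>\<^sub>M lborel))"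
      by simp
  qed
qed

end

section \<open>Solution minus profile of order m + 1\<close>

context decaying_mild_solution
begin

lemma integrable_heat_kernel_datum:
  assumes t: "t > 0"
  shows "integrable lborel (\<lambda>y. heat_kernel \<nu> t (x - y) * u0b y)"
proof (rule integrableI_bounded)
  note [measurable] = u0b(1)
  have [measurable]: "(\<lambda>y. heat_kernel \<nu> t (x - y)) \<in> borel_measurable lborel" by (rule heat_kernel_measurable[OF nz]) measurable
  show "(\<lambda>y. heat_kernel \<nu> t (x - y) * u0b y) \<in> borel_measurable lborel" by measurable
  obtain C where C: "C > 0" "\<forall>t. \<forall>x :: real ^ 'n. norm (heat_kernel \<nu> t x) \<le> (if t > 0 then C * gauss_bound (gauss_rate \<nu>) t x else 0)"
    using heat_kernel_bound[OF nu, where 'n='n] by (elim exE conjE)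
  let ?c = "C * t powr (- (real CARD('n) / 2))"
  have b: "norm (heat_kernel \<nu> t (x - y)) \<le> ?c" for y
  proof -
    have "norm (heat_kernel \<nu> t (x - y)) \<le> C * gauss_bound (gauss_rate \<nu>) t (x - y)" using C(2)[rule_format, of t "x - y"] t by simp
    also have "\<dots> \<le> ?c" using C(1) gauss_bound_le[OF gauss_rate_pos[OF nu] t] by (intro mult_left_mono) auto
    finally show ?thesis .
  qed
  have "(\<integral>\<^sup>+ y. ennreal (norm (heat_kernel \<nu> t (x - y) * u0b y)) \<partial>lborel) \<le> (\<integral>\<^sup>+ y. ennreal ?c * ennreal (norm (u0b y)) \<partial>lborel)"
  proof (rule nn_integral_mono)
    fix y
    show "ennreal (norm (heat_kernel \<nu> t (x - y) * u0b y)) \<le> ennreal ?c * ennreal (norm (u0b y))"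
      using b[of y] C(1) by (simp add: norm_mult ennreal_mult[symmetric] mult_right_mono ennreal_leI)
  qed
  also have "\<dots> = ennreal ?c * (\<integral>\<^sup>+ y. ennreal (norm (u0b y)) \<partial>lborel)" by (rule nn_integral_cmult) measurable
  also have "\<dots> < \<infinity>" using u0b_L1 by (simp add: ennreal_mult_less_top)
  finally show "(\<integral>\<^sup>+ y. ennreal (norm (heat_kernel \<nu> t (x - y) * u0b y)) \<partial>lborel) < \<infinity>" .
qed

text \<open>The kernel is unbounded near s = t, so its mass is paired with the supremum of
  \<open>g s\<close>; the result decays like (1+s)^(-a-n/2).\<close>

lemma integrable_heat_kernel_source:
  "integrable (lborel \<Otimes>\<^sub>M lborel) (\<lambda>z. heat_kernel \<nu> (t - fst z) (x - snd z) * g (fst z) (snd z))"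
proof (rule integrableI_bounded)
  note [measurable] = g_measurable
  have [measurable]: "(\<lambda>z. heat_kernel \<nu> (t - fst z) (x - snd z)) \<in> borel_measurable S.P" by (rule heat_kernel_measurable[OF nz]) measurable
  show "(\<lambda>z. heat_kernel \<nu> (t - fst z) (x - snd z) * g (fst z) (snd z)) \<in> borel_measurable S.P" by measurable
  obtain C where C: "C \<ge> 0" and C': "\<forall>t. \<forall>y :: real ^ 'n. (\<integral>\<^sup>+ x. ennreal (norm (heat_kernel \<nu> t (x - y))) \<partial>lborel) \<le> ennreal C \<and>
     (\<integral>\<^sup>+ x. ennreal (norm (heat_kernel \<nu> t (y - x))) \<partial>lborel) \<le> ennreal C"
    using nn_integral_heat_kernel[OF nu, where 'n='n] by (elim exE conjE)
  let ?b = "a + real CARD('n) / 2"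
  have "(\<integral>\<^sup>+ z. ennreal (norm (heat_kernel \<nu> (t - fst z) (x - snd z) * g (fst z) (snd z))) \<partial>S.P)
     = (\<integral>\<^sup>+ z. ennreal (norm (heat_kernel \<nu> (t - fst z) (x - snd z))) * S.G z \<partial>S.P)"
    by (intro nn_integral_cong) (simp add: norm_mult ennreal_mult)
  also have "\<dots> \<le> (\<integral>\<^sup>+ s. indicator {0<..} s * ennreal (C * C0 * (1 + s) powr (- ?b)) \<partial>lborel)"
  proof (rule S.nn_integral_P_le)
    show "(\<lambda>z. ennreal (norm (heat_kernel \<nu> (t - fst z) (x - snd z)))) \<in> borel_measurable S.P" by measurable
    fix s :: real assume s: "s > 0"
    let ?q = "C0 * (1 + s) powr (- ?b)"
    have mk: "(\<lambda>y. ennreal (norm (heat_kernel \<nu> (t - s) (x - y)))) \<in> borel_measurable lborel"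
      using heat_kernel_measurable[OF nz, of "\<lambda>y. t - s" lborel "\<lambda>y. x - y"] by simp
    have "(\<integral>\<^sup>+ y. ennreal (norm (heat_kernel \<nu> (t - fst (s, y)) (x - snd (s, y)))) * ennreal (norm (g s y)) \<partial>lborel)
      \<le> (\<integral>\<^sup>+ y. ennreal ?q * ennreal (norm (heat_kernel \<nu> (t - s) (x - y))) \<partial>lborel)"
    proof (rule nn_integral_mono_AE)
      show "AE y in lborel. ennreal (norm (heat_kernel \<nu> (t - fst (s, y)) (x - snd (s, y)))) * ennreal (norm (g s y)) \<le> ennreal ?q * ennreal (norm (heat_kernel \<nu> (t - s) (x - y)))"
        using g_sup[OF s]
      proof eventually_elim
        case (elim y)
        then have "norm (g s y) \<le> ?q" by (simp add: algebra_simps)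
        then have "ennreal (norm (g s y)) \<le> ennreal ?q" by (rule ennreal_leI)
        from mult_left_mono[OF this, of "ennreal (norm (heat_kernel \<nu> (t - s) (x - y)))"]
        show ?case by (simp add: mult.commute)
      qed
    qed
    also have "\<dots> = ennreal ?q * (\<integral>\<^sup>+ y. ennreal (norm (heat_kernel \<nu> (t - s) (x - y))) \<partial>lborel)"
      by (rule nn_integral_cmult[OF mk])
    also have "\<dots> \<le> ennreal ?q * ennreal C" using C' by (intro mult_left_mono) auto
    also have "\<dots> = ennreal (C * C0 * (1 + s) powr (- ?b))" using C C0 by (simp add: ennreal_mult[symmetric] mult_ac)
    finally show "(\<integral>\<^sup>+ y. ennreal (norm (heat_kernel \<nu> (t - fst (s, y)) (x - snd (s, y)))) * ennreal (norm (g s y)) \<partial>lborel) \<le> ennreal (C * C0 * (1 + s) powr (- ?b))" .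
  qed
  also have "\<dots> < \<infinity>"
  proof (rule S.decay_finite)
    show "?b > 1" using a_gt_1 by (simp add: add_strict_increasing2)
    show "C * C0 \<ge> 0" using C C0 by simp
  qed
  finally show "(\<integral>\<^sup>+ z. ennreal (norm (heat_kernel \<nu> (t - fst z) (x - snd z) * g (fst z) (snd z))) \<partial>S.P) < \<infinity>" .
qed

text \<open>\<open>Duhamel\<close> minus \<open>profile_eq_heat_taylor\<close>: the datum integrals
  and the source integrals are subtracted separately, and absolute values then move inside.\<close>

lemma norm_solution_minus_profile_le:
  assumes t: "t > 0"
  shows "AE x in lborel. ennreal (norm (u t x - profile \<nu> f u0 u (Suc m) t x)) \<le> S.R t x"
  using Duhamel[OF t]
proof eventually_elim
  case (elim x)
  let ?p = "\<lambda>y. heat_taylor \<nu> (Suc m) t 0 x y"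
  let ?P = "\<lambda>z. heat_taylor \<nu> (Suc m) t (fst z) x (snd z)"
  let ?X = "\<integral>y. (heat_kernel \<nu> t (x - y) - ?p y) * u0b y \<partial>lborel"
  let ?Y = "\<integral>z. (heat_kernel \<nu> (t - fst z) (x - snd z) - ?P z) * g (fst z) (snd z) \<partial>S.P"
  have H: "(\<integral>s. H t s x \<partial>lborel) = (\<integral>z. heat_kernel \<nu> (t - fst z) (x - snd z) * g (fst z) (snd z) \<partial>S.P)"
    unfolding H_def using lborel_pair.integral_fst'[OF integrable_heat_kernel_source[of t x]] by simp
  have "u t x - profile \<nu> f u0 u (Suc m) t x = ?X + ?Y"
    unfolding elim H profile_eq_heat_taylor[OF t] left_diff_distrib
    using Bochner_Integration.integral_diff[OF integrable_heat_kernel_datum[OF t, of x] S.integrable_heat_taylor_datum(1)[of t x]]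
      Bochner_Integration.integral_diff[OF integrable_heat_kernel_source[of t x] S.integrable_heat_taylor_source(1)[of t x]]
    by simp
  then have "norm (u t x - profile \<nu> f u0 u (Suc m) t x) \<le> norm ?X + norm ?Y" by (simp only: norm_triangle_ineq)
  then have "ennreal (norm (u t x - profile \<nu> f u0 u (Suc m) t x)) \<le> ennreal (norm ?X) + ennreal (norm ?Y)"
    by (simp only: ennreal_leI ennreal_plus[OF norm_ge_zero norm_ge_zero, symmetric])
  also have "\<dots> \<le> S.R t x"
    unfolding S.R_def
  proof (rule add_mono)
    show "ennreal (norm ?X) \<le> (\<integral>\<^sup>+ y. ennreal (norm (heat_kernel \<nu> (t - 0) (x - y) - ?p y)) * ennreal (norm (u0b y)) \<partial>lborel)"
      using norm_integral_le_nn_integral[of lborel "\<lambda>y. (heat_kernel \<nu> t (x - y) - ?p y) * u0b y"] by (simp add: norm_mult ennreal_mult)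
    have "ennreal (norm ?Y) \<le> (\<integral>\<^sup>+ z. ennreal (norm ((heat_kernel \<nu> (t - fst z) (x - snd z) - ?P z) * g (fst z) (snd z))) \<partial>S.P)"
      by (rule norm_integral_le_nn_integral)
    \<comment> \<open>For s \<le> 0 both sides vanish together with the source, so
      \<open>max\<close> changes nothing.\<close>
    also have "\<dots> = (\<integral>\<^sup>+ z. ennreal (norm (heat_kernel \<nu> (t - max 0 (fst z)) (x - snd z) - heat_taylor \<nu> (Suc m) t (max 0 (fst z)) x (snd z))) * S.G z \<partial>S.P)"
    proof (rule nn_integral_cong)
      fix z :: "real \<times> (real ^ 'n)"
      show "ennreal (norm ((heat_kernel \<nu> (t - fst z) (x - snd z) - ?P z) * g (fst z) (snd z))) = ennreal (norm (heat_kernel \<nu> (t - max 0 (fst z)) (x - snd z) - heat_taylor \<nu> (Suc m) t (max 0 (fst z)) x (snd z))) * S.G z"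
        by (cases "fst z > 0") (simp_all add: norm_mult ennreal_mult max_def g_def)
    qed
    finally show "ennreal (norm ?Y) \<le> (\<integral>\<^sup>+ z. ennreal (norm (heat_kernel \<nu> (t - max 0 (fst z)) (x - snd z) - heat_taylor \<nu> (Suc m) t (max 0 (fst z)) x (snd z))) * S.G z \<partial>S.P)" .
  qed
  finally show ?case .
qed

lemma profile_measurable:
  assumes t: "t > 0"
  shows "profile \<nu> f u0 u N t \<in> borel_measurable borel"
proof -
  have [measurable]: "(\<lambda>x. heat_deriv \<nu> \<alpha> t (x :: real ^ 'n)) \<in> borel_measurable borel" for \<alpha> by (rule heat_deriv_measurable[OF nz]) measurable
  show ?thesis unfolding profile_eq_heat_deriv[OF t nz, abs_def] by measurable
qed

lemma solution_minus_profile_tendsto_L1: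
  "((\<lambda>t. ennreal (t powr (real (Suc m) / 2)) * lq_norm 1 (\<lambda>x. u t x - profile \<nu> f u0 u (Suc m) t x)) \<longlongrightarrow> 0) at_top"
proof (rule tendsto_sandwich[OF _ _ tendsto_const S.R_L1_tendsto])
  show "\<forall>\<^sub>F t in at_top. ennreal (t powr (real (Suc m) / 2)) * lq_norm 1 (\<lambda>x. u t x - profile \<nu> f u0 u (Suc m) t x) \<le> ennreal (t powr (real (Suc m) / 2)) * (\<integral>\<^sup>+ x. S.R t x \<partial>lborel)"
    using eventually_gt_at_top[of 0]
  proof eventually_elim
    case (elim t)
    have "lq_norm 1 (\<lambda>x. u t x - profile \<nu> f u0 u (Suc m) t x) = (\<integral>\<^sup>+ x. ennreal (norm (u t x - profile \<nu> f u0 u (Suc m) t x)) \<partial>lborel)"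
      unfolding lq_norm_1 by (rule nn_integral_completion)
    also have "\<dots> \<le> (\<integral>\<^sup>+ x. S.R t x \<partial>lborel)" by (rule nn_integral_mono_AE[OF norm_solution_minus_profile_le[OF elim]])
    finally show ?case by (rule mult_left_mono) simp
  qed
qed simp

lemma solution_minus_profile_tendsto_Linf:
  "((\<lambda>t. ennreal (t powr (real (Suc m) / 2 + real CARD('n) / 2)) * lq_norm \<infinity> (\<lambda>x. u t x - profile \<nu> f u0 u (Suc m) t x)) \<longlongrightarrow> 0) at_top"
proof -
  obtain e where e: "(e \<longlongrightarrow> 0) at_top" and e': "\<forall>t>0. \<forall>x. ennreal (t powr (real (Suc m) / 2 + real CARD('n) / 2)) * S.R t x \<le> e t"
    using S.R_inf_bound by (elim exE conjE)
  show ?thesis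
  proof (rule tendsto_sandwich[OF _ _ tendsto_const e])
    show "\<forall>\<^sub>F t in at_top. ennreal (t powr (real (Suc m) / 2 + real CARD('n) / 2)) * lq_norm \<infinity> (\<lambda>x. u t x - profile \<nu> f u0 u (Suc m) t x) \<le> e t"
      using eventually_gt_at_top[of 0]
    proof eventually_elim
      case (elim t)
      let ?c = "t powr (real (Suc m) / 2 + real CARD('n) / 2)"
      have c: "?c > 0" using elim by simp
      have "lq_norm \<infinity> (\<lambda>x. u t x - profile \<nu> f u0 u (Suc m) t x) \<le> e t / ennreal ?c"
      proof (rule lq_norm_inf_le)
        show "(\<lambda>x. u t x - profile \<nu> f u0 u (Suc m) t x) \<in> borel_measurable lebesgue"
        proof -
          have "profile \<nu> f u0 u (Suc m) t \<in> borel_measurable lebesgue" using profile_measurable[OF elim] by (intro measurable_completion) simp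
          then show ?thesis using u_measurable[OF less_imp_le[OF elim]] by measurable
        qed
        show "AE x in lebesgue. ennreal (norm (u t x - profile \<nu> f u0 u (Suc m) t x)) \<le> e t / ennreal ?c"
          using AE_completion[OF norm_solution_minus_profile_le[OF elim]]
        proof eventually_elim
          case (elim x)
          have "ennreal ?c * S.R t x \<le> e t" using e' \<open>t > 0\<close> by blast
          then have "S.R t x \<le> e t / ennreal ?c"
            using divide_right_mono_ennreal[of "ennreal ?c * S.R t x" "e t" "ennreal ?c"] c ennreal_mult_divide_eq[of "ennreal ?c" "S.R t x"]
            by (simp add: mult.commute)
          with elim show ?case by (rule order_trans)
        qed
      qed
      then have "ennreal ?c * lq_norm \<infinity> (\<lambda>x. u t x - profile \<nu> f u0 u (Suc m) t x) \<le> ennreal ?c * (e t / ennreal ?c)" by (rule mult_left_mono) simp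
      also have "\<dots> = e t" using c by (simp add: ennreal_times_divide ennreal_mult_divide_eq mult.commute)
      finally show ?case .
    qed
  qed simp
qed

end

section \<open>Interpolation and scaling of Lebesgue norms\<close>

lemma recip_inf: "recip \<infinity> = 0" "recip top = 0"
  by (simp_all add: recip_def)

lemma recip_ennreal: "r > 0 \<Longrightarrow> recip (ennreal r) = 1 / r"
  by (simp add: recip_def divide_ennreal flip: ennreal_1)

lemma exponent_cases:
  assumes "q \<ge> (1 :: ennreal)"
  obtains "q = \<infinity>" | r where "r \<ge> 1" "q = ennreal r"
  using assms by (cases q) auto

lemma lq_norm_ennreal:
  assumes "r \<ge> 1"
  shows "lq_norm (ennreal r) \<phi> = (let I = (\<integral>\<^sup>+ x. ennreal (norm (\<phi> x) powr r) \<partial>lebesgue)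
    in if I = \<infinity> then \<infinity> else ennreal (enn2real I powr (1 / r)))"
proof -
  have R: "recip (ennreal r) = 1 / r" using assms by (intro recip_ennreal) simp
  show ?thesis unfolding lq_norm_def R using assms by simp
qed

text \<open>Trades the r-th root for a power of the bound; an infinite integral is covered too,
  since then both sides fail.\<close>

lemma lq_norm_ennreal_le_iff:
  assumes r: "r \<ge> 1" and c: "c \<ge> 0"
  shows "lq_norm (ennreal r) \<phi> \<le> ennreal c \<longleftrightarrow> (\<integral>\<^sup>+ x. ennreal (norm (\<phi> x) powr r) \<partial>lebesgue) \<le> ennreal (c powr r)"
proof (cases "\<integral>\<^sup>+ x. ennreal (norm (\<phi> x) powr r) \<partial>lebesgue")
  case (real i)
  have "i powr (1 / r) \<le> c \<longleftrightarrow> i \<le> c powr r"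
  proof
    assume "i powr (1 / r) \<le> c"
    from powr_mono2[OF _ _ this, of r] show "i \<le> c powr r" using r real(1) by (simp add: powr_powr)
  next
    assume "i \<le> c powr r"
    from powr_mono2[OF _ _ this, of "1 / r"] show "i powr (1 / r) \<le> c" using r real(1) c by (simp add: powr_powr)
  qed
  then show ?thesis using real c unfolding lq_norm_ennreal[OF r] by simp
next
  case top
  then show ?thesis unfolding lq_norm_ennreal[OF r] by (simp add: top_unique)
qed

lemma lq_norm_zero:
  assumes "q \<ge> 1"
  shows "lq_norm q (\<lambda>x. 0) = 0"
  using assms
proof (cases rule: exponent_cases)
  case 1
  then show ?thesis using lq_norm_inf_le[of "\<lambda>x. 0" 0] by simp
next
  case (2 r)
  then show ?thesis by (simp add: lq_norm_ennreal)
qed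

lemma lq_norm_eq_0_AE:
  assumes "q \<ge> 1" and m: "\<phi> \<in> borel_measurable lebesgue" and z: "lq_norm q \<phi> = 0"
  shows "AE x in lebesgue. \<phi> x = 0"
  using assms(1)
proof (cases rule: exponent_cases)
  case 1
  then show ?thesis using lq_norm_inf_AE[of \<phi>] z by simp
next
  case (2 r)
  have [measurable]: "\<phi> \<in> borel_measurable lebesgue" by (rule m)
  have "(\<integral>\<^sup>+ x. ennreal (norm (\<phi> x) powr r) \<partial>lebesgue) \<le> ennreal (0 powr r)"
    using lq_norm_ennreal_le_iff[of r 0 \<phi>] z 2 by simp
  then have "(\<integral>\<^sup>+ x. ennreal (norm (\<phi> x) powr r) \<partial>lebesgue) = 0" using 2 by simp
  then have "AE x in lebesgue. ennreal (norm (\<phi> x) powr r) = 0" by (subst (asm) nn_integral_0_iff_AE) measurable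
  then show ?thesis by eventually_elim (simp add: ennreal_eq_0_iff powr_nonneg_iff)
qed

text \<open>Convexity of the r-th power; when x or y is 0 it reduces to c^r \<le> c for 0 < c \<le>
  1.\<close>

lemma powr_convex_combination:
  fixes x y :: real
  assumes r: "r \<ge> 1" and xy: "x \<ge> 0" "y \<ge> 0" and ab: "a > 0" "b > 0" "a + b = 1"
  shows "(a * x + b * y) powr r \<le> a * x powr r + b * y powr r"
proof -
  have z: "(c * w) powr r \<le> c * w powr r" if "c > 0" "c \<le> 1" "w \<ge> 0" for c w :: real
  proof -
    have "c powr r \<le> c powr 1" using that r by (intro powr_mono') auto
    then show ?thesis using that by (simp add: powr_mult mult_right_mono)
  qed
  consider "x = 0" | "y = 0" | "x > 0" "y > 0" using xy by linarith
  then show ?thesis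
  proof cases
    case 1 then show ?thesis using z[of b y] ab xy r by simp
  next
    case 2 then show ?thesis using z[of a x] ab xy r by simp
  next
    case 3
    have a: "a = 1 - b" using ab by simp
    show ?thesis using convex_onD[OF powr_convex[OF r], of b x y] 3 ab unfolding a by simp
  qed
qed

lemma ennreal_linear_combination:
  "a \<ge> 0 \<Longrightarrow> b \<ge> 0 \<Longrightarrow> x \<ge> 0 \<Longrightarrow> y \<ge> 0 \<Longrightarrow> ennreal (a * x + b * y) = ennreal a * ennreal x + ennreal b * ennreal y"
  by (simp add: ennreal_mult)

text \<open>Minkowski's inequality by convexity: for finite r both functions are divided by their
  norms and combined with weights proportional to these norms.\<close>

lemma lq_norm_add_le:
  assumes q: "q \<ge> 1" and m: "\<phi> \<in> borel_measurable lebesgue" "\<psi> \<in> borel_measurable lebesgue"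
  shows "lq_norm q (\<lambda>x. \<phi> x + \<psi> x) \<le> lq_norm q \<phi> + lq_norm q \<psi>"
  using q
proof (cases rule: exponent_cases)
  note [measurable] = m
  case 1
  show ?thesis unfolding 1
  proof (rule lq_norm_inf_le)
    show "AE x in lebesgue. ennreal (norm (\<phi> x + \<psi> x)) \<le> lq_norm \<infinity> \<phi> + lq_norm \<infinity> \<psi>"
      using lq_norm_inf_AE[of \<phi>] lq_norm_inf_AE[of \<psi>]
    proof eventually_elim
      case (elim x)
      have "ennreal (norm (\<phi> x + \<psi> x)) \<le> ennreal (norm (\<phi> x)) + ennreal (norm (\<psi> x))"
        by (simp add: norm_triangle_ineq ennreal_plus[symmetric] ennreal_leI del: ennreal_plus)
      also have "\<dots> \<le> lq_norm \<infinity> \<phi> + lq_norm \<infinity> \<psi>" by (rule add_mono[OF elim])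
      finally show ?case .
    qed
  qed measurable
next
  note [measurable] = m
  case (2 r)
  note r = \<open>r \<ge> 1\<close>
  show ?thesis
  proof (cases "lq_norm q \<phi> = \<infinity> \<or> lq_norm q \<psi> = \<infinity>")
    case True then show ?thesis by auto
  next
    case False
    then obtain A B where A: "A \<ge> 0" "lq_norm q \<phi> = ennreal A" and B: "B \<ge> 0" "lq_norm q \<psi> = ennreal B"
      by (cases "lq_norm q \<phi>"; cases "lq_norm q \<psi>") auto
    have "lq_norm q (\<lambda>x. \<phi> x + \<psi> x) \<le> ennreal (A + B) + ennreal e" if e: "e > 0" for e
    proof -
      \<comment> \<open>The norms are enlarged by e/2 so that one can divide by them even if they
        are 0.\<close>
      define A' where "A' = A + e / 2"
      define B' where "B' = B + e / 2"
      have p: "A' > 0" "B' > 0" using A B e by (simp_all add: A'_def B'_def)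
      have s: "A' + B' = A + B + e" by (simp add: A'_def B'_def)
      let ?a = "A' / (A' + B')" and ?b = "B' / (A' + B')"
      have ab: "?a > 0" "?b > 0" "?a + ?b = 1" using p by (auto simp: add_divide_distrib[symmetric])
      let ?C = "(A' + B') powr r"
      have IA: "(\<integral>\<^sup>+ x. ennreal (norm (\<phi> x) powr r) \<partial>lebesgue) \<le> ennreal (A' powr r)"
        using lq_norm_ennreal_le_iff[OF r, of A' \<phi>] A e p 2 by (simp add: A'_def)
      have IB: "(\<integral>\<^sup>+ x. ennreal (norm (\<psi> x) powr r) \<partial>lebesgue) \<le> ennreal (B' powr r)"
        using lq_norm_ennreal_le_iff[OF r, of B' \<psi>] B e p 2 by (simp add: B'_def)
      have "(\<integral>\<^sup>+ x. ennreal (norm (\<phi> x + \<psi> x) powr r) \<partial>lebesgue)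
         \<le> (\<integral>\<^sup>+ x. ennreal (?C * ?a / A' powr r) * ennreal (norm (\<phi> x) powr r) + ennreal (?C * ?b / B' powr r) * ennreal (norm (\<psi> x) powr r) \<partial>lebesgue)"
      proof (rule nn_integral_mono)
        fix x
        have "norm (\<phi> x + \<psi> x) powr r \<le> (norm (\<phi> x) + norm (\<psi> x)) powr r" using r by (intro powr_mono2 norm_triangle_ineq) auto
        also have "norm (\<phi> x) + norm (\<psi> x) = (A' + B') * (?a * (norm (\<phi> x) / A') + ?b * (norm (\<psi> x) / B'))"
          using p by (simp add: distrib_left)
        also have "\<dots> powr r = ?C * (?a * (norm (\<phi> x) / A') + ?b * (norm (\<psi> x) / B')) powr r" using p by (simp add: powr_mult)
        also have "\<dots> \<le> ?C * (?a * (norm (\<phi> x) / A') powr r + ?b * (norm (\<psi> x) / B') powr r)"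
          using p by (intro mult_left_mono powr_convex_combination[OF r _ _ ab]) auto
        also have "\<dots> = ?C * ?a / A' powr r * norm (\<phi> x) powr r + ?C * ?b / B' powr r * norm (\<psi> x) powr r"
          using p by (simp add: powr_divide distrib_left)
        finally have "ennreal (norm (\<phi> x + \<psi> x) powr r) \<le> ennreal (?C * ?a / A' powr r * norm (\<phi> x) powr r + ?C * ?b / B' powr r * norm (\<psi> x) powr r)" by (rule ennreal_leI)
        also have "\<dots> = ennreal (?C * ?a / A' powr r) * ennreal (norm (\<phi> x) powr r) + ennreal (?C * ?b / B' powr r) * ennreal (norm (\<psi> x) powr r)"
          by (rule ennreal_linear_combination) (use p in auto)
        finally show "ennreal (norm (\<phi> x + \<psi> x) powr r) \<le> ennreal (?C * ?a / A' powr r) * ennreal (norm (\<phi> x) powr r) + ennreal (?C * ?b / B' powr r) * ennreal (norm (\<psi> x) powr r)" .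
      qed
      also have "\<dots> = ennreal (?C * ?a / A' powr r) * (\<integral>\<^sup>+ x. ennreal (norm (\<phi> x) powr r) \<partial>lebesgue) + ennreal (?C * ?b / B' powr r) * (\<integral>\<^sup>+ x. ennreal (norm (\<psi> x) powr r) \<partial>lebesgue)"
        by (simp add: nn_integral_add nn_integral_cmult)
      also have "\<dots> \<le> ennreal (?C * ?a / A' powr r) * ennreal (A' powr r) + ennreal (?C * ?b / B' powr r) * ennreal (B' powr r)"
        by (intro add_mono mult_left_mono IA IB) auto
      also have "\<dots> = ennreal (?C * ?a / A' powr r * A' powr r + ?C * ?b / B' powr r * B' powr r)"
        by (rule ennreal_linear_combination[symmetric]) (use p in auto)
      also have "?C * ?a / A' powr r * A' powr r + ?C * ?b / B' powr r * B' powr r = ?C * (?a + ?b)"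
        using p by (simp add: distrib_left)
      also have "\<dots> = ?C" unfolding ab(3) by simp
      finally have "lq_norm (ennreal r) (\<lambda>x. \<phi> x + \<psi> x) \<le> ennreal (A' + B')"
        using p by (subst lq_norm_ennreal_le_iff[OF r]) auto
      then show ?thesis unfolding s 2 using A B e by simp
    qed
    then have "lq_norm q (\<lambda>x. \<phi> x + \<psi> x) \<le> ennreal (A + B)" by (rule ennreal_le_epsilon)
    then show ?thesis unfolding A(2) B(2) ennreal_plus[OF A(1) B(1)] .
  qed
qed

text \<open>For q = r finite it follows from |\<phi>|^r \<le> B^(r-1) |\<phi>| almost
  everywhere.\<close>

lemma lq_norm_interpolation:
  assumes q: "q \<ge> 1" and m: "\<phi> \<in> borel_measurable lebesgue"
    and A: "A > 0" "lq_norm 1 \<phi> \<le> ennreal A" and B: "B > 0" "lq_norm \<infinity> \<phi> \<le> ennreal B"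
  shows "lq_norm q \<phi> \<le> ennreal (A powr recip q * B powr (1 - recip q))"
  using q
proof (cases rule: exponent_cases)
  case 1
  then show ?thesis using A B by (simp add: recip_inf)
next
  case (2 r)
  note r = \<open>r \<ge> 1\<close>
  note [measurable] = m
  have "lq_norm (ennreal r) \<phi> \<le> ennreal (A powr (1 / r) * B powr (1 - 1 / r))"
  proof (subst lq_norm_ennreal_le_iff[OF r])
    have "(\<integral>\<^sup>+ x. ennreal (norm (\<phi> x) powr r) \<partial>lebesgue) \<le> (\<integral>\<^sup>+ x. ennreal (B powr (r - 1)) * ennreal (norm (\<phi> x)) \<partial>lebesgue)"
    proof (rule nn_integral_mono_AE)
      show "AE x in lebesgue. ennreal (norm (\<phi> x) powr r) \<le> ennreal (B powr (r - 1)) * ennreal (norm (\<phi> x))"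
        using lq_norm_inf_AE[of \<phi>]
      proof eventually_elim
        case (elim x)
        then have "ennreal (norm (\<phi> x)) \<le> ennreal B" using B(2) by (rule order_trans)
        then have b: "norm (\<phi> x) \<le> B" using B(1) by simp
        have "norm (\<phi> x) powr r = norm (\<phi> x) powr (r - 1) * norm (\<phi> x)"
          using powr_add[of "norm (\<phi> x)" "r - 1" 1] by simp
        also have "\<dots> \<le> B powr (r - 1) * norm (\<phi> x)" using b r by (intro mult_right_mono powr_mono2) auto
        finally show ?case by (simp add: ennreal_mult[symmetric] ennreal_leI)
      qed
    qed
    also have "\<dots> = ennreal (B powr (r - 1)) * lq_norm 1 \<phi>" unfolding lq_norm_1 by (rule nn_integral_cmult) measurable
    also have "\<dots> \<le> ennreal (B powr (r - 1)) * ennreal A" using A by (intro mult_left_mono) auto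
    also have "\<dots> = ennreal (B powr (r - 1) * A)" using A by (simp add: ennreal_mult)
    also have "B powr (r - 1) * A = (A powr (1 / r) * B powr (1 - 1 / r)) powr r"
    proof -
      have "(1 - 1 / r) * r = r - 1" using r by (simp add: field_simps)
      then show ?thesis using A B r by (simp add: powr_mult powr_powr)
    qed
    finally show "(\<integral>\<^sup>+ x. ennreal (norm (\<phi> x) powr r) \<partial>lebesgue) \<le> ennreal ((A powr (1 / r) * B powr (1 - 1 / r)) powr r)" .
  qed simp
  then show ?thesis using 2 by (simp add: recip_ennreal)
qed

lemma AE_lborel_scale:
  fixes P :: "'a::euclidean_space \<Rightarrow> bool"
  assumes s: "s \<noteq> 0" and P: "{x. P x} \<in> sets borel" and "AE x in lborel. P x"
  shows "AE x in lborel. P (s *\<^sub>R x)"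
proof -
  have "AE x in density (distr lborel borel (\<lambda>x. 0 + s *\<^sub>R x)) (\<lambda>_. ennreal (\<bar>s\<bar> ^ DIM('a))). P x"
    using assms(3) by (subst (asm) lborel_affine[OF s, of "0 :: 'a"])
  then have "AE x in distr lborel borel (\<lambda>x. 0 + s *\<^sub>R x). P x" using s by (simp add: AE_density)
  then show ?thesis using P by (subst (asm) AE_distr_iff) auto
qed

lemma nn_integral_lborel_scale:
  fixes f :: "'a::euclidean_space \<Rightarrow> ennreal"
  assumes s: "s > 0" and f[measurable]: "f \<in> borel_measurable borel"
  shows "(\<integral>\<^sup>+ x. f x \<partial>lborel) = ennreal (s ^ DIM('a)) * (\<integral>\<^sup>+ x. f (s *\<^sub>R x) \<partial>lborel)"
proof -
  have "(\<integral>\<^sup>+ x. f x \<partial>lborel) = (\<integral>\<^sup>+ x. f x \<partial>density (distr lborel borel (\<lambda>x. 0 + s *\<^sub>R x)) (\<lambda>_. ennreal (\<bar>s\<bar> ^ DIM('a))))"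
    using s by (subst lborel_affine[of s "0 :: 'a"]) auto
  also have "\<dots> = ennreal (s ^ DIM('a)) * (\<integral>\<^sup>+ x. f (s *\<^sub>R x) \<partial>lborel)"
    using s by (simp add: nn_integral_density nn_integral_distr nn_integral_cmult)
  finally show ?thesis .
qed

lemma lq_norm_scale_le:
  fixes \<phi> :: "real ^ 'n::finite \<Rightarrow> complex"
  assumes q: "q \<ge> 1" and m: "\<phi> \<in> borel_measurable borel" and b: "b > 0" and s: "s > 0"
  shows "lq_norm q (\<lambda>x. of_real b * \<phi> (s *\<^sub>R x)) \<le> ennreal (b * s powr (- (real CARD('n) * recip q))) * lq_norm q \<phi>"
  using q
proof (cases rule: exponent_cases)
  note [measurable] = m
  have m': "(\<lambda>x. of_real b * \<phi> (s *\<^sub>R x)) \<in> borel_measurable borel" by measurable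
  case 1
  have "AE x in lborel. ennreal (norm (\<phi> (s *\<^sub>R x))) \<le> lq_norm \<infinity> \<phi>"
  proof (rule AE_lborel_scale)
    show "AE x in lborel. ennreal (norm (\<phi> x)) \<le> lq_norm \<infinity> \<phi>" using lq_norm_inf_AE[of \<phi>] by (simp add: AE_completion_iff)
    show "{x. ennreal (norm (\<phi> x)) \<le> lq_norm \<infinity> \<phi>} \<in> sets borel" by measurable
  qed (use s in auto)
  then have "AE x in lebesgue. ennreal (norm (of_real b * \<phi> (s *\<^sub>R x))) \<le> ennreal b * lq_norm \<infinity> \<phi>"
    by (intro AE_completion, eventually_elim) (use b in \<open>simp add: norm_mult ennreal_mult mult_left_mono\<close>)
  moreover have "(\<lambda>x. of_real b * \<phi> (s *\<^sub>R x)) \<in> borel_measurable lebesgue" by (rule measurable_completion) (use m' in simp)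
  ultimately have "lq_norm \<infinity> (\<lambda>x. of_real b * \<phi> (s *\<^sub>R x)) \<le> ennreal b * lq_norm \<infinity> \<phi>" by (intro lq_norm_inf_le)
  then show ?thesis unfolding 1 using s by (simp add: recip_inf)
next
  note [measurable] = m
  case (2 r)
  note r = \<open>r \<ge> 1\<close>
  show ?thesis
  proof (cases "lq_norm q \<phi>")
    case top
    then show ?thesis using b s by (simp add: ennreal_mult_top)
  next
    case (real c)
    let ?B = "b * s powr (- (real CARD('n) / r))"
    have ic: "(\<integral>\<^sup>+ x. ennreal (norm (\<phi> x) powr r) \<partial>lborel) \<le> ennreal (c powr r)"
      using lq_norm_ennreal_le_iff[OF r, of c \<phi>] real 2 by (simp add: nn_integral_completion)
    have sp: "ennreal (s ^ CARD('n)) * ennreal (s powr (- real CARD('n))) = 1"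
      using s by (simp add: ennreal_mult[symmetric] powr_minus powr_realpow)
    have "lq_norm (ennreal r) (\<lambda>x. of_real b * \<phi> (s *\<^sub>R x)) \<le> ennreal (?B * c)"
    proof (subst lq_norm_ennreal_le_iff[OF r])
      have "(\<integral>\<^sup>+ x. ennreal (norm (of_real b * \<phi> (s *\<^sub>R x)) powr r) \<partial>lebesgue) = (\<integral>\<^sup>+ x. ennreal (b powr r) * ennreal (norm (\<phi> (s *\<^sub>R x)) powr r) \<partial>lborel)"
        unfolding nn_integral_completion using b by (intro nn_integral_cong) (simp add: norm_mult powr_mult ennreal_mult)
      also have "\<dots> = ennreal (b powr r) * (\<integral>\<^sup>+ x. ennreal (norm (\<phi> (s *\<^sub>R x)) powr r) \<partial>lborel)" by (rule nn_integral_cmult) measurable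
      also have "(\<integral>\<^sup>+ x. ennreal (norm (\<phi> (s *\<^sub>R x)) powr r) \<partial>lborel) = ennreal (s powr (- real CARD('n))) * (\<integral>\<^sup>+ x. ennreal (norm (\<phi> x) powr r) \<partial>lborel)"
        using nn_integral_lborel_scale[OF s, of "\<lambda>x. ennreal (norm (\<phi> x) powr r)"] sp by (simp add: mult.assoc[symmetric] mult.commute)
      also have "ennreal (b powr r) * (ennreal (s powr (- real CARD('n))) * (\<integral>\<^sup>+ x. ennreal (norm (\<phi> x) powr r) \<partial>lborel)) \<le> ennreal (b powr r) * (ennreal (s powr (- real CARD('n))) * ennreal (c powr r))"
        by (intro mult_left_mono ic) auto
      also have "\<dots> = ennreal (b powr r * (s powr (- real CARD('n)) * c powr r))" by (simp add: ennreal_mult)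
      also have "b powr r * (s powr (- real CARD('n)) * c powr r) = (?B * c) powr r"
        using b s real r by (simp add: powr_mult powr_powr)
      finally show "(\<integral>\<^sup>+ x. ennreal (norm (of_real b * \<phi> (s *\<^sub>R x)) powr r) \<partial>lebesgue) \<le> ennreal ((?B * c) powr r)" .
    qed (use b real in auto)
    then show ?thesis using real 2 b r by (simp add: recip_ennreal ennreal_mult)
  qed
qed

text \<open>The inverse scaling also satisfies the inequality of \<open>lq_norm_scale_le\<close>,
  which yields the reverse bound.\<close>

lemma lq_norm_scale:
  fixes \<phi> :: "real ^ 'n::finite \<Rightarrow> complex"
  assumes q: "q \<ge> 1" and m: "\<phi> \<in> borel_measurable borel" and b: "b > 0" and s: "s > 0"
  shows "lq_norm q (\<lambda>x. of_real b * \<phi> (s *\<^sub>R x)) = ennreal (b * s powr (- (real CARD('n) * recip q))) * lq_norm q \<phi>"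
proof (rule antisym)
  let ?e = "- (real CARD('n) * recip q)"
  let ?\<psi> = "\<lambda>x. of_real b * \<phi> (s *\<^sub>R x)"
  have "lq_norm q \<phi> = lq_norm q (\<lambda>x. of_real (1 / b) * ?\<psi> ((1 / s) *\<^sub>R x))" using b s by simp
  also have "\<dots> \<le> ennreal (1 / b * (1 / s) powr ?e) * lq_norm q ?\<psi>"
    by (rule lq_norm_scale_le[OF q]) (use m b s in auto)
  finally have "ennreal (b * s powr ?e) * lq_norm q \<phi> \<le> ennreal (b * s powr ?e) * (ennreal (1 / b * (1 / s) powr ?e) * lq_norm q ?\<psi>)" by (rule mult_left_mono) simp
  also have "\<dots> = ennreal (b * s powr ?e * (1 / b * (1 / s) powr ?e)) * lq_norm q ?\<psi>"
  proof -
    have e: "ennreal (b * s powr ?e * (1 / b * (1 / s) powr ?e)) = ennreal (b * s powr ?e) * ennreal (1 / b * (1 / s) powr ?e)"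
      using b by (intro ennreal_mult) auto
    show ?thesis unfolding e by (rule mult.assoc[symmetric])
  qed
  also have "b * s powr ?e * (1 / b * (1 / s) powr ?e) = 1" using b s by (simp add: powr_divide)
  finally show "ennreal (b * s powr ?e) * lq_norm q \<phi> \<le> lq_norm q ?\<psi>" by simp
qed (rule lq_norm_scale_le[OF assms])

section \<open>The leading term of the expansion\<close>

text \<open>Differentiation lowers every index by one and stays within the family, so induction on N
  removes all coefficients except that of the constant polynomial.\<close>

lemma herm_linear_independent:
  assumes "\<nu> \<noteq> 0" "\<forall>y. (\<Sum>d\<le>N. b d * herm \<nu> d y) = 0" "d \<le> N"
  shows "b d = 0"
  using assms(2,3)
proof (induction N arbitrary: b d)
  case 0
  then show ?case by (simp add: herm_0)
next
  case (Suc N)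
  have "b (Suc e) = 0" if "e \<le> N" for e
  proof -
    have "(\<Sum>d\<le>N. b (Suc d) * of_nat (Suc d) / \<nu> * herm \<nu> d y) = 0" for y
    proof -
      have "((\<lambda>y. \<Sum>d\<le>Suc N. b d * herm \<nu> d y) has_vector_derivative (\<Sum>d\<le>Suc N. b d * (of_nat d / \<nu> * herm \<nu> (d - 1) y))) (at y)"
        by (intro has_vector_derivative_sum has_vector_derivative_mult_right has_vector_derivative_herm assms(1))
      moreover have "((\<lambda>y. \<Sum>d\<le>Suc N. b d * herm \<nu> d y) has_vector_derivative 0) (at y)"
        unfolding Suc.prems(1)[rule_format] by simp
      ultimately have "(\<Sum>d\<le>Suc N. b d * (of_nat d / \<nu> * herm \<nu> (d - 1) y)) = 0" by (rule vector_derivative_unique_at)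
      then show ?thesis unfolding sum.atMost_Suc_shift by (simp add: mult_ac del: of_nat_Suc)
    qed
    then have "b (Suc e) * of_nat (Suc e) / \<nu> = 0" using Suc.IH[of "\<lambda>d. b (Suc d) * of_nat (Suc d) / \<nu>" e] that by blast
    then show ?thesis using assms(1) by (simp del: of_nat_Suc)
  qed
  moreover have "b 0 = 0"
    using Suc.prems(1)[rule_format, of 0] calculation unfolding sum.atMost_Suc_shift by (simp add: herm_0)
  ultimately show ?case using Suc.prems(2) by (cases d) auto
qed

text \<open>Induction over the coordinates: for fixed values of the others, independence in one
  variable isolates the terms with \<alpha> j = \<beta> j. When I is the full set and \<beta> is in
  A, the remaining sum is the single coefficient of \<beta>.\<close>

lemma prod_herm_independent:
  fixes c :: "('n \<Rightarrow> nat) \<Rightarrow> complex"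
  assumes nz: "\<nu> \<noteq> 0" and I: "finite I" and A: "finite A"
    and z: "\<forall>x. (\<Sum>\<alpha>\<in>A. c \<alpha> * (\<Prod>i\<in>I. herm \<nu> (\<alpha> i) (x i))) = 0"
  shows "(\<Sum>\<alpha>\<in>{\<alpha>\<in>A. \<forall>i\<in>I. \<alpha> i = \<beta> i}. c \<alpha>) = 0"
  using I A z
proof (induction I arbitrary: A rule: finite_induct)
  case empty
  then show ?case by simp
next
  case (insert j I)
  note A = insert.prems(1)
  define N where "N = Max (insert (\<beta> j) ((\<lambda>\<alpha>. \<alpha> j) ` A))"
  have N: "\<alpha> j \<le> N" if "\<alpha> \<in> A" for \<alpha> unfolding N_def using that A by (intro Max_ge) auto
  have "(\<Sum>\<alpha>\<in>{\<alpha>\<in>A. \<alpha> j = \<beta> j}. c \<alpha> * (\<Prod>i\<in>I. herm \<nu> (\<alpha> i) (x i))) = 0" for x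
  proof (rule herm_linear_independent[OF nz])
    show "\<beta> j \<le> N" unfolding N_def using A by (intro Max_ge) auto
    show "\<forall>y. (\<Sum>d\<le>N. (\<Sum>\<alpha>\<in>{\<alpha>\<in>A. \<alpha> j = d}. c \<alpha> * (\<Prod>i\<in>I. herm \<nu> (\<alpha> i) (x i))) * herm \<nu> d y) = 0"
    proof
      fix y
      have "(\<Sum>d\<le>N. (\<Sum>\<alpha>\<in>{\<alpha>\<in>A. \<alpha> j = d}. c \<alpha> * (\<Prod>i\<in>I. herm \<nu> (\<alpha> i) (x i))) * herm \<nu> d y)
         = (\<Sum>d\<le>N. \<Sum>\<alpha>\<in>{\<alpha>\<in>A. \<alpha> j = d}. c \<alpha> * (\<Prod>i\<in>insert j I. herm \<nu> (\<alpha> i) ((x(j := y)) i)))"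
      proof (intro sum.cong refl)
        have p: "(\<Prod>i\<in>I. herm \<nu> (\<alpha> i) ((x(j := y)) i)) = (\<Prod>i\<in>I. herm \<nu> (\<alpha> i) (x i))" for \<alpha>
          using insert.hyps(2) by (intro prod.cong) auto
        fix d
        show "(\<Sum>\<alpha>\<in>{\<alpha>\<in>A. \<alpha> j = d}. c \<alpha> * (\<Prod>i\<in>I. herm \<nu> (\<alpha> i) (x i))) * herm \<nu> d y = (\<Sum>\<alpha>\<in>{\<alpha>\<in>A. \<alpha> j = d}. c \<alpha> * (\<Prod>i\<in>insert j I. herm \<nu> (\<alpha> i) ((x(j := y)) i)))"
          unfolding sum_distrib_right prod.insert[OF insert.hyps] p by (intro sum.cong refl) auto
      qed
      also have "\<dots> = (\<Sum>\<alpha>\<in>A. c \<alpha> * (\<Prod>i\<in>insert j I. herm \<nu> (\<alpha> i) ((x(j := y)) i)))"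
        by (rule sum.group) (use A N in auto)
      also have "\<dots> = 0" by (rule insert.prems(2)[rule_format])
      finally show "(\<Sum>d\<le>N. (\<Sum>\<alpha>\<in>{\<alpha>\<in>A. \<alpha> j = d}. c \<alpha> * (\<Prod>i\<in>I. herm \<nu> (\<alpha> i) (x i))) * herm \<nu> d y) = 0" .
    qed
  qed
  then have "(\<Sum>\<alpha>\<in>{\<alpha>\<in>{\<alpha>\<in>A. \<alpha> j = \<beta> j}. \<forall>i\<in>I. \<alpha> i = \<beta> i}. c \<alpha>) = 0" using A by (intro insert.IH) auto
  also have "{\<alpha>\<in>{\<alpha>\<in>A. \<alpha> j = \<beta> j}. \<forall>i\<in>I. \<alpha> i = \<beta> i} = {\<alpha>\<in>A. \<forall>i\<in>insert j I. \<alpha> i = \<beta> i}" by auto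
  finally show ?case .
qed

text \<open>At t = 1 every derivative is a product of Hermite polynomials times the same
  nonvanishing Gaussian.\<close>

lemma heat_deriv_linear_independent:
  fixes c :: "('n::finite \<Rightarrow> nat) \<Rightarrow> complex"
  assumes nz: "\<nu> \<noteq> 0" and A: "finite A" "\<beta> \<in> A"
    and z: "\<forall>x :: real ^ 'n. (\<Sum>\<alpha>\<in>A. c \<alpha> * heat_deriv \<nu> \<alpha> 1 x) = 0"
  shows "c \<beta> = 0"
proof -
  let ?c = "\<lambda>\<alpha>. c \<alpha> * inverse 2 ^ mdeg \<alpha>"
  have g: "gauss \<nu> x \<noteq> 0" for x :: "real ^ 'n" using nz by (simp add: gauss_def)
  have "(\<Sum>\<alpha>\<in>{\<alpha>\<in>A. \<forall>i\<in>UNIV. \<alpha> i = \<beta> i}. ?c \<alpha>) = 0"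
  proof (rule prod_herm_independent[OF nz finite A(1)], rule allI)
    fix x :: "'n \<Rightarrow> real"
    let ?x = "\<chi> i. x i"
    have "heat_deriv \<nu> \<alpha> 1 ?x = inverse 2 ^ mdeg \<alpha> * (\<Prod>i\<in>UNIV. herm \<nu> (\<alpha> i) (x i)) * gauss \<nu> ?x" for \<alpha>
      using nz by (simp add: heat_deriv_eq_dilate dilate_def hpoly_eq_prod_herm)
    then have "(\<Sum>\<alpha>\<in>A. ?c \<alpha> * (\<Prod>i\<in>UNIV. herm \<nu> (\<alpha> i) (x i))) * gauss \<nu> ?x = (\<Sum>\<alpha>\<in>A. c \<alpha> * heat_deriv \<nu> \<alpha> 1 ?x)"
      unfolding sum_distrib_right by (intro sum.cong refl) (simp add: mult_ac)
    also have "\<dots> = 0" using z by blast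
    finally show "(\<Sum>\<alpha>\<in>A. ?c \<alpha> * (\<Prod>i\<in>UNIV. herm \<nu> (\<alpha> i) (x i))) = 0" using g by simp
  qed
  moreover have "{\<alpha>\<in>A. \<forall>i\<in>UNIV. \<alpha> i = \<beta> i} = {\<beta>}" using A(2) by (auto simp: fun_eq_iff)
  ultimately show ?thesis by simp
qed

section \<open>Difference of consecutive profiles\<close>

lemma mdeg_add: "mdeg (\<lambda>i. \<alpha> i + \<beta> i) = mdeg \<alpha> + mdeg \<beta>"
  by (simp add: mdeg_def sum.distrib)

definition leading_coeff ::
  "complex \<Rightarrow> (complex \<Rightarrow> complex) \<Rightarrow> (real ^ 'n::finite \<Rightarrow> complex) \<Rightarrow> (real \<Rightarrow> real ^ 'n \<Rightarrow> complex) \<Rightarrow> nat \<Rightarrow> ('n \<Rightarrow> nat) \<Rightarrow> complex"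
  where "leading_coeff \<nu> f u0 u m \<alpha> = moment \<alpha> u0
         + (\<Sum>(\<beta>, \<gamma>) \<in> {(\<beta>, \<gamma>). (\<lambda>i. \<beta> i + 2 * \<gamma> i) = \<alpha> \<and> real (mdeg \<gamma>) \<le> (real m + 1) / 2}.
              (- \<nu>) ^ mdeg \<gamma> / of_nat (mfact \<gamma>) * moment \<beta> (psi f u (mdeg \<gamma>)))"

text \<open>A term of the double sum over (\<beta>, \<gamma>) has parabolic order |\<beta>| +
  2|\<gamma>|. The difference therefore consists of the terms of order exactly m + 1, grouped by the
  derivative \<beta> + 2 \<gamma> that they multiply.\<close>

lemma profile_diff:
  fixes x :: "real ^ 'n::finite"
  assumes t: "t > 0" and nz: "\<nu> \<noteq> 0"
  shows "profile \<nu> f u0 u (m + 1) t x - profile \<nu> f u0 u m t x = (\<Sum>\<alpha>\<in>{\<alpha>. mdeg \<alpha> = m + 1}. leading_coeff \<nu> f u0 u m \<alpha> * heat_deriv \<nu> \<alpha> t x)"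
proof -
  define T :: "('n \<Rightarrow> nat) \<times> ('n \<Rightarrow> nat) \<Rightarrow> complex" where "T = (\<lambda>(\<beta>, \<gamma>). (- \<nu>) ^ mdeg \<gamma> / of_nat (mfact \<gamma>) * moment \<beta> (psi f u (mdeg \<gamma>)))"
  define s :: "('n \<Rightarrow> nat) \<times> ('n \<Rightarrow> nat) \<Rightarrow> 'n \<Rightarrow> nat" where "s = (\<lambda>(\<beta>, \<gamma>) i. \<beta> i + 2 * \<gamma> i)"
  have s_mdeg: "mdeg (s (\<beta>, \<gamma>)) = mdeg \<beta> + 2 * mdeg \<gamma>" for \<beta> \<gamma> :: "'n \<Rightarrow> nat"
    unfolding s_def by (simp add: mdeg_add mdeg_double)
  have fin: "finite {z. mdeg (s z) \<le> k}" for k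
    by (rule finite_subset[of _ "{\<beta>. mdeg \<beta> \<le> k} \<times> {\<beta>. mdeg \<beta> \<le> k}"]) (auto simp: s_mdeg intro!: finite_mdeg_le)
  have source: "(\<Sum>\<gamma>\<in>{\<gamma>. 2 * mdeg \<gamma> \<le> k}. (- \<nu>) ^ mdeg \<gamma> / of_nat (mfact \<gamma>) *
        (\<Sum>\<beta>\<in>{\<beta>. mdeg \<beta> \<le> k - 2 * mdeg \<gamma>}. moment \<beta> (psi f u (mdeg \<gamma>)) * heat_deriv \<nu> (\<lambda>i. 2 * \<gamma> i + \<beta> i) t x))
      = (\<Sum>z\<in>{z. mdeg (s z) \<le> k}. T z * heat_deriv \<nu> (s z) t x)" for k
  proof -
    have "(\<Sum>\<gamma>\<in>{\<gamma>. 2 * mdeg \<gamma> \<le> k}. (- \<nu>) ^ mdeg \<gamma> / of_nat (mfact \<gamma>) *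
        (\<Sum>\<beta>\<in>{\<beta>. mdeg \<beta> \<le> k - 2 * mdeg \<gamma>}. moment \<beta> (psi f u (mdeg \<gamma>)) * heat_deriv \<nu> (\<lambda>i. 2 * \<gamma> i + \<beta> i) t x))
      = (\<Sum>\<gamma>\<in>{\<gamma>. 2 * mdeg \<gamma> \<le> k}. \<Sum>\<beta>\<in>{\<beta>. mdeg \<beta> \<le> k - 2 * mdeg \<gamma>}. T (\<beta>, \<gamma>) * heat_deriv \<nu> (s (\<beta>, \<gamma>)) t x)"
      unfolding T_def s_def sum_distrib_left by (rule sum.cong[OF refl], rule sum.cong[OF refl]) (simp add: mult.assoc add.commute)
    also have "\<dots> = (\<Sum>z\<in>(SIGMA \<gamma>:{\<gamma>. 2 * mdeg \<gamma> \<le> k}. {\<beta>. mdeg \<beta> \<le> k - 2 * mdeg \<gamma>}). T (snd z, fst z) * heat_deriv \<nu> (s (snd z, fst z)) t x)"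
      by (subst sum.Sigma) (auto simp: finite_2mdeg_le finite_mdeg_le case_prod_beta)
    also have "\<dots> = (\<Sum>z\<in>{z. mdeg (s z) \<le> k}. T z * heat_deriv \<nu> (s z) t x)"
      by (rule sum.reindex_bij_witness[where i=prod.swap and j=prod.swap]) (auto simp: s_mdeg)
    finally show ?thesis .
  qed
  have split: "(\<Sum>z\<in>{z. d z \<le> m + 1}. F z) - (\<Sum>z\<in>{z. d z \<le> m}. F z) = (\<Sum>z\<in>{z. d z = m + 1}. F z)"
    if "finite {z. d z \<le> m + 1}" for d :: "'b \<Rightarrow> nat" and F :: "'b \<Rightarrow> complex"
  proof -
    have "(\<Sum>z\<in>{z. d z \<le> m + 1}. F z) - (\<Sum>z\<in>{z. d z \<le> m}. F z) = (\<Sum>z\<in>{z. d z \<le> m + 1} - {z. d z \<le> m}. F z)"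
      by (rule sum_diff[symmetric]) (use that in auto)
    also have "{z. d z \<le> m + 1} - {z. d z \<le> m} = {z. d z = m + 1}" by auto
    finally show ?thesis .
  qed
  have group: "(\<Sum>z\<in>{z. mdeg (s z) = m + 1}. T z * heat_deriv \<nu> (s z) t x) = (\<Sum>\<alpha>\<in>{\<alpha>. mdeg \<alpha> = m + 1}. (\<Sum>z\<in>{z. s z = \<alpha>}. T z) * heat_deriv \<nu> \<alpha> t x)"
  proof -
    have "(\<Sum>z\<in>{z. mdeg (s z) = m + 1}. T z * heat_deriv \<nu> (s z) t x)
       = (\<Sum>\<alpha>\<in>{\<alpha>. mdeg \<alpha> = m + 1}. \<Sum>z\<in>{z \<in> {z. mdeg (s z) = m + 1}. s z = \<alpha>}. T z * heat_deriv \<nu> (s z) t x)"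
      by (rule sum.group[symmetric]) (auto intro: finite_mdeg_eq finite_subset[OF _ fin[of "m + 1"]])
    also have "\<dots> = (\<Sum>\<alpha>\<in>{\<alpha>. mdeg \<alpha> = m + 1}. (\<Sum>z\<in>{z. s z = \<alpha>}. T z) * heat_deriv \<nu> \<alpha> t x)"
      unfolding sum_distrib_right by (rule sum.cong[OF refl], rule sum.cong) auto
    finally show ?thesis .
  qed
  have lc: "leading_coeff \<nu> f u0 u m \<alpha> = moment \<alpha> u0 + (\<Sum>z\<in>{z. s z = \<alpha>}. T z)" if "mdeg \<alpha> = m + 1" for \<alpha>
  proof -
    have "{(\<beta>, \<gamma>). (\<lambda>i. \<beta> i + 2 * \<gamma> i) = \<alpha> \<and> real (mdeg \<gamma>) \<le> (real m + 1) / 2} = {z. s z = \<alpha>}"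
    proof -
      have "real (mdeg \<gamma>) \<le> (real m + 1) / 2" if "s (\<beta>, \<gamma>) = \<alpha>" for \<beta> \<gamma>
        using s_mdeg[of \<beta> \<gamma>] \<open>mdeg \<alpha> = m + 1\<close> unfolding that by simp
      then show ?thesis by (auto simp: s_def)
    qed
    then show ?thesis unfolding leading_coeff_def T_def by (simp add: case_prod_unfold)
  qed
  have "profile \<nu> f u0 u (m + 1) t x - profile \<nu> f u0 u m t x
     = (\<Sum>\<beta>\<in>{\<beta>. mdeg \<beta> = m + 1}. moment \<beta> u0 * heat_deriv \<nu> \<beta> t x) + (\<Sum>z\<in>{z. mdeg (s z) = m + 1}. T z * heat_deriv \<nu> (s z) t x)"
    unfolding profile_eq_heat_deriv[OF t nz] source split[OF finite_mdeg_le, symmetric] split[OF fin, symmetric] by simp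
  also have "\<dots> = (\<Sum>\<alpha>\<in>{\<alpha>. mdeg \<alpha> = m + 1}. leading_coeff \<nu> f u0 u m \<alpha> * heat_deriv \<nu> \<alpha> t x)"
    unfolding group sum.distrib[symmetric] by (rule sum.cong[OF refl]) (simp add: lc distrib_right)
  finally show ?thesis .
qed

text \<open>All kernel derivatives in the difference have the same order m + 1, hence the same
  factor under parabolic dilation.\<close>

lemma profile_diff_scale:
  fixes x :: "real ^ 'n::finite"
  assumes t: "t > 0" and nz: "\<nu> \<noteq> 0"
  shows "profile \<nu> f u0 u (m + 1) t x - profile \<nu> f u0 u m t x = of_real (t powr (- ((real m + 1) / 2 + real CARD('n) / 2)))
    * (profile \<nu> f u0 u (m + 1) 1 (t powr (- (1 / 2)) *\<^sub>R x) - profile \<nu> f u0 u m 1 (t powr (- (1 / 2)) *\<^sub>R x))"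
proof -
  have "heat_deriv \<nu> \<alpha> t x = of_real (t powr (- ((real m + 1) / 2 + real CARD('n) / 2))) * heat_deriv \<nu> \<alpha> 1 (t powr (- (1 / 2)) *\<^sub>R x)" if "mdeg \<alpha> = m + 1" for \<alpha>
    using that t by (simp add: heat_deriv_eq powr_add[symmetric] algebra_simps)
  then show ?thesis unfolding profile_diff[OF t nz] profile_diff[OF zero_less_one nz] sum_distrib_left
    by (intro sum.cong refl) simp
qed

section \<open>The limit\<close>

text \<open>Interpolation for each fixed e: e^\<theta> e^(1-\<theta>) = e with \<theta> = 1/q, and
  the exponents a and a + b combine to a + b (1 - 1/q).\<close>

lemma tendsto_lq_norm_interpolation:
  fixes \<phi> :: "real \<Rightarrow> real ^ 'n::finite \<Rightarrow> complex"
  assumes q: "q \<ge> 1" and m: "\<forall>t>0. \<phi> t \<in> borel_measurable lebesgue"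
    and A: "((\<lambda>t. ennreal (t powr a) * lq_norm 1 (\<phi> t)) \<longlongrightarrow> 0) at_top"
    and B: "((\<lambda>t. ennreal (t powr (a + b)) * lq_norm \<infinity> (\<phi> t)) \<longlongrightarrow> 0) at_top"
  shows "((\<lambda>t. ennreal (t powr (b * (1 - recip q) + a)) * lq_norm q (\<phi> t)) \<longlongrightarrow> 0) at_top"
proof (rule order_tendstoI)
  fix c :: ennreal assume "0 < c"
  then obtain c' where c': "0 < c'" "c' < c" using dense by blast
  then obtain e where e: "c' = ennreal e" "e > 0" by (cases c') (auto simp: less_top[symmetric])
  have "\<forall>\<^sub>F t in at_top. ennreal (t powr a) * lq_norm 1 (\<phi> t) < ennreal e" "\<forall>\<^sub>F t in at_top. ennreal (t powr (a + b)) * lq_norm \<infinity> (\<phi> t) < ennreal e"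
    using order_tendstoD(2)[OF A] order_tendstoD(2)[OF B] c' e by auto
  then show "\<forall>\<^sub>F t in at_top. ennreal (t powr (b * (1 - recip q) + a)) * lq_norm q (\<phi> t) < c"
    using eventually_gt_at_top[of 0]
  proof eventually_elim
    case (elim t)
    have cancel: "t powr X * (e * t powr (- X)) = e" for X using elim(3) by (simp add: powr_minus)
    have div: "X \<le> ennreal (e * t powr (- r))" if "ennreal (t powr r) * X < ennreal e" for r X
    proof -
      have "X = ennreal (t powr (- r)) * (ennreal (t powr r) * X)"
      proof -
        have "ennreal (t powr (- r)) * ennreal (t powr r) = 1"
          using elim(3) by (simp add: ennreal_mult[symmetric] powr_add[symmetric])
        then show ?thesis by (simp only: mult.assoc[symmetric] mult_1_left)
      qed
      also have "\<dots> \<le> ennreal (t powr (- r)) * ennreal e" using that by (intro mult_left_mono[OF less_imp_le]) auto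
      finally show ?thesis using e by (simp add: ennreal_mult mult.commute)
    qed
    have "lq_norm q (\<phi> t) \<le> ennreal ((e * t powr (- a)) powr recip q * (e * t powr (- (a + b))) powr (1 - recip q))"
      using div[OF elim(1)] div[OF elim(2)] m e elim(3) by (intro lq_norm_interpolation q) auto
    also have "(e * t powr (- a)) powr recip q * (e * t powr (- (a + b))) powr (1 - recip q)
       = (e powr recip q * e powr (1 - recip q)) * (t powr (- a * recip q) * t powr (- (a + b) * (1 - recip q)))"
      using e elim(3) by (simp add: powr_mult powr_powr)
    also have "\<dots> = e * t powr (- (b * (1 - recip q) + a))"
      using e elim(3) by (simp add: powr_add[symmetric] algebra_simps)
    finally have "ennreal (t powr (b * (1 - recip q) + a)) * lq_norm q (\<phi> t) \<le> ennreal (t powr (b * (1 - recip q) + a)) * ennreal (e * t powr (- (b * (1 - recip q) + a)))"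
      by (rule mult_left_mono) simp
    also have "\<dots> = ennreal (t powr (b * (1 - recip q) + a) * (e * t powr (- (b * (1 - recip q) + a))))" using e by (simp add: ennreal_mult)
    also have "t powr (b * (1 - recip q) + a) * (e * t powr (- (b * (1 - recip q) + a))) = e"
      by (rule cancel)
    finally show ?case using c' e by simp
  qed
qed simp

lemma heat_deriv_continuous:
  assumes nz: "\<nu> \<noteq> 0"
  shows "continuous_on UNIV (\<lambda>x :: real ^ 'n::finite. heat_deriv \<nu> \<alpha> t x)"
  unfolding heat_deriv_def herm_kernel_def
  by (intro continuous_intros continuous_on_compose2[OF herm_gauss_continuous[OF nz]]) auto

text \<open>By continuity the set where \<phi> is nonzero is open, and a nonempty open set is not
  negligible.\<close>

lemma continuous_AE_zero:
  fixes \<phi> :: "real ^ 'n::finite \<Rightarrow> complex"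
  assumes c: "continuous_on UNIV \<phi>" and z: "AE x in lebesgue. \<phi> x = 0"
  shows "\<phi> x = 0"
proof (rule ccontr)
  assume x: "\<phi> x \<noteq> 0"
  have o: "open {x. \<phi> x \<noteq> 0}" by (intro open_Collect_neq c continuous_intros)
  have "{x. \<phi> x \<noteq> 0} \<in> null_sets lebesgue"
    using z o by (subst (asm) AE_iff_null) (auto simp: borel_open)
  then show False using open_not_negligible[OF o] x by (auto simp: negligible_iff_null_sets)
qed

section \<open>The leading term as limit\<close>

context decaying_mild_solution
begin

abbreviation D :: "real ^ 'n \<Rightarrow> complex" where "D x \<equiv> profile \<nu> f u0 u (m + 1) 1 x - profile \<nu> f u0 u m 1 x"

lemma leading_profile_continuous: "continuous_on UNIV D"
  unfolding profile_diff[OF zero_less_one nz] by (intro continuous_intros heat_deriv_continuous nz)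

lemma leading_profile_borel: "D \<in> borel_measurable borel"
  by (rule borel_measurable_continuous_onI[OF leading_profile_continuous])

lemma leading_profile_lebesgue: "D \<in> borel_measurable lebesgue"
  by (rule measurable_completion) (use leading_profile_borel in simp)

text \<open>From domination by a Gaussian. Finiteness is what permits subtraction in the extended
  reals when the limit is taken.\<close>

lemma leading_profile_finite:
  assumes q: "q \<ge> 1"
  shows "lq_norm q D < \<infinity>"
proof -
  have "\<exists>C. \<forall>\<alpha>. C \<alpha> > 0 \<and> (\<forall>t>0. \<forall>x :: real ^ 'n. norm (heat_deriv \<nu> \<alpha> t x) \<le> C \<alpha> * t powr (- (real (mdeg \<alpha>) / 2)) * gauss_bound (gauss_rate \<nu>) t x)"
    by (rule choice) (use heat_deriv_bound[OF nu, where 'n='n] in blast)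
  then obtain C where C: "\<forall>\<alpha>. C \<alpha> > 0 \<and> (\<forall>t>0. \<forall>x :: real ^ 'n. norm (heat_deriv \<nu> \<alpha> t x) \<le> C \<alpha> * t powr (- (real (mdeg \<alpha>) / 2)) * gauss_bound (gauss_rate \<nu>) t x)"
    by (elim exE)
  define E where "E = (\<Sum>\<alpha>\<in>{\<alpha>. mdeg \<alpha> = m + 1}. norm (leading_coeff \<nu> f u0 u m \<alpha>) * C \<alpha>) + 1"
  have E: "E > 0" unfolding E_def using C by (intro add_nonneg_pos sum_nonneg mult_nonneg_nonneg) (auto intro: less_imp_le)
  have b: "norm (D x) \<le> E * gauss_bound (gauss_rate \<nu>) 1 x" for x
  proof -
    have "norm (D x) \<le> (\<Sum>\<alpha>\<in>{\<alpha>. mdeg \<alpha> = m + 1}. norm (leading_coeff \<nu> f u0 u m \<alpha>) * norm (heat_deriv \<nu> \<alpha> 1 x))"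
      unfolding profile_diff[OF zero_less_one nz] norm_mult[symmetric] by (rule norm_sum)
    also have "\<dots> \<le> (\<Sum>\<alpha>\<in>{\<alpha>. mdeg \<alpha> = m + 1}. norm (leading_coeff \<nu> f u0 u m \<alpha>) * (C \<alpha> * gauss_bound (gauss_rate \<nu>) 1 x))"
    proof (intro sum_mono mult_left_mono norm_ge_zero)
      fix \<alpha> show "norm (heat_deriv \<nu> \<alpha> 1 x) \<le> C \<alpha> * gauss_bound (gauss_rate \<nu>) 1 x"
        using conjunct2[OF C[rule_format, of \<alpha>]] by (metis mult.right_neutral powr_one_eq_one zero_less_one)
    qed
    also have "\<dots> = (E - 1) * gauss_bound (gauss_rate \<nu>) 1 x" unfolding E_def by (simp add: sum_distrib_right mult.assoc)
    also have "\<dots> \<le> E * gauss_bound (gauss_rate \<nu>) 1 x" by (intro mult_right_mono gauss_bound_nonneg) simp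
    finally show ?thesis .
  qed
  define A where "A = E * sqrt (pi / gauss_rate \<nu>) ^ CARD('n)"
  have "lq_norm q D \<le> ennreal (A powr recip q * E powr (1 - recip q))"
  proof (rule lq_norm_interpolation[OF q leading_profile_lebesgue])
    show "A > 0" unfolding A_def using E gauss_rate_pos[OF nu] by simp
    have "lq_norm 1 D \<le> (\<integral>\<^sup>+ x. ennreal E * ennreal (gauss_bound (gauss_rate \<nu>) 1 (x :: real ^ 'n)) \<partial>lborel)"
      unfolding lq_norm_1 nn_integral_completion using b E
      by (intro nn_integral_mono) (simp add: ennreal_mult[OF _ gauss_bound_nonneg, symmetric] ennreal_leI)
    also have "\<dots> = ennreal E * (\<integral>\<^sup>+ x. ennreal (gauss_bound (gauss_rate \<nu>) 1 (x :: real ^ 'n)) \<partial>lborel)" by (rule nn_integral_cmult) measurable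
    also have "\<dots> = ennreal A" using E gauss_rate_pos[OF nu] by (simp add: nn_integral_gauss_bound A_def ennreal_mult)
    finally show "lq_norm 1 D \<le> ennreal A" .
    show "lq_norm \<infinity> D \<le> ennreal E"
    proof (rule lq_norm_inf_le[OF leading_profile_lebesgue], rule AE_I2)
      fix x :: "real ^ 'n"
      have "E * gauss_bound (gauss_rate \<nu>) 1 x \<le> E * 1" using gauss_bound_le[OF gauss_rate_pos[OF nu] zero_less_one, of x] E by (intro mult_left_mono) auto
      with b[of x] show "ennreal (norm (D x)) \<le> ennreal E" by (intro ennreal_leI) simp
    qed
  qed (rule E)
  then show ?thesis by (rule order_le_less_trans) simp
qed

text \<open>By continuity: a vanishing norm would make D zero almost everywhere, hence
  everywhere.\<close>

lemma leading_profile_nonzero: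
  assumes q: "q \<ge> 1" and "D x \<noteq> 0"
  shows "lq_norm q D > 0"
proof (rule ccontr)
  assume "\<not> lq_norm q D > 0"
  then have "lq_norm q D = 0" by simp
  from continuous_AE_zero[OF leading_profile_continuous lq_norm_eq_0_AE[OF q leading_profile_lebesgue this]] show False
    using assms(2) by blast
qed

lemma leading_profile_nonzero_iff: "(\<exists>x. D x \<noteq> 0) \<longleftrightarrow> (\<exists>\<alpha>. mdeg \<alpha> = m + 1 \<and> leading_coeff \<nu> f u0 u m \<alpha> \<noteq> 0)"
proof
  assume "\<exists>x. D x \<noteq> 0"
  then show "\<exists>\<alpha>. mdeg \<alpha> = m + 1 \<and> leading_coeff \<nu> f u0 u m \<alpha> \<noteq> 0"
    unfolding profile_diff[OF zero_less_one nz] by (metis (mono_tags, lifting) mem_Collect_eq mult_zero_left sum.neutral)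
next
  assume "\<exists>\<alpha>. mdeg \<alpha> = m + 1 \<and> leading_coeff \<nu> f u0 u m \<alpha> \<noteq> 0"
  then obtain \<alpha> where \<alpha>: "\<alpha> \<in> {\<alpha>. mdeg \<alpha> = m + 1}" "leading_coeff \<nu> f u0 u m \<alpha> \<noteq> 0" by blast
  then show "\<exists>x. D x \<noteq> 0"
    using heat_deriv_linear_independent[OF nz finite_mdeg_eq \<alpha>(1), of "leading_coeff \<nu> f u0 u m"]
    unfolding profile_diff[OF zero_less_one nz] by blast
qed

text \<open>The dilation changes the L^q norm by exactly the inverse of the power of t in front, so
  the product does not depend on t; this identifies the limit.\<close>

lemma leading_profile_scale:
  assumes t: "t > 0" and q: "q \<ge> 1"
  shows "ennreal (t powr (real CARD('n) / 2 * (1 - recip q) + real m / 2 + 1 / 2))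
    * lq_norm q (\<lambda>x. profile \<nu> f u0 u (m + 1) t x - profile \<nu> f u0 u m t x) = lq_norm q D"
proof -
  let ?e = "real CARD('n) / 2 * (1 - recip q) + real m / 2 + 1 / 2"
  let ?b = "t powr (- ((real m + 1) / 2 + real CARD('n) / 2))" and ?s = "t powr (- (1 / 2))"
  have "lq_norm q (\<lambda>x. profile \<nu> f u0 u (m + 1) t x - profile \<nu> f u0 u m t x) = ennreal (?b * ?s powr (- (real CARD('n) * recip q))) * lq_norm q D"
    unfolding profile_diff_scale[OF t nz] by (rule lq_norm_scale[OF q leading_profile_borel]) (use t in auto)
  moreover have "?b * ?s powr (- (real CARD('n) * recip q)) = t powr (- ?e)"
    using t by (simp add: powr_powr powr_add[symmetric] algebra_simps add_divide_distrib diff_divide_distrib)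
  moreover have "ennreal (t powr ?e) * (ennreal (t powr (- ?e)) * X) = X" for X
  proof -
    have "ennreal (t powr ?e) * ennreal (t powr (- ?e)) = 1" using t by (simp only: ennreal_mult[symmetric] powr_ge_zero powr_add[symmetric]) simp
    then show ?thesis by (simp only: mult.assoc[symmetric] mult_1_left)
  qed
  ultimately show ?thesis by simp
qed

lemma profile_lebesgue: "t > 0 \<Longrightarrow> profile \<nu> f u0 u N t \<in> borel_measurable lebesgue"
  by (rule measurable_completion) (use profile_measurable in simp)

text \<open>By the triangle inequality in both directions, replacing the solution by the profile of
  order m + 1 costs at most \<open>e t\<close>, which tends to 0; what is left is constant in
  t.\<close>

lemma solution_minus_profile_tendsto:
  assumes q: "q \<ge> 1"
  shows "((\<lambda>t. ennreal (t powr (real CARD('n) / 2 * (1 - recip q) + real m / 2 + 1 / 2))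
              * lq_norm q (\<lambda>x. u t x - profile \<nu> f u0 u m t x)) \<longlongrightarrow> lq_norm q D) at_top"
proof -
  let ?c = "\<lambda>t. ennreal (t powr (real CARD('n) / 2 * (1 - recip q) + real m / 2 + 1 / 2))"
  let ?w = "\<lambda>t x. u t x - profile \<nu> f u0 u (m + 1) t x"
  define e where "e = (\<lambda>t. ?c t * lq_norm q (?w t))"
  define F where "F = (\<lambda>t. ?c t * lq_norm q (\<lambda>x. u t x - profile \<nu> f u0 u m t x))"
  have wm: "?w t \<in> borel_measurable lebesgue" "(\<lambda>x. u t x - profile \<nu> f u0 u m t x) \<in> borel_measurable lebesgue"
    "(\<lambda>x. profile \<nu> f u0 u (m + 1) t x - profile \<nu> f u0 u m t x) \<in> borel_measurable lebesgue" if "t > 0" for t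
    using u_measurable[of t] profile_lebesgue[OF that] that by (auto intro!: borel_measurable_diff)
  have "((\<lambda>t. ennreal (t powr (real CARD('n) / 2 * (1 - recip q) + real (m + 1) / 2)) * lq_norm q (?w t)) \<longlongrightarrow> 0) at_top"
    by (rule tendsto_lq_norm_interpolation[OF q])
      (use wm(1) solution_minus_profile_tendsto_L1 solution_minus_profile_tendsto_Linf in auto)
  moreover have "real CARD('n) / 2 * (1 - recip q) + real (m + 1) / 2 = real CARD('n) / 2 * (1 - recip q) + real m / 2 + 1 / 2" by (simp add: add_divide_distrib)
  ultimately have e0: "(e \<longlongrightarrow> 0) at_top" unfolding e_def by (simp only:)
  have upper: "F t \<le> lq_norm q D + e t" if t: "t > 0" for t
  proof -
    have "lq_norm q (\<lambda>x. u t x - profile \<nu> f u0 u m t x) = lq_norm q (\<lambda>x. (profile \<nu> f u0 u (m + 1) t x - profile \<nu> f u0 u m t x) + ?w t x)" by simp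
    also have "\<dots> \<le> lq_norm q (\<lambda>x. profile \<nu> f u0 u (m + 1) t x - profile \<nu> f u0 u m t x) + lq_norm q (?w t)"
      by (rule lq_norm_add_le[OF q wm(3)[OF t] wm(1)[OF t]])
    finally have "F t \<le> ?c t * (lq_norm q (\<lambda>x. profile \<nu> f u0 u (m + 1) t x - profile \<nu> f u0 u m t x) + lq_norm q (?w t))"
      unfolding F_def by (rule mult_left_mono) simp
    then show ?thesis unfolding distrib_left leading_profile_scale[OF t q] e_def .
  qed
  have lower: "lq_norm q D \<le> F t + e t" if t: "t > 0" for t
  proof -
    have m: "(\<lambda>x. profile \<nu> f u0 u (m + 1) t x - u t x) \<in> borel_measurable lebesgue"
      using u_measurable[of t] profile_lebesgue[OF t] t by (auto intro!: borel_measurable_diff)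
    have "lq_norm q (\<lambda>x. profile \<nu> f u0 u (m + 1) t x - profile \<nu> f u0 u m t x) = lq_norm q (\<lambda>x. (u t x - profile \<nu> f u0 u m t x) + (profile \<nu> f u0 u (m + 1) t x - u t x))" by simp
    also have "\<dots> \<le> lq_norm q (\<lambda>x. u t x - profile \<nu> f u0 u m t x) + lq_norm q (\<lambda>x. profile \<nu> f u0 u (m + 1) t x - u t x)"
      by (rule lq_norm_add_le[OF q wm(2)[OF t] m])
    also have "lq_norm q (\<lambda>x. profile \<nu> f u0 u (m + 1) t x - u t x) = lq_norm q (?w t)" by (rule lq_norm_minus_commute)
    finally have "?c t * lq_norm q (\<lambda>x. profile \<nu> f u0 u (m + 1) t x - profile \<nu> f u0 u m t x) \<le> ?c t * (lq_norm q (\<lambda>x. u t x - profile \<nu> f u0 u m t x) + lq_norm q (?w t))"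
      by (rule mult_left_mono) simp
    then show ?thesis unfolding distrib_left leading_profile_scale[OF t q] e_def F_def .
  qed
  have "(F \<longlongrightarrow> lq_norm q D) at_top"
  proof (rule tendsto_sandwich)
    show "\<forall>\<^sub>F t in at_top. lq_norm q D - e t \<le> F t"
      using eventually_gt_at_top[of 0] by eventually_elim (use lower leading_profile_finite[OF q] in \<open>auto simp: ennreal_minus_le_iff add.commute\<close>)
    show "\<forall>\<^sub>F t in at_top. F t \<le> lq_norm q D + e t"
      using eventually_gt_at_top[of 0] by eventually_elim (rule upper)
    show "((\<lambda>t. lq_norm q D - e t) \<longlongrightarrow> lq_norm q D) at_top"
      using tendsto_diff_ennreal[OF tendsto_const e0, of "lq_norm q D"] leading_profile_finite[OF q] by simp
    show "((\<lambda>t. lq_norm q D + e t) \<longlongrightarrow> lq_norm q D) at_top"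
      using tendsto_add[OF tendsto_const e0, of "lq_norm q D"] by simp
  qed
  then show ?thesis unfolding F_def .
qed

lemma solution_minus_profile_rate:
  assumes q: "q \<ge> 1" and D: "D x \<noteq> 0" and \<epsilon>: "0 < \<epsilon>" "\<epsilon> < 1"
  shows "\<exists>t0>0. \<forall>t>t0.
            0 < ennreal (t powr (- (1 / 2)) * (1 - \<epsilon>)) * lq_norm q D
            \<and> ennreal (t powr (- (1 / 2)) * (1 - \<epsilon>)) * lq_norm q D
              \<le> ennreal (t powr (real CARD('n) / 2 * (1 - recip q) + real m / 2)) * lq_norm q (\<lambda>x. u t x - profile \<nu> f u0 u m t x)
            \<and> ennreal (t powr (real CARD('n) / 2 * (1 - recip q) + real m / 2)) * lq_norm q (\<lambda>x. u t x - profile \<nu> f u0 u m t x)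
              \<le> ennreal (t powr (- (1 / 2)) * (1 + \<epsilon>)) * lq_norm q D"
proof -
  let ?e = "real CARD('n) / 2 * (1 - recip q) + real m / 2"
  define F where "F = (\<lambda>t. ennreal (t powr (?e + 1 / 2)) * lq_norm q (\<lambda>x. u t x - profile \<nu> f u0 u m t x))"
  obtain l where l: "lq_norm q D = ennreal l" "l > 0"
    using leading_profile_nonzero[OF q D] leading_profile_finite[OF q] by (cases "lq_norm q D") auto
  have F: "(F \<longlongrightarrow> ennreal l) at_top" using solution_minus_profile_tendsto[OF q] unfolding F_def l(1) by (simp only: add.assoc)
  \<comment> \<open>Positivity of l makes both inequalities strict, so F eventually lies between the
    two bounds.\<close>
  have "ennreal ((1 - \<epsilon>) * l) < ennreal l" "ennreal l < ennreal ((1 + \<epsilon>) * l)"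
    using l(2) \<epsilon> by (auto simp: ennreal_less_iff)
  then have "\<forall>\<^sub>F t in at_top. ennreal ((1 - \<epsilon>) * l) < F t \<and> F t < ennreal ((1 + \<epsilon>) * l)"
    using order_tendstoD[OF F] by (intro eventually_conj) auto
  then obtain N where N: "\<forall>t>N. ennreal ((1 - \<epsilon>) * l) < F t \<and> F t < ennreal ((1 + \<epsilon>) * l)"
    unfolding eventually_at_top_dense by (elim exE)
  show ?thesis
  \<comment> \<open>The maximum with 1 guarantees that t0 is positive.\<close>
  proof (intro exI[of _ "max N 1"] conjI allI impI)
    fix t assume "t > max N 1"
    then have t: "t > 0" "t > N" by auto
    \<comment> \<open>The weight in (iii) lacks the factor t^(1/2) of the limit statement; it
      reappears as t^(-1/2) in the bounds.\<close>
    have e: "ennreal (t powr ?e) * X = ennreal (t powr (- (1 / 2))) * (ennreal (t powr (?e + 1 / 2)) * X)" for X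
    proof -
      have "t powr ?e = t powr (- (1 / 2)) * t powr (?e + 1 / 2)" using t by (simp only: powr_add[symmetric]) simp
      then have "ennreal (t powr ?e) = ennreal (t powr (- (1 / 2))) * ennreal (t powr (?e + 1 / 2))" by (simp only: ennreal_mult[OF powr_ge_zero powr_ge_zero])
      then show ?thesis by (simp only: mult.assoc)
    qed
    have g: "ennreal (t powr (- (1 / 2)) * b) * ennreal l = ennreal (t powr (- (1 / 2))) * ennreal (b * l)" if "b \<ge> 0" for b
      using that l by (simp add: ennreal_mult mult.assoc)
    show "0 < ennreal (t powr (- (1 / 2)) * (1 - \<epsilon>)) * lq_norm q D"
      unfolding l(1) using l(2) \<epsilon> t by (simp add: ennreal_zero_less_mult_iff)
    show "ennreal (t powr (- (1 / 2)) * (1 - \<epsilon>)) * lq_norm q D \<le> ennreal (t powr ?e) * lq_norm q (\<lambda>x. u t x - profile \<nu> f u0 u m t x)"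
      unfolding l(1) e using N[unfolded F_def] t \<epsilon> by (subst g) (auto intro!: mult_left_mono[OF less_imp_le] simp del: times_divide_eq_left)
    show "ennreal (t powr ?e) * lq_norm q (\<lambda>x. u t x - profile \<nu> f u0 u m t x) \<le> ennreal (t powr (- (1 / 2)) * (1 + \<epsilon>)) * lq_norm q D"
      unfolding l(1) e using N[unfolded F_def] t \<epsilon> by (subst g) (auto intro!: mult_left_mono[OF less_imp_le] simp del: times_divide_eq_left)
  qed simp
qed

end

theorem theorem1p5:
  fixes \<nu> :: complex and p :: real and f :: "complex \<Rightarrow> complex" and m :: nat
    and u0 :: "real ^ 'n::finite \<Rightarrow> complex"
    and u :: "real \<Rightarrow> real ^ 'n \<Rightarrow> complex"
  assumes "Re \<nu> > 0"
    and "p > 1"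
    and "f 0 = 0"
    and "\<exists>K>0. \<forall>\<xi> \<eta>. norm (f \<xi> - f \<eta>)
           \<le> K * (norm \<xi> powr (p - 1) + norm \<eta> powr (p - 1)) * norm (\<xi> - \<eta>)"
    and "p > 1 + (real m + 3) / real CARD('n)"
    and "u0 \<in> L1_weighted (m + 1) \<inter> Lq \<infinity>"
    and "global_mild_solution \<nu> f u0 u"
    and "(SUP q\<in>{1..}. SUP t\<in>{0<..}.
            ennreal (t powr (real CARD('n) / 2 * (1 - recip q))) * lq_norm q (u t)) < \<infinity>"
  shows
    "(\<forall>q\<ge>1.
        ((\<lambda>t. ennreal (t powr (real CARD('n) / 2 * (1 - recip q) + real m / 2 + 1 / 2))
              * lq_norm q (\<lambda>x. u t x - profile \<nu> f u0 u m t x))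
          \<longlongrightarrow> lq_norm q (\<lambda>x. profile \<nu> f u0 u (m + 1) 1 x - profile \<nu> f u0 u m 1 x)) at_top)
     \<and>
     ((\<exists>x. profile \<nu> f u0 u (m + 1) 1 x - profile \<nu> f u0 u m 1 x \<noteq> 0) \<longleftrightarrow>
      (\<exists>\<alpha> :: 'n \<Rightarrow> nat. mdeg \<alpha> = m + 1 \<and>
         moment \<alpha> u0
         + (\<Sum>(\<beta>, \<gamma>) \<in> {(\<beta>, \<gamma>). (\<lambda>i. \<beta> i + 2 * \<gamma> i) = \<alpha> \<and> real (mdeg \<gamma>) \<le> (real m + 1) / 2}.
              (- \<nu>) ^ mdeg \<gamma> / of_nat (mfact \<gamma>) * moment \<beta> (psi f u (mdeg \<gamma>))) \<noteq> 0))
     \<and>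
     ((\<exists>\<alpha> :: 'n \<Rightarrow> nat. mdeg \<alpha> = m + 1 \<and>
         moment \<alpha> u0
         + (\<Sum>(\<beta>, \<gamma>) \<in> {(\<beta>, \<gamma>). (\<lambda>i. \<beta> i + 2 * \<gamma> i) = \<alpha> \<and> real (mdeg \<gamma>) \<le> (real m + 1) / 2}.
              (- \<nu>) ^ mdeg \<gamma> / of_nat (mfact \<gamma>) * moment \<beta> (psi f u (mdeg \<gamma>))) \<noteq> 0) \<longleftrightarrow>
      (\<forall>q\<ge>1. \<forall>\<epsilon>::real. 0 < \<epsilon> \<and> \<epsilon> < 1 \<longrightarrow>
         (\<exists>t0>0. \<forall>t>t0.
            0 < ennreal (t powr (- (1 / 2)) * (1 - \<epsilon>))
                * lq_norm q (\<lambda>x. profile \<nu> f u0 u (m + 1) 1 x - profile \<nu> f u0 u m 1 x)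
            \<and> ennreal (t powr (- (1 / 2)) * (1 - \<epsilon>))
                * lq_norm q (\<lambda>x. profile \<nu> f u0 u (m + 1) 1 x - profile \<nu> f u0 u m 1 x)
              \<le> ennreal (t powr (real CARD('n) / 2 * (1 - recip q) + real m / 2))
                * lq_norm q (\<lambda>x. u t x - profile \<nu> f u0 u m t x)
            \<and> ennreal (t powr (real CARD('n) / 2 * (1 - recip q) + real m / 2))
                * lq_norm q (\<lambda>x. u t x - profile \<nu> f u0 u m t x)
              \<le> ennreal (t powr (- (1 / 2)) * (1 + \<epsilon>))
                * lq_norm q (\<lambda>x. profile \<nu> f u0 u (m + 1) 1 x - profile \<nu> f u0 u m 1 x))))"
proof -
  interpret decaying_mild_solution \<nu> p f m u0 u
    by (rule decaying_mild_solution.intro) (fact assms)+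
  note limit = solution_minus_profile_tendsto
  note nonzero_iff = leading_profile_nonzero_iff[unfolded leading_coeff_def]
  show ?thesis
  proof (intro conjI allI impI limit)
    show "(\<exists>x. D x \<noteq> 0) \<longleftrightarrow> (\<exists>\<alpha> :: 'n \<Rightarrow> nat. mdeg \<alpha> = m + 1 \<and>
         moment \<alpha> u0
         + (\<Sum>(\<beta>, \<gamma>) \<in> {(\<beta>, \<gamma>). (\<lambda>i. \<beta> i + 2 * \<gamma> i) = \<alpha> \<and> real (mdeg \<gamma>) \<le> (real m + 1) / 2}.
              (- \<nu>) ^ mdeg \<gamma> / of_nat (mfact \<gamma>) * moment \<beta> (psi f u (mdeg \<gamma>))) \<noteq> 0)"
      by (rule nonzero_iff)
  next
    show "(\<exists>\<alpha> :: 'n \<Rightarrow> nat. mdeg \<alpha> = m + 1 \<and>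
         moment \<alpha> u0
         + (\<Sum>(\<beta>, \<gamma>) \<in> {(\<beta>, \<gamma>). (\<lambda>i. \<beta> i + 2 * \<gamma> i) = \<alpha> \<and> real (mdeg \<gamma>) \<le> (real m + 1) / 2}.
              (- \<nu>) ^ mdeg \<gamma> / of_nat (mfact \<gamma>) * moment \<beta> (psi f u (mdeg \<gamma>))) \<noteq> 0) \<longleftrightarrow>
      (\<forall>q\<ge>1. \<forall>\<epsilon>::real. 0 < \<epsilon> \<and> \<epsilon> < 1 \<longrightarrow>
         (\<exists>t0>0. \<forall>t>t0.
            0 < ennreal (t powr (- (1 / 2)) * (1 - \<epsilon>)) * lq_norm q D
            \<and> ennreal (t powr (- (1 / 2)) * (1 - \<epsilon>)) * lq_norm q D
              \<le> ennreal (t powr (real CARD('n) / 2 * (1 - recip q) + real m / 2))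
                * lq_norm q (\<lambda>x. u t x - profile \<nu> f u0 u m t x)
            \<and> ennreal (t powr (real CARD('n) / 2 * (1 - recip q) + real m / 2))
                * lq_norm q (\<lambda>x. u t x - profile \<nu> f u0 u m t x)
              \<le> ennreal (t powr (- (1 / 2)) * (1 + \<epsilon>)) * lq_norm q D))"
      (is "_ \<longleftrightarrow> (\<forall>q\<ge>1. \<forall>\<epsilon>::real. _ \<longrightarrow> ?rate q \<epsilon>)")
      unfolding nonzero_iff[symmetric]
    proof (intro iffI allI impI)
      fix q :: ennreal and \<epsilon> :: real
      assume "\<exists>x. D x \<noteq> 0" and q: "q \<ge> 1" and \<epsilon>: "0 < \<epsilon> \<and> \<epsilon> < 1"
      then obtain x where "D x \<noteq> 0" by (elim exE)
      from solution_minus_profile_rate[OF q this conjunct1[OF \<epsilon>] conjunct2[OF \<epsilon>]] show "?rate q \<epsilon>" .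
    next
      assume R: "\<forall>q\<ge>1. \<forall>\<epsilon>::real. 0 < \<epsilon> \<and> \<epsilon> < 1 \<longrightarrow> ?rate q \<epsilon>"
      \<comment> \<open>The strict positivity in (iii) already forces a nonzero norm of D, so a
        single instance is enough.\<close>
      have "?rate 1 (1 / 2)" by (rule R[THEN spec, THEN mp, THEN spec, THEN mp]) auto
      then obtain t0 where "\<forall>t>t0. 0 < ennreal (t powr (- (1 / 2)) * (1 - 1 / 2)) * lq_norm 1 D" by blast
      from this[rule_format, of "t0 + 1"] have "lq_norm 1 D \<noteq> 0" by auto
      moreover have "lq_norm 1 D = 0" if "\<forall>x. D x = 0" unfolding that[rule_format] by (rule lq_norm_zero) simp
      ultimately show "\<exists>x. D x \<noteq> 0" by blast
    qed
  qed
qed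

end
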